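(* Let $0<\varepsilon\le 1$ and let $|\psi\rangle^{ABR}\in\mathcal H_A\otimes\mathcal H_B\otimes\mathcal H_R$ be a tripartite pure state. Then there exists an $\varepsilon$-error one-shot FQSW protocol for $\psi^{ABR}$ whose entanglement gain $e^{(1)}_\varepsilon$ and quantum communication cost $q^{(1)}_\varepsilon$ satisfy $$e^{(1)}_{\varepsilon}\ \ge\ \tfrac12\left[H^{\delta}_0(A)_\psi+H_{\min}^{\delta}(A|R)_{\psi}\right]+\log\delta',$$ $$q^{(1)}_{\varepsilon}\ \le\ \tfrac12\left[H^{\delta}_0(A)_\psi-H_{\min}^{\delta}(A|R)_{\psi}\right]-\log\delta',$$ for some $\delta>0$ such that $\varepsilon=2\sqrt{5\delta'}+2\sqrt{\delta}$, where $\delta'=\delta+\sqrt{4\sqrt{\delta}-4\delta}$.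
   Context: All Hilbert spaces are finite-dimensional; $|A|=\dim\mathcal H_A$; logarithms are to base 2. $\mathcal D(\mathcal H)$ is the set of states (positive operators of trace 1) and $\mathcal D_\le(\mathcal H)$ the set of subnormalized states (positive operators of trace $\le 1$). For a pure state $|\psi\rangle$, write $\psi=|\psi\rangle\langle\psi|$; superscript subsystems denote reduced (partial-trace) states. One-shot FQSW protocol. Alice holds $A$, Bob holds $B$, and $R$ is an inaccessible reference. A protocol for $\psi^{ABR}$ consists of: an encoding CPTP map $\mathcal E^{A\to A_1A_2}$ performed by Alice, after which she sends the quantum system $A_2$ to Bob (renamed $B_2\simeq A_2$); then a decoding CPTP map $\mathcal D^{B_2B\to B_1B'B}$ performed by Bob, where $\mathcal H_{B_1}\simeq\mathcal H_{A_1}$ and $\mathcal H_{B'}\simeq\mathcal H_A$. Let $\widehat\Omega^{A_1B_1B'BR}$ be the final state. The protocol is $\varepsilon$-error if $\|\Phi^{A_1B_1}\otimes\psi^{B'BR}-\widehat\Omega^{A_1B_1B'BR}\|_1\le\varepsilon$, where $\Phi^{A_1B_1}$ is the maximally entangled state of Schmidt rank $|A_1|$, and $\psi^{B'BR}$ is the state $\psi^{ABR}$ with $A$ replaced by $B'$. Its quantum communication cost is $q^{(1)}_\varepsilon=\log|A_2|$ and its entanglement gain is $e^{(1)}_\varepsilon=\log|A_1|$. Entropies. Fidelity: $F(\rho,\sigma)=\|\sqrt\rho\sqrt\sigma\|_1$. $D_{\max}(\rho\|\sigma)=\log\min\{\lambda:\rho\le\lambda\sigma\}$. For $\rho^{AB}\in\mathcal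 D_\le(\mathcal H_A\otimes\mathcal H_B)$, $H_{\min}(A|B)_\rho=\max_{\sigma^B\in\mathcal D(\mathcal H_B)}[-D_{\max}(\rho^{AB}\|\mathbb I_A\otimes\sigma^B)]$. For $\rho\in\mathcal D(\mathcal H)$ and $0\le\epsilon\le1$, $\mathcal B^\epsilon(\rho)=\{\overline\rho\in\mathcal D_\le(\mathcal H):F^2(\overline\rho,\rho)\ge1-\epsilon^2\}$, and $H_{\min}^\epsilon(A|B)_\rho=\max_{\overline\rho^{AB}\in\mathcal B^\epsilon(\rho^{AB})}H_{\min}(A|B)_{\overline\rho}$. For $\rho^A\in\mathcal D(\mathcal H_A)$ and $0\le\epsilon\le 1$, $$H_0^\epsilon(A)_\rho=\min_{0\le Q\le\mathbb I_A,\ \operatorname{tr}Q\rho^A\ge1-\epsilon}\log\operatorname{rank}\big(\sqrt Q\rho^A\sqrt Q\big).$$ *)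

theory Defs
  imports
    "Jordan_Normal_Form.Schur_Decomposition"
    "Jordan_Normal_Form.DL_Rank"
    "HOL-Library.Extended_Real"
begin

text \<open>
  A Hilbert space of dimension \<open>n\<close> is \<open>\<complex>\<^sup>n\<close>, and an operator on it is a complex matrix in
  \<^term>\<open>carrier_mat n n\<close>.  The tensor product of spaces of dimensions \<open>m\<close> and \<open>n\<close> is the space
  of dimension \<open>m * n\<close>, where the product basis vector \<open>e\<^sub>i \<otimes> e\<^sub>j\<close> is the one with index
  \<open>i * n + j\<close>.  This identification is strictly associative, so that the factors of a
  multiple tensor product can be regrouped without any change of indices.
\<close>

section \<open>Operators\<close>

definition mat_trace :: "complex mat \<Rightarrow> complex" where
  "mat_trace A = (\<Sum>i<dim_row A. A $$ (i, i))"

text \<open>The order on \<^typ>\<open>complex\<close> makes \<open>0 \<le> z\<close> mean that \<open>z\<close> is real and nonnegative, so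
  \<open>psd A\<close> implies that \<open>A\<close> is Hermitian.\<close>

definition psd :: "complex mat \<Rightarrow> bool" where
  "psd A \<longleftrightarrow> square_mat A \<and> (\<forall>v \<in> carrier_vec (dim_row A). 0 \<le> (A *\<^sub>v v) \<bullet>c v)"

definition op_le :: "complex mat \<Rightarrow> complex mat \<Rightarrow> bool" where
  "op_le A B \<longleftrightarrow> dim_row A = dim_row B \<and> dim_col A = dim_col B \<and> psd (B - A)"

text \<open>The positive square root; it exists and is unique for every positive semidefinite matrix.\<close>

definition psd_sqrt :: "complex mat \<Rightarrow> complex mat" where
  "psd_sqrt A = (THE S. psd S \<and> S * S = A)"

definition trace_norm :: "complex mat \<Rightarrow> real" where
  "trace_norm X = Re (mat_trace (psd_sqrt (mat_adjoint X * X)))"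

definition mat_rank :: "complex mat \<Rightarrow> nat" where
  "mat_rank A = vec_space.rank (dim_row A) A"

definition tensor_mat :: "complex mat \<Rightarrow> complex mat \<Rightarrow> complex mat" where
  "tensor_mat A B = mat (dim_row A * dim_row B) (dim_col A * dim_col B)
     (\<lambda>(i, j). A $$ (i div dim_row B, j div dim_col B) * B $$ (i mod dim_row B, j mod dim_col B))"

text \<open>\<open>partial_trace l m r\<close> traces out the middle factor of \<open>\<complex>\<^sup>l \<otimes> \<complex>\<^sup>m \<otimes> \<complex>\<^sup>r\<close>; the outer
  factors may be trivial.\<close>

definition partial_trace :: "nat \<Rightarrow> nat \<Rightarrow> nat \<Rightarrow> complex mat \<Rightarrow> complex mat" where
  "partial_trace l m r X = mat (l * r) (l * r)
     (\<lambda>(i, j). \<Sum>k<m. X $$ ((i div r * m + k) * r + i mod r, (j div r * m + k) * r + j mod r))"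

section \<open>States\<close>

definition states :: "nat \<Rightarrow> complex mat set" where
  "states n = {\<rho> \<in> carrier_mat n n. psd \<rho> \<and> mat_trace \<rho> = 1}"

definition substates :: "nat \<Rightarrow> complex mat set" where
  "substates n = {\<rho> \<in> carrier_mat n n. psd \<rho> \<and> mat_trace \<rho> \<le> 1}"

definition pure_state :: "complex vec \<Rightarrow> complex mat" where
  "pure_state \<psi> = mat (dim_vec \<psi>) (dim_vec \<psi>) (\<lambda>(i, j). \<psi> $ i * cnj (\<psi> $ j))"

definition max_entangled_vec :: "nat \<Rightarrow> complex vec" where
  "max_entangled_vec d =
     vec (d * d) (\<lambda>i. if i div d = i mod d then complex_of_real (1 / sqrt (real d)) else 0)"

definition fidelity :: "complex mat \<Rightarrow> complex mat \<Rightarrow> real" where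
  "fidelity \<rho> \<sigma> = trace_norm (psd_sqrt \<rho> * psd_sqrt \<sigma>)"

section \<open>Entropies\<close>

definition elog2 :: "ereal \<Rightarrow> ereal" where
  "elog2 x = (if x = \<infinity> then \<infinity> else if x \<le> 0 then - \<infinity> else ereal (log 2 (real_of_ereal x)))"

text \<open>Entropies take values in \<^typ>\<open>ereal\<close>: the infimum over the empty set is \<open>\<infinity>\<close>, which is the
  value of \<open>D_max \<rho> \<sigma>\<close> when the support of \<open>\<rho>\<close> is not contained in that of \<open>\<sigma>\<close>.\<close>

definition D_max :: "complex mat \<Rightarrow> complex mat \<Rightarrow> ereal" where
  "D_max \<rho> \<sigma> = elog2 (INF c \<in> {c :: real. op_le \<rho> (complex_of_real c \<cdot>\<^sub>m \<sigma>)}. ereal c)"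

text \<open>In the following, \<open>\<rho>\<close> is an operator on \<open>\<complex>\<^sup>a \<otimes> \<complex>\<^sup>b\<close>, and the conditioning system is the
  second factor.\<close>

definition H_min :: "nat \<Rightarrow> nat \<Rightarrow> complex mat \<Rightarrow> ereal" where
  "H_min a b \<rho> = (SUP \<sigma> \<in> states b. - D_max \<rho> (tensor_mat (1\<^sub>m a) \<sigma>))"

definition state_ball :: "real \<Rightarrow> nat \<Rightarrow> complex mat \<Rightarrow> complex mat set" where
  "state_ball \<epsilon> n \<rho> = {\<rho>' \<in> substates n. (fidelity \<rho>' \<rho>)\<^sup>2 \<ge> 1 - \<epsilon>\<^sup>2}"

definition H_min_smooth :: "real \<Rightarrow> nat \<Rightarrow> nat \<Rightarrow> complex mat \<Rightarrow> ereal" where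
  "H_min_smooth \<epsilon> a b \<rho> = (SUP \<rho>' \<in> state_ball \<epsilon> (a * b) \<rho>. H_min a b \<rho>')"

definition H_0_smooth :: "real \<Rightarrow> nat \<Rightarrow> complex mat \<Rightarrow> ereal" where
  "H_0_smooth \<epsilon> a \<rho> =
     (INF Q \<in> {Q \<in> carrier_mat a a. op_le (0\<^sub>m a a) Q \<and> op_le Q (1\<^sub>m a)
                 \<and> Re (mat_trace (Q * \<rho>)) \<ge> 1 - \<epsilon>}.
        elog2 (ereal (real (mat_rank (psd_sqrt Q * \<rho> * psd_sqrt Q)))))"

section \<open>Quantum channels\<close>

text \<open>For a linear map \<open>\<Phi>\<close> from \<open>m \<times> m\<close> to \<open>n \<times> n\<close> matrices, \<open>extend_map l m n r \<Phi>\<close> is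
  \<open>id \<otimes> \<Phi> \<otimes> id\<close> on operators on \<open>\<complex>\<^sup>l \<otimes> \<complex>\<^sup>m \<otimes> \<complex>\<^sup>r\<close>: \<open>\<Phi>\<close> is applied to each \<open>m \<times> m\<close> block
  obtained by fixing the row and column indices of the two outer factors.\<close>

definition extend_map ::
  "nat \<Rightarrow> nat \<Rightarrow> nat \<Rightarrow> nat \<Rightarrow> (complex mat \<Rightarrow> complex mat) \<Rightarrow> complex mat \<Rightarrow> complex mat" where
  "extend_map l m n r \<Phi> X = mat (l * n * r) (l * n * r)
     (\<lambda>(i, j). \<Phi> (mat m m (\<lambda>(a, b).
                    X $$ ((i div (n * r) * m + a) * r + i mod r,
                          (j div (n * r) * m + b) * r + j mod r)))
                $$ (i div r mod n, j div r mod n))"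

definition linear_map :: "nat \<Rightarrow> nat \<Rightarrow> (complex mat \<Rightarrow> complex mat) \<Rightarrow> bool" where
  "linear_map m n \<Phi> \<longleftrightarrow>
     (\<forall>X \<in> carrier_mat m m. \<Phi> X \<in> carrier_mat n n) \<and>
     (\<forall>X \<in> carrier_mat m m. \<forall>Y \<in> carrier_mat m m. \<Phi> (X + Y) = \<Phi> X + \<Phi> Y) \<and>
     (\<forall>X \<in> carrier_mat m m. \<forall>c. \<Phi> (c \<cdot>\<^sub>m X) = c \<cdot>\<^sub>m \<Phi> X)"

definition completely_positive :: "nat \<Rightarrow> nat \<Rightarrow> (complex mat \<Rightarrow> complex mat) \<Rightarrow> bool" where
  "completely_positive m n \<Phi> \<longleftrightarrow>
     (\<forall>k. \<forall>X \<in> carrier_mat (k * m) (k * m). psd X \<longrightarrow> psd (extend_map k m n 1 \<Phi> X))"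

definition cptp :: "nat \<Rightarrow> nat \<Rightarrow> (complex mat \<Rightarrow> complex mat) \<Rightarrow> bool" where
  "cptp m n \<Phi> \<longleftrightarrow> linear_map m n \<Phi> \<and> completely_positive m n \<Phi> \<and>
     (\<forall>X \<in> carrier_mat m m. mat_trace (\<Phi> X) = mat_trace X)"

section \<open>One-shot FQSW protocols\<close>

record fqsw_data =
  dim_A1 :: nat
  dim_A2 :: nat
  encoder :: "complex mat \<Rightarrow> complex mat"
  decoder :: "complex mat \<Rightarrow> complex mat"

text \<open>The encoder maps \<open>A\<close> to \<open>A\<^sub>1 A\<^sub>2\<close> and the decoder maps \<open>B\<^sub>2 B\<close> to \<open>B\<^sub>1 B' B\<close>, where
  \<open>B\<^sub>2\<close>, \<open>B\<^sub>1\<close>, \<open>B'\<close> have the dimensions of \<open>A\<^sub>2\<close>, \<open>A\<^sub>1\<close>, \<open>A\<close>, respectively.\<close>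

definition fqsw_protocol :: "nat \<Rightarrow> nat \<Rightarrow> fqsw_data \<Rightarrow> bool" where
  "fqsw_protocol dA dB P \<longleftrightarrow>
     dim_A1 P > 0 \<and> dim_A2 P > 0 \<and>
     cptp dA (dim_A1 P * dim_A2 P) (encoder P) \<and>
     cptp (dim_A2 P * dB) (dim_A1 P * dA * dB) (decoder P)"

text \<open>The systems are ordered \<open>A B R\<close> in the initial state, \<open>A\<^sub>1 A\<^sub>2 B R\<close> after the encoding,
  and \<open>A\<^sub>1 B\<^sub>1 B' B R\<close> in the final state.\<close>

definition fqsw_final_state ::
  "nat \<Rightarrow> nat \<Rightarrow> nat \<Rightarrow> fqsw_data \<Rightarrow> complex mat \<Rightarrow> complex mat" where
  "fqsw_final_state dA dB dR P \<rho> =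
     extend_map (dim_A1 P) (dim_A2 P * dB) (dim_A1 P * dA * dB) dR (decoder P)
       (extend_map 1 dA (dim_A1 P * dim_A2 P) (dB * dR) (encoder P) \<rho>)"

definition fqsw_error_le ::
  "real \<Rightarrow> nat \<Rightarrow> nat \<Rightarrow> nat \<Rightarrow> complex vec \<Rightarrow> fqsw_data \<Rightarrow> bool" where
  "fqsw_error_le \<epsilon> dA dB dR \<psi> P \<longleftrightarrow>
     trace_norm (tensor_mat (pure_state (max_entangled_vec (dim_A1 P))) (pure_state \<psi>)
                 - fqsw_final_state dA dB dR P (pure_state \<psi>)) \<le> \<epsilon>"

definition entanglement_gain :: "fqsw_data \<Rightarrow> real" where
  "entanglement_gain P = log 2 (real (dim_A1 P))"

definition quantum_cost :: "fqsw_data \<Rightarrow> real" where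
  "quantum_cost P = log 2 (real (dim_A2 P))"

end

theory Submission
  imports
    Defs
    "Jordan_Normal_Form.Spectral_Radius"
    "HOL-Analysis.L2_Norm"
    "HOL-Combinatorics.Permutations"
begin

text \<open>
  Alice compresses \<open>A\<close> to a space of dimension \<open>d = 2^H\<^sub>0\<close>, embeds it into \<open>A\<^sub>1 A\<^sub>2\<close> and applies a
  unitary after which \<open>A\<^sub>1\<close> is nearly maximally mixed and decoupled from \<open>R\<close>; by Uhlmann's theorem,
  Bob can then turn \<open>A\<^sub>2 B\<close> into his halves of \<open>\<Phi> \<otimes> \<psi>\<close>.  The existence of such a unitary follows
  from a second moment bound, with \<open>|A\<^sub>1| / |A\<^sub>2|\<close> times \<open>2^(-H_min)\<close> as the squared decoupling error.

  Instead of Haar measure, the average is taken over a finite set of unitaries, products of random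
  diagonal phases, a permutation and a Fourier matrix, which makes every average a finite sum.  Trace
  norms are bounded by duality with contractions, and the Powers-Stormer inequality
  \<open>\<parallel>\<surd>\<rho> - \<surd>\<sigma>\<parallel>\<^sub>2\<^sup>2 \<le> \<parallel>\<rho> - \<sigma>\<parallel>\<^sub>1\<close> replaces the inequalities of Fuchs and
  van de Graaf.  If \<open>t = \<surd>(d 2^H_min) \<delta>' \<le> 1\<close>, no entanglement has to be gained and Alice sends
  everything; otherwise \<open>|A\<^sub>2| = \<lfloor>d / t\<rfloor>\<close> and \<open>|A\<^sub>1| = \<lceil>d / |A\<^sub>2|\<rceil>\<close>.
\<close>

subsection \<open>Adjoints and traces\<close>

text \<open>Crude estimates suffice because \<delta>' is of order \<delta>^(1/4): losses linear in
  \<delta>, from smoothing and compression, are negligible against \<delta>'. The decoupling error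
  is kept below 12/5 \<delta>' and the total below 3 \<delta>'; the gap between 3 and the prescribed
  5 pays for the linear term in the final error 2 sqrt x + x. The obstacle is rounding: the ideal
  dimensions are real numbers, and rounding d / t down is harmless only if this quotient is large.
  That holds because 2^H_min cannot exceed d by much, which in turn needs the smoothed state to keep
  weight near 1 under the compression. Compressions, decoders and test operators are contractions
  between spaces of unrelated dimensions. Channels appear only at the end, when extra Kraus
  operators restore the trace, so no isometry has to be extended to larger spaces.\<close>

abbreviation adj :: "complex mat \<Rightarrow> complex mat" where "adj \<equiv> mat_adjoint"

lemma dim_adj [simp]: "dim_row (adj A) = dim_col A" "dim_col (adj A) = dim_row A"
  by (simp_all add: mat_adjoint_def)

lemma adj_carrier [simp, intro]: "A \<in> carrier_mat m n \<Longrightarrow> adj A \<in> carrier_mat n m"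
  by (intro carrier_matI) (simp_all add: carrier_matD)

lemma adj_index [simp]:
  "i < dim_col A \<Longrightarrow> j < dim_row A \<Longrightarrow> adj A $$ (i, j) = cnj (A $$ (j, i))"
  by (simp add: mat_adjoint_def mat_of_rows_index)

lemma adj_adj [simp]: "adj (adj A) = A"
  by (rule eq_matI) auto

lemma mult_index_sum:
  "A \<in> carrier_mat m n \<Longrightarrow> B \<in> carrier_mat n p \<Longrightarrow> i < m \<Longrightarrow> j < p \<Longrightarrow>
   (A * B) $$ (i, j) = (\<Sum>k<n. A $$ (i, k) * B $$ (k, j))"
  by (auto simp: scalar_prod_def lessThan_atLeast0)

lemma adj_mult:
  assumes "A \<in> carrier_mat m n" "B \<in> carrier_mat n p"
  shows "adj (A * B) = adj B * adj A"
proof (rule eq_matI)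
  fix i j assume "i < dim_row (adj B * adj A)" "j < dim_col (adj B * adj A)"
  then have ij: "i < p" "j < m" using assms by auto
  have "(adj B * adj A) $$ (i, j) = (\<Sum>k<n. adj B $$ (i, k) * adj A $$ (k, j))"
    by (rule mult_index_sum) (use assms ij in auto)
  also have "\<dots> = (\<Sum>k<n. cnj (A $$ (j, k) * B $$ (k, i)))"
    using assms ij by (intro sum.cong) auto
  also have "\<dots> = adj (A * B) $$ (i, j)"
    using assms ij mult_index_sum[OF assms ij(2,1)] by simp
  finally show "adj (A * B) $$ (i, j) = (adj B * adj A) $$ (i, j)" by simp
qed (use assms in auto)

lemma adj_minus: "A \<in> carrier_mat m n \<Longrightarrow> B \<in> carrier_mat m n \<Longrightarrow> adj (A - B) = adj A - adj B"
  by (rule eq_matI) auto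

lemma adj_one [simp]: "adj (1\<^sub>m n) = 1\<^sub>m n"
  by (rule eq_matI) auto

lemma trace_mult_sum:
  assumes "A \<in> carrier_mat m n" "B \<in> carrier_mat n m"
  shows "mat_trace (A * B) = (\<Sum>i<m. \<Sum>k<n. A $$ (i, k) * B $$ (k, i))"
  unfolding mat_trace_def using assms mult_index_sum[OF assms] by (intro sum.cong) auto

lemma trace_mult_comm:
  assumes "A \<in> carrier_mat m n" "B \<in> carrier_mat n m"
  shows "mat_trace (A * B) = mat_trace (B * A)"
  unfolding trace_mult_sum[OF assms] trace_mult_sum[OF assms(2,1)]
  by (subst sum.swap) (simp add: mult.commute)

lemma trace_add:
  "A \<in> carrier_mat n n \<Longrightarrow> B \<in> carrier_mat n n \<Longrightarrow> mat_trace (A + B) = mat_trace A + mat_trace B"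
  by (auto simp: mat_trace_def sum.distrib)

lemma trace_minus:
  "A \<in> carrier_mat n n \<Longrightarrow> B \<in> carrier_mat n n \<Longrightarrow> mat_trace (A - B) = mat_trace A - mat_trace B"
  by (auto simp: mat_trace_def sum_subtractf)

lemma trace_smult: "A \<in> carrier_mat n n \<Longrightarrow> mat_trace (c \<cdot>\<^sub>m A) = c * mat_trace A"
  by (auto simp: mat_trace_def sum_distrib_left)

lemma trace_adj: "A \<in> carrier_mat n n \<Longrightarrow> mat_trace (adj A) = cnj (mat_trace A)"
  by (auto simp: mat_trace_def)

text \<open>The squared Hilbert-Schmidt norm, as a real number. Rectangular matrices are allowed, so
  that it also measures single columns and the amplitude matrices of bipartite vectors.\<close>

definition hs_sq :: "complex mat \<Rightarrow> real" where
  "hs_sq A = (\<Sum>i<dim_row A. \<Sum>j<dim_col A. (cmod (A $$ (i, j)))\<^sup>2)"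

lemma hs_sq_nonneg [simp]: "0 \<le> hs_sq A"
  by (simp add: hs_sq_def sum_nonneg)

lemma trace_mult_adj: "mat_trace (A * adj A) = complex_of_real (hs_sq A)"
proof -
  have "mat_trace (A * adj A) =
      (\<Sum>i<dim_row A. \<Sum>k<dim_col A. A $$ (i, k) * adj A $$ (k, i))"
    by (rule trace_mult_sum) auto
  also have "\<dots> = (\<Sum>i<dim_row A. \<Sum>k<dim_col A. complex_of_real ((cmod (A $$ (i, k)))\<^sup>2))"
    by (intro sum.cong) (auto simp: complex_norm_square simp del: of_real_power)
  finally show ?thesis by (simp add: hs_sq_def)
qed

lemma trace_adj_mult: "mat_trace (adj A * A) = complex_of_real (hs_sq A)"
  using trace_mult_adj[of A] trace_mult_comm[of A "dim_row A" "dim_col A" "adj A"] by auto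

lemma hs_sq_adj [simp]: "hs_sq (adj A) = hs_sq A"
  using trace_mult_adj[of "adj A"] trace_adj_mult[of A] by (metis adj_adj of_real_eq_iff)

lemma hs_sq_eq_0:
  assumes "A \<in> carrier_mat m n" "hs_sq A = 0" shows "A = 0\<^sub>m m n"
proof (rule eq_matI)
  fix i j assume "i < dim_row (0\<^sub>m m n :: complex mat)" "j < dim_col (0\<^sub>m m n :: complex mat)"
  then have ij: "i < dim_row A" "j < dim_col A" using assms by auto
  have "(\<Sum>j<dim_col A. (cmod (A $$ (i, j)))\<^sup>2) = 0"
    using assms(2) ij unfolding hs_sq_def
    by (subst (asm) sum_nonneg_eq_0_iff) (auto intro: sum_nonneg)
  then have "(cmod (A $$ (i, j)))\<^sup>2 = 0"
    using ij by (subst (asm) sum_nonneg_eq_0_iff) auto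
  then show "A $$ (i, j) = 0\<^sub>m m n $$ (i, j)" using ij assms by auto
qed (use assms in auto)

text \<open>Cauchy-Schwarz for the Hilbert-Schmidt inner product, with the matrix entries flattened
  to the single index set \<open>?I\<close>.\<close>

lemma cmod_trace_adj_mult_le:
  assumes "A \<in> carrier_mat m n" "B \<in> carrier_mat m n"
  shows "cmod (mat_trace (adj A * B)) \<le> sqrt (hs_sq A) * sqrt (hs_sq B)"
proof -
  let ?I = "{..<m} \<times> {..<n}"
  have *: "mat_trace (adj A * B) = (\<Sum>(i, j)\<in>?I. cnj (A $$ (i, j)) * B $$ (i, j))"
  proof -
    have "mat_trace (adj A * B) = (\<Sum>j<n. \<Sum>i<m. adj A $$ (j, i) * B $$ (i, j))"
      by (rule trace_mult_sum) (use assms in auto)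
    also have "\<dots> = (\<Sum>j<n. \<Sum>i<m. cnj (A $$ (i, j)) * B $$ (i, j))"
      using assms by (intro sum.cong) auto
    finally show ?thesis by (subst (asm) sum.swap) (simp add: sum.cartesian_product)
  qed
  have hs: "sqrt (hs_sq X) = L2_set (\<lambda>x. cmod (X $$ x)) ?I" if "X \<in> carrier_mat m n" for X
    using that by (simp add: hs_sq_def L2_set_def sum.cartesian_product case_prod_unfold)
  have "cmod (mat_trace (adj A * B)) \<le> (\<Sum>x\<in>?I. \<bar>cmod (A $$ x)\<bar> * \<bar>cmod (B $$ x)\<bar>)"
    unfolding * by (rule order.trans[OF norm_sum]) (auto simp: norm_mult case_prod_unfold)
  also have "\<dots> \<le> sqrt (hs_sq A) * sqrt (hs_sq B)"
    unfolding hs[OF assms(1)] hs[OF assms(2)] by (rule L2_set_mult_ineq)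
  finally show ?thesis .
qed

subsection \<open>Positive operators\<close>

lemma quad_form_adj:
  assumes "A \<in> carrier_mat m n" "v \<in> carrier_vec n" "w \<in> carrier_vec m"
  shows "(A *\<^sub>v v) \<bullet>c w = v \<bullet>c (adj A *\<^sub>v w)"
proof -
  have "(A *\<^sub>v v) \<bullet>c w = (\<Sum>i<m. \<Sum>j<n. A $$ (i, j) * v $ j * cnj (w $ i))"
    using assms by (auto simp: scalar_prod_def lessThan_atLeast0 sum_distrib_right intro!: sum.cong)
  also have "\<dots> = (\<Sum>j<n. \<Sum>i<m. A $$ (i, j) * v $ j * cnj (w $ i))" by (rule sum.swap)
  also have "\<dots> = v \<bullet>c (adj A *\<^sub>v w)"
    using assms by (auto simp: scalar_prod_def lessThan_atLeast0 sum_distrib_left intro!: sum.cong)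
  finally show ?thesis .
qed

lemma cscalar_self: "v \<bullet>c v = complex_of_real (\<Sum>i<dim_vec v. (cmod (v $ i))\<^sup>2)"
  by (auto simp: scalar_prod_def lessThan_atLeast0 complex_norm_square simp del: of_real_power)

lemma cscalar_self_nonneg: "(0 :: complex) \<le> v \<bullet>c v"
  unfolding cscalar_self by (simp add: less_eq_complex_def sum_nonneg)

lemma psd_carrier: assumes "psd A" obtains n where "A \<in> carrier_mat n n"
  using assms by (auto simp: psd_def)

lemma psdI:
  assumes "A \<in> carrier_mat n n" "\<And>v. v \<in> carrier_vec n \<Longrightarrow> 0 \<le> (A *\<^sub>v v) \<bullet>c v"
  shows "psd A"
  using assms by (auto simp: psd_def)

lemma psdD:
  assumes "psd A" "A \<in> carrier_mat n n" "v \<in> carrier_vec n"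
  shows "0 \<le> (A *\<^sub>v v) \<bullet>c v"
  using assms by (auto simp: psd_def)

lemma psd_adj_mult:
  assumes "G \<in> carrier_mat m n" shows "psd (adj G * G)"
proof (rule psdI)
  fix v :: "complex vec" assume v: "v \<in> carrier_vec n"
  have "((adj G * G) *\<^sub>v v) \<bullet>c v = (adj G *\<^sub>v (G *\<^sub>v v)) \<bullet>c v"
    using assms v by (subst assoc_mult_mat_vec) auto
  also have "\<dots> = (G *\<^sub>v v) \<bullet>c (G *\<^sub>v v)"
    using assms v by (subst quad_form_adj[of _ n m]) auto
  finally show "0 \<le> ((adj G * G) *\<^sub>v v) \<bullet>c v" using cscalar_self_nonneg by simp
qed (use assms in auto)

lemma psd_mult_adj: "psd (G * adj G)"
  using psd_adj_mult[of "adj G" "dim_col G" "dim_row G"] by auto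

lemma quad_form_sum:
  assumes "A \<in> carrier_mat n n" "v \<in> carrier_vec n"
  shows "(A *\<^sub>v v) \<bullet>c v = (\<Sum>i<n. \<Sum>j<n. A $$ (i, j) * v $ j * cnj (v $ i))"
  using assms by (auto simp: scalar_prod_def lessThan_atLeast0 sum_distrib_right intro!: sum.cong)

lemma psd_add:
  assumes "psd A" "psd B" "A \<in> carrier_mat n n" "B \<in> carrier_mat n n"
  shows "psd (A + B)"
proof (rule psdI)
  fix v :: "complex vec" assume v: "v \<in> carrier_vec n"
  have "((A + B) *\<^sub>v v) \<bullet>c v = (A *\<^sub>v v) \<bullet>c v + (B *\<^sub>v v) \<bullet>c v"
    unfolding quad_form_sum[OF assms(3) v] quad_form_sum[OF assms(4) v]
      quad_form_sum[OF add_carrier_mat[OF assms(4)] v]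
    using assms by (simp add: sum.distrib algebra_simps)
  then show "0 \<le> ((A + B) *\<^sub>v v) \<bullet>c v"
    using psdD[OF assms(1,3) v] psdD[OF assms(2,4) v] by simp
qed (use assms in auto)

lemma psd_smult:
  assumes "psd A" "0 \<le> c" shows "psd (complex_of_real c \<cdot>\<^sub>m A)"
proof -
  obtain n where A: "A \<in> carrier_mat n n" using psd_carrier[OF assms(1)] .
  show ?thesis
  proof (rule psdI)
    fix v :: "complex vec" assume v: "v \<in> carrier_vec n"
    have "((complex_of_real c \<cdot>\<^sub>m A) *\<^sub>v v) \<bullet>c v = complex_of_real c * ((A *\<^sub>v v) \<bullet>c v)"
      unfolding quad_form_sum[OF A v] quad_form_sum[OF smult_carrier_mat[OF A] v]
      using A by (simp add: sum_distrib_left mult.assoc)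
    then show "0 \<le> ((complex_of_real c \<cdot>\<^sub>m A) *\<^sub>v v) \<bullet>c v"
      using psdD[OF assms(1) A v] assms(2) by (simp add: less_eq_complex_def)
  qed (use A in auto)
qed

lemma psd_conj:
  assumes "psd A" "A \<in> carrier_mat n n" "K \<in> carrier_mat m n"
  shows "psd (K * A * adj K)"
proof (rule psdI)
  fix v :: "complex vec" assume v: "v \<in> carrier_vec m"
  have w: "adj K *\<^sub>v v \<in> carrier_vec n"
    by (rule mult_mat_vec_carrier[OF adj_carrier[OF assms(3)] v])
  have "(K * A * adj K *\<^sub>v v) \<bullet>c v = (K *\<^sub>v (A *\<^sub>v (adj K *\<^sub>v v))) \<bullet>c v"
  proof -
    have "K * A * adj K *\<^sub>v v = (K * A) *\<^sub>v (adj K *\<^sub>v v)"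
      by (rule assoc_mult_mat_vec[of _ m n _ m]) (use assms v in auto)
    also have "\<dots> = K *\<^sub>v (A *\<^sub>v (adj K *\<^sub>v v))"
      by (rule assoc_mult_mat_vec[OF assms(3,2) w])
    finally show ?thesis by simp
  qed
  also have "\<dots> = (A *\<^sub>v (adj K *\<^sub>v v)) \<bullet>c (adj K *\<^sub>v v)"
    by (rule quad_form_adj[OF assms(3) mult_mat_vec_carrier[OF assms(2) w] v])
  finally have "(K * A * adj K *\<^sub>v v) \<bullet>c v = (A *\<^sub>v (adj K *\<^sub>v v)) \<bullet>c (adj K *\<^sub>v v)" .
  then show "0 \<le> (K * A * adj K *\<^sub>v v) \<bullet>c v"
    using psdD[OF assms(1,2) w] by simp
qed (use assms in auto)

lemma psd_conj_adj:
  assumes "psd A" "A \<in> carrier_mat n n" "K \<in> carrier_mat n m"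
  shows "psd (adj K * A * K)"
  using psd_conj[OF assms(1,2), of "adj K" m] assms(3) by auto

lemma psd_one [simp]: "psd (1\<^sub>m n)"
  using psd_adj_mult[of "1\<^sub>m n" n n] by simp

lemma psd_zero [simp]: "psd (0\<^sub>m n n)"
  using psd_adj_mult[of "0\<^sub>m n n" n n] by simp

lemma psd_diag_nonneg:
  assumes "psd A" "A \<in> carrier_mat n n" "i < n"
  shows "0 \<le> A $$ (i, i)"
proof -
  have "(A *\<^sub>v unit_vec n i) \<bullet>c unit_vec n i = A $$ (i, i)"
    using assms by (auto simp: mult_mat_vec_def scalar_prod_def unit_vec_def if_distrib
      if_distribR sum.delta cong: if_cong)
  then show ?thesis using psdD[OF assms(1,2), of "unit_vec n i"] by simp
qed

text \<open>Polarization. The quadratic form is real on every vector; on e_i + e_j this forces the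
  imaginary parts of the two mirrored entries to cancel, and on e_i + \<i> e_j it forces their real
  parts to agree.\<close>

lemma psd_adj_eq:
  assumes "psd A" shows "adj A = A"
proof -
  obtain n where A: "A \<in> carrier_mat n n" using psd_carrier[OF assms] .
  let ?q = "\<lambda>v. \<Sum>i<n. \<Sum>j<n. A $$ (i, j) * v j * cnj (v i)"
  have real: "Im (?q v) = 0" for v
  proof -
    have "?q v = (A *\<^sub>v vec n v) \<bullet>c vec n v"
      by (subst quad_form_sum[OF A]) (auto intro!: sum.cong)
    then show ?thesis using psdD[OF assms A, of "vec n v"] by (simp add: less_eq_complex_def)
  qed
  have q: "?q (\<lambda>k. (if k = i then x else 0) + (if k = j then y else 0)) =
      A $$ (i, i) * x * cnj x + A $$ (i, j) * y * cnj x + A $$ (j, i) * x * cnj y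
        + A $$ (j, j) * y * cnj y" (is "?L = _")
    if ij: "i < n" "j < n" for i j and x y :: complex
  proof -
    have "?L = (\<Sum>k<n. \<Sum>l<n. (if k = i then (if l = i then A $$ (i, i) * x * cnj x else 0) else 0)
       + (if k = i then (if l = j then A $$ (i, j) * y * cnj x else 0) else 0)
       + (if k = j then (if l = i then A $$ (j, i) * x * cnj y else 0) else 0)
       + (if k = j then (if l = j then A $$ (j, j) * y * cnj y else 0) else 0))"
      by (intro sum.cong refl) (auto simp: algebra_simps)
    also have "\<dots> = A $$ (i, i) * x * cnj x + A $$ (i, j) * y * cnj x + A $$ (j, i) * x * cnj y
        + A $$ (j, j) * y * cnj y"
    proof -
      have one: "(\<Sum>k<n. \<Sum>l<n. if k = a then (if l = b then c else 0) else 0) = (c :: complex)"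
        if "a < n" "b < n" for a b c
      proof -
        have "(\<Sum>k<n. \<Sum>l<n. if k = a then (if l = b then c else 0) else 0) =
            (\<Sum>k<n. if k = a then (\<Sum>l<n. if l = b then c else 0) else 0)"
          by (intro sum.cong) auto
        also have "\<dots> = c" using that by (simp add: sum.delta)
        finally show ?thesis .
      qed
      show ?thesis using ij by (simp only: sum.distrib one)
    qed
    finally show ?thesis .
  qed
  show ?thesis
  proof (rule eq_matI)
    fix i j assume "i < dim_row A" "j < dim_col A"
    then have ij: "i < n" "j < n" using A by auto
    have d: "Im (A $$ (i, i)) = 0" "Im (A $$ (j, j)) = 0"
      using psd_diag_nonneg[OF assms A ij(1)] psd_diag_nonneg[OF assms A ij(2)]
      by (simp_all add: less_eq_complex_def)
    have "Im (A $$ (i, j)) + Im (A $$ (j, i)) = 0"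
      using real[of "\<lambda>k. (if k = i then 1 else 0) + (if k = j then 1 else 0)"]
      unfolding q[OF ij] using d by simp
    moreover have "Re (A $$ (i, j)) = Re (A $$ (j, i))"
      using real[of "\<lambda>k. (if k = i then 1 else 0) + (if k = j then \<i> else 0)"]
      unfolding q[OF ij] using d by simp
    ultimately show "adj A $$ (i, j) = A $$ (i, j)"
      using ij A by (auto simp: complex_eq_iff)
  qed (use A in auto)
qed

lemma psd_trace_nonneg:
  assumes "psd A" shows "0 \<le> mat_trace A"
proof -
  obtain n where A: "A \<in> carrier_mat n n" using psd_carrier[OF assms] .
  show ?thesis
    unfolding mat_trace_def using psd_diag_nonneg[OF assms A] A by (intro sum_nonneg) auto
qed

lemma psd_trace_real: "psd A \<Longrightarrow> mat_trace A = complex_of_real (Re (mat_trace A))"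
  using psd_trace_nonneg[of A] by (simp add: less_eq_complex_def complex_eq_iff)

text \<open>This rule and the next ones have equations between dimensions as side conditions, which
  the simplifier solves by rewriting. With carrier sets the inner dimensions would occur only in the
  premises and would have to be guessed.\<close>

lemma mat_mult_assoc:
  "dim_col A = dim_row B \<Longrightarrow> dim_col B = dim_row C \<Longrightarrow> A * B * C = A * (B * (C :: complex mat))"
  by (rule assoc_mult_mat) auto

lemma adj_times: "dim_col A = dim_row B \<Longrightarrow> adj (A * B) = adj B * adj A"
  by (rule adj_mult) auto

lemma mat_add_times:
  "dim_row A = dim_row B \<Longrightarrow> dim_col A = dim_col B \<Longrightarrow> dim_col A = dim_row C \<Longrightarrow>
   (A + B) * C = A * C + B * (C :: complex mat)"
  by (rule add_mult_distrib_mat) auto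

lemma mat_times_add:
  "dim_row B = dim_row C \<Longrightarrow> dim_col B = dim_col C \<Longrightarrow> dim_col A = dim_row B \<Longrightarrow>
   A * (B + C) = A * B + A * (C :: complex mat)"
  by (rule mult_add_distrib_mat) auto

lemma mat_minus_times:
  "dim_row A = dim_row B \<Longrightarrow> dim_col A = dim_col B \<Longrightarrow> dim_col A = dim_row C \<Longrightarrow>
   (A - B) * C = A * C - B * (C :: complex mat)"
  by (rule minus_mult_distrib_mat) auto

lemma mat_times_minus:
  "dim_row B = dim_row C \<Longrightarrow> dim_col B = dim_col C \<Longrightarrow> dim_col A = dim_row B \<Longrightarrow>
   A * (B - C) = A * B - A * (C :: complex mat)"
  by (rule mult_minus_distrib_mat) auto

lemma mat_one_times: "dim_row A = n \<Longrightarrow> 1\<^sub>m n * A = (A :: complex mat)"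
  by (rule left_mult_one_mat) auto

lemma mat_times_one: "dim_col A = n \<Longrightarrow> A * 1\<^sub>m n = (A :: complex mat)"
  by (rule right_mult_one_mat) auto

lemmas mat_ring = mat_mult_assoc adj_times mat_add_times mat_times_add mat_minus_times
  mat_times_minus mat_one_times mat_times_one

section \<open>Spectral theorem for Hermitian matrices\<close>

definition rdiag :: "nat \<Rightarrow> (nat \<Rightarrow> real) \<Rightarrow> complex mat" where
  "rdiag n d = mat n n (\<lambda>(i, j). if i = j then complex_of_real (d i) else 0)"

lemma rdiag_dim [simp]: "dim_row (rdiag n d) = n" "dim_col (rdiag n d) = n"
  "rdiag n d \<in> carrier_mat n n"
  by (simp_all add: rdiag_def)

lemma adj_rdiag [simp]: "adj (rdiag n d) = rdiag n d"
  by (rule eq_matI) (auto simp: rdiag_def)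

lemma rdiag_mult: "rdiag n d * rdiag n e = rdiag n (\<lambda>i. d i * e i)"
proof (rule eq_matI)
  fix i j assume "i < dim_row (rdiag n (\<lambda>i. d i * e i))" "j < dim_col (rdiag n (\<lambda>i. d i * e i))"
  then have ij: "i < n" "j < n" by auto
  have "(rdiag n d * rdiag n e) $$ (i, j) =
      (\<Sum>k<n. if k = i then (if i = j then complex_of_real (d i * e i) else 0) else 0)"
  proof -
    have "(rdiag n d * rdiag n e) $$ (i, j) = (\<Sum>k<n. rdiag n d $$ (i, k) * rdiag n e $$ (k, j))"
      by (rule mult_index_sum) (use ij in auto)
    also have "\<dots> = (\<Sum>k<n. if k = i then (if i = j then complex_of_real (d i * e i) else 0) else 0)"
      using ij by (intro sum.cong) (auto simp: rdiag_def)
    finally show ?thesis .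
  qed
  then show "(rdiag n d * rdiag n e) $$ (i, j) = rdiag n (\<lambda>i. d i * e i) $$ (i, j)"
    using ij by (simp add: rdiag_def)
qed auto

text \<open>The reflection \<open>1 - w w\<^sup>*/s\<close> along \<open>w = v - e\<^sub>0\<close> maps \<open>e\<^sub>0\<close> to the unit vector \<open>v\<close>,
  provided the first component of \<open>v\<close> is real; taking it nonpositive keeps \<open>s\<close> away from 0.\<close>

lemma householder:
  fixes v :: "nat \<Rightarrow> complex" and p :: real
  assumes "(\<Sum>i<Suc n. (cmod (v i))\<^sup>2) = 1" "v 0 = - complex_of_real p" "0 \<le> p"
  shows "\<exists>H \<in> carrier_mat (Suc n) (Suc n). adj H = H \<and> H * H = 1\<^sub>m (Suc n)
    \<and> (\<forall>i<Suc n. H $$ (i, 0) = v i)"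
proof -
  define s where "s = complex_of_real (1 + p)"
  define w where "w = (\<lambda>i. v i - (if i = 0 then 1 else 0))"
  define H where "H = mat (Suc n) (Suc n) (\<lambda>(i, j). (if i = j then 1 else 0) - w i * cnj (w j) / s)"
  have s0: "s \<noteq> 0" and cs: "cnj s = s" using assms(3) unfolding s_def by (simp_all add: complex_eq_iff)
  have H: "H \<in> carrier_mat (Suc n) (Suc n)" by (simp add: H_def)
  have aH: "adj H = H"
    by (rule eq_matI) (auto simp: H_def cs)
  \<comment> \<open>So \<open>s\<close> is half of the squared norm of \<open>w\<close>, and
    \<open>H\<close> is indeed the reflection 1 - 2 w w^* / |w|^2.\<close>
  have ww: "(\<Sum>k<Suc n. cnj (w k) * w k) = 2 * s"
  proof -
    have "(\<Sum>k<Suc n. cnj (w k) * w k) =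
        (\<Sum>k<Suc n. complex_of_real ((cmod (v k))\<^sup>2) + (if k = 0 then 1 - v k - cnj (v k) else 0))"
      by (intro sum.cong) (auto simp: w_def complex_norm_square algebra_simps simp del: of_real_power)
    also have "\<dots> = complex_of_real (\<Sum>k<Suc n. (cmod (v k))\<^sup>2) + (1 - v 0 - cnj (v 0))"
      by (simp add: sum.distrib sum.delta del: sum.lessThan_Suc of_real_power)
    also have "\<dots> = 2 * s" using assms by (simp add: s_def)
    finally show ?thesis .
  qed
  have "H * H = 1\<^sub>m (Suc n)"
  proof (rule eq_matI)
    fix i j assume "i < dim_row (1\<^sub>m (Suc n) :: complex mat)" "j < dim_col (1\<^sub>m (Suc n) :: complex mat)"
    then have ij: "i < Suc n" "j < Suc n" by auto
    have "(H * H) $$ (i, j) = (\<Sum>k<Suc n. H $$ (i, k) * H $$ (k, j))"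
      by (rule mult_index_sum[OF H H ij])
    also have "\<dots> = (\<Sum>k<Suc n. (if k = i then (if i = j then 1 else 0) else 0)
        - (if k = i then w i * cnj (w j) / s else 0) - (if k = j then w i * cnj (w j) / s else 0)
        + w i * cnj (w j) / (s * s) * (cnj (w k) * w k))"
      using ij by (intro sum.cong) (auto simp: H_def field_simps s0)
    also have "\<dots> = (if i = j then 1 else 0) - w i * cnj (w j) / s - w i * cnj (w j) / s
        + w i * cnj (w j) / (s * s) * (2 * s)"
      unfolding sum.distrib sum_subtractf sum_distrib_left[symmetric] ww
      using ij by (simp add: sum.delta del: sum.lessThan_Suc)
    also have "\<dots> = (if i = j then 1 else 0)" using s0 by (simp add: field_simps)
    finally show "(H * H) $$ (i, j) = 1\<^sub>m (Suc n) $$ (i, j)" using ij by simp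
  qed (auto simp: H_def)
  moreover have "H $$ (i, 0) = v i" if "i < Suc n" for i
  proof -
    have "cnj (w 0) = - s" using assms(2) by (simp add: w_def s_def)
    then show ?thesis using that s0 by (auto simp: H_def w_def)
  qed
  ultimately show ?thesis using H aH by blast
qed

lemma four_block_adj_diag:
  assumes "A \<in> carrier_mat m m" "B \<in> carrier_mat n n"
  shows "adj (four_block_mat A (0\<^sub>m m n) (0\<^sub>m n m) B) = four_block_mat (adj A) (0\<^sub>m m n) (0\<^sub>m n m) (adj B)"
  using assms by (intro eq_matI) auto

lemma four_block_mult_diag:
  assumes "A \<in> carrier_mat m m" "B \<in> carrier_mat n n" "C \<in> carrier_mat m m" "D \<in> carrier_mat n n"
  shows "four_block_mat A (0\<^sub>m m n) (0\<^sub>m n m) B * four_block_mat C (0\<^sub>m m n) (0\<^sub>m n m) D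
    = four_block_mat (A * C) (0\<^sub>m m n) (0\<^sub>m n m) (B * (D :: complex mat))"
  using assms by (subst mult_four_block_mat[OF assms(1) zero_carrier_mat zero_carrier_mat assms(2,3)
    zero_carrier_mat zero_carrier_mat assms(4)]) auto

text \<open>Deflation. A Householder reflection \<open>H\<close> moves e_0 to a unit eigenvector, so
  the first column of \<open>B\<close>, the conjugate of \<open>A\<close> by \<open>H\<close>, is a
  multiple of e_0. As \<open>B\<close> is Hermitian, its first row is too, and the remaining block
  \<open>C\<close> is Hermitian of smaller size.\<close>

theorem hermitian_diagonalization:
  assumes "A \<in> carrier_mat n n" "adj A = A"
  shows "\<exists>U d. U \<in> carrier_mat n n \<and> adj U * U = 1\<^sub>m n \<and> U * adj U = 1\<^sub>m n
    \<and> A = U * rdiag n d * adj U"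
  using assms
proof (induction n arbitrary: A)
  case 0
  then show ?case by (intro exI[of _ "1\<^sub>m 0"]) (auto intro!: eq_matI)
next
  case (Suc n)
  note A = Suc.prems(1)
  obtain k v0 where ev: "eigenvector A v0 k"
    using spectrum_non_empty[OF A] by (auto simp: spectrum_def eigenvalue_def)
  then have v0: "v0 \<in> carrier_vec (Suc n)" "v0 \<noteq> 0\<^sub>v (Suc n)" "A *\<^sub>v v0 = k \<cdot>\<^sub>v v0"
    using A by (auto simp: eigenvector_def)
  define nv where "nv = sqrt (\<Sum>i<Suc n. (cmod (v0 $ i))\<^sup>2)"
  have nv: "nv > 0"
  proof -
    obtain i where i: "i < Suc n" "v0 $ i \<noteq> 0"
      using v0 by (metis carrier_vecD eq_vecI index_zero_vec)
    have "0 < (\<Sum>i<Suc n. (cmod (v0 $ i))\<^sup>2)"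
      by (rule sum_pos2[of _ i]) (use i in auto)
    then show ?thesis by (simp add: nv_def del: sum.lessThan_Suc)
  qed
  define z where "z = v0 $ 0"
  \<comment> \<open>Normalizes the eigenvector and rotates its first component to the nonpositive
    reals, as \<open>householder\<close> requires. If that component is 0, any phase will do and 1
    is taken.\<close>
  define a where "a = (if z = 0 then 1 else - cnj z / complex_of_real (cmod z)) / complex_of_real nv"
  define v where "v = (\<lambda>i. a * v0 $ i)"
  have ca: "cmod a = 1 / nv" using nv by (simp add: a_def norm_divide)
  have v1: "(\<Sum>i<Suc n. (cmod (v i))\<^sup>2) = 1"
  proof -
    have "(\<Sum>i<Suc n. (cmod (v i))\<^sup>2) = (1 / nv)\<^sup>2 * (\<Sum>i<Suc n. (cmod (v0 $ i))\<^sup>2)"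
      unfolding v_def norm_mult ca power_mult_distrib sum_distrib_left ..
    also have "(\<Sum>i<Suc n. (cmod (v0 $ i))\<^sup>2) = nv\<^sup>2"
      unfolding nv_def by (simp add: sum_nonneg del: sum.lessThan_Suc)
    finally show ?thesis using nv by (simp add: power_divide)
  qed
  have v2: "v 0 = - complex_of_real (cmod z / nv)"
  proof (cases "z = 0")
    case False
    have "cnj z * z = complex_of_real (cmod z) * complex_of_real (cmod z)"
      using complex_norm_square[of z] by (simp add: power2_eq_square mult.commute)
    then show ?thesis using False nv by (simp add: v_def a_def z_def[symmetric] field_simps)
  qed (simp add: v_def z_def)
  obtain H where H: "H \<in> carrier_mat (Suc n) (Suc n)" "adj H = H" "H * H = 1\<^sub>m (Suc n)"
    "\<forall>i<Suc n. H $$ (i, 0) = v i"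
    using householder[OF v1 v2] nv by auto
  note d = carrier_matD[OF A] carrier_matD[OF H(1)]
  define B where "B = H * (A * H)"
  have B: "B \<in> carrier_mat (Suc n) (Suc n)" unfolding B_def using H A by auto
  have aB: "adj B = B"
    unfolding B_def by (simp add: mat_ring d H(2) Suc.prems(2))
  have Av: "(\<Sum>l<Suc n. A $$ (i, l) * v l) = k * v i" if i: "i < Suc n" for i
  proof -
    have "(A *\<^sub>v v0) $ i = (\<Sum>l<Suc n. A $$ (i, l) * v0 $ l)"
      using A v0(1) i by (auto simp: scalar_prod_def lessThan_atLeast0)
    then have *: "(\<Sum>l<Suc n. A $$ (i, l) * v0 $ l) = k * v0 $ i"
      unfolding v0(3) using v0 i by simp
    have "(\<Sum>l<Suc n. A $$ (i, l) * v l) = a * (\<Sum>l<Suc n. A $$ (i, l) * v0 $ l)"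
      unfolding sum_distrib_left v_def by (intro sum.cong) auto
    then show ?thesis unfolding * by (simp add: v_def)
  qed
  \<comment> \<open>The first column of \<open>H\<close> is the eigenvector, so \<open>A * H\<close>
    acts on it as multiplication by \<open>k\<close>; the second factor \<open>H\<close> returns it
    to e_0 because \<open>H\<close> is an involution.\<close>
  have B0: "B $$ (i, 0) = (if i = 0 then k else 0)" if i: "i < Suc n" for i
  proof -
    have "B $$ (i, 0) = (\<Sum>j<Suc n. H $$ (i, j) * (A * H) $$ (j, 0))"
      unfolding B_def by (rule mult_index_sum) (use H A i in auto)
    also have "\<dots> = (\<Sum>j<Suc n. H $$ (i, j) * (k * H $$ (j, 0)))"
    proof (intro sum.cong arg_cong2[of _ _ _ _ times] refl)
      fix j assume j: "j \<in> {..<Suc n}"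
      then have "(A * H) $$ (j, 0) = (\<Sum>l<Suc n. A $$ (j, l) * H $$ (l, 0))"
        by (intro mult_index_sum) (use H A in auto)
      also have "\<dots> = (\<Sum>l<Suc n. A $$ (j, l) * v l)" using H(4) by (intro sum.cong) auto
      finally show "(A * H) $$ (j, 0) = k * H $$ (j, 0)" using Av[of j] H(4) j by auto
    qed
    also have "\<dots> = k * (H * H) $$ (i, 0)"
      by (subst mult_index_sum[OF H(1) H(1) i]) (auto simp: sum_distrib_left mult_ac simp del: sum.lessThan_Suc)
    finally show ?thesis using i by (simp add: H(3))
  qed
  have Bh: "B $$ (i, j) = cnj (B $$ (j, i))" if "i < Suc n" "j < Suc n" for i j
    using adj_index[of i B j] B that unfolding aB by auto
  have k: "k = complex_of_real (Re k)"
    using Bh[of 0 0] B0[of 0] by (simp add: complex_eq_iff)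
  define C where "C = mat n n (\<lambda>(i, j). B $$ (Suc i, Suc j))"
  have C: "C \<in> carrier_mat n n" by (simp add: C_def)
  have "adj C = C" by (rule eq_matI) (auto simp: C_def Bh[symmetric])
  from Suc.IH[OF C this] obtain V e where V: "V \<in> carrier_mat n n" "adj V * V = 1\<^sub>m n"
    "V * adj V = 1\<^sub>m n" "C = V * rdiag n e * adj V" by blast
  define fb where "fb = (\<lambda>X Y. four_block_mat X (0\<^sub>m 1 n) (0\<^sub>m n 1) (Y :: complex mat))"
  have fbm: "fb X Y * fb X' Y' = fb (X * X') (Y * Y')"
    if "X \<in> carrier_mat 1 1" "Y \<in> carrier_mat n n" "X' \<in> carrier_mat 1 1" "Y' \<in> carrier_mat n n" for X Y X' Y'
    unfolding fb_def by (rule four_block_mult_diag) (use that in auto)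
  have fb1: "fb (1\<^sub>m 1) (1\<^sub>m n) = 1\<^sub>m (Suc n)"
    unfolding fb_def by simp
  define W where "W = fb (1\<^sub>m 1) V"
  define e' where "e' = case_nat (Re k) e"
  have W: "W \<in> carrier_mat (Suc n) (Suc n)" unfolding W_def fb_def using V(1) by auto
  have aW: "adj W = fb (1\<^sub>m 1) (adj V)"
    unfolding W_def fb_def by (subst four_block_adj_diag) (use V(1) in auto)
  have W1: "adj W * W = 1\<^sub>m (Suc n)" "W * adj W = 1\<^sub>m (Suc n)"
    unfolding aW unfolding W_def using V(1) fb1 by (simp_all add: fbm V(2,3))
  have D: "rdiag (Suc n) e' = fb (mat 1 1 (\<lambda>_. k)) (rdiag n e)"
    unfolding fb_def by (rule eq_matI) (use k in \<open>auto simp: rdiag_def e'_def split: nat.splits\<close>)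
  have "W * rdiag (Suc n) e' * adj W = fb (1\<^sub>m 1 * mat 1 1 (\<lambda>_. k) * 1\<^sub>m 1) (V * rdiag n e * adj V)"
    unfolding aW D unfolding W_def using V(1) by (simp add: fbm)
  also have "\<dots> = fb (mat 1 1 (\<lambda>_. k)) C"
    using V by simp
  also have "\<dots> = B"
  proof (rule eq_matI)
    fix i j assume "i < dim_row B" "j < dim_col B"
    then have ij: "i < Suc n" "j < Suc n" using B by auto
    show "fb (mat 1 1 (\<lambda>_. k)) C $$ (i, j) = B $$ (i, j)"
      using ij B0 Bh[of i j] by (cases i; cases j) (auto simp: fb_def C_def)
  qed (use B in \<open>auto simp: fb_def C_def\<close>)
  finally have BW: "B = W * rdiag (Suc n) e' * adj W" ..
  have dW: "dim_row W = Suc n" "dim_col W = Suc n" using W by auto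
  have "A = H * B * H"
  proof -
    have "H * B * H = (H * H) * (A * (H * H))" unfolding B_def by (simp add: mat_ring d)
    also have "\<dots> = A" unfolding H(3) using A by simp
    finally show ?thesis ..
  qed
  also have "\<dots> = (H * W) * rdiag (Suc n) e' * adj (H * W)"
    unfolding BW by (simp add: mat_ring d dW H(2))
  finally have "A = (H * W) * rdiag (Suc n) e' * adj (H * W)" .
  moreover have "adj (H * W) * (H * W) = 1\<^sub>m (Suc n)"
  proof -
    have "adj (H * W) * (H * W) = adj W * ((H * H) * W)" by (simp add: mat_ring d dW H(2))
    then show ?thesis by (simp add: H(3) W1 mat_ring dW)
  qed
  moreover have "(H * W) * adj (H * W) = 1\<^sub>m (Suc n)"
  proof -
    have "(H * W) * adj (H * W) = H * ((W * adj W) * H)" by (simp add: mat_ring d dW H(2))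
    then show ?thesis by (simp add: H(3) W1 mat_ring d)
  qed
  moreover have "H * W \<in> carrier_mat (Suc n) (Suc n)" using H W by auto
  ultimately show ?case by blast
qed

lemma psd_diagonalization:
  assumes "psd A" "A \<in> carrier_mat n n"
  shows "\<exists>U d. U \<in> carrier_mat n n \<and> adj U * U = 1\<^sub>m n \<and> U * adj U = 1\<^sub>m n
    \<and> A = U * rdiag n d * adj U \<and> (\<forall>i<n. 0 \<le> d i)"
proof -
  obtain U d where U: "U \<in> carrier_mat n n" "adj U * U = 1\<^sub>m n" "U * adj U = 1\<^sub>m n"
    and A: "A = U * rdiag n d * adj U"
    using hermitian_diagonalization[OF assms(2) psd_adj_eq[OF assms(1)]] by blast
  have dU: "dim_row U = n" "dim_col U = n" using U(1) by auto
  have "adj U * A * U = (adj U * U) * rdiag n d * (adj U * U)"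
    unfolding A by (simp add: mat_ring dU)
  also have "\<dots> = rdiag n d" unfolding U(2) by (simp add: mat_ring)
  finally have "psd (rdiag n d)"
    using psd_conj_adj[OF assms U(1)] by simp
  then have "0 \<le> d i" if "i < n" for i
    using psd_diag_nonneg[of "rdiag n d" n i] that by (simp add: rdiag_def less_eq_complex_def)
  then show ?thesis using U A by blast
qed

lemma psd_rdiag:
  assumes "\<And>i. i < n \<Longrightarrow> 0 \<le> d i" shows "psd (rdiag n d)"
proof -
  have "rdiag n d = adj (rdiag n (\<lambda>i. sqrt (d i))) * rdiag n (\<lambda>i. sqrt (d i))"
    by (rule eq_matI) (use assms in \<open>auto simp: rdiag_mult, auto simp: rdiag_def\<close>)
  then show ?thesis using psd_adj_mult[of "rdiag n (\<lambda>i. sqrt (d i))" n n] by simp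
qed

text \<open>With \<open>Q\<close> = \<open>G * adj G\<close>, the trace equals that of
  \<open>adj G * P * G\<close>, which is positive. The product of \<open>P\<close> and
  \<open>Q\<close> itself need not be Hermitian.\<close>

lemma trace_psd_mult_nonneg:
  assumes "psd P" "psd Q" "P \<in> carrier_mat n n" "Q \<in> carrier_mat n n"
  shows "0 \<le> mat_trace (P * Q)"
proof -
  obtain U d where U: "U \<in> carrier_mat n n" "Q = U * rdiag n d * adj U" "\<forall>i<n. 0 \<le> d i"
    using psd_diagonalization[OF assms(2,4)] by blast
  define G where "G = U * rdiag n (\<lambda>i. sqrt (d i))"
  have G: "G \<in> carrier_mat n n" unfolding G_def using U by auto
  have dims: "dim_row U = n" "dim_col U = n" "dim_row P = n" "dim_col P = n" "dim_row G = n" "dim_col G = n"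
    using U assms G by auto
  have r: "rdiag n (\<lambda>i. sqrt (d i)) * rdiag n (\<lambda>i. sqrt (d i)) = rdiag n d"
    unfolding rdiag_mult by (rule eq_matI) (use U(3) in \<open>auto simp: rdiag_def\<close>)
  have "G * adj G = U * (rdiag n (\<lambda>i. sqrt (d i)) * rdiag n (\<lambda>i. sqrt (d i))) * adj U"
    unfolding G_def by (simp add: mat_ring dims)
  then have Q: "Q = G * adj G" unfolding r U(2) by simp
  have "mat_trace (P * Q) = mat_trace ((P * G) * adj G)" unfolding Q by (simp add: mat_ring dims)
  also have "\<dots> = mat_trace (adj G * (P * G))"
    by (rule trace_mult_comm[of _ n n]) (use G assms in auto)
  also have "\<dots> = mat_trace (adj G * P * G)" by (simp add: mat_ring dims)
  also have "0 \<le> \<dots>" by (rule psd_trace_nonneg[OF psd_conj_adj[OF assms(1,3) G]])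
  finally show ?thesis .
qed

section \<open>Contractions, and trace norm bounds by duality\<close>

definition contr :: "complex mat \<Rightarrow> bool" where
  "contr K \<longleftrightarrow> psd (1\<^sub>m (dim_col K) - adj K * K)"

lemma contr_isometry:
  assumes "K \<in> carrier_mat m n" "adj K * K = 1\<^sub>m n" shows "contr K"
proof -
  have "1\<^sub>m n - 1\<^sub>m n = (0\<^sub>m n n :: complex mat)" by (rule eq_matI) auto
  then have "psd (1\<^sub>m n - 1\<^sub>m n)" by (metis psd_zero)
  then show ?thesis unfolding contr_def assms(2) carrier_matD(2)[OF assms(1)] .
qed

text \<open>The defect of a product is the defect of \<open>L\<close> plus the defect of
  \<open>K\<close> conjugated by \<open>L\<close>, a sum of two positive operators.\<close>

lemma contr_mult:
  assumes "contr K" "contr L" "K \<in> carrier_mat m n" "L \<in> carrier_mat n p"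
  shows "contr (K * L)"
proof -
  note d = carrier_matD[OF assms(3)] carrier_matD[OF assms(4)]
  have "1\<^sub>m p - adj (K * L) * (K * L)
      = (1\<^sub>m p - adj L * L) + adj L * (1\<^sub>m n - adj K * K) * L" (is "?A = ?B + ?C")
  proof -
    have "?C = adj L * L - adj (K * L) * (K * L)" by (simp add: mat_ring d)
    then show ?thesis by (intro eq_matI) (use assms in auto)
  qed
  moreover have "psd (?B + ?C)"
  proof (rule psd_add[where n = p])
    show "psd ?B" using assms(2,4) by (simp add: contr_def)
    show "psd ?C" by (rule psd_conj_adj[of _ n]) (use assms in \<open>auto simp: contr_def\<close>)
  qed (use assms in auto)
  ultimately show ?thesis using assms by (simp add: contr_def)
qed

text \<open>For P = \<open>K * adj K\<close>, the operator 1 - P is the sum of (1 - P)^2 and P -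
  P^2. The second summand is the defect 1 - \<open>adj K * K\<close> conjugated by \<open>K\<close>,
  hence positive; no singular values are involved.\<close>

lemma contr_adj:
  assumes "contr K" shows "contr (adj K)"
proof -
  obtain m n where K: "K \<in> carrier_mat m n" by blast
  note d = carrier_matD[OF K]
  define P where "P = K * adj K"
  have P: "P \<in> carrier_mat m m" "adj P = P" unfolding P_def using K by (auto simp: mat_ring)
  note dP = carrier_matD[OF P(1)]
  have 1: "K * (1\<^sub>m n - adj K * K) * adj K = P - P * P"
    unfolding P_def by (simp add: mat_ring d)
  have 2: "adj (1\<^sub>m m - P) * (1\<^sub>m m - P) = 1\<^sub>m m - P - (P - P * P)"
    using P by (simp add: mat_ring dP adj_minus[of _ m m])
  have "psd (P - P * P)"
    unfolding 1[symmetric] by (rule psd_conj[of _ n]) (use assms K in \<open>auto simp: contr_def\<close>)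
  moreover have "psd (1\<^sub>m m - P - (P - P * P))"
    unfolding 2[symmetric] by (rule psd_adj_mult[of _ m]) (use P in auto)
  moreover have "(1\<^sub>m m - P - (P - P * P)) + (P - P * P) = 1\<^sub>m m - P"
    by (rule eq_matI) (use P in auto)
  ultimately have "psd (1\<^sub>m m - P)"
    using psd_add[of "1\<^sub>m m - P - (P - P * P)" "P - P * P" m] P(1) by fastforce
  then show ?thesis using K by (simp add: contr_def P_def)
qed

lemma hs_sq_contr_mult:
  assumes "contr C" "C \<in> carrier_mat m n" "G \<in> carrier_mat n p"
  shows "hs_sq (C * G) \<le> hs_sq G"
proof -
  note d = carrier_matD[OF assms(2)] carrier_matD[OF assms(3)]
  have "psd (adj G * (1\<^sub>m n - adj C * C) * G)"
    by (rule psd_conj_adj[of _ n]) (use assms in \<open>auto simp: contr_def\<close>)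
  from psd_trace_nonneg[OF this]
  have "0 \<le> mat_trace (adj G * G - adj (C * G) * (C * G))" by (simp add: mat_ring d)
  then have "0 \<le> mat_trace (adj G * G) - mat_trace (adj (C * G) * (C * G))"
    by (subst (asm) trace_minus[of _ p]) (use assms in auto)
  then show ?thesis unfolding trace_adj_mult by (simp add: less_eq_complex_def)
qed

text \<open>\<open>tn_le M c\<close> expresses \<open>\<parallel>M\<parallel>\<^sub>1 \<le> c\<close> through the dual characterization of the trace norm.\<close>

definition tn_le :: "complex mat \<Rightarrow> real \<Rightarrow> bool" where
  "tn_le M c \<longleftrightarrow> (\<forall>C \<in> carrier_mat (dim_row M) (dim_row M).
     contr C \<longrightarrow> cmod (mat_trace (C * M)) \<le> c)"

lemma tn_leI:
  assumes "M \<in> carrier_mat n n"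
    "\<And>C. C \<in> carrier_mat n n \<Longrightarrow> contr C \<Longrightarrow> cmod (mat_trace (C * M)) \<le> c"
  shows "tn_le M c"
  using assms by (auto simp: tn_le_def)

lemma tn_leD:
  "tn_le M c \<Longrightarrow> M \<in> carrier_mat n n \<Longrightarrow> C \<in> carrier_mat n n \<Longrightarrow> contr C \<Longrightarrow>
   cmod (mat_trace (C * M)) \<le> c"
  by (auto simp: tn_le_def)

lemma tn_le_mono: "tn_le M c \<Longrightarrow> c \<le> c' \<Longrightarrow> tn_le M c'"
  unfolding tn_le_def by (meson order.trans)

lemma tn_le_add:
  assumes "tn_le M c" "tn_le N d" "M \<in> carrier_mat n n" "N \<in> carrier_mat n n"
  shows "tn_le (M + N) (c + d)"
proof (rule tn_leI)
  fix C assume C: "C \<in> carrier_mat n n" "contr C"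
  have "mat_trace (C * (M + N)) = mat_trace (C * M) + mat_trace (C * N)"
    using C assms by (subst trace_add[symmetric, of _ n]) (auto simp: mult_add_distrib_mat[of _ n n])
  then show "cmod (mat_trace (C * (M + N))) \<le> c + d"
    using norm_triangle_ineq tn_leD[OF assms(1,3) C] tn_leD[OF assms(2,4) C]
    by (metis add_mono order.trans)
qed (use assms in auto)

lemma tn_le_uminus:
  assumes "tn_le M c" "M \<in> carrier_mat n n" shows "tn_le (- M) c"
proof (rule tn_leI)
  fix C assume C: "C \<in> carrier_mat n n" "contr C"
  have "mat_trace (C * (- M)) = - mat_trace (C * M)"
    using C assms(2) by (subst (1 2) trace_mult_sum[of _ n n]) (auto simp: sum_negf)
  then show "cmod (mat_trace (C * (- M))) \<le> c" using tn_leD[OF assms C] by simp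
qed (use assms in auto)

lemma tn_le_minus:
  assumes "tn_le M c" "tn_le N d" "M \<in> carrier_mat n n" "N \<in> carrier_mat n n"
  shows "tn_le (M - N) (c + d)"
proof -
  have "M - N = M + - N" by (rule eq_matI) (use assms in auto)
  then show ?thesis using tn_le_add[OF assms(1) tn_le_uminus[OF assms(2,4)] assms(3)] assms(4) by simp
qed

text \<open>Hoelder's inequality. By cyclicity the test operator is absorbed into \<open>X\<close>,
  whose Hilbert-Schmidt norm it cannot increase; Cauchy-Schwarz does the rest.\<close>

lemma tn_le_mult_adj:
  assumes "X \<in> carrier_mat n p" "Y \<in> carrier_mat n p"
  shows "tn_le (X * adj Y) (sqrt (hs_sq X) * sqrt (hs_sq Y))"
proof (rule tn_leI)
  fix C assume C: "C \<in> carrier_mat n n" "contr C"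
  note d = carrier_matD[OF assms(1)] carrier_matD[OF assms(2)] carrier_matD[OF C(1)]
  have "mat_trace (C * (X * adj Y)) = mat_trace ((C * X) * adj Y)" by (simp add: mat_ring d)
  also have "\<dots> = mat_trace (adj Y * (C * X))"
    by (rule trace_mult_comm[of _ n p]) (use assms C in auto)
  finally have "cmod (mat_trace (C * (X * adj Y))) \<le> sqrt (hs_sq Y) * sqrt (hs_sq (C * X))"
    using cmod_trace_adj_mult_le[of Y n p "C * X"] assms C by auto
  also have "\<dots> \<le> sqrt (hs_sq Y) * sqrt (hs_sq X)"
    using hs_sq_contr_mult[OF C(2,1) assms(1)] by (intro mult_left_mono) auto
  finally show "cmod (mat_trace (C * (X * adj Y))) \<le> sqrt (hs_sq X) * sqrt (hs_sq Y)"
    by (simp add: mult.commute)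
qed (use assms in auto)

text \<open>Testing the conjugated operator with \<open>C\<close> is the same as testing
  \<open>M\<close> with \<open>adj K * (C * K)\<close>, again a contraction. The dimension may
  change under \<open>K\<close>.\<close>

lemma tn_le_conj:
  assumes "tn_le M c" "M \<in> carrier_mat n n" "K \<in> carrier_mat m n" "contr K"
  shows "tn_le (K * M * adj K) c"
proof (rule tn_leI)
  fix C assume C: "C \<in> carrier_mat m m" "contr C"
  note d = carrier_matD[OF assms(2)] carrier_matD[OF assms(3)] carrier_matD[OF C(1)]
  have "mat_trace (C * (K * M * adj K)) = mat_trace ((C * K * M) * adj K)" by (simp add: mat_ring d)
  also have "\<dots> = mat_trace (adj K * (C * K * M))"
    by (rule trace_mult_comm[of _ m n]) (use assms C in auto)
  also have "\<dots> = mat_trace ((adj K * (C * K)) * M)" by (simp add: mat_ring d)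
  finally have e: "mat_trace (C * (K * M * adj K)) = mat_trace ((adj K * (C * K)) * M)" .
  show "cmod (mat_trace (C * (K * M * adj K))) \<le> c"
  proof -
    have CK: "contr (C * K)" "C * K \<in> carrier_mat m n"
      using contr_mult[OF C(2) assms(4) C(1) assms(3)] mult_carrier_mat[OF C(1) assms(3)] by auto
    have "contr (adj K * (C * K))"
      by (rule contr_mult[OF contr_adj[OF assms(4)] CK(1) adj_carrier[OF assms(3)] CK(2)])
    from tn_leD[OF assms(1,2) mult_carrier_mat[OF adj_carrier[OF assms(3)] CK(2)] this]
    show ?thesis unfolding e .
  qed
qed (use assms in auto)

text \<open>Let D = A - B, let C be the sign of D and M = CD = DC its absolute value. Since A^2 -
  B^2 = DA + BD, testing with C gives tr MA + tr MB. As M dominates both D and -D, this is at least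
  tr DA - tr DB, the squared norm of D.\<close>

lemma powers_stormer:
  assumes "psd A" "psd B" "A \<in> carrier_mat n n" "B \<in> carrier_mat n n"
    and "tn_le (A * A - B * B) c"
  shows "hs_sq (A - B) \<le> c"
proof -
  define D where "D = A - B"
  have D: "D \<in> carrier_mat n n" "adj D = D"
    unfolding D_def using assms psd_adj_eq adj_minus by auto
  obtain U l where U: "U \<in> carrier_mat n n" "adj U * U = 1\<^sub>m n" "U * adj U = 1\<^sub>m n"
    and Dd: "D = U * rdiag n l * adj U"
    using hermitian_diagonalization[OF D] by blast
  define C where "C = U * rdiag n (\<lambda>i. sgn (l i)) * adj U"
  define M where "M = U * rdiag n (\<lambda>i. \<bar>l i\<bar>) * adj U"
  have C: "C \<in> carrier_mat n n" and M: "M \<in> carrier_mat n n" using U by (auto simp: C_def M_def)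
  note d = carrier_matD[OF assms(3)] carrier_matD[OF assms(4)] carrier_matD[OF D(1)]
    carrier_matD[OF U(1)] carrier_matD[OF C] carrier_matD[OF M]
  have UU: "(U * rdiag n f * adj U) * (U * rdiag n g * adj U) = U * rdiag n (\<lambda>i. f i * g i) * adj U" for f g
  proof -
    have "(U * rdiag n f * adj U) * (U * rdiag n g * adj U)
        = U * (rdiag n f * ((adj U * U) * (rdiag n g * adj U)))" by (simp add: mat_ring d)
    also have "\<dots> = U * ((rdiag n f * rdiag n g) * adj U)" unfolding U(2) by (simp add: mat_ring d)
    also have "\<dots> = U * rdiag n (\<lambda>i. f i * g i) * adj U" unfolding rdiag_mult by (simp add: mat_ring d)
    finally show ?thesis .
  qed
  have CD: "C * D = M" "D * C = M"
    unfolding C_def Dd UU M_def by (simp_all add: abs_sgn mult.commute)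
  have psdU: "psd (U * rdiag n f * adj U)" if "\<And>i. i < n \<Longrightarrow> 0 \<le> f i" for f
    by (rule psd_conj[of _ n]) (use that U in \<open>auto intro: psd_rdiag\<close>)
  \<comment> \<open>The sign vanishes on the kernel of \<open>D\<close>, so \<open>C\<close> is only
    a partial isometry; its defect is the projection onto that kernel.\<close>
  have "contr C"
  proof -
    have one: "rdiag n (\<lambda>_. 1) = 1\<^sub>m n" by (rule eq_matI) (auto simp: rdiag_def)
    have rsub: "rdiag n f - rdiag n g = rdiag n (\<lambda>i. f i - g i)" for f g
      by (rule eq_matI) (auto simp: rdiag_def)
    have "1\<^sub>m n = U * rdiag n (\<lambda>_. 1) * adj U" unfolding one using U by (simp add: mat_ring d)
    moreover have "adj C * C = U * rdiag n (\<lambda>i. sgn (l i) * sgn (l i)) * adj U"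
    proof -
      have "adj C = C" unfolding C_def by (simp add: mat_ring d)
      then show ?thesis using UU unfolding C_def by metis
    qed
    ultimately have "1\<^sub>m n - adj C * C = U * rdiag n (\<lambda>i. 1 - sgn (l i) * sgn (l i)) * adj U"
      unfolding rsub[symmetric] by (simp add: mat_ring d)
    then show ?thesis unfolding contr_def using d psdU by (simp add: sgn_if)
  qed
  have rsub: "U * rdiag n f * adj U - U * rdiag n g * adj U = U * rdiag n (\<lambda>i. f i - g i) * adj U" for f g
  proof -
    have "rdiag n (\<lambda>i. f i - g i) = rdiag n f - rdiag n g" by (rule eq_matI) (auto simp: rdiag_def)
    then show ?thesis by (simp add: mat_ring d)
  qed
  have radd: "U * rdiag n f * adj U + U * rdiag n g * adj U = U * rdiag n (\<lambda>i. f i + g i) * adj U" for f g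
  proof -
    have "rdiag n (\<lambda>i. f i + g i) = rdiag n f + rdiag n g" by (rule eq_matI) (auto simp: rdiag_def)
    then show ?thesis by (simp add: mat_ring d)
  qed
  have p1: "psd (M - D)" and p2: "psd (M + D)"
    unfolding M_def Dd rsub radd by (auto intro!: psdU)
  have t1: "0 \<le> mat_trace ((M - D) * A)" and t2: "0 \<le> mat_trace ((M + D) * B)"
    by (rule trace_psd_mult_nonneg[OF p1 assms(1) minus_carrier_mat[OF D(1)] assms(3)],
        rule trace_psd_mult_nonneg[OF p2 assms(2) add_carrier_mat[OF D(1)] assms(4)])
  have tC: "mat_trace (C * (A * A - B * B)) = mat_trace (M * A) + mat_trace (M * B)"
  proof -
    have e: "A * A - B * B = D * A + B * D"
      unfolding D_def by (simp add: mat_ring d) (intro eq_matI; use assms in auto)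
    have "mat_trace (C * (A * A - B * B)) = mat_trace (C * (D * A) + C * (B * D))"
      unfolding e using d by (simp add: mat_times_add)
    also have "\<dots> = mat_trace ((C * D) * A) + mat_trace ((C * B) * D)"
      by (subst trace_add[of _ n]) (use C D assms in \<open>auto simp: mat_ring d\<close>)
    also have "mat_trace ((C * B) * D) = mat_trace (D * (C * B))"
      by (rule trace_mult_comm[of _ n n]) (use C D assms in auto)
    also have "D * (C * B) = (D * C) * B" by (simp add: mat_ring d)
    finally show ?thesis unfolding CD .
  qed
  have tD: "complex_of_real (hs_sq D) = mat_trace (D * A) - mat_trace (D * B)"
  proof -
    have "complex_of_real (hs_sq D) = mat_trace (D * (A - B))"
      using trace_mult_adj[of D] unfolding D(2) unfolding D_def by simp
    then show ?thesis using D assms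
      by (simp add: mat_times_minus d) (rule trace_minus[of _ n]; auto)
  qed
  have "0 \<le> mat_trace (M * A) - mat_trace (D * A)"
    using t1 M D assms by (simp add: mat_minus_times d) (subst (asm) trace_minus[of _ n]; auto)
  moreover have "0 \<le> mat_trace (M * B) + mat_trace (D * B)"
    using t2 M D assms by (simp add: mat_add_times d) (subst (asm) trace_add[of _ n]; auto)
  ultimately have "hs_sq D \<le> Re (mat_trace (M * A) + mat_trace (M * B))"
    using arg_cong[OF tD, of Re] by (simp add: less_eq_complex_def)
  also have "\<dots> \<le> cmod (mat_trace (C * (A * A - B * B)))"
    unfolding tC by (rule complex_Re_le_cmod)
  also have "\<dots> \<le> c"
    by (rule tn_leD[OF assms(5) _ C \<open>contr C\<close>]) (use assms in auto)
  finally show ?thesis unfolding D_def .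
qed

section \<open>Square roots, polar decomposition and fidelity\<close>

lemma psd_sqrt_ex:
  assumes "psd A" "A \<in> carrier_mat n n"
  shows "\<exists>S. psd S \<and> S * S = A"
proof -
  obtain U l where U: "U \<in> carrier_mat n n" "adj U * U = 1\<^sub>m n"
    and A: "A = U * rdiag n l * adj U" and l: "\<forall>i<n. 0 \<le> l i"
    using psd_diagonalization[OF assms] by blast
  define S where "S = U * rdiag n (\<lambda>i. sqrt (l i)) * adj U"
  note d = carrier_matD[OF U(1)]
  have "S * S = U * (rdiag n (\<lambda>i. sqrt (l i)) * ((adj U * U) * (rdiag n (\<lambda>i. sqrt (l i)) * adj U)))"
    unfolding S_def by (simp add: mat_ring d)
  also have "\<dots> = U * ((rdiag n (\<lambda>i. sqrt (l i)) * rdiag n (\<lambda>i. sqrt (l i))) * adj U)"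
    unfolding U(2) by (simp add: mat_ring d)
  also have "rdiag n (\<lambda>i. sqrt (l i)) * rdiag n (\<lambda>i. sqrt (l i)) = rdiag n l"
    unfolding rdiag_mult by (rule eq_matI) (use l in \<open>auto simp: rdiag_def\<close>)
  finally have "S * S = A" unfolding A by (simp add: mat_ring d)
  moreover have "psd S"
    unfolding S_def by (rule psd_conj[of _ n]) (use l U in \<open>auto intro!: psd_rdiag\<close>)
  ultimately show ?thesis by blast
qed

text \<open>Uniqueness is the Powers-Stormer inequality with bound 0.\<close>

lemma psd_sqrt_unique:
  assumes "psd S" "psd T" "S * S = T * T"
  shows "S = T"
proof -
  obtain n where S: "S \<in> carrier_mat n n" using psd_carrier[OF assms(1)] .
  obtain n' where T: "T \<in> carrier_mat n' n'" using psd_carrier[OF assms(2)] .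
  have "n' = n" using arg_cong[OF assms(3), of dim_row] S T by auto
  with T have T: "T \<in> carrier_mat n n" by simp
  have "tn_le (S * S - T * T) 0"
  proof (rule tn_leI)
    fix C :: "complex mat" assume C: "C \<in> carrier_mat n n"
    have z: "S * S - T * T = 0\<^sub>m n n" unfolding assms(3) using T by auto
    show "cmod (mat_trace (C * (S * S - T * T))) \<le> 0"
      unfolding z using C by (simp add: mat_trace_def)
  qed (use S T in auto)
  from powers_stormer[OF assms(1,2) S T this] have "hs_sq (S - T) = 0"
    using hs_sq_nonneg[of "S - T"] by linarith
  then have z: "S - T = 0\<^sub>m n n" using hs_sq_eq_0[OF minus_carrier_mat[OF T]] by auto
  show ?thesis
  proof (rule eq_matI)
    fix i j assume "i < dim_row T" "j < dim_col T"
    then show "S $$ (i, j) = T $$ (i, j)" using arg_cong[OF z, of "\<lambda>X. X $$ (i, j)"] S T by auto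
  qed (use S T in auto)
qed

lemma psd_sqrt:
  assumes "psd A" "A \<in> carrier_mat n n"
  shows "psd (psd_sqrt A)" "psd_sqrt A * psd_sqrt A = A" "psd_sqrt A \<in> carrier_mat n n"
    "adj (psd_sqrt A) = psd_sqrt A"
proof -
  have "\<exists>!S. psd S \<and> S * S = A" using psd_sqrt_ex[OF assms] psd_sqrt_unique by metis
  from theI'[OF this] show *: "psd (psd_sqrt A)" "psd_sqrt A * psd_sqrt A = A"
    unfolding psd_sqrt_def by auto
  obtain n' where S: "psd_sqrt A \<in> carrier_mat n' n'" using psd_carrier[OF *(1)] .
  then show "psd_sqrt A \<in> carrier_mat n n" using arg_cong[OF *(2), of dim_row] assms(2) by auto
  show "adj (psd_sqrt A) = psd_sqrt A" by (rule psd_adj_eq[OF *(1)])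
qed

text \<open>The contraction is C = \<open>Q * adj M\<close>, with \<open>Q\<close> the pseudoinverse
  of H = |M|: then CM = Q H^2 = H. The product \<open>C * adj C\<close> = Q H^2 Q is the projection
  onto the support of H, so \<open>adj C\<close> is a contraction and thus C is one as well.\<close>

lemma polar_contr:
  assumes "M \<in> carrier_mat m n"
  shows "\<exists>C \<in> carrier_mat n m. contr C \<and> C * M = psd_sqrt (adj M * M)"
proof -
  define H where "H = psd_sqrt (adj M * M)"
  have "adj M * M \<in> carrier_mat n n" using assms by auto
  note H = psd_sqrt[OF psd_adj_mult[OF assms] this, folded H_def]
  obtain U h where U: "U \<in> carrier_mat n n" "adj U * U = 1\<^sub>m n" "U * adj U = 1\<^sub>m n"
    and Hd: "H = U * rdiag n h * adj U"
    using psd_diagonalization[OF H(1,3)] by blast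
  note d = carrier_matD[OF U(1)] carrier_matD[OF H(3)] carrier_matD[OF assms]
  define p where "p = (\<lambda>i. if h i = 0 then 0 else 1 / h i)"
  define Q where "Q = U * rdiag n p * adj U"
  have Q: "Q \<in> carrier_mat n n" unfolding Q_def using U by auto
  note d = d carrier_matD[OF Q]
  have UU: "(U * rdiag n f * adj U) * (U * rdiag n g * adj U) = U * rdiag n (\<lambda>i. f i * g i) * adj U" for f g
  proof -
    have "(U * rdiag n f * adj U) * (U * rdiag n g * adj U)
        = U * (rdiag n f * ((adj U * U) * (rdiag n g * adj U)))" by (simp add: mat_ring d)
    also have "\<dots> = U * ((rdiag n f * rdiag n g) * adj U)" unfolding U(2) by (simp add: mat_ring d)
    also have "\<dots> = U * rdiag n (\<lambda>i. f i * g i) * adj U" unfolding rdiag_mult by (simp add: mat_ring d)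
    finally show ?thesis .
  qed
  define C where "C = Q * adj M"
  have C: "C \<in> carrier_mat n m" unfolding C_def using Q assms by auto
  have php: "(\<lambda>i. p i * (h i * h i)) = h" by (auto simp: p_def)
  have "C * M = Q * (H * H)" unfolding C_def H(2) by (simp add: mat_ring d)
  also have "\<dots> = U * rdiag n h * adj U" unfolding Q_def Hd UU php ..
  finally have CM: "C * M = H" unfolding Hd .
  have "contr (adj C)"
  proof -
    have aQ: "adj Q = Q" unfolding Q_def by (simp add: mat_ring d)
    have "adj (adj C) * adj C = Q * ((adj M * M) * Q)"
      unfolding C_def by (simp add: mat_ring d aQ)
    also have "\<dots> = (Q * (H * H)) * Q" unfolding H(2)[symmetric] by (simp add: mat_ring d)
    also have "\<dots> = U * rdiag n (\<lambda>i. h i * p i) * adj U" unfolding Q_def Hd UU php ..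
    finally have 1: "adj (adj C) * adj C = U * rdiag n (\<lambda>i. h i * p i) * adj U" .
    have one: "rdiag n (\<lambda>i. 1 - h i * p i) = 1\<^sub>m n - rdiag n (\<lambda>i. h i * p i)"
      by (rule eq_matI) (auto simp: rdiag_def)
    have "1\<^sub>m n - adj (adj C) * adj C = U * rdiag n (\<lambda>i. 1 - h i * p i) * adj U"
      unfolding 1 one using U by (simp add: mat_ring d)
    moreover have "psd \<dots>"
      by (rule psd_conj[of _ n]) (use U in \<open>auto intro!: psd_rdiag simp: p_def\<close>)
    ultimately show ?thesis unfolding contr_def using C by simp
  qed
  from contr_adj[OF this] have "contr C" by simp
  then show ?thesis using C CM unfolding H_def by blast
qed

lemma trace_norm_polar:
  assumes "M \<in> carrier_mat m n"
  shows "\<exists>C \<in> carrier_mat n m. contr C \<and> mat_trace (C * M) = complex_of_real (trace_norm M)"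
proof -
  obtain C where C: "C \<in> carrier_mat n m" "contr C" "C * M = psd_sqrt (adj M * M)"
    using polar_contr[OF assms] by blast
  have "adj M * M \<in> carrier_mat n n" using assms by auto
  then have "psd (psd_sqrt (adj M * M))" by (rule psd_sqrt(1)[OF psd_adj_mult[OF assms]])
  then show ?thesis using C psd_trace_real unfolding trace_norm_def by metis
qed

lemma trace_norm_le:
  assumes "tn_le M c" "M \<in> carrier_mat n n" shows "trace_norm M \<le> c"
proof -
  obtain C where "C \<in> carrier_mat n n" "contr C" "mat_trace (C * M) = complex_of_real (trace_norm M)"
    using trace_norm_polar[OF assms(2)] by blast
  then show ?thesis using tn_leD[OF assms, of C] by simp
qed

text \<open>Hoelder's inequality for P = S S with S the square root, whose squared Hilbert-Schmidt
  norm is the trace of P.\<close>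

lemma tn_le_psd:
  assumes "psd P" shows "tn_le P (Re (mat_trace P))"
proof -
  obtain n where P: "P \<in> carrier_mat n n" using psd_carrier[OF assms] .
  note S = psd_sqrt[OF assms P]
  have e: "P = psd_sqrt P * adj (psd_sqrt P)" unfolding S(4) S(2) ..
  have "tn_le P (sqrt (hs_sq (psd_sqrt P)) * sqrt (hs_sq (psd_sqrt P)))"
    using tn_le_mult_adj[OF S(3,3)] e by simp
  moreover have "Re (mat_trace P) = hs_sq (psd_sqrt P)"
    using trace_mult_adj[of "psd_sqrt P"] e by simp
  ultimately show ?thesis by simp
qed

text \<open>Let X and Y be the roots of \<rho>' and \<rho>, V the contraction attaining the fidelity
  F, and Z = VX. As 1 - F is at most \<delta>^2, Z and Y differ by at most sqrt 2 \<delta> in norm,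
  which Hoelder turns into a bound on \<open>adj Z * Z\<close> - \<rho>. What V loses, P = \<rho>' -
  \<open>adj Z * Z\<close>, is positive with trace at most \<delta>^2. The sum \<delta>^2 + 2 sqrt 2
  \<delta> is rounded up to 4 \<delta>; only linearity in \<delta> matters later.\<close>

lemma tn_le_fidelity:
  assumes "\<rho>' \<in> substates n" "\<rho> \<in> states n" "0 \<le> \<delta>" "\<delta> \<le> 1"
    and "(fidelity \<rho>' \<rho>)\<^sup>2 \<ge> 1 - \<delta>\<^sup>2"
  shows "tn_le (\<rho>' - \<rho>) (4 * \<delta>)"
proof -
  have r': "psd \<rho>'" "\<rho>' \<in> carrier_mat n n" "mat_trace \<rho>' \<le> 1"
    and r: "psd \<rho>" "\<rho> \<in> carrier_mat n n" "mat_trace \<rho> = 1"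
    using assms(1,2) by (auto simp: substates_def states_def)
  define X Y where "X = psd_sqrt \<rho>'" and "Y = psd_sqrt \<rho>"
  note X = psd_sqrt[OF r'(1,2), folded X_def] and Y = psd_sqrt[OF r(1,2), folded Y_def]
  have XY: "X * Y \<in> carrier_mat n n" using X Y by auto
  obtain V where V: "V \<in> carrier_mat n n" "contr V"
    "mat_trace (V * (X * Y)) = complex_of_real (fidelity \<rho>' \<rho>)"
    using trace_norm_polar[OF XY] unfolding fidelity_def X_def Y_def by blast
  define Z where "Z = V * X"
  have Z: "Z \<in> carrier_mat n n" unfolding Z_def using V X by auto
  note d = carrier_matD[OF X(3)] carrier_matD[OF Y(3)] carrier_matD[OF V(1)] carrier_matD[OF Z]
  define F where "F = fidelity \<rho>' \<rho>"
  have F0: "0 \<le> F"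
  proof -
    have "adj (X * Y) * (X * Y) \<in> carrier_mat n n" by (rule mult_carrier_mat[OF adj_carrier[OF XY] XY])
    then have "psd (psd_sqrt (adj (X * Y) * (X * Y)))"
      by (rule psd_sqrt(1)[OF psd_adj_mult[OF XY]])
    then show ?thesis
      unfolding F_def fidelity_def trace_norm_def X_def Y_def
      by (metis less_eq_complex_def psd_trace_nonneg zero_complex.sel(1))
  qed
  have tZY: "mat_trace (Z * Y) = complex_of_real F"
    using V(3) unfolding Z_def F_def by (simp add: mat_ring d)
  have hY: "hs_sq Y = 1" using trace_mult_adj[of Y] unfolding Y(4,2) r(3) by simp
  have hX: "hs_sq X \<le> 1" using trace_mult_adj[of X] r'(3) unfolding X(4,2)
    by (simp add: less_eq_complex_def)
  have hZ: "hs_sq Z \<le> hs_sq X" unfolding Z_def by (rule hs_sq_contr_mult[OF V(2,1) X(3)])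
  have FZ: "F \<le> sqrt (hs_sq Z)"
    using cmod_trace_adj_mult_le[of "adj Z" n n Y] Z Y tZY hY F0 by simp
  have F2: "F\<^sup>2 \<le> hs_sq Z" using power_mono[OF FZ F0, of 2] by simp
  have F1: "F \<le> 1" using FZ hZ hX by (smt (verit) real_sqrt_le_1_iff)
  have FF: "F\<^sup>2 \<ge> 1 - \<delta>\<^sup>2" using assms(5) unfolding F_def .
  have Fd: "1 - F \<le> \<delta>\<^sup>2"
  proof -
    have "F\<^sup>2 \<le> F" using F0 F1 by (simp add: power2_eq_square mult_left_le)
    then show ?thesis using FF by linarith
  qed
  define W where "W = Z - Y"
  have W: "W \<in> carrier_mat n n" unfolding W_def using Z Y by auto
  have hW: "hs_sq W \<le> 2 * \<delta>\<^sup>2"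
  proof -
    have e: "adj W * W = adj Z * Z - Y * Z - (adj Z * Y - Y * Y)"
      unfolding W_def using Z Y by (simp add: adj_minus[of _ n n] mat_ring d Y(4))
    have tYZ: "mat_trace (Y * Z) = complex_of_real F"
      using trace_mult_comm[OF Y(3) Z] tZY by simp
    have "mat_trace (adj Z * Y) = cnj (mat_trace (Y * Z))"
      using trace_adj[of "Y * Z" n] Z Y by (simp add: mat_ring d)
    then have tZ: "mat_trace (adj Z * Y) = complex_of_real F" unfolding tYZ by simp
    have "mat_trace (adj W * W) = (mat_trace (adj Z * Z) - mat_trace (Y * Z))
        - (mat_trace (adj Z * Y) - mat_trace (Y * Y))"
    proof -
      have c: "adj Z * Z \<in> carrier_mat n n" "Y * Z \<in> carrier_mat n n" "adj Z * Y \<in> carrier_mat n n"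
        "Y * Y \<in> carrier_mat n n" using Z Y(3) by auto
      show ?thesis
        unfolding e trace_minus[OF minus_carrier_mat[OF c(2)] minus_carrier_mat[OF c(4)]]
          trace_minus[OF c(1,2)] trace_minus[OF c(3,4)] ..
    qed
    also have "\<dots> = complex_of_real (hs_sq Z + 1 - 2 * F)"
      unfolding tYZ tZ trace_adj_mult Y(2) r(3) by simp
    finally have "hs_sq W = hs_sq Z + 1 - 2 * F"
      unfolding trace_adj_mult of_real_eq_iff .
    then show ?thesis using hZ hX Fd by linarith
  qed
  define P where "P = X * (1\<^sub>m n - adj V * V) * X"
  have P: "P \<in> carrier_mat n n" unfolding P_def using X V by auto
  have Pe: "P = X * X - adj Z * Z" unfolding P_def Z_def by (simp add: mat_ring d X(4))
  have "psd P"
  proof -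
    have "psd (1\<^sub>m n - adj V * V)" using V(1,2) by (simp add: contr_def)
    from psd_conj[OF this minus_carrier_mat[OF mult_carrier_mat[OF adj_carrier[OF V(1)] V(1)]] X(3)]
    show ?thesis unfolding P_def X(4) .
  qed
  moreover have "Re (mat_trace P) \<le> \<delta>\<^sup>2"
  proof -
    have "mat_trace P = complex_of_real (hs_sq X) - complex_of_real (hs_sq Z)"
      unfolding Pe trace_minus[OF mult_carrier_mat[OF X(3,3)] mult_carrier_mat[OF adj_carrier[OF Z] Z]]
      using trace_adj_mult[of Z] trace_adj_mult[of X] X(4) by simp
    then show ?thesis using hX F2 FF by simp
  qed
  ultimately have 1: "tn_le P (\<delta>\<^sup>2)" using tn_le_psd tn_le_mono by blast
  have sW: "sqrt (hs_sq W) \<le> sqrt 2 * \<delta>"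
    using real_sqrt_le_mono[OF hW] assms(3) by (simp add: real_sqrt_mult)
  have sZ: "sqrt (hs_sq Z) \<le> 1" using hZ hX by simp
  have 2: "tn_le (adj Z * W) (1 * (sqrt 2 * \<delta>))"
  proof (rule tn_le_mono)
    show "tn_le (adj Z * W) (sqrt (hs_sq Z) * sqrt (hs_sq W))"
      using tn_le_mult_adj[OF adj_carrier[OF Z] adj_carrier[OF W]] by simp
    show "sqrt (hs_sq Z) * sqrt (hs_sq W) \<le> 1 * (sqrt 2 * \<delta>)"
      by (rule mult_mono[OF sZ sW]) simp_all
  qed
  have 3: "tn_le (adj W * Y) (sqrt 2 * \<delta> * 1)"
  proof (rule tn_le_mono)
    show "tn_le (adj W * Y) (sqrt (hs_sq W) * 1)"
      using tn_le_mult_adj[OF adj_carrier[OF W] Y(3)] Y(4) hY by simp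
  qed (use sW in simp)
  have "\<rho>' - \<rho> = P + (adj Z * W + adj W * Y)"
  proof -
    have "adj Z * W + adj W * Y = (adj Z * Z - adj Z * Y) + (adj Z * Y - \<rho>)"
      unfolding W_def using Z Y by (simp add: adj_minus[of _ n n] mat_ring d Y(4) Y(2))
    then show ?thesis unfolding Pe X(2) using Z Y r r' by (intro eq_matI) auto
  qed
  moreover have "tn_le (P + (adj Z * W + adj W * Y)) (\<delta>\<^sup>2 + (1 * (sqrt 2 * \<delta>) + sqrt 2 * \<delta> * 1))"
    by (rule tn_le_add[of _ _ _ _ n] 1 2 3)+ (use P Z W Y in auto)
  moreover have "\<delta>\<^sup>2 + (1 * (sqrt 2 * \<delta>) + sqrt 2 * \<delta> * 1) \<le> 4 * \<delta>"
  proof -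
    have "\<delta>\<^sup>2 \<le> \<delta>" using assms(3,4) by (simp add: power2_eq_square mult_left_le)
    moreover have "sqrt 2 \<le> 3 / 2" by (rule real_le_lsqrt) (auto simp: power2_eq_square)
    then have "sqrt 2 * \<delta> \<le> 3 / 2 * \<delta>" using assms(3) by (rule mult_right_mono)
    ultimately show ?thesis by linarith
  qed
  ultimately show ?thesis using tn_le_mono by metis
qed

subsection \<open>Averages over random unitaries\<close>

text \<open>The larger exponents are compared: 2^i + 2^l is at most 2^(l + 1), so if l < k it is at
  most 2^k and falls short of the other side.\<close>

lemma pow2_add_eq_aux:
  assumes "(i::nat) \<le> l" "j \<le> k" "(2::nat) ^ i + 2 ^ l = 2 ^ j + 2 ^ k"
  shows "i = j \<and> l = k"
proof -
  have *: "\<not> l < k" if "(i::nat) \<le> l" "(2::nat) ^ i + 2 ^ l = 2 ^ j + 2 ^ k" for i l j k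
  proof
    assume "l < k"
    have "(2::nat) ^ i + 2 ^ l \<le> 2 ^ Suc l" using that(1) by (simp add: power_increasing)
    also have "\<dots> \<le> 2 ^ k" using \<open>l < k\<close> by (intro power_increasing) auto
    also have "\<dots> < 2 ^ j + 2 ^ k" by simp
    finally show False using that(2) by simp
  qed
  have "l = k" using *[OF assms(1,3)] *[OF assms(2) assms(3)[symmetric]] by simp
  then show ?thesis using assms(3) by simp
qed

lemma pow2_add_eq:
  assumes "(2::nat) ^ i + 2 ^ l = 2 ^ j + 2 ^ k"
  shows "(i = j \<and> l = k) \<or> (i = k \<and> l = j)"
  using pow2_add_eq_aux[of i l j k] pow2_add_eq_aux[of l i j k] pow2_add_eq_aux[of i l k j]
    pow2_add_eq_aux[of l i k j] assms by (metis add.commute nat_le_linear)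

lemma sum_roots_of_unity:
  assumes "Q > 0"
  shows "(\<Sum>r<Q. cis (2 * pi * real r * real_of_int k / real Q)) = (if int Q dvd k then of_nat Q else 0)"
proof -
  define z where "z = cis (2 * pi * real_of_int k / real Q)"
  have pow: "cis (2 * pi * real r * real_of_int k / real Q) = z ^ r" for r
    by (simp add: z_def DeMoivre mult_ac)
  have zQ: "z ^ Q = 1"
    using assms cis_multiple_2pi[of "real_of_int k"] by (simp add: z_def DeMoivre)
  show ?thesis
  proof (cases "int Q dvd k")
    case True
    then obtain m where "k = int Q * m" by (auto simp: dvd_def)
    then have "2 * pi * real_of_int k / real Q = 2 * pi * real_of_int m" using assms by simp
    then have "z = 1" unfolding z_def using cis_multiple_2pi[of "real_of_int m"] by (simp only:) simp
    then show ?thesis using True by (simp add: pow)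
  next
    case False
    have "z \<noteq> 1"
    proof
      assume "z = 1"
      then have "cos (2 * pi * real_of_int k / real Q) = 1" by (simp add: z_def complex_eq_iff)
      then obtain n :: int where "2 * pi * real_of_int k / real Q = real_of_int n * 2 * pi"
        using cos_one_2pi_int by auto
      then have "real_of_int k = real_of_int n * real Q" using assms by (simp add: field_simps)
      then have "k = n * int Q" by (metis of_int_eq_iff of_int_mult of_int_of_nat_eq)
      then show False using False by simp
    qed
    then show ?thesis using False zQ by (simp add: pow geometric_sum)
  qed
qed

text \<open>Phase number \<open>i\<close> has frequency 2^i modulo 2^(N + 1). The modulus is so
  large that a difference of two sums of two frequencies is divisible by it only if it
  vanishes.\<close>

definition phase :: "nat \<Rightarrow> nat \<Rightarrow> nat \<Rightarrow> complex" where
  "phase N r i = cis (2 * pi * real r * 2 ^ i / 2 ^ Suc N)"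

lemma phase_cnj [simp]: "phase N r i * cnj (phase N r i) = 1" "cnj (phase N r i) * phase N r i = 1"
  by (simp_all add: phase_def cis_cnj cis_mult)

lemma cmod_square: "complex_of_real ((cmod z)\<^sup>2) = z * cnj z"
  by (rule complex_norm_square)

text \<open>The fourth moment of the phases. The sum over \<open>r\<close> is a geometric sum with
  exponent \<open>c\<close>, which is small compared to the modulus; hence only c = 0 contributes,
  and by \<open>pow2_add_eq\<close> this leaves the two pairings that independent uniform phases
  would give.\<close>

lemma phase_fourfold:
  assumes "i < N" "j < N" "k < N" "l < N"
  shows "(\<Sum>r<2 ^ Suc N. phase N r i * cnj (phase N r j) * (cnj (phase N r k) * phase N r l))
    = (if (i = j \<and> l = k) \<or> (i = k \<and> l = j) then 2 ^ Suc N else 0)"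
proof -
  define c where "c = (2 ^ i + 2 ^ l - (2 ^ j + 2 ^ k) :: int)"
  have "phase N r i * cnj (phase N r j) * (cnj (phase N r k) * phase N r l)
      = cis (2 * pi * real r * real_of_int c / real (2 ^ Suc N))" for r
  proof -
    have "phase N r i * cnj (phase N r j) * (cnj (phase N r k) * phase N r l)
      = cis (2 * pi * real r * 2 ^ i / 2 ^ Suc N + - (2 * pi * real r * 2 ^ j / 2 ^ Suc N)
        + (- (2 * pi * real r * 2 ^ k / 2 ^ Suc N) + 2 * pi * real r * 2 ^ l / 2 ^ Suc N))"
      by (simp add: phase_def cis_cnj cis_mult del: power_Suc)
    also have "2 * pi * real r * 2 ^ i / 2 ^ Suc N + - (2 * pi * real r * 2 ^ j / 2 ^ Suc N)
        + (- (2 * pi * real r * 2 ^ k / 2 ^ Suc N) + 2 * pi * real r * 2 ^ l / 2 ^ Suc N)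
        = 2 * pi * real r * real_of_int c / real (2 ^ Suc N)"
      by (simp add: c_def field_simps del: power_Suc)
    finally show ?thesis .
  qed
  then have "(\<Sum>r<2 ^ Suc N. phase N r i * cnj (phase N r j) * (cnj (phase N r k) * phase N r l))
      = (if int (2 ^ Suc N) dvd c then of_nat (2 ^ Suc N) else 0)"
    using sum_roots_of_unity[of "2 ^ Suc N" c] by (simp del: power_Suc of_nat_power)
  moreover have "int (2 ^ Suc N) dvd c \<longleftrightarrow> (i = j \<and> l = k) \<or> (i = k \<and> l = j)"
  proof
    have small: "(2::int) * 2 ^ a \<le> 2 ^ N" if "a < N" for a
      using that power_increasing[of "Suc a" N "2::int"] by simp
    have pos: "(0::int) < 2 ^ a" for a :: nat by simp
    assume d: "int (2 ^ Suc N) dvd c"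
    have "\<bar>c\<bar> < 2 * 2 ^ N"
      unfolding c_def using small[OF assms(1)] small[OF assms(2)] small[OF assms(3)] small[OF assms(4)]
        pos[of i] pos[of j] pos[of k] pos[of l] pos[of N] by linarith
    then have "c = 0" using dvd_imp_le_int[OF _ d] by fastforce
    then have "int (2 ^ i + 2 ^ l) = int (2 ^ j + 2 ^ k)" by (simp add: c_def)
    then have "(2::nat) ^ i + 2 ^ l = 2 ^ j + 2 ^ k" by (simp only: of_nat_eq_iff)
    then show "(i = j \<and> l = k) \<or> (i = k \<and> l = j)" by (rule pow2_add_eq)
  next
    assume "(i = j \<and> l = k) \<or> (i = k \<and> l = j)"
    then have "c = 0" by (auto simp: c_def)
    then show "int (2 ^ Suc N) dvd c" by simp
  qed
  ultimately show ?thesis by simp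
qed

text \<open>Because the powers of 2 form a Sidon set, averaging over the single parameter \<open>r\<close>
  has the effect of independent uniformly random phases.\<close>

lemma phase_average:
  fixes w :: "nat \<Rightarrow> nat \<Rightarrow> complex"
  shows "(\<Sum>r<2 ^ Suc N. (cmod (\<Sum>i<N. \<Sum>j<N. phase N r i * cnj (phase N r j) * w i j))\<^sup>2)
    = 2 ^ Suc N * ((cmod (\<Sum>i<N. w i i))\<^sup>2 + (\<Sum>i<N. \<Sum>j<N. if i \<noteq> j then (cmod (w i j))\<^sup>2 else 0))"
    (is "?L = ?R")
proof -
  let ?I = "{..<N} \<times> {..<N}" and ?Q = "2 ^ Suc N :: nat"
  define W where "W = (\<lambda>p. w (fst p) (snd p))"
  define E where "E = (\<lambda>r p. phase N r (fst p) * cnj (phase N r (snd p)))"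
  have pair: "(\<Sum>i<N. \<Sum>j<N. f i j) = (\<Sum>p\<in>?I. f (fst p) (snd p))" for f :: "nat \<Rightarrow> nat \<Rightarrow> complex"
    by (simp add: sum.cartesian_product case_prod_unfold)
  have "complex_of_real ?L = (\<Sum>r<?Q. (\<Sum>p\<in>?I. E r p * W p) * cnj (\<Sum>p\<in>?I. E r p * W p))"
    unfolding of_real_sum cmod_square pair by (simp add: E_def W_def)
  also have "\<dots> = (\<Sum>r<?Q. \<Sum>p\<in>?I. \<Sum>q\<in>?I. W p * cnj (W q) * (E r p * cnj (E r q)))"
    by (simp add: sum_product mult_ac)
  also have "\<dots> = (\<Sum>p\<in>?I. \<Sum>q\<in>?I. W p * cnj (W q) * (\<Sum>r<?Q. E r p * cnj (E r q)))"
    unfolding sum_distrib_left by (subst sum.swap, rule sum.cong[OF refl], rule sum.swap)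
  \<comment> \<open>Diagonal pairs correlate with every diagonal pair, an off-diagonal pair only
    with itself. Restricting the second indicator to off-diagonal \<open>p\<close> keeps the overlap
    i = j = k = l from being counted twice.\<close>
  also have "\<dots> = (\<Sum>p\<in>?I. \<Sum>q\<in>?I. W p * cnj (W q) *
      ((if fst p = snd p \<and> fst q = snd q then of_nat ?Q else 0) + (if fst p \<noteq> snd p \<and> q = p then of_nat ?Q else 0)))"
  proof (intro sum.cong refl arg_cong2[of _ _ _ _ times])
    fix p q assume "p \<in> ?I" "q \<in> ?I"
    then obtain i j k l where pq: "p = (i, j)" "q = (k, l)" and l: "i < N" "j < N" "k < N" "l < N"
      by auto
    have e: "(\<Sum>r<?Q. E r p * cnj (E r q)) = (if (i = j \<and> l = k) \<or> (i = k \<and> l = j) then of_nat ?Q else 0)"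
      using phase_fourfold[OF l]
      unfolding E_def pq fst_conv snd_conv complex_cnj_mult complex_cnj_cnj of_nat_power of_nat_numeral .
    show "(\<Sum>r<?Q. E r p * cnj (E r q)) = (if fst p = snd p \<and> fst q = snd q then of_nat ?Q else 0)
        + (if fst p \<noteq> snd p \<and> q = p then of_nat ?Q else 0)"
      unfolding pq e[unfolded pq] by (cases "i = j"; cases "k = l"; cases "i = k"; cases "l = j") simp_all
  qed
  also have "\<dots> = of_nat ?Q * ((\<Sum>p\<in>?I. if fst p = snd p then W p else 0) * cnj (\<Sum>p\<in>?I. if fst p = snd p then W p else 0)
      + (\<Sum>p\<in>?I. if fst p \<noteq> snd p then W p * cnj (W p) else 0))"
  proof -
    have 1: "(\<Sum>p\<in>?I. \<Sum>q\<in>?I. W p * cnj (W q) * (if fst p = snd p \<and> fst q = snd q then of_nat ?Q else 0))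
      = of_nat ?Q * ((\<Sum>p\<in>?I. if fst p = snd p then W p else 0) * cnj (\<Sum>p\<in>?I. if fst p = snd p then W p else 0))"
      (is "?A = _")
    proof -
      define D where "D = (\<lambda>p. if fst p = snd p then W p else 0)"
      have "?A = (\<Sum>p\<in>?I. \<Sum>q\<in>?I. of_nat ?Q * (D p * cnj (D q)))"
        by (rule sum.cong[OF refl], rule sum.cong[OF refl]) (simp add: D_def del: power_Suc)
      also have "\<dots> = of_nat ?Q * (\<Sum>p\<in>?I. \<Sum>q\<in>?I. D p * cnj (D q))"
        by (simp only: sum_distrib_left)
      also have "\<dots> = of_nat ?Q * ((\<Sum>p\<in>?I. D p) * cnj (\<Sum>p\<in>?I. D p))"
        by (simp only: sum_product cnj_sum)
      finally show ?thesis unfolding D_def .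
    qed
    have 2: "(\<Sum>p\<in>?I. \<Sum>q\<in>?I. W p * cnj (W q) * (if fst p \<noteq> snd p \<and> q = p then of_nat ?Q else 0))
      = of_nat ?Q * (\<Sum>p\<in>?I. if fst p \<noteq> snd p then W p * cnj (W p) else 0)"
      unfolding sum_distrib_left
    proof (intro sum.cong refl)
      fix p assume p: "p \<in> ?I"
      have "(\<Sum>q\<in>?I. W p * cnj (W q) * (if fst p \<noteq> snd p \<and> q = p then of_nat ?Q else 0))
        = (\<Sum>q\<in>?I. if q = p then (of_nat ?Q * (if fst p \<noteq> snd p then W p * cnj (W p) else 0)) else 0)"
        by (intro sum.cong refl) (simp del: power_Suc)
      then show "(\<Sum>q\<in>?I. W p * cnj (W q) * (if fst p \<noteq> snd p \<and> q = p then of_nat ?Q else 0))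
        = of_nat ?Q * (if fst p \<noteq> snd p then W p * cnj (W p) else 0)"
        using p by (simp del: power_Suc)
    qed
    show ?thesis unfolding distrib_left sum.distrib 1 2 ..
  qed
  also have "(\<Sum>p\<in>?I. if fst p = snd p then W p else 0) = (\<Sum>i<N. w i i)"
    unfolding W_def pair[symmetric, of "\<lambda>i j. if i = j then w i j else 0"] by simp
  also have "(\<Sum>p\<in>?I. if fst p \<noteq> snd p then W p * cnj (W p) else 0)
      = (\<Sum>i<N. \<Sum>j<N. if i \<noteq> j then w i j * cnj (w i j) else 0)"
    unfolding W_def pair[symmetric, of "\<lambda>i j. if i \<noteq> j then w i j * cnj (w i j) else 0"] ..
  also have "of_nat ?Q * ((\<Sum>i<N. w i i) * cnj (\<Sum>i<N. w i i)
      + (\<Sum>i<N. \<Sum>j<N. if i \<noteq> j then w i j * cnj (w i j) else 0)) = complex_of_real ?R"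
  proof -
    have q: "complex_of_real (2 ^ Suc N) = of_nat ?Q" by simp
    show ?thesis
      unfolding of_real_mult of_real_add of_real_sum cmod_square q
      by (simp add: if_distrib[of complex_of_real] cmod_square
        del: power_Suc of_real_power of_nat_power cong: if_cong)
  qed
  finally show ?thesis unfolding of_real_eq_iff .
qed

text \<open>The sum does not depend on \<open>i\<close>, since composing with a transposition
  permutes the summands. Adding over all \<open>i\<close> produces the full sum of \<open>h\<close>
  once for each permutation.\<close>

lemma perm_average_single:
  fixes h :: "nat \<Rightarrow> 'a :: field_char_0"
  assumes "i < N"
  shows "(\<Sum>p | p permutes {..<N}. h (p i)) = fact N / of_nat N * (\<Sum>k<N. h k)"
proof -
  let ?P = "{p. p permutes {..<N}}"
  define S where "S = (\<lambda>i. \<Sum>p\<in>?P. h (p i))"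
  have const: "S j = S i" if "j < N" for j
  proof -
    have "transpose i j permutes {..<N}" using that assms by (intro permutes_swap_id) auto
    from sum_permutations_compose_right[OF this, of "\<lambda>p. h (p i)"]
    show ?thesis by (simp add: S_def)
  qed
  have "of_nat N * S i = (\<Sum>j<N. S j)" using const by simp
  also have "\<dots> = (\<Sum>p\<in>?P. \<Sum>j<N. h (p j))" unfolding S_def by (rule sum.swap)
  also have "\<dots> = (\<Sum>p\<in>?P. \<Sum>k<N. h k)"
  proof (rule sum.cong[OF refl])
    fix p assume "p \<in> ?P"
    then show "(\<Sum>j<N. h (p j)) = (\<Sum>k<N. h k)"
      using sum.permute[of p "{..<N}" h] by (simp add: comp_def)
  qed
  also have "\<dots> = fact N * (\<Sum>k<N. h k)" using card_permutations[of "{..<N}" N] by simp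
  finally have "of_nat N * S i = fact N * (\<Sum>k<N. h k)" .
  moreover have "(of_nat N :: 'a) \<noteq> 0" using assms by simp
  ultimately show ?thesis unfolding S_def by (simp add: field_simps)
qed

lemma perm_average_pair:
  fixes h :: "nat \<Rightarrow> nat \<Rightarrow> 'a :: field_char_0"
  assumes "i < N" "j < N" "i \<noteq> j"
  shows "(\<Sum>p | p permutes {..<N}. h (p i) (p j))
    = fact N / (of_nat N * of_nat (N - 1)) * (\<Sum>k<N. \<Sum>l<N. if k \<noteq> l then h k l else 0)"
proof -
  let ?P = "{p. p permutes {..<N}}"
  define S where "S = (\<lambda>i j. \<Sum>p\<in>?P. h (p i) (p j))"
  have const: "S i' j' = S i j" if "i' < N" "j' < N" "i' \<noteq> j'" for i' j'
  proof -
    \<comment> \<open>Double transitivity of the permutations: the transposition of i and i' moves j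
      to \<open>a\<close>, and a second one moves \<open>a\<close> to j'. The latter fixes i', which
      differs from both \<open>a\<close> and j'.\<close>
    define a where "a = transpose i i' j"
    define t where "t = transpose a j' \<circ> transpose i i'"
    have a: "a < N" "a \<noteq> i'" using that assms unfolding a_def transpose_def by auto
    have "t permutes {..<N}" unfolding t_def
      by (intro permutes_compose permutes_swap_id) (use a that assms in auto)
    moreover have "t i = i'" "t j = j'"
      using a that unfolding t_def a_def[symmetric] comp_def by (auto simp: a_def[symmetric])
    ultimately show ?thesis
      using sum_permutations_compose_right[of t "{..<N}" "\<lambda>p. h (p i) (p j)"] by (simp add: S_def)
  qed
  have "(\<Sum>k<N. \<Sum>l<N. if k \<noteq> l then S k l else 0) = (\<Sum>k<N. \<Sum>l<N. if k \<noteq> l then S i j else 0)"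
    by (intro sum.cong refl) (auto simp: const)
  also have "\<dots> = (\<Sum>k<N. of_nat (N - 1) * S i j)"
  proof (intro sum.cong refl)
    fix k assume k: "k \<in> {..<N}"
    have "(\<Sum>l<N. if k \<noteq> l then S i j else 0) = (\<Sum>l\<in>{..<N} - {k}. S i j)"
      by (rule sum.mono_neutral_cong_right) auto
    moreover have "card ({..<N} - {k}) = N - 1" using k by simp
    ultimately show "(\<Sum>l<N. if k \<noteq> l then S i j else 0) = of_nat (N - 1) * S i j"
      by (simp only: sum_constant)
  qed
  also have "\<dots> = of_nat N * of_nat (N - 1) * S i j"
    by (simp only: sum_constant card_lessThan mult.assoc)
  finally have 1: "of_nat N * of_nat (N - 1) * S i j = (\<Sum>k<N. \<Sum>l<N. if k \<noteq> l then S k l else 0)" ..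
  also have "\<dots> = (\<Sum>k<N. \<Sum>l<N. \<Sum>p\<in>?P. if k \<noteq> l then h (p k) (p l) else 0)"
    unfolding S_def by (intro sum.cong refl) auto
  also have "\<dots> = (\<Sum>p\<in>?P. \<Sum>k<N. \<Sum>l<N. if k \<noteq> l then h (p k) (p l) else 0)"
    by (subst (2) sum.swap, subst sum.swap) simp
  also have "\<dots> = (\<Sum>p\<in>?P. \<Sum>k<N. \<Sum>l<N. if k \<noteq> l then h k l else 0)"
  proof (rule sum.cong[OF refl])
    fix p assume "p \<in> ?P"
    then have p: "p permutes {..<N}" by simp
    have inj: "p k = p l \<longleftrightarrow> k = l" for k l using permutes_inj[OF p] by (auto dest: injD)
    have "(\<Sum>k<N. \<Sum>l<N. if k \<noteq> l then h (p k) (p l) else 0)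
        = (\<Sum>k<N. (\<lambda>k. \<Sum>l<N. if k \<noteq> p l then h k (p l) else 0) (p k))"
      by (simp add: inj)
    also have "\<dots> = (\<Sum>k<N. \<Sum>l<N. if k \<noteq> p l then h k (p l) else 0)"
      using sum.permute[OF p, of "\<lambda>k. \<Sum>l<N. if k \<noteq> p l then h k (p l) else 0"] by (simp add: comp_def)
    also have "\<dots> = (\<Sum>k<N. \<Sum>l<N. if k \<noteq> l then h k l else 0)"
      using sum.permute[OF p, of "\<lambda>l. if k \<noteq> l then h k l else 0" for k] by (simp add: comp_def)
    finally show "(\<Sum>k<N. \<Sum>l<N. if k \<noteq> l then h (p k) (p l) else 0)
        = (\<Sum>k<N. \<Sum>l<N. if k \<noteq> l then h k l else 0)" .
  qed
  also have "\<dots> = fact N * (\<Sum>k<N. \<Sum>l<N. if k \<noteq> l then h k l else 0)"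
    using card_permutations[of "{..<N}" N] by simp
  finally have "of_nat N * of_nat (N - 1) * S i j = fact N * (\<Sum>k<N. \<Sum>l<N. if k \<noteq> l then h k l else 0)" .
  moreover have "(of_nat N * of_nat (N - 1) :: 'a) \<noteq> 0" using assms by auto
  ultimately show ?thesis unfolding S_def by (simp add: field_simps)
qed

lemma double_sum_split_diag:
  fixes f :: "nat \<Rightarrow> nat \<Rightarrow> 'a :: comm_monoid_add"
  shows "(\<Sum>i<N. \<Sum>j<N. f i j) = (\<Sum>i<N. f i i) + (\<Sum>i<N. \<Sum>j<N. if i \<noteq> j then f i j else 0)"
proof -
  have "(\<Sum>i<N. \<Sum>j<N. f i j) = (\<Sum>i<N. \<Sum>j<N. (if i = j then f i j else 0) + (if i \<noteq> j then f i j else 0))"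
    by (intro sum.cong refl) auto
  then show ?thesis by (simp add: sum.distrib)
qed

text \<open>The variance of sampling without replacement. As \<open>Z\<close> sums to 0, its values
  at two distinct positions are negatively correlated; this turns N into N - 1 in the main term and
  leaves a multiple of |\<Sum> w|^2 with negative sign, which is dropped.\<close>

lemma perm_average_linear:
  fixes w Z :: "nat \<Rightarrow> complex"
  assumes "2 \<le> N" "(\<Sum>k<N. Z k) = 0"
  shows "(\<Sum>p | p permutes {..<N}. (cmod (\<Sum>i<N. w i * Z (p i)))\<^sup>2)
    \<le> fact N / real (N - 1) * (\<Sum>k<N. (cmod (Z k))\<^sup>2) * (\<Sum>i<N. (cmod (w i))\<^sup>2)" (is "?L \<le> _")
proof -
  let ?P = "{p. p permutes {..<N}}"
  define z where "z = (\<Sum>k<N. (cmod (Z k))\<^sup>2)"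
  define s where "s = (\<Sum>i<N. (cmod (w i))\<^sup>2)"
  define u where "u = (cmod (\<Sum>i<N. w i))\<^sup>2"
  define f where "f = (fact N :: real) / (real N * real (N - 1))"
  have offdiag: "(\<Sum>k<N. \<Sum>l<N. if k \<noteq> l then x k * cnj (x l) else 0)
      = complex_of_real ((cmod (\<Sum>k<N. x k))\<^sup>2 - (\<Sum>k<N. (cmod (x k))\<^sup>2))" for x :: "nat \<Rightarrow> complex"
  proof -
    have "complex_of_real ((cmod (\<Sum>k<N. x k))\<^sup>2) = (\<Sum>k<N. \<Sum>l<N. x k * cnj (x l))"
      unfolding cmod_square cnj_sum sum_product ..
    also have "\<dots> = complex_of_real (\<Sum>k<N. (cmod (x k))\<^sup>2) + (\<Sum>k<N. \<Sum>l<N. if k \<noteq> l then x k * cnj (x l) else 0)"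
      unfolding double_sum_split_diag[of "\<lambda>k l. x k * cnj (x l)"] of_real_sum cmod_square ..
    finally show ?thesis by (simp add: algebra_simps)
  qed
  have N: "real N > 0" "real (N - 1) > 0" "real N = real (N - 1) + 1" using assms(1) by auto
  have "complex_of_real ?L = (\<Sum>p\<in>?P. \<Sum>i<N. \<Sum>j<N. w i * cnj (w j) * (Z (p i) * cnj (Z (p j))))"
    unfolding of_real_sum cmod_square cnj_sum sum_product by (simp add: mult_ac)
  also have "\<dots> = (\<Sum>i<N. \<Sum>j<N. w i * cnj (w j) * (\<Sum>p\<in>?P. Z (p i) * cnj (Z (p j))))"
    unfolding sum_distrib_left by (subst sum.swap, subst (2) sum.swap) simp
  also have "\<dots> = (\<Sum>i<N. w i * cnj (w i) * (\<Sum>p\<in>?P. Z (p i) * cnj (Z (p i))))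
      + (\<Sum>i<N. \<Sum>j<N. if i \<noteq> j then w i * cnj (w j) * (\<Sum>p\<in>?P. Z (p i) * cnj (Z (p j))) else 0)"
    by (rule double_sum_split_diag)
  also have "(\<Sum>i<N. w i * cnj (w i) * (\<Sum>p\<in>?P. Z (p i) * cnj (Z (p i))))
      = complex_of_real s * complex_of_real (fact N / real N * z)"
  proof -
    have "(\<Sum>p\<in>?P. Z (p i) * cnj (Z (p i))) = complex_of_real (fact N / real N * z)" if "i < N" for i
      using perm_average_single[OF that, of "\<lambda>k. Z k * cnj (Z k)"]
      unfolding z_def of_real_mult of_real_sum cmod_square by simp
    then show ?thesis unfolding s_def of_real_sum cmod_square sum_distrib_right by (intro sum.cong) auto
  qed
  also have "(\<Sum>i<N. \<Sum>j<N. if i \<noteq> j then w i * cnj (w j) * (\<Sum>p\<in>?P. Z (p i) * cnj (Z (p j))) else 0)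
      = (\<Sum>i<N. \<Sum>j<N. (if i \<noteq> j then w i * cnj (w j) else 0) * complex_of_real (f * (0 - z)))"
  proof (intro sum.cong refl)
    fix i j assume "i \<in> {..<N}" "j \<in> {..<N}"
    then have "i \<noteq> j \<Longrightarrow> (\<Sum>p\<in>?P. Z (p i) * cnj (Z (p j))) = complex_of_real (f * (0 - z))"
      using perm_average_pair[of i N j "\<lambda>k l. Z k * cnj (Z l)"] unfolding offdiag f_def z_def assms(2)
      by (simp add: of_nat_diff)
    then show "(if i \<noteq> j then w i * cnj (w j) * (\<Sum>p\<in>?P. Z (p i) * cnj (Z (p j))) else 0)
      = (if i \<noteq> j then w i * cnj (w j) else 0) * complex_of_real (f * (0 - z))" by simp
  qed
  also have "\<dots> = complex_of_real (u - s) * complex_of_real (f * (0 - z))"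
    unfolding sum_distrib_right[symmetric] offdiag u_def s_def ..
  finally have "complex_of_real ?L = complex_of_real (s * (fact N / real N * z) + (u - s) * (f * (0 - z)))"
    by simp
  then have "?L = s * (fact N / real N * z) + (u - s) * (f * (0 - z))" by (simp only: of_real_eq_iff)
  also have "\<dots> = fact N / real (N - 1) * z * s - f * z * u"
  proof -
    have "s * (F / (m + 1) * z) + (u - s) * (F / ((m + 1) * m) * (0 - z)) = F / m * z * s - F / ((m + 1) * m) * z * u"
      if "m > 0" for m F :: real
    proof -
      define t where "t = F / ((m + 1) * m)"
      have m: "m \<noteq> 0" "m + 1 \<noteq> 0" using that by auto
      then have e: "F / (m + 1) = t * m" "F / m = t * (m + 1)" by (simp_all add: t_def)
      show ?thesis unfolding t_def[symmetric] e by (simp add: algebra_simps)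
    qed
    from this[OF N(2), of "fact N"] show ?thesis unfolding f_def N(3) .
  qed
  also have "\<dots> \<le> fact N / real (N - 1) * z * s"
    unfolding f_def z_def u_def by (simp add: sum_nonneg)
  finally show ?thesis unfolding z_def s_def .
qed

section \<open>Block indices and the Fourier basis\<close>

lemma sum_nat_mult:
  fixes f :: "nat \<Rightarrow> 'a :: comm_monoid_add"
  shows "(\<Sum>x<a * b. f x) = (\<Sum>p<a. \<Sum>y<b. f (p * b + y))"
proof -
  have "(\<Sum>x<a * b. f x) = (\<Sum>p<a. sum f {p * b..<p * b + b})"
    by (rule sum.nat_group[symmetric])
  also have "\<dots> = (\<Sum>p<a. \<Sum>y<b. f (p * b + y))"
  proof (rule sum.cong[OF refl])
    fix p
    show "sum f {p * b..<p * b + b} = (\<Sum>y<b. f (p * b + y))"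
      by (rule sum.reindex_bij_witness[of _ "\<lambda>y. p * b + y" "\<lambda>x. x - p * b"]) auto
  qed
  finally show ?thesis .
qed

lemma sum_delta_pair:
  fixes f :: "nat \<Rightarrow> nat \<Rightarrow> 'a :: comm_monoid_add"
  assumes "q < a" "y < b"
  shows "(\<Sum>q'<a. \<Sum>y'<b. if q' = q \<and> y' = y then f q' y' else 0) = f q y"
proof -
  have "(\<Sum>q'<a. \<Sum>y'<b. if q' = q \<and> y' = y then f q' y' else 0)
      = (\<Sum>q'<a. if q' = q then (\<Sum>y'<b. if y' = y then f q y' else 0) else 0)"
    by (rule sum.cong[OF refl]) auto
  then show ?thesis using assms by simp
qed

text \<open>The kernel inside \<open>g\<close> is the one by which a reduced matrix element between
  blocks \<open>p\<close> and \<open>q\<close> becomes a double sum over full indices. It is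
  evaluated both linearly, with phases, and through squared moduli; hence the abstract
  \<open>g\<close>.\<close>

lemma sum_block:
  fixes g :: "nat \<Rightarrow> nat \<Rightarrow> complex \<Rightarrow> 'b :: comm_monoid_add" and c :: "nat \<Rightarrow> nat \<Rightarrow> complex"
  assumes "p < a" "q < a" "\<And>x x'. g x x' 0 = 0"
  shows "(\<Sum>x<a * b. \<Sum>x'<a * b. g x x' (if x div b = p \<and> x' div b = q \<and> x mod b = x' mod b then c x x' else 0))
    = (\<Sum>y<b. g (p * b + y) (q * b + y) (c (p * b + y) (q * b + y)))"
proof -
  define w where "w = (\<lambda>x x'. if x div b = p \<and> x' div b = q \<and> x mod b = x' mod b then c x x' else 0)"
  define G where "G = (\<lambda>y. g (p * b + y) (q * b + y) (c (p * b + y) (q * b + y)))"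
  have "(\<Sum>x<a * b. \<Sum>x'<a * b. g x x' (w x x')) = (\<Sum>p'<a. \<Sum>y<b. \<Sum>q'<a. \<Sum>y'<b.
      g (p' * b + y) (q' * b + y') (w (p' * b + y) (q' * b + y')))"
    unfolding sum_nat_mult ..
  also have "\<dots> = (\<Sum>p'<a. \<Sum>y<b. \<Sum>q'<a. \<Sum>y'<b. if q' = q \<and> y' = y then (if p' = p then G y else 0) else 0)"
    by (rule sum.cong[OF refl], rule sum.cong[OF refl], rule sum.cong[OF refl], rule sum.cong[OF refl])
      (auto simp: w_def assms(3) G_def)
  also have "\<dots> = (\<Sum>p'<a. \<Sum>y<b. if p' = p then G y else 0)"
    by (rule sum.cong[OF refl], rule sum.cong[OF refl], rule sum_delta_pair) (use assms in auto)
  also have "\<dots> = (\<Sum>p'<a. if p' = p then (\<Sum>y<b. G y) else 0)"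
    by (rule sum.cong[OF refl]) auto
  also have "\<dots> = (\<Sum>y<b. G y)"
    using assms(1) by simp
  finally show ?thesis unfolding w_def G_def .
qed

lemma index_less:
  assumes "p < a" "y < b" shows "p * b + y < a * (b::nat)"
proof -
  have "p * b + y < Suc p * b" using assms(2) by simp
  also have "\<dots> \<le> a * b" using assms(1) by (intro mult_le_mono1) simp
  finally show ?thesis .
qed

definition fourier :: "nat \<Rightarrow> nat \<Rightarrow> nat \<Rightarrow> complex" where
  "fourier N x k = cis (2 * pi * real x * real k / real N) / complex_of_real (sqrt (real N))"

lemma fourier_commute: "fourier N x k = fourier N k x"
  by (simp add: fourier_def mult_ac)

lemma fourier_mult_cnj:
  assumes "N > 0"
  shows "fourier N x k * cnj (fourier N y l)
    = cis (2 * pi * (real x * real k - real y * real l) / real N) / of_nat N"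
proof -
  have "complex_of_real (sqrt (real N)) * complex_of_real (sqrt (real N)) = of_nat N"
    by (simp flip: of_real_mult)
  then show ?thesis
    by (simp add: fourier_def cis_cnj cis_mult diff_divide_distrib right_diff_distrib mult_ac)
qed

lemma fourier_orth:
  assumes "x < N" "y < N"
  shows "(\<Sum>k<N. fourier N x k * cnj (fourier N y k)) = (if x = y then 1 else 0)"
proof -
  have N: "N > 0" using assms by auto
  have "(\<Sum>k<N. fourier N x k * cnj (fourier N y k))
      = (\<Sum>k<N. cis (2 * pi * real k * real_of_int (int x - int y) / real N)) / of_nat N"
    unfolding fourier_mult_cnj[OF N] sum_divide_distrib by (intro sum.cong) (auto simp: algebra_simps)
  also have "\<dots> = (if int N dvd int x - int y then 1 else 0)"
    unfolding sum_roots_of_unity[OF N] using N by simp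
  also have "int N dvd int x - int y \<longleftrightarrow> x = y"
  proof
    assume d: "int N dvd int x - int y"
    have "\<bar>int x - int y\<bar> < int N" using assms by auto
    then have "int x - int y = 0" using dvd_imp_le_int[OF _ d] by fastforce
    then show "x = y" by simp
  qed simp
  finally show ?thesis .
qed

lemma sum_average_le:
  fixes f :: "'a \<Rightarrow> real"
  assumes "finite A" "A \<noteq> {}" "(\<Sum>x\<in>A. f x) \<le> real (card A) * c"
  shows "\<exists>x\<in>A. f x \<le> c"
proof (rule ccontr)
  assume "\<not> ?thesis"
  then have "(\<Sum>x\<in>A. c) < (\<Sum>x\<in>A. f x)" using assms(1,2) by (intro sum_strict_mono) auto
  then show False using assms(3) by simp
qed

lemma cmod_fourier_sq: "N > 0 \<Longrightarrow> (cmod (fourier N x k))\<^sup>2 = 1 / real N"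
  by (simp add: fourier_def norm_divide power_divide)

text \<open>The random phases make the columns of the Fourier matrix nearly maximally entangled
  between the two factors: only the off-diagonal part of a reduced state survives in the variance.\<close>

lemma near_max_entangled_basis:
  fixes a b :: nat
  assumes "a > 0" "b > 0"
  defines "N \<equiv> a * b"
  shows "\<exists>V :: nat \<Rightarrow> nat \<Rightarrow> complex.
    (\<forall>x<N. \<forall>y<N. (\<Sum>k<N. V x k * cnj (V y k)) = (if x = y then 1 else 0)) \<and>
    (\<forall>k<N. \<forall>l<N. (\<Sum>x<N. cnj (V x k) * V x l) = (if k = l then 1 else 0)) \<and>
    (\<Sum>p<a. \<Sum>q<a. \<Sum>k<N. (cmod ((\<Sum>y<b. V (p * b + y) k * cnj (V (q * b + y) k))
        - (if p = q then 1 / of_nat a else 0)))\<^sup>2) \<le> real N / real b"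
proof -
  have N: "N > 0" using assms by (simp add: N_def)
  define V where "V = (\<lambda>r x k. phase N r x * fourier N x k)"
  define X where "X = (\<lambda>r k p q. (\<Sum>y<b. V r (p * b + y) k * cnj (V r (q * b + y) k))
        - (if p = q then 1 / of_nat a else 0))"
  have row: "(\<Sum>k<N. V r x k * cnj (V r y k)) = (if x = y then 1 else 0)" if "x < N" "y < N" for r x y
  proof -
    have "(\<Sum>k<N. V r x k * cnj (V r y k))
        = phase N r x * cnj (phase N r y) * (\<Sum>k<N. fourier N x k * cnj (fourier N y k))"
      unfolding V_def sum_distrib_left by (simp add: mult_ac)
    then show ?thesis unfolding fourier_orth[OF that] by simp
  qed
  have column: "(\<Sum>x<N. cnj (V r x k) * V r x l) = (if k = l then 1 else 0)" if "k < N" "l < N" for r k l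
  proof -
    have "(\<Sum>x<N. cnj (V r x k) * V r x l)
        = (\<Sum>x<N. (cnj (phase N r x) * phase N r x) * (fourier N l x * cnj (fourier N k x)))"
      unfolding V_def by (intro sum.cong refl) (simp add: fourier_commute[of N _ k] fourier_commute[of N _ l] mult_ac)
    then show ?thesis using fourier_orth[OF that(2,1)] by simp
  qed
  have avg: "(\<Sum>r<2 ^ Suc N. (cmod (X r k p q))\<^sup>2) \<le> 2 ^ Suc N * (real b / (real N)\<^sup>2)"
    if "k < N" "p < a" "q < a" for k p q
  proof (cases "p = q")
    \<comment> \<open>Every entry of \<open>V\<close> has modulus 1 / sqrt N, so the diagonal of
      each reduced state is exactly b / N = 1 / a, for every value of \<open>r\<close>.\<close>
    case True
    have "X r k p q = 0" for r
    proof -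
      have "(\<Sum>y<b. V r (p * b + y) k * cnj (V r (p * b + y) k)) = (\<Sum>y<b. 1 / of_nat N)"
      proof (intro sum.cong refl)
        fix y
        have "V r (p * b + y) k * cnj (V r (p * b + y) k)
          = (phase N r (p * b + y) * cnj (phase N r (p * b + y)))
            * (fourier N (p * b + y) k * cnj (fourier N (p * b + y) k))"
          unfolding V_def by (simp add: mult_ac)
        then show "V r (p * b + y) k * cnj (V r (p * b + y) k) = 1 / of_nat N"
          unfolding fourier_mult_cnj[OF N] by simp
      qed
      then show ?thesis using True assms by (simp add: X_def N_def)
    qed
    then show ?thesis by simp
  next
    case False
    \<comment> \<open>Rewrites the sum over the second factor as a double sum over full indices, the
      form required by \<open>phase_average\<close>. For p \<noteq> q the kernel has no diagonal, so
      only the sum of \<open>b\<close> squared moduli, each 1 / N^2, survives.\<close>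
    define w where "w = (\<lambda>x x'. if x div b = p \<and> x' div b = q \<and> x mod b = x' mod b
      then fourier N x k * cnj (fourier N x' k) else 0)"
    note wsum = sum_block[OF \<open>p < a\<close> \<open>q < a\<close>, of _ b "\<lambda>x x'. fourier N x k * cnj (fourier N x' k)",
      folded N_def]
    have Xw: "X r k p q = (\<Sum>i<N. \<Sum>j<N. phase N r i * cnj (phase N r j) * w i j)" for r
    proof -
      have "(\<Sum>i<N. \<Sum>j<N. phase N r i * cnj (phase N r j) * w i j)
        = (\<Sum>y<b. phase N r (p * b + y) * cnj (phase N r (q * b + y))
            * (fourier N (p * b + y) k * cnj (fourier N (q * b + y) k)))"
        unfolding w_def by (rule wsum[of "\<lambda>i j z. phase N r i * cnj (phase N r j) * z"]) simp
      then show ?thesis using False by (simp add: X_def V_def mult_ac)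
    qed
    have diag: "(\<Sum>i<N. w i i) = 0"
      using False by (intro sum.neutral) (auto simp: w_def)
    have "(\<Sum>i<N. \<Sum>j<N. if i \<noteq> j then (cmod (w i j))\<^sup>2 else 0)
      = (\<Sum>y<b. if p * b + y \<noteq> q * b + y then
          (cmod (fourier N (p * b + y) k * cnj (fourier N (q * b + y) k)))\<^sup>2 else 0)"
      unfolding w_def by (rule wsum[of "\<lambda>i j z. if i \<noteq> j then (cmod z)\<^sup>2 else 0"]) simp
    also have "\<dots> \<le> (\<Sum>y<b. (1 / real N)\<^sup>2)"
    proof (rule sum_mono)
      fix y
      have "(cmod (fourier N (p * b + y) k * cnj (fourier N (q * b + y) k)))\<^sup>2 = (1 / real N)\<^sup>2"
        unfolding norm_mult power_mult_distrib complex_mod_cnj cmod_fourier_sq[OF N]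
        by (simp add: power2_eq_square)
      then show "(if p * b + y \<noteq> q * b + y then
          (cmod (fourier N (p * b + y) k * cnj (fourier N (q * b + y) k)))\<^sup>2 else 0) \<le> (1 / real N)\<^sup>2"
        by simp
    qed
    also have "\<dots> = real b / (real N)\<^sup>2" by (simp add: power_divide)
    finally have "(\<Sum>i<N. \<Sum>j<N. if i \<noteq> j then (cmod (w i j))\<^sup>2 else 0) \<le> real b / (real N)\<^sup>2" .
    then show ?thesis
      unfolding Xw phase_average diag by (intro mult_left_mono) auto
  qed
  have "(\<Sum>r<2 ^ Suc N. \<Sum>p<a. \<Sum>q<a. \<Sum>k<N. (cmod (X r k p q))\<^sup>2)
      = (\<Sum>p<a. \<Sum>q<a. \<Sum>k<N. \<Sum>r<2 ^ Suc N. (cmod (X r k p q))\<^sup>2)"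
  proof -
    have "(\<Sum>r<2 ^ Suc N. \<Sum>p<a. \<Sum>q<a. \<Sum>k<N. (cmod (X r k p q))\<^sup>2)
        = (\<Sum>p<a. \<Sum>r<2 ^ Suc N. \<Sum>q<a. \<Sum>k<N. (cmod (X r k p q))\<^sup>2)" by (rule sum.swap)
    also have "\<dots> = (\<Sum>p<a. \<Sum>q<a. \<Sum>r<2 ^ Suc N. \<Sum>k<N. (cmod (X r k p q))\<^sup>2)"
      by (rule sum.cong[OF refl], rule sum.swap)
    also have "\<dots> = (\<Sum>p<a. \<Sum>q<a. \<Sum>k<N. \<Sum>r<2 ^ Suc N. (cmod (X r k p q))\<^sup>2)"
      by (rule sum.cong[OF refl], rule sum.cong[OF refl], rule sum.swap)
    finally show ?thesis .
  qed
  also have "\<dots> \<le> (\<Sum>p<a. \<Sum>q<a. \<Sum>k<N. 2 ^ Suc N * (real b / (real N)\<^sup>2))"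
    by (intro sum_mono avg) auto
  also have "\<dots> = real (card {..<2 ^ Suc N :: nat}) * (real N / real b)"
  proof -
    have "real a * (real a * (real N * (Q * (real b / (real N)\<^sup>2)))) = Q * (real N / real b)" for Q
      using assms(1,2) by (simp add: N_def field_simps power2_eq_square)
    then show ?thesis by (simp only: sum_constant card_lessThan of_nat_power of_nat_numeral)
  qed
  finally have s: "(\<Sum>r<2 ^ Suc N. \<Sum>p<a. \<Sum>q<a. \<Sum>k<N. (cmod (X r k p q))\<^sup>2)
    \<le> real (card {..<2 ^ Suc N :: nat}) * (real N / real b)" .
  obtain r where "(\<Sum>p<a. \<Sum>q<a. \<Sum>k<N. (cmod (X r k p q))\<^sup>2) \<le> real N / real b"
    using sum_average_le[OF _ _ s] by (force simp: lessThan_empty_iff)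
  then show ?thesis
    using row[of _ _ r] column[of _ _ r] unfolding X_def by (intro exI[of _ "V r"] conjI allI impI)
qed

text \<open>The phases separate the diagonal of \<open>w\<close> from the rest, and the permutation
  then spreads each part over \<open>X\<close>. The diagonal part meets the centred diagonal of
  \<open>X\<close>, where \<open>perm_average_linear\<close> applies; each off-diagonal entry of
  \<open>w\<close> meets the mean squared modulus of the off-diagonal entries of
  \<open>X\<close>.\<close>

lemma twirl_bound:
  fixes w X :: "nat \<Rightarrow> nat \<Rightarrow> complex"
  assumes "2 \<le> N" "(\<Sum>k<N. X k k - d) = 0"
  shows "(\<Sum>\<pi> | \<pi> permutes {..<N}. \<Sum>r<2 ^ Suc N. (cmod (\<Sum>i<N. \<Sum>j<N. phase N r i * cnj (phase N r j)
      * (w i j * X (\<pi> i) (\<pi> j) - (if i = j then w i i * d else 0))))\<^sup>2)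
    \<le> 2 ^ Suc N * fact N / real (N - 1) * ((\<Sum>k<N. (cmod (X k k - d))\<^sup>2) * (\<Sum>i<N. (cmod (w i i))\<^sup>2)
      + (\<Sum>k<N. \<Sum>l<N. (cmod (X k l))\<^sup>2) / real N * (\<Sum>i<N. \<Sum>j<N. if i \<noteq> j then (cmod (w i j))\<^sup>2 else 0))"
proof -
  let ?P = "{\<pi>. \<pi> permutes {..<N}}" and ?Q = "2 ^ Suc N :: real"
  define x where "x = (\<Sum>k<N. \<Sum>l<N. if k \<noteq> l then (cmod (X k l))\<^sup>2 else 0)"
  have x: "x \<le> (\<Sum>k<N. \<Sum>l<N. (cmod (X k l))\<^sup>2)"
    unfolding x_def by (intro sum_mono) auto
  have N: "0 < real N" "0 < real (N - 1)" using assms(1) by auto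
  have "(\<Sum>\<pi>\<in>?P. \<Sum>r<2 ^ Suc N. (cmod (\<Sum>i<N. \<Sum>j<N. phase N r i * cnj (phase N r j)
      * (w i j * X (\<pi> i) (\<pi> j) - (if i = j then w i i * d else 0))))\<^sup>2)
    = (\<Sum>\<pi>\<in>?P. ?Q * ((cmod (\<Sum>i<N. w i i * (X (\<pi> i) (\<pi> i) - d)))\<^sup>2
      + (\<Sum>i<N. \<Sum>j<N. if i \<noteq> j then (cmod (w i j))\<^sup>2 * (cmod (X (\<pi> i) (\<pi> j)))\<^sup>2 else 0)))"
    unfolding phase_average
    by (intro sum.cong refl arg_cong2[of _ _ _ _ times] arg_cong2[of _ _ _ _ plus])
      (auto simp: right_diff_distrib norm_mult power_mult_distrib intro!: sum.cong)
  also have "\<dots> = ?Q * ((\<Sum>\<pi>\<in>?P. (cmod (\<Sum>i<N. w i i * (X (\<pi> i) (\<pi> i) - d)))\<^sup>2)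
      + (\<Sum>i<N. \<Sum>j<N. if i \<noteq> j then (cmod (w i j))\<^sup>2 * (\<Sum>\<pi>\<in>?P. (cmod (X (\<pi> i) (\<pi> j)))\<^sup>2) else 0))"
  proof -
    have "(\<Sum>\<pi>\<in>?P. \<Sum>i<N. \<Sum>j<N. if i \<noteq> j then (cmod (w i j))\<^sup>2 * (cmod (X (\<pi> i) (\<pi> j)))\<^sup>2 else 0)
      = (\<Sum>i<N. \<Sum>j<N. \<Sum>\<pi>\<in>?P. if i \<noteq> j then (cmod (w i j))\<^sup>2 * (cmod (X (\<pi> i) (\<pi> j)))\<^sup>2 else 0)"
      by (subst sum.swap, rule sum.cong[OF refl], rule sum.swap)
    also have "\<dots> = (\<Sum>i<N. \<Sum>j<N. if i \<noteq> j then (cmod (w i j))\<^sup>2 * (\<Sum>\<pi>\<in>?P. (cmod (X (\<pi> i) (\<pi> j)))\<^sup>2) else 0)"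
      by (rule sum.cong[OF refl], rule sum.cong[OF refl]) (simp add: sum_distrib_left)
    finally show ?thesis unfolding sum_distrib_left[symmetric] sum.distrib by simp
  qed
  also have "(\<Sum>i<N. \<Sum>j<N. if i \<noteq> j then (cmod (w i j))\<^sup>2 * (\<Sum>\<pi>\<in>?P. (cmod (X (\<pi> i) (\<pi> j)))\<^sup>2) else 0)
      = (\<Sum>i<N. \<Sum>j<N. (if i \<noteq> j then (cmod (w i j))\<^sup>2 else 0) * (fact N / (real N * real (N - 1)) * x))"
  proof (rule sum.cong[OF refl], rule sum.cong[OF refl])
    fix i j assume "i \<in> {..<N}" "j \<in> {..<N}"
    then have "i \<noteq> j \<Longrightarrow> (\<Sum>\<pi>\<in>?P. (cmod (X (\<pi> i) (\<pi> j)))\<^sup>2) = fact N / (real N * real (N - 1)) * x"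
      unfolding x_def by (intro perm_average_pair) auto
    then show "(if i \<noteq> j then (cmod (w i j))\<^sup>2 * (\<Sum>\<pi>\<in>?P. (cmod (X (\<pi> i) (\<pi> j)))\<^sup>2) else 0)
      = (if i \<noteq> j then (cmod (w i j))\<^sup>2 else 0) * (fact N / (real N * real (N - 1)) * x)" by simp
  qed
  also have "\<dots> = (\<Sum>i<N. \<Sum>j<N. if i \<noteq> j then (cmod (w i j))\<^sup>2 else 0) * (fact N / (real N * real (N - 1)) * x)"
    unfolding sum_distrib_right ..
  also have "?Q * ((\<Sum>\<pi>\<in>?P. (cmod (\<Sum>i<N. w i i * (X (\<pi> i) (\<pi> i) - d)))\<^sup>2)
      + (\<Sum>i<N. \<Sum>j<N. if i \<noteq> j then (cmod (w i j))\<^sup>2 else 0) * (fact N / (real N * real (N - 1)) * x))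
    \<le> ?Q * (fact N / real (N - 1) * (\<Sum>k<N. (cmod (X k k - d))\<^sup>2) * (\<Sum>i<N. (cmod (w i i))\<^sup>2)
      + (\<Sum>i<N. \<Sum>j<N. if i \<noteq> j then (cmod (w i j))\<^sup>2 else 0) * (fact N / (real N * real (N - 1))
        * (\<Sum>k<N. \<Sum>l<N. (cmod (X k l))\<^sup>2)))"
  proof (rule mult_left_mono[OF add_mono])
    show "(\<Sum>\<pi>\<in>?P. (cmod (\<Sum>i<N. w i i * (X (\<pi> i) (\<pi> i) - d)))\<^sup>2)
      \<le> fact N / real (N - 1) * (\<Sum>k<N. (cmod (X k k - d))\<^sup>2) * (\<Sum>i<N. (cmod (w i i))\<^sup>2)"
      by (rule perm_average_linear[OF assms(1), of "\<lambda>k. X k k - d"]) (rule assms(2))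
    show "(\<Sum>i<N. \<Sum>j<N. if i \<noteq> j then (cmod (w i j))\<^sup>2 else 0) * (fact N / (real N * real (N - 1)) * x)
      \<le> (\<Sum>i<N. \<Sum>j<N. if i \<noteq> j then (cmod (w i j))\<^sup>2 else 0) * (fact N / (real N * real (N - 1))
        * (\<Sum>k<N. \<Sum>l<N. (cmod (X k l))\<^sup>2))"
      by (rule mult_left_mono[OF mult_left_mono[OF x]]) (auto intro!: sum_nonneg)
  qed simp
  also have "\<dots> = ?Q * fact N / real (N - 1) * ((\<Sum>k<N. (cmod (X k k - d))\<^sup>2) * (\<Sum>i<N. (cmod (w i i))\<^sup>2)
      + (\<Sum>k<N. \<Sum>l<N. (cmod (X k l))\<^sup>2) / real N * (\<Sum>i<N. \<Sum>j<N. if i \<noteq> j then (cmod (w i j))\<^sup>2 else 0))"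
  proof -
    have "Q * (F / n * A * B + D * (F / (m * n) * C)) = Q * F / n * (A * B + C / m * D)"
      for Q F n m A B C D :: real
      by (simp add: divide_inverse algebra_simps)
    then show ?thesis .
  qed
  finally show ?thesis .
qed

lemma sum_swap4:
  fixes f :: "'a \<Rightarrow> 'b \<Rightarrow> 'c \<Rightarrow> 'd \<Rightarrow> 'e :: comm_monoid_add"
  shows "(\<Sum>k\<in>A. \<Sum>l\<in>B. \<Sum>y\<in>C. \<Sum>z\<in>D. f k l y z) = (\<Sum>y\<in>C. \<Sum>z\<in>D. \<Sum>k\<in>A. \<Sum>l\<in>B. f k l y z)"
proof -
  have "(\<Sum>k\<in>A. \<Sum>l\<in>B. \<Sum>y\<in>C. \<Sum>z\<in>D. f k l y z) = (\<Sum>k\<in>A. \<Sum>y\<in>C. \<Sum>l\<in>B. \<Sum>z\<in>D. f k l y z)"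
    by (rule sum.cong[OF refl], rule sum.swap)
  also have "\<dots> = (\<Sum>y\<in>C. \<Sum>k\<in>A. \<Sum>l\<in>B. \<Sum>z\<in>D. f k l y z)" by (rule sum.swap)
  also have "\<dots> = (\<Sum>y\<in>C. \<Sum>k\<in>A. \<Sum>z\<in>D. \<Sum>l\<in>B. f k l y z)"
    by (rule sum.cong[OF refl], rule sum.cong[OF refl], rule sum.swap)
  also have "\<dots> = (\<Sum>y\<in>C. \<Sum>z\<in>D. \<Sum>k\<in>A. \<Sum>l\<in>B. f k l y z)"
    by (rule sum.cong[OF refl], rule sum.swap)
  finally show ?thesis .
qed

text \<open>Every block entry of the reduced operator is a twirled pairing of \<open>w s\<close>
  with a matrix \<open>X p q\<close> made from rows of \<open>V\<close>. For the off-diagonal part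
  of \<open>w s\<close> the norm of \<open>X p q\<close> suffices, which any unitary
  \<open>V\<close> bounds; for the diagonal part the columns of \<open>V\<close> have to be nearly
  maximally entangled. The index \<open>s\<close> will run over matrix entries on R, and one unitary
  serves them all.\<close>

lemma decoupling_unitary:
  fixes w :: "'s \<Rightarrow> nat \<Rightarrow> nat \<Rightarrow> complex" and a b :: nat
  assumes S: "finite S" and ab: "0 < a" "0 < b" "2 \<le> a * b"
  defines "N \<equiv> a * b"
  shows "\<exists>U :: nat \<Rightarrow> nat \<Rightarrow> complex.
    (\<forall>i<N. \<forall>j<N. (\<Sum>x<N. cnj (U x i) * U x j) = (if i = j then 1 else 0)) \<and>
    (\<Sum>s\<in>S. \<Sum>p<a. \<Sum>q<a. (cmod ((\<Sum>y<b. \<Sum>i<N. \<Sum>j<N. U (p * b + y) i * cnj (U (q * b + y) j) * w s i j)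
        - (if p = q then (\<Sum>i<N. w s i i) / of_nat a else 0)))\<^sup>2)
      \<le> 2 / real b * (\<Sum>s\<in>S. \<Sum>i<N. \<Sum>j<N. (cmod (w s i j))\<^sup>2)"
proof -
  obtain V :: "nat \<Rightarrow> nat \<Rightarrow> complex" where
    row: "\<And>x y. x < N \<Longrightarrow> y < N \<Longrightarrow> (\<Sum>k<N. V x k * cnj (V y k)) = (if x = y then 1 else 0)" and
    col: "\<And>k l. k < N \<Longrightarrow> l < N \<Longrightarrow> (\<Sum>x<N. cnj (V x k) * V x l) = (if k = l then 1 else 0)" and
    ent: "(\<Sum>p<a. \<Sum>q<a. \<Sum>k<N. (cmod ((\<Sum>y<b. V (p * b + y) k * cnj (V (q * b + y) k))
        - (if p = q then 1 / of_nat a else 0)))\<^sup>2) \<le> real N / real b"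
    using near_max_entangled_basis[OF ab(1,2)] unfolding N_def by blast
  define X where "X = (\<lambda>p q k l. \<Sum>y<b. V (p * b + y) k * cnj (V (q * b + y) l))"
  define d where "d = (\<lambda>p q :: nat. if p = q then 1 / of_nat a else (0 :: complex))"
  define U where "U = (\<lambda>\<pi> r x i. V x (\<pi> i) * phase N r i)"
  let ?P = "{\<pi>. \<pi> permutes {..<N}}" and ?Q = "{..<2 ^ Suc N} :: nat set"
  define T where "T = (\<lambda>s p q \<pi> r. (cmod ((\<Sum>y<b. \<Sum>i<N. \<Sum>j<N. U \<pi> r (p * b + y) i * cnj (U \<pi> r (q * b + y) j) * w s i j)
        - (if p = q then (\<Sum>i<N. w s i i) / of_nat a else 0)))\<^sup>2)"
  define W where "W = (\<lambda>s. \<Sum>i<N. \<Sum>j<N. (cmod (w s i j))\<^sup>2)"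
  define C where "C = 2 ^ Suc N * fact N / real (N - 1)"
  have N2: "2 \<le> N" using ab by (simp add: N_def)
  have C0: "0 \<le> C" by (simp add: C_def)
  have unit: "(\<Sum>x<N. cnj (U \<pi> r x i) * U \<pi> r x j) = (if i = j then 1 else 0)"
    if "\<pi> permutes {..<N}" "i < N" "j < N" for \<pi> r i j
  proof -
    have "\<pi> i < N" "\<pi> j < N" using that permutes_in_image[OF that(1)] by auto
    moreover have "\<pi> i = \<pi> j \<longleftrightarrow> i = j" using permutes_inj[OF that(1)] by (auto dest: injD)
    moreover have "(\<Sum>x<N. cnj (U \<pi> r x i) * U \<pi> r x j)
        = cnj (phase N r i) * phase N r j * (\<Sum>x<N. cnj (V x (\<pi> i)) * V x (\<pi> j))"
      unfolding U_def sum_distrib_left by (rule sum.cong[OF refl]) (simp add: mult_ac)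
    ultimately show ?thesis by (simp add: col)
  qed
  have T_eq: "T s p q \<pi> r = (cmod (\<Sum>i<N. \<Sum>j<N. phase N r i * cnj (phase N r j)
      * (w s i j * X p q (\<pi> i) (\<pi> j) - (if i = j then w s i i * d p q else 0))))\<^sup>2" for s p q \<pi> r
  proof -
    have 1: "(\<Sum>y<b. \<Sum>i<N. \<Sum>j<N. U \<pi> r (p * b + y) i * cnj (U \<pi> r (q * b + y) j) * w s i j)
        = (\<Sum>i<N. \<Sum>j<N. phase N r i * cnj (phase N r j) * (w s i j * X p q (\<pi> i) (\<pi> j)))"
    proof -
      have "(\<Sum>y<b. \<Sum>i<N. \<Sum>j<N. U \<pi> r (p * b + y) i * cnj (U \<pi> r (q * b + y) j) * w s i j)
        = (\<Sum>i<N. \<Sum>y<b. \<Sum>j<N. U \<pi> r (p * b + y) i * cnj (U \<pi> r (q * b + y) j) * w s i j)"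
        by (rule sum.swap)
      also have "\<dots> = (\<Sum>i<N. \<Sum>j<N. \<Sum>y<b. U \<pi> r (p * b + y) i * cnj (U \<pi> r (q * b + y) j) * w s i j)"
        by (rule sum.cong[OF refl], rule sum.swap)
      also have "\<dots> = (\<Sum>i<N. \<Sum>j<N. phase N r i * cnj (phase N r j) * (w s i j * X p q (\<pi> i) (\<pi> j)))"
        unfolding X_def U_def sum_distrib_left
        by (rule sum.cong[OF refl], rule sum.cong[OF refl], rule sum.cong[OF refl]) (simp add: mult_ac)
      finally show ?thesis .
    qed
    have 2: "(\<Sum>i<N. \<Sum>j<N. phase N r i * cnj (phase N r j) * (if i = j then w s i i * d p q else 0))
        = (if p = q then (\<Sum>i<N. w s i i) / of_nat a else 0)"
    proof -
      have "(\<Sum>i<N. \<Sum>j<N. phase N r i * cnj (phase N r j) * (if i = j then w s i i * d p q else 0))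
          = (\<Sum>i<N. \<Sum>j<N. if i = j then w s i i * d p q else 0)"
        by (rule sum.cong[OF refl], rule sum.cong[OF refl]) auto
      also have "\<dots> = (\<Sum>i<N. w s i i * d p q)" by simp
      finally show ?thesis by (simp add: d_def sum_divide_distrib)
    qed
    show ?thesis unfolding T_def 1 2[symmetric] right_diff_distrib sum_subtractf ..
  qed
  \<comment> \<open>Orthonormal rows give \<open>X p q\<close> trace \<open>b\<close> or 0, and N /
    a = b is what the subtracted constants add up to: the centring that \<open>twirl_bound\<close>
    asks for.\<close>
  have tr0: "(\<Sum>k<N. X p q k k - d p q) = 0" if "p < a" "q < a" for p q
  proof -
    have "(\<Sum>k<N. X p q k k) = (\<Sum>y<b. \<Sum>k<N. V (p * b + y) k * cnj (V (q * b + y) k))"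
      unfolding X_def by (rule sum.swap)
    also have "\<dots> = (\<Sum>y<b. if p = q then 1 else 0)"
    proof (rule sum.cong[OF refl])
      fix y assume "y \<in> {..<b}"
      then have "p * b + y < N" "q * b + y < N" using index_less that unfolding N_def by auto
      from row[OF this] show "(\<Sum>k<N. V (p * b + y) k * cnj (V (q * b + y) k)) = (if p = q then 1 else 0)"
        using ab by simp
    qed
    finally show ?thesis using ab by (simp add: sum_subtractf d_def N_def)
  qed
  \<comment> \<open>\<open>X p q\<close> is a partial isometry of rank \<open>b\<close>, because the
    rows of \<open>V\<close> are orthonormal.\<close>
  have B: "(\<Sum>k<N. \<Sum>l<N. (cmod (X p q k l))\<^sup>2) = real b" if "p < a" "q < a" for p q
  proof -
    have "complex_of_real (\<Sum>k<N. \<Sum>l<N. (cmod (X p q k l))\<^sup>2) = (\<Sum>k<N. \<Sum>l<N. \<Sum>y<b. \<Sum>z<b.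
        (V (p * b + y) k * cnj (V (p * b + z) k)) * (V (q * b + z) l * cnj (V (q * b + y) l)))"
      unfolding of_real_sum cmod_square X_def cnj_sum sum_product by (simp add: mult_ac)
    also have "\<dots> = (\<Sum>y<b. \<Sum>z<b. (\<Sum>k<N. V (p * b + y) k * cnj (V (p * b + z) k))
        * (\<Sum>l<N. V (q * b + z) l * cnj (V (q * b + y) l)))"
      unfolding sum_swap4[of _ "{..<N}"] sum_product ..
    also have "\<dots> = (\<Sum>y<b. \<Sum>z<b. if y = z then 1 else 0)"
    proof (rule sum.cong[OF refl], rule sum.cong[OF refl])
      fix y z assume "y \<in> {..<b}" "z \<in> {..<b}"
      then have l: "p * b + y < N" "p * b + z < N" "q * b + y < N" "q * b + z < N"
        using index_less that unfolding N_def by auto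
      show "(\<Sum>k<N. V (p * b + y) k * cnj (V (p * b + z) k)) * (\<Sum>l<N. V (q * b + z) l * cnj (V (q * b + y) l))
        = (if y = z then 1 else 0)"
        unfolding row[OF l(1,2)] row[OF l(4,3)] by simp
    qed
    also have "\<dots> = complex_of_real (real b)" by simp
    finally show ?thesis unfolding of_real_eq_iff .
  qed
  have avg: "(\<Sum>p<a. \<Sum>q<a. \<Sum>\<pi>\<in>?P. \<Sum>r\<in>?Q. T s p q \<pi> r) \<le> C * (real a * W s)" for s
  proof -
    define D where "D = (\<Sum>i<N. (cmod (w s i i))\<^sup>2)"
    define R where "R = (\<Sum>i<N. \<Sum>j<N. if i \<noteq> j then (cmod (w s i j))\<^sup>2 else 0)"
    have D0: "0 \<le> D" by (simp add: D_def sum_nonneg)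
    have W: "W s = D + R" unfolding W_def D_def R_def by (rule double_sum_split_diag)
    have "(\<Sum>p<a. \<Sum>q<a. \<Sum>\<pi>\<in>?P. \<Sum>r\<in>?Q. T s p q \<pi> r)
        \<le> (\<Sum>p<a. \<Sum>q<a. C * ((\<Sum>k<N. (cmod (X p q k k - d p q))\<^sup>2) * D + real b / real N * R))"
    proof (intro sum_mono)
      fix p q assume pq: "p \<in> {..<a}" "q \<in> {..<a}"
      then have pq': "p < a" "q < a" by auto
      show "(\<Sum>\<pi>\<in>?P. \<Sum>r\<in>?Q. T s p q \<pi> r)
        \<le> C * ((\<Sum>k<N. (cmod (X p q k k - d p q))\<^sup>2) * D + real b / real N * R)"
        using twirl_bound[where X = "X p q" and d = "d p q" and w = "w s", OF N2 tr0[OF pq']] unfolding B[OF pq'] T_eq C_def D_def R_def .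
    qed
    also have "\<dots> = C * ((\<Sum>p<a. \<Sum>q<a. \<Sum>k<N. (cmod (X p q k k - d p q))\<^sup>2) * D
        + real a * (real a * (real b / real N * R)))"
      by (simp only: sum_distrib_left[symmetric] sum_distrib_right[symmetric] sum.distrib sum_constant card_lessThan)
        (simp only: mult.left_commute)
    also have "\<dots> \<le> C * (real N / real b * D + real a * (real a * (real b / real N * R)))"
      using ent C0 D0 unfolding X_def d_def by (intro mult_left_mono add_mono mult_right_mono order_refl)
    \<comment> \<open>Both parts carry the same weight: N / b and a a b / N are each equal to
      \<open>a\<close>.\<close>
    also have "real N / real b * D + real a * (real a * (real b / real N * R)) = real a * W s"
      using ab unfolding W N_def by (simp add: field_simps)
    finally show ?thesis .
  qed
  have "(\<Sum>\<pi>r\<in>?P \<times> ?Q. \<Sum>s\<in>S. \<Sum>p<a. \<Sum>q<a. T s p q (fst \<pi>r) (snd \<pi>r))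
      = (\<Sum>s\<in>S. \<Sum>p<a. \<Sum>q<a. \<Sum>\<pi>r\<in>?P \<times> ?Q. T s p q (fst \<pi>r) (snd \<pi>r))"
  proof -
    have "(\<Sum>\<pi>r\<in>?P \<times> ?Q. \<Sum>s\<in>S. \<Sum>p<a. \<Sum>q<a. T s p q (fst \<pi>r) (snd \<pi>r))
      = (\<Sum>s\<in>S. \<Sum>\<pi>r\<in>?P \<times> ?Q. \<Sum>p<a. \<Sum>q<a. T s p q (fst \<pi>r) (snd \<pi>r))" by (rule sum.swap)
    also have "\<dots> = (\<Sum>s\<in>S. \<Sum>p<a. \<Sum>\<pi>r\<in>?P \<times> ?Q. \<Sum>q<a. T s p q (fst \<pi>r) (snd \<pi>r))"
      by (rule sum.cong[OF refl], rule sum.swap)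
    also have "\<dots> = (\<Sum>s\<in>S. \<Sum>p<a. \<Sum>q<a. \<Sum>\<pi>r\<in>?P \<times> ?Q. T s p q (fst \<pi>r) (snd \<pi>r))"
      by (rule sum.cong[OF refl], rule sum.cong[OF refl], rule sum.swap)
    finally show ?thesis .
  qed
  also have "\<dots> = (\<Sum>s\<in>S. \<Sum>p<a. \<Sum>q<a. \<Sum>\<pi>\<in>?P. \<Sum>r\<in>?Q. T s p q \<pi> r)"
    unfolding sum.cartesian_product case_prod_unfold ..
  also have "\<dots> \<le> (\<Sum>s\<in>S. C * (real a * W s))" by (intro sum_mono avg)
  also have "\<dots> = C * (real a * (\<Sum>s\<in>S. W s))" unfolding sum_distrib_left ..
  also have "\<dots> \<le> real (card (?P \<times> ?Q)) * (2 / real b * (\<Sum>s\<in>S. W s))"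
  proof -
    \<comment> \<open>Here N / (N - 1) \<le> 2 is spent, the origin of the factor 2 in the
      bound.\<close>
    have "real a / real (N - 1) \<le> 2 / real b"
    proof -
      have "real a * real b = real N" by (simp add: N_def)
      moreover have "real N \<le> 2 * real (N - 1)" using N2 by (simp add: of_nat_diff)
      ultimately show ?thesis using ab N2 by (simp add: divide_simps)
    qed
    then have "2 ^ Suc N * fact N * (real a / real (N - 1)) \<le> 2 ^ Suc N * fact N * (2 / real b)"
      by (intro mult_left_mono) auto
    moreover have "0 \<le> (\<Sum>s\<in>S. W s)" unfolding W_def by (intro sum_nonneg) auto
    ultimately have "2 ^ Suc N * fact N * (real a / real (N - 1)) * (\<Sum>s\<in>S. W s)
        \<le> 2 ^ Suc N * fact N * (2 / real b) * (\<Sum>s\<in>S. W s)"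
      by (rule mult_right_mono)
    moreover have "real (card (?P \<times> ?Q)) = 2 ^ Suc N * fact N"
      unfolding card_cartesian_product using card_permutations[of "{..<N}" N] by simp
    ultimately show ?thesis by (simp add: C_def mult_ac del: power_Suc)
  qed
  finally have s: "(\<Sum>\<pi>r\<in>?P \<times> ?Q. \<Sum>s\<in>S. \<Sum>p<a. \<Sum>q<a. T s p q (fst \<pi>r) (snd \<pi>r))
    \<le> real (card (?P \<times> ?Q)) * (2 / real b * (\<Sum>s\<in>S. W s))" .
  have fin: "finite (?P \<times> ?Q)" by (intro finite_cartesian_product finite_permutations) auto
  have "(id, 0) \<in> ?P \<times> ?Q" by (simp add: permutes_id)
  then have ne: "?P \<times> ?Q \<noteq> {}" by blast
  obtain \<pi> r where \<pi>: "\<pi> permutes {..<N}" and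
    b: "(\<Sum>s\<in>S. \<Sum>p<a. \<Sum>q<a. T s p q \<pi> r) \<le> 2 / real b * (\<Sum>s\<in>S. W s)"
    using sum_average_le[OF fin ne s] by auto
  show ?thesis
    using unit[OF \<pi>] b unfolding T_def W_def by (intro exI[of _ "U \<pi> r"] conjI allI impI)
qed

subsection \<open>Tensor products\<close>

lemma tensor_dim [simp]:
  "dim_row (tensor_mat A B) = dim_row A * dim_row B" "dim_col (tensor_mat A B) = dim_col A * dim_col B"
  by (simp_all add: tensor_mat_def)

lemma tensor_carrier [simp, intro]:
  "A \<in> carrier_mat m n \<Longrightarrow> B \<in> carrier_mat r s \<Longrightarrow> tensor_mat A B \<in> carrier_mat (m * r) (n * s)"
  by (intro carrier_matI) auto

lemma tensor_index:
  assumes "A \<in> carrier_mat m n" "B \<in> carrier_mat r s" "i < m" "x < r" "j < n" "y < s"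
  shows "tensor_mat A B $$ (i * r + x, j * s + y) = A $$ (i, j) * B $$ (x, y)"
  using assms index_less[of i m x r] index_less[of j n y s] by (auto simp: tensor_mat_def)

lemma div_mod_index:
  assumes "i < n * (r :: nat)" obtains i' x where "i = i' * r + x" "i' < n" "x < r"
proof
  have "r > 0" using assms by (cases r) auto
  then show "i div r < n" "i mod r < r" using assms by (auto simp: less_mult_imp_div_less)
  show "i = i div r * r + i mod r" by simp
qed

lemma eq_mat_tensorI:
  assumes "A \<in> carrier_mat (m * r) (n * s)" "B \<in> carrier_mat (m * r) (n * s)"
    and "\<And>i x j y. i < m \<Longrightarrow> x < r \<Longrightarrow> j < n \<Longrightarrow> y < s \<Longrightarrow> A $$ (i * r + x, j * s + y) = B $$ (i * r + x, j * s + y)"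
  shows "A = B"
proof (rule eq_matI)
  fix i j assume "i < dim_row B" "j < dim_col B"
  then have "i < m * r" "j < n * s" using assms(2) by auto
  then show "A $$ (i, j) = B $$ (i, j)" by (elim div_mod_index) (use assms(3) in auto)
qed (use assms in auto)

lemma tensor_mult:
  assumes "A \<in> carrier_mat m n" "B \<in> carrier_mat r s" "C \<in> carrier_mat n p" "D \<in> carrier_mat s t"
  shows "tensor_mat A B * tensor_mat C D = tensor_mat (A * C) (B * D)"
proof (rule eq_mat_tensorI[of _ m r p t])
  fix i x j y assume l: "i < m" "x < r" "j < p" "y < t"
  have "(tensor_mat A B * tensor_mat C D) $$ (i * r + x, j * t + y)
      = (\<Sum>k<n * s. tensor_mat A B $$ (i * r + x, k) * tensor_mat C D $$ (k, j * t + y))"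
    by (rule mult_index_sum) (use assms l index_less in auto)
  also have "\<dots> = (\<Sum>k<n. \<Sum>z<s. (A $$ (i, k) * C $$ (k, j)) * (B $$ (x, z) * D $$ (z, y)))"
    unfolding sum_nat_mult using assms l
    by (intro sum.cong refl) (simp add: tensor_index[of _ m n _ r s] tensor_index[of _ n p _ s t])
  also have "\<dots> = (A * C) $$ (i, j) * (B * D) $$ (x, y)"
    unfolding mult_index_sum[OF assms(1,3) l(1,3)] mult_index_sum[OF assms(2,4) l(2,4)] sum_product ..
  also have "\<dots> = tensor_mat (A * C) (B * D) $$ (i * r + x, j * t + y)"
    by (rule tensor_index[symmetric]) (use assms l in auto)
  finally show "(tensor_mat A B * tensor_mat C D) $$ (i * r + x, j * t + y)
    = tensor_mat (A * C) (B * D) $$ (i * r + x, j * t + y)" .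
qed (rule mult_carrier_mat[OF tensor_carrier[OF assms(1,2)] tensor_carrier[OF assms(3,4)]]
    tensor_carrier[OF mult_carrier_mat[OF assms(1,3)] mult_carrier_mat[OF assms(2,4)]])+

lemma adj_tensor: "adj (tensor_mat A B) = tensor_mat (adj A) (adj B)"
proof -
  obtain m n where A: "A \<in> carrier_mat m n" by blast
  obtain r s where B: "B \<in> carrier_mat r s" by blast
  show ?thesis
  proof (rule eq_mat_tensorI[of _ n s m r])
    fix i x j y assume l: "i < n" "x < s" "j < m" "y < r"
    have "adj (tensor_mat A B) $$ (i * s + x, j * r + y) = cnj (tensor_mat A B $$ (j * r + y, i * s + x))"
      by (rule adj_index) (use A B l index_less in auto)
    also have "\<dots> = adj A $$ (i, j) * adj B $$ (x, y)"
      using A B l by (simp add: tensor_index[of _ m n _ r s])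
    also have "\<dots> = tensor_mat (adj A) (adj B) $$ (i * s + x, j * r + y)"
      by (rule tensor_index[symmetric]) (use A B l in auto)
    finally show "adj (tensor_mat A B) $$ (i * s + x, j * r + y)
      = tensor_mat (adj A) (adj B) $$ (i * s + x, j * r + y)" .
  qed (use A B in auto)
qed

lemma index_eq_iff:
  assumes "x < r" "y < r" shows "i * r + x = j * r + y \<longleftrightarrow> i = j \<and> x = (y :: nat)"
proof
  assume e: "i * r + x = j * r + y"
  have "(i * r + x) div r = (j * r + y) div r" "(i * r + x) mod r = (j * r + y) mod r"
    unfolding e by auto
  then show "i = j \<and> x = y" using assms by simp
qed simp

lemma tensor_one: "tensor_mat (1\<^sub>m n) (1\<^sub>m r) = 1\<^sub>m (n * r)"
proof (rule eq_mat_tensorI[of _ n r n r])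
  fix i x j y assume l: "i < n" "x < r" "j < n" "y < r"
  then have "i * r + x = j * r + y \<longleftrightarrow> i = j \<and> x = y"
    by (intro index_eq_iff)
  then show "tensor_mat (1\<^sub>m n) (1\<^sub>m r) $$ (i * r + x, j * r + y) = (1\<^sub>m (n * r) :: complex mat) $$ (i * r + x, j * r + y)"
    using l index_less by (subst tensor_index[of _ n n _ r r]) auto
qed auto

lemma tensor_add_right:
  assumes "A \<in> carrier_mat m n" "B \<in> carrier_mat r s" "C \<in> carrier_mat r s"
  shows "tensor_mat A (B + C) = tensor_mat A B + tensor_mat A C"
proof (rule eq_mat_tensorI[of _ m r n s])
  fix i x j y assume l: "i < m" "x < r" "j < n" "y < s"
  then have "i * r + x < m * r" "j * s + y < n * s" using index_less by auto
  then show "tensor_mat A (B + C) $$ (i * r + x, j * s + y) = (tensor_mat A B + tensor_mat A C) $$ (i * r + x, j * s + y)"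
    using assms l by (simp add: tensor_index[of _ m n _ r s] distrib_left)
qed (use assms in auto)

lemma tensor_smult_right:
  assumes "A \<in> carrier_mat m n" "B \<in> carrier_mat r s"
  shows "tensor_mat A (c \<cdot>\<^sub>m B) = c \<cdot>\<^sub>m tensor_mat A B"
proof (rule eq_mat_tensorI[of _ m r n s])
  fix i x j y assume l: "i < m" "x < r" "j < n" "y < s"
  then have "i * r + x < m * r" "j * s + y < n * s" using index_less by auto
  then show "tensor_mat A (c \<cdot>\<^sub>m B) $$ (i * r + x, j * s + y) = (c \<cdot>\<^sub>m tensor_mat A B) $$ (i * r + x, j * s + y)"
    using assms l by (simp add: tensor_index[of _ m n _ r s])
qed (use assms in auto)

lemma tensor_minus_left:
  assumes "A \<in> carrier_mat m n" "B \<in> carrier_mat m n" "C \<in> carrier_mat r s"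
  shows "tensor_mat (A - B) C = tensor_mat A C - tensor_mat B C"
proof (rule eq_mat_tensorI[of _ m r n s])
  fix i x j y assume l: "i < m" "x < r" "j < n" "y < s"
  then have "i * r + x < m * r" "j * s + y < n * s" using index_less by auto
  then show "tensor_mat (A - B) C $$ (i * r + x, j * s + y) = (tensor_mat A C - tensor_mat B C) $$ (i * r + x, j * s + y)"
    using assms l tensor_index[OF minus_carrier_mat[OF assms(2)] assms(3) l(1,2) l(3,4), of A]
    by (simp add: tensor_index[of _ m n _ r s] left_diff_distrib)
qed (use assms in auto)

lemma trace_tensor:
  assumes "A \<in> carrier_mat n n" "B \<in> carrier_mat r r"
  shows "mat_trace (tensor_mat A B) = mat_trace A * mat_trace B"
proof -
  have "mat_trace (tensor_mat A B) = (\<Sum>i<n. \<Sum>x<r. A $$ (i, i) * B $$ (x, x))"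
    using assms by (simp add: mat_trace_def sum_nat_mult tensor_index[of _ n n _ r r])
  then show ?thesis using assms by (simp add: mat_trace_def sum_product)
qed

text \<open>The tensor product of the two square roots is a square root of the tensor product, so
  the latter has the form \<open>adj G * G\<close>.\<close>

lemma psd_tensor:
  assumes "psd A" "psd B" shows "psd (tensor_mat A B)"
proof -
  obtain n where A: "A \<in> carrier_mat n n" using psd_carrier[OF assms(1)] .
  obtain r where B: "B \<in> carrier_mat r r" using psd_carrier[OF assms(2)] .
  note a = psd_sqrt[OF assms(1) A] and b = psd_sqrt[OF assms(2) B]
  have "tensor_mat A B = adj (tensor_mat (psd_sqrt A) (psd_sqrt B)) * tensor_mat (psd_sqrt A) (psd_sqrt B)"
    unfolding adj_tensor a(4) b(4) tensor_mult[OF a(3) b(3) a(3) b(3)] a(2) b(2) ..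
  then show ?thesis using psd_adj_mult[OF tensor_carrier[OF a(3) b(3)]] by simp
qed

lemma contr_tensor_one:
  assumes "contr K" "K \<in> carrier_mat m n" shows "contr (tensor_mat K (1\<^sub>m r))"
proof -
  note o = one_carrier_mat[of r]
  have "1\<^sub>m (n * r) - adj (tensor_mat K (1\<^sub>m r)) * tensor_mat K (1\<^sub>m r) = tensor_mat (1\<^sub>m n - adj K * K) (1\<^sub>m r)"
    unfolding adj_tensor adj_one tensor_mult[OF adj_carrier[OF assms(2)] o assms(2) o] left_mult_one_mat[OF o]
      tensor_minus_left[OF one_carrier_mat mult_carrier_mat[OF adj_carrier[OF assms(2)] assms(2)] o] tensor_one ..
  moreover have "psd (1\<^sub>m n - adj K * K)" using assms by (simp add: contr_def)
  ultimately show ?thesis using psd_tensor[of "1\<^sub>m n - adj K * K" "1\<^sub>m r"] assms(2) by (simp add: contr_def)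
qed

subsection \<open>Partial traces\<close>

lemma partial_trace_carrier [simp]: "partial_trace l m r X \<in> carrier_mat (l * r) (l * r)"
  by (simp add: partial_trace_def)

lemma partial_trace_index:
  assumes "i < l" "j < l" "x < r" "y < r"
  shows "partial_trace l m r X $$ (i * r + x, j * r + y)
    = (\<Sum>k<m. X $$ ((i * m + k) * r + x, (j * m + k) * r + y))"
  using assms index_less[of i l x r] index_less[of j l y r] by (simp add: partial_trace_def)

lemma trace_sum: "X \<in> carrier_mat n n \<Longrightarrow> mat_trace X = (\<Sum>i<n. X $$ (i, i))"
  by (auto simp: mat_trace_def)

lemma trace_partial_trace:
  assumes "X \<in> carrier_mat (l * m * r) (l * m * r)"
  shows "mat_trace (partial_trace l m r X) = mat_trace X"
proof -
  have "mat_trace (partial_trace l m r X) = (\<Sum>i<l. \<Sum>x<r. \<Sum>k<m. X $$ ((i * m + k) * r + x, (i * m + k) * r + x))"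
    unfolding trace_sum[OF partial_trace_carrier] sum_nat_mult
    by (rule sum.cong[OF refl], rule sum.cong[OF refl]) (simp add: partial_trace_index)
  also have "\<dots> = (\<Sum>i<l. \<Sum>k<m. \<Sum>x<r. X $$ ((i * m + k) * r + x, (i * m + k) * r + x))"
    by (rule sum.cong[OF refl], rule sum.swap)
  also have "\<dots> = mat_trace X"
    unfolding trace_sum[OF assms] sum_nat_mult ..
  finally show ?thesis .
qed

lemma partial_trace_minus:
  assumes "X \<in> carrier_mat (l * m * r) (l * m * r)" "Y \<in> carrier_mat (l * m * r) (l * m * r)"
  shows "partial_trace l m r (X - Y) = partial_trace l m r X - partial_trace l m r Y"
proof (rule eq_mat_tensorI[of _ l r l r])
  fix i x j y assume l: "i < l" "x < r" "j < l" "y < r"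
  have "(i * m + k) * r + x < l * m * r" "(j * m + k) * r + y < l * m * r" if "k < m" for k
    using l that by (intro index_less; simp)+
  then show "partial_trace l m r (X - Y) $$ (i * r + x, j * r + y)
    = (partial_trace l m r X - partial_trace l m r Y) $$ (i * r + x, j * r + y)"
    using l assms index_less[of i l x r] index_less[of j l y r]
    by (simp add: partial_trace_index sum_subtractf carrier_matD[OF partial_trace_carrier])
qed (auto intro!: minus_carrier_mat)

text \<open>\<open>C \<otimes> 1\<close> with the identity acting on the middle factor; it is dual to \<^const>\<open>partial_trace\<close>.\<close>

definition middle_ext :: "nat \<Rightarrow> nat \<Rightarrow> nat \<Rightarrow> complex mat \<Rightarrow> complex mat" where
  "middle_ext l m r C = mat (l * m * r) (l * m * r) (\<lambda>(i, j).
     if i div r mod m = j div r mod m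
     then C $$ (i div r div m * r + i mod r, j div r div m * r + j mod r) else 0)"

lemma middle_ext_carrier [simp]: "middle_ext l m r C \<in> carrier_mat (l * m * r) (l * m * r)"
  by (simp add: middle_ext_def)

lemma middle_ext_index:
  assumes "i < l" "j < l" "k < m" "k' < m" "x < r" "y < r"
  shows "middle_ext l m r C $$ ((i * m + k) * r + x, (j * m + k') * r + y)
    = (if k = k' then C $$ (i * r + x, j * r + y) else 0)"
proof -
  have "(i * m + k) * r + x < l * m * r" "(j * m + k') * r + y < l * m * r"
    using assms by (intro index_less; simp)+
  then show ?thesis using assms by (simp add: middle_ext_def)
qed

lemma eq_mat_tensor3I:
  assumes "A \<in> carrier_mat (l * m * r) (l * m * r)" "B \<in> carrier_mat (l * m * r) (l * m * r)"
    and "\<And>i k x j k' y. i < l \<Longrightarrow> k < m \<Longrightarrow> x < r \<Longrightarrow> j < l \<Longrightarrow> k' < m \<Longrightarrow> y < r \<Longrightarrow>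
      A $$ ((i * m + k) * r + x, (j * m + k') * r + y) = B $$ ((i * m + k) * r + x, (j * m + k') * r + y)"
  shows "A = B"
proof (rule eq_mat_tensorI[OF assms(1,2)])
  fix u x v y assume "u < l * m" "x < r" "v < l * m" "y < r"
  then show "A $$ (u * r + x, v * r + y) = B $$ (u * r + x, v * r + y)"
    by (elim div_mod_index) (use assms(3) in auto)
qed

lemma middle_ext_mult:
  assumes "A \<in> carrier_mat (l * r) (l * r)" "B \<in> carrier_mat (l * r) (l * r)"
  shows "middle_ext l m r A * middle_ext l m r B = middle_ext l m r (A * B)"
proof (rule eq_mat_tensor3I[of _ l m r])
  fix i k x j k' y assume h: "i < l" "k < m" "x < r" "j < l" "k' < m" "y < r"
  have b: "(i * m + k) * r + x < l * m * r" "(j * m + k') * r + y < l * m * r"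
    using h by (intro index_less; simp)+
  have "(middle_ext l m r A * middle_ext l m r B) $$ ((i * m + k) * r + x, (j * m + k') * r + y)
      = (\<Sum>i'<l. \<Sum>q<m. \<Sum>x'<r. middle_ext l m r A $$ ((i * m + k) * r + x, (i' * m + q) * r + x')
          * middle_ext l m r B $$ ((i' * m + q) * r + x', (j * m + k') * r + y))"
    unfolding mult_index_sum[OF middle_ext_carrier middle_ext_carrier b] sum_nat_mult ..
  also have "\<dots> = (\<Sum>i'<l. \<Sum>q<m. if q = k then (if k = k' then
      (\<Sum>x'<r. A $$ (i * r + x, i' * r + x') * B $$ (i' * r + x', j * r + y)) else 0) else 0)"
    by (rule sum.cong[OF refl], rule sum.cong[OF refl]) (use h in \<open>auto simp: middle_ext_index\<close>)
  also have "\<dots> = (if k = k' then (\<Sum>i'<l. \<Sum>x'<r. A $$ (i * r + x, i' * r + x') * B $$ (i' * r + x', j * r + y)) else 0)"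
    using h by simp
  also have "(\<Sum>i'<l. \<Sum>x'<r. A $$ (i * r + x, i' * r + x') * B $$ (i' * r + x', j * r + y))
      = (A * B) $$ (i * r + x, j * r + y)"
    using mult_index_sum[OF assms index_less[of i l x r] index_less[of j l y r]] h by (simp add: sum_nat_mult)
  finally show "(middle_ext l m r A * middle_ext l m r B) $$ ((i * m + k) * r + x, (j * m + k') * r + y)
    = middle_ext l m r (A * B) $$ ((i * m + k) * r + x, (j * m + k') * r + y)"
    using h by (simp add: middle_ext_index)
qed (rule mult_carrier_mat[OF middle_ext_carrier middle_ext_carrier] middle_ext_carrier)+

lemma adj_middle_ext:
  assumes "A \<in> carrier_mat (l * r) (l * r)"
  shows "adj (middle_ext l m r A) = middle_ext l m r (adj A)"
proof (rule eq_mat_tensor3I[of _ l m r])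
  fix i k x j k' y assume h: "i < l" "k < m" "x < r" "j < l" "k' < m" "y < r"
  have b: "(i * m + k) * r + x < l * m * r" "(j * m + k') * r + y < l * m * r" "i * r + x < l * r" "j * r + y < l * r"
    using h by (intro index_less; simp)+
  have "adj (middle_ext l m r A) $$ ((i * m + k) * r + x, (j * m + k') * r + y)
    = cnj (middle_ext l m r A $$ ((j * m + k') * r + y, (i * m + k) * r + x))"
    by (rule adj_index) (use b in \<open>auto simp: carrier_matD[OF middle_ext_carrier]\<close>)
  then show "adj (middle_ext l m r A) $$ ((i * m + k) * r + x, (j * m + k') * r + y)
    = middle_ext l m r (adj A) $$ ((i * m + k) * r + x, (j * m + k') * r + y)"
    using h b assms by (simp add: middle_ext_index)
qed auto

lemma middle_ext_minus:
  assumes "A \<in> carrier_mat (l * r) (l * r)" "B \<in> carrier_mat (l * r) (l * r)"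
  shows "middle_ext l m r (A - B) = middle_ext l m r A - middle_ext l m r B"
proof (rule eq_mat_tensor3I[of _ l m r])
  fix i k x j k' y assume h: "i < l" "k < m" "x < r" "j < l" "k' < m" "y < r"
  have b: "(i * m + k) * r + x < l * m * r" "(j * m + k') * r + y < l * m * r" "i * r + x < l * r" "j * r + y < l * r"
    using h by (intro index_less; simp)+
  then show "middle_ext l m r (A - B) $$ ((i * m + k) * r + x, (j * m + k') * r + y)
    = (middle_ext l m r A - middle_ext l m r B) $$ ((i * m + k) * r + x, (j * m + k') * r + y)"
    using h assms by (simp add: middle_ext_index carrier_matD[OF middle_ext_carrier])
qed (auto intro!: minus_carrier_mat)

lemma middle_ext_one: "middle_ext l m r (1\<^sub>m (l * r)) = 1\<^sub>m (l * m * r)"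
proof (rule eq_mat_tensor3I[of _ l m r])
  fix i k x j k' y assume h: "i < l" "k < m" "x < r" "j < l" "k' < m" "y < r"
  have b: "(i * m + k) * r + x < l * m * r" "(j * m + k') * r + y < l * m * r" "i * r + x < l * r" "j * r + y < l * r"
    using h by (intro index_less; simp)+
  then show "middle_ext l m r (1\<^sub>m (l * r)) $$ ((i * m + k) * r + x, (j * m + k') * r + y)
    = 1\<^sub>m (l * m * r) $$ ((i * m + k) * r + x, (j * m + k') * r + y)"
    using h by (auto simp: middle_ext_index index_eq_iff)
qed auto

text \<open>The extension respects products, adjoints and the identity, so it carries the
  factorization of the defect through its square root to a factorization of the extended
  defect.\<close>

lemma contr_middle_ext:
  assumes "contr C" "C \<in> carrier_mat (l * r) (l * r)"
  shows "contr (middle_ext l m r C)"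
proof -
  define P where "P = 1\<^sub>m (l * r) - adj C * C"
  have CC: "adj C * C \<in> carrier_mat (l * r) (l * r)" by (rule mult_carrier_mat[OF adj_carrier[OF assms(2)] assms(2)])
  have P: "P \<in> carrier_mat (l * r) (l * r)" "psd P"
    unfolding P_def using assms minus_carrier_mat[OF CC] by (auto simp: contr_def)
  note s = psd_sqrt[OF P(2,1)]
  have "1\<^sub>m (l * m * r) - adj (middle_ext l m r C) * middle_ext l m r C = middle_ext l m r P"
    unfolding P_def middle_ext_minus[OF one_carrier_mat CC] middle_ext_one adj_middle_ext[OF assms(2)]
      middle_ext_mult[OF adj_carrier[OF assms(2)] assms(2)] ..
  also have "\<dots> = adj (middle_ext l m r (psd_sqrt P)) * middle_ext l m r (psd_sqrt P)"
    unfolding adj_middle_ext[OF s(3)] s(4) middle_ext_mult[OF s(3,3)] s(2) ..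
  finally show ?thesis
    unfolding contr_def carrier_matD[OF middle_ext_carrier] using psd_adj_mult[OF middle_ext_carrier] by simp
qed

text \<open>Testing the partial trace with \<open>C\<close> amounts to testing \<open>X\<close> with
  \<open>middle_ext l m r C\<close>, which is again a contraction.\<close>

lemma tn_le_partial_trace:
  assumes "tn_le X c" "X \<in> carrier_mat (l * m * r) (l * m * r)"
  shows "tn_le (partial_trace l m r X) c"
proof (rule tn_leI[OF partial_trace_carrier])
  fix C assume C: "C \<in> carrier_mat (l * r) (l * r)" "contr C"
  have "mat_trace (middle_ext l m r C * X) = (\<Sum>i<l. \<Sum>k<m. \<Sum>x<r. \<Sum>j<l. \<Sum>k'<m. \<Sum>y<r.
      middle_ext l m r C $$ ((i * m + k) * r + x, (j * m + k') * r + y) * X $$ ((j * m + k') * r + y, (i * m + k) * r + x))"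
    unfolding trace_mult_sum[OF middle_ext_carrier assms(2)] sum_nat_mult ..
  also have "\<dots> = (\<Sum>i<l. \<Sum>k<m. \<Sum>x<r. \<Sum>j<l. \<Sum>k'<m. if k' = k then
      (\<Sum>y<r. C $$ (i * r + x, j * r + y) * X $$ ((j * m + k) * r + y, (i * m + k) * r + x)) else 0)"
    by (rule sum.cong[OF refl], rule sum.cong[OF refl], rule sum.cong[OF refl], rule sum.cong[OF refl], rule sum.cong[OF refl])
      (auto simp: middle_ext_index)
  also have "\<dots> = (\<Sum>i<l. \<Sum>k<m. \<Sum>x<r. \<Sum>j<l.
      \<Sum>y<r. C $$ (i * r + x, j * r + y) * X $$ ((j * m + k) * r + y, (i * m + k) * r + x))"
    by simp
  also have "\<dots> = (\<Sum>i<l. \<Sum>x<r. \<Sum>k<m. \<Sum>j<l.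
      \<Sum>y<r. C $$ (i * r + x, j * r + y) * X $$ ((j * m + k) * r + y, (i * m + k) * r + x))"
    by (rule sum.cong[OF refl], rule sum.swap)
  also have "\<dots> = (\<Sum>i<l. \<Sum>x<r. \<Sum>j<l. \<Sum>k<m.
      \<Sum>y<r. C $$ (i * r + x, j * r + y) * X $$ ((j * m + k) * r + y, (i * m + k) * r + x))"
    by (rule sum.cong[OF refl], rule sum.cong[OF refl], rule sum.swap)
  also have "\<dots> = (\<Sum>i<l. \<Sum>x<r. \<Sum>j<l. \<Sum>y<r.
      \<Sum>k<m. C $$ (i * r + x, j * r + y) * X $$ ((j * m + k) * r + y, (i * m + k) * r + x))"
    by (rule sum.cong[OF refl], rule sum.cong[OF refl], rule sum.cong[OF refl], rule sum.swap)
  also have "\<dots> = mat_trace (C * partial_trace l m r X)"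
    unfolding trace_mult_sum[OF C(1) partial_trace_carrier] sum_nat_mult
    by (rule sum.cong[OF refl], rule sum.cong[OF refl], rule sum.cong[OF refl], rule sum.cong[OF refl])
      (simp add: partial_trace_index sum_distrib_left)
  finally show "cmod (mat_trace (C * partial_trace l m r X)) \<le> c"
    using tn_leD[OF assms middle_ext_carrier contr_middle_ext[OF C(2,1)]] by simp
qed

text \<open>With \<open>E i\<close> the isometry onto block \<open>i\<close>, the test value is the
  average over \<open>i\<close> of the values obtained from the compressed operators
  \<open>adj (E i) * (C * E i)\<close>, and these are contractions.\<close>

lemma tn_le_max_mixed:
  assumes "tn_le M c" "M \<in> carrier_mat r r" "0 < a"
  shows "tn_le (tensor_mat ((1 / of_nat a) \<cdot>\<^sub>m 1\<^sub>m a) M) c"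
proof -
  let ?p = "(1 / of_nat a) \<cdot>\<^sub>m 1\<^sub>m a :: complex mat"
  have p: "?p \<in> carrier_mat a a" by simp
  show ?thesis
  proof (rule tn_leI[OF tensor_carrier[OF p assms(2)]])
    fix C assume C: "C \<in> carrier_mat (a * r) (a * r)" "contr C"
    define E where "E = (\<lambda>i. mat (a * r) r (\<lambda>(u, x). if u = i * r + x then 1 else 0 :: complex))"
    have E: "E i \<in> carrier_mat (a * r) r" for i by (simp add: E_def)
    have col: "(\<Sum>u<a * r. f u * E i $$ (u, x)) = f (i * r + x)" if "i < a" "x < r" for f i x
    proof -
      have "(\<Sum>u<a * r. f u * E i $$ (u, x)) = (\<Sum>u<a * r. if u = i * r + x then f (i * r + x) else 0)"
        by (rule sum.cong[OF refl]) (use that in \<open>auto simp: E_def\<close>)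
      then show ?thesis using index_less[OF that] by simp
    qed
    have conj: "(adj (E i) * (Z * E i)) $$ (x, y) = Z $$ (i * r + x, i * r + y)"
      if "i < a" "x < r" "y < r" "Z \<in> carrier_mat (a * r) (a * r)" for i x y Z
    proof -
      have ZE: "(Z * E i) $$ (u, y) = Z $$ (u, i * r + y)" if "u < a * r" for u
        using mult_index_sum[OF \<open>Z \<in> _\<close> E that \<open>y < r\<close>] col[OF \<open>i < a\<close> \<open>y < r\<close>] by simp
      have "(adj (E i) * (Z * E i)) $$ (x, y) = (\<Sum>u<a * r. adj (E i) $$ (x, u) * (Z * E i) $$ (u, y))"
        by (rule mult_index_sum[OF adj_carrier[OF E] mult_carrier_mat[OF \<open>Z \<in> _\<close> E]]) (use that in auto)
      also have "\<dots> = (\<Sum>u<a * r. Z $$ (u, i * r + y) * E i $$ (u, x))"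
        by (rule sum.cong[OF refl]) (use that ZE in \<open>auto simp: E_def\<close>)
      finally show ?thesis using col[OF that(1,2)] by simp
    qed
    have iso: "adj (E i) * E i = 1\<^sub>m r" if i: "i < a" for i
    proof (rule eq_matI)
      fix x y assume "x < dim_row (1\<^sub>m r :: complex mat)" "y < dim_col (1\<^sub>m r :: complex mat)"
      then have xy: "x < r" "y < r" by auto
      have b: "i * r + x < a * r" "i * r + y < a * r" using index_less i xy by auto
      have "1\<^sub>m (a * r) * E i = E i" by (rule left_mult_one_mat[OF E])
      then show "(adj (E i) * E i) $$ (x, y) = 1\<^sub>m r $$ (x, y)"
        using conj[OF i xy one_carrier_mat] xy b by simp
    qed (auto simp: E_def)
    have blk: "cmod (mat_trace ((adj (E i) * (C * E i)) * M)) \<le> c" if i: "i < a" for i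
    proof (rule tn_leD[OF assms(1,2)])
      have "contr (E i)" by (rule contr_isometry[OF E iso[OF i]])
      then show "contr (adj (E i) * (C * E i))"
        by (intro contr_mult[of _ _ r "a * r" r] contr_mult[of _ _ "a * r" "a * r" r] contr_adj C E adj_carrier
          mult_carrier_mat[OF C(1) E])
      show "adj (E i) * (C * E i) \<in> carrier_mat r r"
        by (rule mult_carrier_mat[OF adj_carrier[OF E] mult_carrier_mat[OF C(1) E]])
    qed
    have "mat_trace (C * tensor_mat ?p M) = (\<Sum>i<a. \<Sum>x<r. \<Sum>j<a. \<Sum>y<r.
        C $$ (i * r + x, j * r + y) * tensor_mat ?p M $$ (j * r + y, i * r + x))"
      unfolding trace_mult_sum[OF C(1) tensor_carrier[OF p assms(2)]] sum_nat_mult ..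
    also have "\<dots> = (\<Sum>i<a. \<Sum>x<r. \<Sum>j<a. if j = i then (1 / of_nat a) * (\<Sum>y<r. C $$ (i * r + x, i * r + y) * M $$ (y, x)) else 0)"
    proof (rule sum.cong[OF refl], rule sum.cong[OF refl], rule sum.cong[OF refl])
      fix i x j assume h: "i \<in> {..<a}" "x \<in> {..<r}" "j \<in> {..<a}"
      have "tensor_mat ?p M $$ (j * r + y, i * r + x) = (if j = i then M $$ (y, x) / of_nat a else 0)"
        if "y < r" for y
        using tensor_index[OF p assms(2), of j y i x] h that by simp
      then show "(\<Sum>y<r. C $$ (i * r + x, j * r + y) * tensor_mat ?p M $$ (j * r + y, i * r + x))
        = (if j = i then (1 / of_nat a) * (\<Sum>y<r. C $$ (i * r + x, i * r + y) * M $$ (y, x)) else 0)"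
        by (auto simp: sum_distrib_left intro!: sum.cong)
    qed
    also have "\<dots> = (\<Sum>i<a. \<Sum>x<r. (1 / of_nat a) * (\<Sum>y<r. C $$ (i * r + x, i * r + y) * M $$ (y, x)))"
      by simp
    also have "\<dots> = (\<Sum>i<a. (1 / of_nat a) * mat_trace ((adj (E i) * (C * E i)) * M))"
    proof (rule sum.cong[OF refl])
      fix i assume "i \<in> {..<a}"
      then have i: "i < a" by simp
      show "(\<Sum>x<r. (1 / of_nat a) * (\<Sum>y<r. C $$ (i * r + x, i * r + y) * M $$ (y, x)))
        = (1 / of_nat a) * mat_trace ((adj (E i) * (C * E i)) * M)"
        unfolding trace_mult_sum[OF mult_carrier_mat[OF adj_carrier[OF E] mult_carrier_mat[OF C(1) E]] assms(2)]
          sum_distrib_left[symmetric] using conj[OF i _ _ C(1)] by simp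
    qed
    finally have "cmod (mat_trace (C * tensor_mat ?p M)) \<le> (\<Sum>i<a. (1 / real a) * c)"
      using blk by (simp only:) (intro sum_norm_le, simp add: norm_mult norm_divide divide_right_mono)
    then show "cmod (mat_trace (C * tensor_mat ?p M)) \<le> c" using assms(3) by simp
  qed
qed

section \<open>Entries of operators conjugated on one tensor factor\<close>

lemma adj_index_carrier:
  "X \<in> carrier_mat m n \<Longrightarrow> i < n \<Longrightarrow> j < m \<Longrightarrow> adj X $$ (i, j) = cnj (X $$ (j, i))"
  by auto

lemma tensor_one_mult_index:
  assumes "A \<in> carrier_mat n m" "Z \<in> carrier_mat (m * r) p" "i < n" "x < r" "c < p"
  shows "(tensor_mat A (1\<^sub>m r) * Z) $$ (i * r + x, c) = (\<Sum>k<m. A $$ (i, k) * Z $$ (k * r + x, c))"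
proof -
  have "(tensor_mat A (1\<^sub>m r) * Z) $$ (i * r + x, c)
      = (\<Sum>k<m. \<Sum>y<r. tensor_mat A (1\<^sub>m r) $$ (i * r + x, k * r + y) * Z $$ (k * r + y, c))"
    using mult_index_sum[OF tensor_carrier[OF assms(1) one_carrier_mat] assms(2) index_less[OF assms(3,4)] assms(5)]
    by (simp add: sum_nat_mult)
  also have "\<dots> = (\<Sum>k<m. \<Sum>y<r. if y = x then A $$ (i, k) * Z $$ (k * r + x, c) else 0)"
    by (rule sum.cong[OF refl], rule sum.cong[OF refl])
      (use assms in \<open>auto simp: tensor_index[OF assms(1) one_carrier_mat]\<close>)
  finally show ?thesis using assms(4) by simp
qed

lemma one_tensor_mult_index:
  assumes "B \<in> carrier_mat r s" "Z \<in> carrier_mat (n * s) p" "i < n" "x < r" "c < p"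
  shows "(tensor_mat (1\<^sub>m n) B * Z) $$ (i * r + x, c) = (\<Sum>y<s. B $$ (x, y) * Z $$ (i * s + y, c))"
proof -
  have "(tensor_mat (1\<^sub>m n) B * Z) $$ (i * r + x, c)
      = (\<Sum>k<n. \<Sum>y<s. tensor_mat (1\<^sub>m n) B $$ (i * r + x, k * s + y) * Z $$ (k * s + y, c))"
    using mult_index_sum[OF tensor_carrier[OF one_carrier_mat assms(1)] assms(2) index_less[OF assms(3,4)] assms(5)]
    by (simp add: sum_nat_mult)
  also have "\<dots> = (\<Sum>k<n. if k = i then (\<Sum>y<s. B $$ (x, y) * Z $$ (i * s + y, c)) else 0)"
    by (rule sum.cong[OF refl]) (use assms in \<open>auto simp: tensor_index[OF one_carrier_mat assms(1)]\<close>)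
  finally show ?thesis using assms(3) by simp
qed

lemma conj_tensor_one_index:
  assumes "K \<in> carrier_mat n m" "Z \<in> carrier_mat (m * r) (m * r)" "i < n" "x < r" "j < n" "y < r"
  shows "(tensor_mat K (1\<^sub>m r) * Z * adj (tensor_mat K (1\<^sub>m r))) $$ (i * r + x, j * r + y)
    = (\<Sum>k<m. \<Sum>l<m. K $$ (i, k) * cnj (K $$ (j, l)) * Z $$ (k * r + x, l * r + y))"
proof -
  let ?T = "tensor_mat K (1\<^sub>m r)"
  have T: "?T \<in> carrier_mat (n * r) (m * r)" using assms by auto
  have b: "i * r + x < n * r" "j * r + y < n * r" using assms index_less by auto
  have TZ: "?T * Z \<in> carrier_mat (n * r) (m * r)" by (rule mult_carrier_mat[OF T assms(2)])
  have a: "(adj (?T * Z)) \<in> carrier_mat (m * r) (n * r)" by (rule adj_carrier[OF TZ])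
  have "(?T * Z * adj ?T) $$ (i * r + x, j * r + y) = cnj ((?T * adj (?T * Z)) $$ (j * r + y, i * r + x))"
  proof -
    have "?T * Z * adj ?T = adj (?T * adj (?T * Z))"
      using carrier_matD[OF T] carrier_matD[OF assms(2)] by (subst adj_times) auto
    then show ?thesis
      by (simp only:) (rule adj_index_carrier[OF mult_carrier_mat[OF T a] b])
  qed
  also have "(?T * adj (?T * Z)) $$ (j * r + y, i * r + x) = (\<Sum>l<m. K $$ (j, l) * adj (?T * Z) $$ (l * r + y, i * r + x))"
    by (rule tensor_one_mult_index[OF assms(1) a]) (use assms b in auto)
  also have "\<dots> = (\<Sum>l<m. K $$ (j, l) * cnj (\<Sum>k<m. K $$ (i, k) * Z $$ (k * r + x, l * r + y)))"
  proof (rule sum.cong[OF refl])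
    fix l assume l: "l \<in> {..<m}"
    then have c: "l * r + y < m * r" using index_less assms by auto
    show "K $$ (j, l) * adj (?T * Z) $$ (l * r + y, i * r + x)
      = K $$ (j, l) * cnj (\<Sum>k<m. K $$ (i, k) * Z $$ (k * r + x, l * r + y))"
      unfolding adj_index_carrier[OF TZ c b(1)] tensor_one_mult_index[OF assms(1,2,3,4) c] ..
  qed
  also have "cnj \<dots> = (\<Sum>l<m. \<Sum>k<m. K $$ (i, k) * cnj (K $$ (j, l)) * Z $$ (k * r + x, l * r + y))"
    by (simp add: sum_distrib_left mult_ac)
  finally show ?thesis by (subst sum.swap)
qed

lemma conj_one_tensor_index:
  assumes "S \<in> carrier_mat r r" "Z \<in> carrier_mat (n * r) (n * r)" "i < n" "x < r" "j < n" "y < r"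
  shows "(tensor_mat (1\<^sub>m n) S * Z * adj (tensor_mat (1\<^sub>m n) S)) $$ (i * r + x, j * r + y)
    = (\<Sum>x'<r. \<Sum>y'<r. S $$ (x, x') * cnj (S $$ (y, y')) * Z $$ (i * r + x', j * r + y'))"
proof -
  let ?T = "tensor_mat (1\<^sub>m n) S"
  have T: "?T \<in> carrier_mat (n * r) (n * r)" using assms by auto
  have b: "i * r + x < n * r" "j * r + y < n * r" using assms index_less by auto
  have TZ: "?T * Z \<in> carrier_mat (n * r) (n * r)" by (rule mult_carrier_mat[OF T assms(2)])
  have a: "(adj (?T * Z)) \<in> carrier_mat (n * r) (n * r)" by (rule adj_carrier[OF TZ])
  have "(?T * Z * adj ?T) $$ (i * r + x, j * r + y) = cnj ((?T * adj (?T * Z)) $$ (j * r + y, i * r + x))"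
  proof -
    have "?T * Z * adj ?T = adj (?T * adj (?T * Z))"
      using carrier_matD[OF T] carrier_matD[OF assms(2)] by (subst adj_times) auto
    then show ?thesis
      by (simp only:) (rule adj_index_carrier[OF mult_carrier_mat[OF T a] b])
  qed
  also have "(?T * adj (?T * Z)) $$ (j * r + y, i * r + x) = (\<Sum>y'<r. S $$ (y, y') * adj (?T * Z) $$ (j * r + y', i * r + x))"
    by (rule one_tensor_mult_index[OF assms(1) a]) (use assms b in auto)
  also have "\<dots> = (\<Sum>y'<r. S $$ (y, y') * cnj (\<Sum>x'<r. S $$ (x, x') * Z $$ (i * r + x', j * r + y')))"
  proof (rule sum.cong[OF refl])
    fix l assume l: "l \<in> {..<r}"
    then have c: "j * r + l < n * r" using index_less assms by auto
    show "S $$ (y, l) * adj (?T * Z) $$ (j * r + l, i * r + x)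
      = S $$ (y, l) * cnj (\<Sum>x'<r. S $$ (x, x') * Z $$ (i * r + x', j * r + l))"
      unfolding adj_index_carrier[OF TZ c b(1)] one_tensor_mult_index[OF assms(1,2,3,4) c] ..
  qed
  also have "cnj \<dots> = (\<Sum>y'<r. \<Sum>x'<r. S $$ (x, x') * cnj (S $$ (y, y')) * Z $$ (i * r + x', j * r + y'))"
    by (simp add: sum_distrib_left mult_ac)
  finally show ?thesis by (subst sum.swap)
qed

text \<open>Operators on the last factor commute with tracing out the middle one. This pulls weights
  on R out of the decoupling error.\<close>

lemma partial_trace_conj_one_tensor:
  assumes "S \<in> carrier_mat r r" "Z \<in> carrier_mat (l * m * r) (l * m * r)"
  shows "partial_trace l m r (tensor_mat (1\<^sub>m (l * m)) S * Z * adj (tensor_mat (1\<^sub>m (l * m)) S))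
    = tensor_mat (1\<^sub>m l) S * partial_trace l m r Z * adj (tensor_mat (1\<^sub>m l) S)"
proof (rule eq_mat_tensorI[of _ l r l r])
  fix i x j y assume h: "i < l" "x < r" "j < l" "y < r"
  have "partial_trace l m r (tensor_mat (1\<^sub>m (l * m)) S * Z * adj (tensor_mat (1\<^sub>m (l * m)) S)) $$ (i * r + x, j * r + y)
      = (\<Sum>k<m. \<Sum>x'<r. \<Sum>y'<r. S $$ (x, x') * cnj (S $$ (y, y')) * Z $$ ((i * m + k) * r + x', (j * m + k) * r + y'))"
    unfolding partial_trace_index[OF h(1,3,2,4)]
    by (rule sum.cong[OF refl], rule conj_one_tensor_index[OF assms]) (use h index_less in auto)
  also have "\<dots> = (\<Sum>x'<r. \<Sum>k<m. \<Sum>y'<r. S $$ (x, x') * cnj (S $$ (y, y')) * Z $$ ((i * m + k) * r + x', (j * m + k) * r + y'))"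
    by (rule sum.swap)
  also have "\<dots> = (\<Sum>x'<r. \<Sum>y'<r. \<Sum>k<m. S $$ (x, x') * cnj (S $$ (y, y')) * Z $$ ((i * m + k) * r + x', (j * m + k) * r + y'))"
    by (rule sum.cong[OF refl], rule sum.swap)
  also have "\<dots> = (\<Sum>x'<r. \<Sum>y'<r. S $$ (x, x') * cnj (S $$ (y, y')) * partial_trace l m r Z $$ (i * r + x', j * r + y'))"
    by (rule sum.cong[OF refl], rule sum.cong[OF refl]) (use h in \<open>simp add: partial_trace_index sum_distrib_left\<close>)
  also have "\<dots> = (tensor_mat (1\<^sub>m l) S * partial_trace l m r Z * adj (tensor_mat (1\<^sub>m l) S)) $$ (i * r + x, j * r + y)"
    by (rule conj_one_tensor_index[symmetric, OF assms(1) partial_trace_carrier h])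
  finally show "partial_trace l m r (tensor_mat (1\<^sub>m (l * m)) S * Z * adj (tensor_mat (1\<^sub>m (l * m)) S)) $$ (i * r + x, j * r + y)
    = (tensor_mat (1\<^sub>m l) S * partial_trace l m r Z * adj (tensor_mat (1\<^sub>m l) S)) $$ (i * r + x, j * r + y)" .
next
  have T: "tensor_mat (1\<^sub>m l) S \<in> carrier_mat (l * r) (l * r)" using assms by auto
  show "tensor_mat (1\<^sub>m l) S * partial_trace l m r Z * adj (tensor_mat (1\<^sub>m l) S) \<in> carrier_mat (l * r) (l * r)"
    by (rule mult_carrier_mat[OF mult_carrier_mat[OF T partial_trace_carrier] adj_carrier[OF T]])
qed simp

text \<open>Second moments control the Hilbert-Schmidt norm, not the trace norm, so \<omega> is
  first conjugated with \<tau>^(-1/4), where \<tau> is \<sigma> made invertible. The operator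
  inequality gives the weighted operator squared norm at most c tr \<omega>. Undoing the weights by
  Cauchy-Schwarz costs a factor a tr \<tau>. With tr \<tau> = 11/10 and the factor 2 of
  \<open>decoupling_unitary\<close>, this is the constant 11/5.\<close>

lemma decoupling:
  fixes \<omega> \<sigma> :: "complex mat" and a b r :: nat and c :: real
  assumes ab: "0 < a" "0 < b" "2 \<le> a * b" and r: "0 < r" and c: "0 \<le> c"
    and w: "\<omega> \<in> carrier_mat (a * b * r) (a * b * r)" "psd \<omega>" "Re (mat_trace \<omega>) \<le> 1"
    and s: "\<sigma> \<in> states r" "op_le \<omega> (complex_of_real c \<cdot>\<^sub>m tensor_mat (1\<^sub>m (a * b)) \<sigma>)"
  shows "\<exists>U \<in> carrier_mat (a * b) (a * b). adj U * U = 1\<^sub>m (a * b) \<and>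
    tn_le (partial_trace a b r (tensor_mat U (1\<^sub>m r) * \<omega> * adj (tensor_mat U (1\<^sub>m r)))
        - tensor_mat ((1 / of_nat a) \<cdot>\<^sub>m 1\<^sub>m a) (partial_trace 1 (a * b) r \<omega>))
      (sqrt (11 / 5 * (real a / real b) * c))"
proof -
  define N where "N = a * b"
  note w = w[folded N_def] and s = s[folded N_def]
  have sc: "\<sigma> \<in> carrier_mat r r" "psd \<sigma>" "mat_trace \<sigma> = 1" using s(1) by (auto simp: states_def)
  obtain V e where V: "V \<in> carrier_mat r r" "adj V * V = 1\<^sub>m r" "V * adj V = 1\<^sub>m r"
    and sV: "\<sigma> = V * rdiag r e * adj V" and e: "\<forall>x<r. 0 \<le> e x"
    using psd_diagonalization[OF sc(2,1)] by blast
  note dV = carrier_matD[OF V(1)]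
  define R where "R = (\<lambda>f. V * rdiag r f * adj V)"
  have R: "R f \<in> carrier_mat r r" for f unfolding R_def using V by auto
  have RR: "R f * R g = R (\<lambda>x. f x * g x)" for f g
  proof -
    have "R f * R g = V * (rdiag r f * ((adj V * V) * (rdiag r g * adj V)))"
      unfolding R_def by (simp add: mat_ring dV)
    also have "\<dots> = V * ((rdiag r f * rdiag r g) * adj V)" unfolding V(2) by (simp add: mat_ring dV)
    finally show ?thesis unfolding rdiag_mult R_def by (simp add: mat_ring dV)
  qed
  have aR: "adj (R f) = R f" for f unfolding R_def by (simp add: mat_ring dV)
  have Rcong: "R f = R g" if "\<And>x. x < r \<Longrightarrow> f x = g x" for f g
  proof -
    have "rdiag r f = rdiag r g" by (rule eq_matI) (use that in \<open>auto simp: rdiag_def\<close>)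
    then show ?thesis by (simp add: R_def)
  qed
  have R1: "R (\<lambda>_. 1) = 1\<^sub>m r"
  proof -
    have "rdiag r (\<lambda>_. 1) = 1\<^sub>m r" by (rule eq_matI) (auto simp: rdiag_def)
    then show ?thesis using V by (simp add: R_def mat_ring dV)
  qed
  \<comment> \<open>Eigenvalues of \<tau> = \<sigma> + 1 / (10 r). The shift makes \<tau> invertible
    and raises its trace only to 11/10. Below, \<open>q\<close> is the fourth root, and
    \<open>S\<close>, \<open>Si\<close> are \<tau>^(1/4) and its inverse.\<close>
  define t where "t = (\<lambda>x. e x + 1 / (10 * real r))"
  define q where "q = (\<lambda>x. sqrt (sqrt (t x)))"
  have t0: "0 < t x" if "x < r" for x using e that r by (auto simp: t_def intro: add_nonneg_pos)
  have q4: "q x * q x * (q x * q x) = t x" and q0: "q x \<noteq> 0" if "x < r" for x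
    using t0[OF that] by (simp_all add: q_def)
  define S where "S = R q"
  define Si where "Si = R (\<lambda>x. 1 / q x)"
  have SSi: "S * Si = 1\<^sub>m r" "Si * S = 1\<^sub>m r"
    unfolding S_def Si_def RR R1[symmetric] by (rule Rcong; simp add: q0)+
  have Rt: "R t = \<sigma> + complex_of_real (1 / (10 * real r)) \<cdot>\<^sub>m 1\<^sub>m r"
  proof -
    have "rdiag r t = rdiag r e + complex_of_real (1 / (10 * real r)) \<cdot>\<^sub>m 1\<^sub>m r"
      by (rule eq_matI) (auto simp: rdiag_def t_def)
    then have "R t = V * (rdiag r e + complex_of_real (1 / (10 * real r)) \<cdot>\<^sub>m 1\<^sub>m r) * adj V"
      by (simp add: R_def)
    also have "\<dots> = \<sigma> + V * (complex_of_real (1 / (10 * real r)) \<cdot>\<^sub>m 1\<^sub>m r) * adj V"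
      unfolding sV by (simp add: mat_ring dV)
    also have "V * (complex_of_real (1 / (10 * real r)) \<cdot>\<^sub>m 1\<^sub>m r) * adj V
        = complex_of_real (1 / (10 * real r)) \<cdot>\<^sub>m (V * adj V)"
    proof -
      have "V * (complex_of_real (1 / (10 * real r)) \<cdot>\<^sub>m 1\<^sub>m r) = complex_of_real (1 / (10 * real r)) \<cdot>\<^sub>m V"
        using mult_smult_distrib[OF V(1) one_carrier_mat] V(1) by simp
      then show ?thesis using mult_smult_assoc_mat[OF V(1) adj_carrier[OF V(1)]] by simp
    qed
    finally show ?thesis unfolding V(3) .
  qed
  define T where "T = (\<lambda>X. tensor_mat (1\<^sub>m N) X :: complex mat)"
  have T: "X \<in> carrier_mat r r \<Longrightarrow> T X \<in> carrier_mat (N * r) (N * r)" for X unfolding T_def by auto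
  have TT: "T X * T Y = T (X * Y)" if "X \<in> carrier_mat r r" "Y \<in> carrier_mat r r" for X Y
    unfolding T_def tensor_mult[OF one_carrier_mat that(1) one_carrier_mat that(2)] by simp
  have aT: "adj (T X) = T (adj X)" for X unfolding T_def adj_tensor by simp
  have Sc: "S \<in> carrier_mat r r" "Si \<in> carrier_mat r r" "adj S = S" "adj Si = Si"
    unfolding S_def Si_def using R aR by auto
  have T1: "T (1\<^sub>m r) = 1\<^sub>m (N * r)" unfolding T_def by (rule tensor_one)
  define \<omega>' where "\<omega>' = T Si * \<omega> * T Si"
  have w': "\<omega>' \<in> carrier_mat (N * r) (N * r)" "psd \<omega>'"
  proof -
    show "\<omega>' \<in> carrier_mat (N * r) (N * r)"
      unfolding \<omega>'_def by (rule mult_carrier_mat[OF mult_carrier_mat[OF T[OF Sc(2)] w(1)] T[OF Sc(2)]])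
    show "psd \<omega>'"
      using psd_conj[OF w(2,1) T[OF Sc(2)]] unfolding \<omega>'_def aT Sc(4) .
  qed
  note d = carrier_matD[OF w(1)] carrier_matD[OF w'(1)] carrier_matD[OF T[OF Sc(1)]] carrier_matD[OF T[OF Sc(2)]]
    carrier_matD[OF T[OF R]]
  have \<omega>_eq: "\<omega> = T S * \<omega>' * T S"
  proof -
    have "T S * \<omega>' * T S = (T S * T Si) * \<omega> * (T Si * T S)"
      unfolding \<omega>'_def by (simp add: mat_ring d)
    then show ?thesis
      unfolding TT[OF Sc(1,2)] TT[OF Sc(2,1)] SSi T1 using w(1) by (simp add: mat_ring d)
  qed
  \<comment> \<open>From \<omega> \<le> c \<tau> on the second factor, conjugation with
    \<tau>^(-1/4) leaves \<omega>' \<le> c \<tau>^(1/2).\<close>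
  have dom: "psd (complex_of_real c \<cdot>\<^sub>m T (R (\<lambda>x. q x * q x)) - \<omega>')"
  proof -
    have cT: "complex_of_real c \<cdot>\<^sub>m T X \<in> carrier_mat (N * r) (N * r)" if "X \<in> carrier_mat r r" for X
      using T[OF that] by auto
    have p1: "psd (complex_of_real c \<cdot>\<^sub>m T \<sigma> - \<omega>)" using s(2) by (simp add: op_le_def T_def)
    have p2: "psd (complex_of_real (c * (1 / (10 * real r))) \<cdot>\<^sub>m 1\<^sub>m (N * r))"
      by (rule psd_smult) (use c in auto)
    have "complex_of_real c \<cdot>\<^sub>m T (R t) - \<omega>
      = (complex_of_real c \<cdot>\<^sub>m T \<sigma> - \<omega>) + complex_of_real (c * (1 / (10 * real r))) \<cdot>\<^sub>m 1\<^sub>m (N * r)"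
    proof -
      have "T (R t) = T \<sigma> + complex_of_real (1 / (10 * real r)) \<cdot>\<^sub>m 1\<^sub>m (N * r)"
        unfolding Rt T_def tensor_add_right[OF one_carrier_mat sc(1) smult_carrier_mat[OF one_carrier_mat]]
          tensor_smult_right[OF one_carrier_mat one_carrier_mat] tensor_one ..
      then show ?thesis
        by (intro eq_matI) (use T[OF sc(1)] w(1) in \<open>auto simp: algebra_simps\<close>)
    qed
    then have p3: "psd (complex_of_real c \<cdot>\<^sub>m T (R t) - \<omega>)"
      using psd_add[OF p1 p2 minus_carrier_mat[OF w(1)] smult_carrier_mat[OF one_carrier_mat]] by simp
    have "psd (T Si * (complex_of_real c \<cdot>\<^sub>m T (R t) - \<omega>) * T Si)"
      using psd_conj[OF p3 minus_carrier_mat[OF w(1)] T[OF Sc(2)]] unfolding aT Sc(4) .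
    also have "T Si * (complex_of_real c \<cdot>\<^sub>m T (R t) - \<omega>) * T Si
      = complex_of_real c \<cdot>\<^sub>m (T Si * T (R t) * T Si) - \<omega>'"
    proof -
      have 1: "T Si * (complex_of_real c \<cdot>\<^sub>m T (R t)) * T Si = complex_of_real c \<cdot>\<^sub>m (T Si * T (R t) * T Si)"
        unfolding mult_smult_distrib[OF T[OF Sc(2)] T[OF R]]
        by (rule mult_smult_assoc_mat[OF mult_carrier_mat[OF T[OF Sc(2)] T[OF R]] T[OF Sc(2)]])
      have "T Si * (complex_of_real c \<cdot>\<^sub>m T (R t) - \<omega>) * T Si
        = T Si * (complex_of_real c \<cdot>\<^sub>m T (R t)) * T Si - T Si * \<omega> * T Si"
        unfolding mult_minus_distrib_mat[OF T[OF Sc(2)] cT[OF R] w(1)]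
        by (rule minus_mult_distrib_mat[OF mult_carrier_mat[OF T[OF Sc(2)] cT[OF R]]
          mult_carrier_mat[OF T[OF Sc(2)] w(1)] T[OF Sc(2)]])
      then show ?thesis unfolding 1 \<omega>'_def .
    qed
    also have "T Si * T (R t) * T Si = T (R (\<lambda>x. q x * q x))"
    proof -
      have "Si * R t * Si = R (\<lambda>x. q x * q x)"
        unfolding Si_def RR by (rule Rcong) (use q4 q0 in \<open>simp add: field_simps\<close>)
      then show ?thesis
        unfolding TT[OF Sc(2) R] TT[OF mult_carrier_mat[OF Sc(2) R] Sc(2)] by simp
    qed
    finally show ?thesis .
  qed
  \<comment> \<open>By the preceding domination, tr \<omega>'^2 is at most c tr \<omega>'
    \<tau>^(1/2), and by cyclicity the last trace is tr \<omega>.\<close>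
  have hs: "hs_sq \<omega>' \<le> c"
  proof -
    let ?D = "complex_of_real c \<cdot>\<^sub>m T (R (\<lambda>x. q x * q x))"
    have SS: "T (R (\<lambda>x. q x * q x)) = T S * T S" unfolding TT[OF Sc(1,1)] unfolding S_def RR ..
    have "mat_trace (\<omega>' * ?D) = complex_of_real c * mat_trace (\<omega>' * (T S * T S))"
      unfolding SS[symmetric] mult_smult_distrib[OF w'(1) T[OF R]]
      by (rule trace_smult[OF mult_carrier_mat[OF w'(1) T[OF R]]])
    also have "mat_trace (\<omega>' * (T S * T S)) = mat_trace ((\<omega>' * T S) * T S)" by (simp add: mat_ring d)
    also have "\<dots> = mat_trace (T S * (\<omega>' * T S))"
      by (rule trace_mult_comm[OF mult_carrier_mat[OF w'(1) T[OF Sc(1)]] T[OF Sc(1)]])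
    also have "T S * (\<omega>' * T S) = \<omega>" by (subst \<omega>_eq) (simp add: mat_ring d)
    finally have tD: "mat_trace (\<omega>' * ?D) = complex_of_real c * mat_trace \<omega>" .
    have "0 \<le> mat_trace (\<omega>' * (?D - \<omega>'))"
      by (rule trace_psd_mult_nonneg[OF w'(2) dom w'(1) minus_carrier_mat[OF w'(1)]])
    also have "mat_trace (\<omega>' * (?D - \<omega>')) = mat_trace (\<omega>' * ?D) - mat_trace (\<omega>' * \<omega>')"
      unfolding mult_minus_distrib_mat[OF w'(1) smult_carrier_mat[OF T[OF R]] w'(1)]
      by (rule trace_minus[OF mult_carrier_mat[OF w'(1) smult_carrier_mat[OF T[OF R]]] mult_carrier_mat[OF w'(1) w'(1)]])
    also have "mat_trace (\<omega>' * \<omega>') = complex_of_real (hs_sq \<omega>')"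
      using trace_mult_adj[of \<omega>'] psd_adj_eq[OF w'(2)] by simp
    finally have "hs_sq \<omega>' \<le> c * Re (mat_trace \<omega>)" unfolding tD by (simp add: less_eq_complex_def)
    also have "\<dots> \<le> c * 1" using w(3) c by (intro mult_left_mono) auto
    finally show ?thesis by simp
  qed
  \<comment> \<open>Fixing a row and a column index on R, paired as \<open>s\<close>, cuts \<omega>'
    into blocks on the other factors; all of them are decoupled by one unitary.\<close>
  define w0 where "w0 = (\<lambda>s i j. \<omega>' $$ (i * r + fst s, j * r + snd s))"
  obtain U0 :: "nat \<Rightarrow> nat \<Rightarrow> complex" where
    U0: "\<And>i j. i < N \<Longrightarrow> j < N \<Longrightarrow> (\<Sum>x<N. cnj (U0 x i) * U0 x j) = (if i = j then 1 else 0)" and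
    U0b: "(\<Sum>s\<in>{..<r} \<times> {..<r}. \<Sum>p<a. \<Sum>q<a. (cmod ((\<Sum>y<b. \<Sum>i<N. \<Sum>j<N. U0 (p * b + y) i * cnj (U0 (q * b + y) j) * w0 s i j)
        - (if p = q then (\<Sum>i<N. w0 s i i) / of_nat a else 0)))\<^sup>2)
      \<le> 2 / real b * (\<Sum>s\<in>{..<r} \<times> {..<r}. \<Sum>i<N. \<Sum>j<N. (cmod (w0 s i j))\<^sup>2)"
    using decoupling_unitary[OF _ ab(1,2) ab(3), of "{..<r} \<times> {..<r}" w0] unfolding N_def by auto
  define U where "U = mat N N (\<lambda>(i, j). U0 i j)"
  have U: "U \<in> carrier_mat N N" by (simp add: U_def)
  have UU: "adj U * U = 1\<^sub>m N"
  proof (rule eq_matI)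
    fix i j assume "i < dim_row (1\<^sub>m N :: complex mat)" "j < dim_col (1\<^sub>m N :: complex mat)"
    then have ij: "i < N" "j < N" by auto
    have "(adj U * U) $$ (i, j) = (\<Sum>x<N. cnj (U0 x i) * U0 x j)"
      unfolding mult_index_sum[OF adj_carrier[OF U] U ij]
      by (rule sum.cong[OF refl]) (use ij in \<open>auto simp: U_def\<close>)
    then show "(adj U * U) $$ (i, j) = 1\<^sub>m N $$ (i, j)" using U0[OF ij] ij by simp
  qed (use U in auto)
  define TU where "TU = tensor_mat U (1\<^sub>m r)"
  have TU: "TU \<in> carrier_mat (N * r) (N * r)" unfolding TU_def using U by auto
  define \<pi> where "\<pi> = ((1 / of_nat a) \<cdot>\<^sub>m 1\<^sub>m a :: complex mat)"
  have \<pi>: "\<pi> \<in> carrier_mat a a" by (simp add: \<pi>_def)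
  define L where "L = (\<lambda>X. partial_trace a b r (TU * X * adj TU) - tensor_mat \<pi> (partial_trace 1 N r X))"
  have ptr1: "partial_trace 1 N r X \<in> carrier_mat r r" for X
    using partial_trace_carrier[of 1 N r X] by simp
  have Lc: "L X \<in> carrier_mat (a * r) (a * r)" for X
    unfolding L_def by (rule minus_carrier_mat[OF tensor_carrier[OF \<pi> ptr1]])
  define \<Sigma> where "\<Sigma> = tensor_mat (1\<^sub>m a) S"
  have \<Sigma>: "\<Sigma> \<in> carrier_mat (a * r) (a * r)" "adj \<Sigma> = \<Sigma>"
    unfolding \<Sigma>_def using Sc by (auto simp: adj_tensor)
  \<comment> \<open>The unitary acts on the first two factors and the weights on R, so they commute;
    forming the decoupling error therefore commutes with undoing the weights.\<close>
  have L_eq: "L \<omega> = \<Sigma> * L \<omega>' * \<Sigma>"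
  proof -
    have w'N: "\<omega>' \<in> carrier_mat (1 * N * r) (1 * N * r)" using w' by simp
    have Z: "TU * \<omega>' * adj TU \<in> carrier_mat (a * b * r) (a * b * r)"
      using mult_carrier_mat[OF mult_carrier_mat[OF TU w'(1)] adj_carrier[OF TU]] unfolding N_def .
    have comm: "TU * T S = T S * TU"
      unfolding TU_def T_def tensor_mult[OF U one_carrier_mat one_carrier_mat Sc(1)]
        tensor_mult[OF one_carrier_mat Sc(1) U one_carrier_mat] using U Sc by simp
    have "TU * \<omega> * adj TU = T S * (TU * \<omega>' * adj TU) * adj (T S)"
    proof -
      have comm': "adj (T S) * adj TU = adj TU * adj (T S)"
        using arg_cong[OF comm, of adj] by (simp add: adj_times d carrier_matD[OF TU])
      have "TU * \<omega> * adj TU = (TU * T S) * \<omega>' * (adj (T S) * adj TU)"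
        by (subst \<omega>_eq) (simp add: mat_ring d carrier_matD[OF TU] aT Sc)
      then show ?thesis unfolding comm comm' by (simp add: mat_ring d carrier_matD[OF TU])
    qed
    then have 1: "partial_trace a b r (TU * \<omega> * adj TU) = \<Sigma> * partial_trace a b r (TU * \<omega>' * adj TU) * \<Sigma>"
      using partial_trace_conj_one_tensor[OF Sc(1) Z] \<Sigma>(2) unfolding T_def N_def \<Sigma>_def by simp
    have one: "tensor_mat (1\<^sub>m 1) S = S"
      by (rule eq_matI) (use Sc in \<open>auto simp: tensor_mat_def\<close>)
    have "partial_trace 1 N r \<omega> = S * partial_trace 1 N r \<omega>' * adj S"
      using partial_trace_conj_one_tensor[OF Sc(1) w'N] unfolding one
      by (subst \<omega>_eq) (simp add: T_def[symmetric] aT Sc(3))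
    then have "tensor_mat \<pi> (partial_trace 1 N r \<omega>) = \<Sigma> * tensor_mat \<pi> (partial_trace 1 N r \<omega>') * \<Sigma>"
      unfolding \<Sigma>_def tensor_mult[OF one_carrier_mat Sc(1) \<pi> ptr1] Sc(3)
        tensor_mult[OF mult_carrier_mat[OF one_carrier_mat \<pi>] mult_carrier_mat[OF Sc(1) ptr1] one_carrier_mat Sc(1)]
      using \<pi> by simp
    then show ?thesis
      unfolding L_def 1 using \<Sigma>(1) carrier_matD[OF \<pi>]
      by (simp add: mat_ring carrier_matD[OF partial_trace_carrier] carrier_matD[OF ptr1] carrier_matD[OF \<Sigma>(1)])
  qed
  have hsL: "hs_sq (L \<omega>') \<le> 2 / real b * c"
  proof -
    have ent: "L \<omega>' $$ (p * r + x, q * r + y)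
        = (\<Sum>z<b. \<Sum>i<N. \<Sum>j<N. U0 (p * b + z) i * cnj (U0 (q * b + z) j) * w0 (x, y) i j)
          - (if p = q then (\<Sum>i<N. w0 (x, y) i i) / of_nat a else 0)"
      if h: "p < a" "x < r" "q < a" "y < r" for p x q y
    proof -
      have b1: "p * r + x < a * r" "q * r + y < a * r" using index_less h by auto
      have "partial_trace a b r (TU * \<omega>' * adj TU) $$ (p * r + x, q * r + y)
          = (\<Sum>z<b. \<Sum>i<N. \<Sum>j<N. U0 (p * b + z) i * cnj (U0 (q * b + z) j) * w0 (x, y) i j)"
        unfolding partial_trace_index[OF h(1,3,2,4)]
      proof (rule sum.cong[OF refl])
        fix z assume "z \<in> {..<b}"
        then have z: "p * b + z < N" "q * b + z < N" using index_less h unfolding N_def by auto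
        show "(TU * \<omega>' * adj TU) $$ ((p * b + z) * r + x, (q * b + z) * r + y)
          = (\<Sum>i<N. \<Sum>j<N. U0 (p * b + z) i * cnj (U0 (q * b + z) j) * w0 (x, y) i j)"
          unfolding TU_def conj_tensor_one_index[OF U w'(1) z(1) h(2) z(2) h(4)]
          by (rule sum.cong[OF refl], rule sum.cong[OF refl]) (use z in \<open>simp add: U_def w0_def\<close>)
      qed
      moreover have "tensor_mat \<pi> (partial_trace 1 N r \<omega>') $$ (p * r + x, q * r + y)
          = (if p = q then (\<Sum>i<N. w0 (x, y) i i) / of_nat a else 0)"
        unfolding tensor_index[OF \<pi> ptr1 h(1,2,3,4)]
        using partial_trace_index[of 0 1 0 x r y N \<omega>'] h by (simp add: \<pi>_def w0_def)
      ultimately show ?thesis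
        unfolding L_def using b1 carrier_matD[OF tensor_carrier[OF \<pi> ptr1]] by simp
    qed
    have sq: "hs_sq X = (\<Sum>s\<in>{..<r} \<times> {..<r}. \<Sum>p<n. \<Sum>q<n. (cmod (X $$ (p * r + fst s, q * r + snd s)))\<^sup>2)"
      if X: "X \<in> carrier_mat (n * r) (n * r)" for X n
    proof -
      have "hs_sq X = (\<Sum>p<n. \<Sum>x<r. \<Sum>q<n. \<Sum>y<r. (cmod (X $$ (p * r + x, q * r + y)))\<^sup>2)"
        unfolding hs_sq_def carrier_matD[OF X] sum_nat_mult ..
      also have "\<dots> = (\<Sum>x<r. \<Sum>p<n. \<Sum>q<n. \<Sum>y<r. (cmod (X $$ (p * r + x, q * r + y)))\<^sup>2)"
        by (rule sum.swap)
      also have "\<dots> = (\<Sum>x<r. \<Sum>p<n. \<Sum>y<r. \<Sum>q<n. (cmod (X $$ (p * r + x, q * r + y)))\<^sup>2)"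
        by (rule sum.cong[OF refl], rule sum.cong[OF refl], rule sum.swap)
      also have "\<dots> = (\<Sum>x<r. \<Sum>y<r. \<Sum>p<n. \<Sum>q<n. (cmod (X $$ (p * r + x, q * r + y)))\<^sup>2)"
        by (rule sum.cong[OF refl], rule sum.swap)
      also have "\<dots> = (\<Sum>s\<in>{..<r} \<times> {..<r}. \<Sum>p<n. \<Sum>q<n. (cmod (X $$ (p * r + fst s, q * r + snd s)))\<^sup>2)"
        unfolding sum.cartesian_product[where g = "\<lambda>x y. \<Sum>p<n. \<Sum>q<n. (cmod (X $$ (p * r + x, q * r + y)))\<^sup>2"]
          case_prod_unfold ..
      finally show ?thesis .
    qed
    have "hs_sq (L \<omega>') = (\<Sum>s\<in>{..<r} \<times> {..<r}. \<Sum>p<a. \<Sum>q<a. (cmod ((\<Sum>y<b. \<Sum>i<N. \<Sum>j<N. U0 (p * b + y) i * cnj (U0 (q * b + y) j) * w0 s i j)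
        - (if p = q then (\<Sum>i<N. w0 s i i) / of_nat a else 0)))\<^sup>2)"
      unfolding sq[OF Lc]
      by (rule sum.cong[OF refl], rule sum.cong[OF refl], rule sum.cong[OF refl]) (auto simp: ent)
    also have "\<dots> \<le> 2 / real b * hs_sq \<omega>'"
      using U0b unfolding sq[OF w'(1)] w0_def .
    also have "\<dots> \<le> 2 / real b * c" using hs by (intro mult_left_mono) auto
    finally show ?thesis .
  qed
  have "tn_le (L \<omega>) (sqrt (11 / 5 * (real a / real b) * c))"
  proof (rule tn_leI[OF Lc])
    fix C assume C: "C \<in> carrier_mat (a * r) (a * r)" "contr C"
    note dd = carrier_matD[OF \<Sigma>(1)] carrier_matD[OF C(1)] carrier_matD[OF Lc]
    define Q where "Q = \<Sigma> * \<Sigma>"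
    have Q: "Q \<in> carrier_mat (a * r) (a * r)" "adj Q = Q"
      unfolding Q_def using \<Sigma> by (auto simp: mat_ring dd)
    define K where "K = \<Sigma> * C * \<Sigma>"
    have K: "K \<in> carrier_mat (a * r) (a * r)"
      unfolding K_def by (rule mult_carrier_mat[OF mult_carrier_mat[OF \<Sigma>(1) C(1)] \<Sigma>(1)])
    have hQ: "hs_sq Q = real a * (11 / 10)"
    proof -
      have "adj Q * Q = tensor_mat (1\<^sub>m a) (R t)"
      proof -
        have q: "Q = tensor_mat (1\<^sub>m a) (R (\<lambda>x. q x * q x))"
          unfolding Q_def \<Sigma>_def tensor_mult[OF one_carrier_mat Sc(1) one_carrier_mat Sc(1)] unfolding S_def RR by simp
        have "R (\<lambda>x. q x * q x) * R (\<lambda>x. q x * q x) = R t"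
          unfolding RR by (rule Rcong) (use q4 in simp)
        then show ?thesis unfolding Q(2) unfolding q tensor_mult[OF one_carrier_mat R one_carrier_mat R] by simp
      qed
      then have "complex_of_real (hs_sq Q) = mat_trace (1\<^sub>m a) * mat_trace (R t)"
        using trace_adj_mult[of Q] trace_tensor[OF one_carrier_mat R, of a t] by simp
      moreover have "mat_trace (1\<^sub>m a) = complex_of_real (real a)" by (simp add: mat_trace_def)
      moreover have "mat_trace (R t) = complex_of_real (11 / 10)"
      proof -
        have "mat_trace (R t) = mat_trace \<sigma> + complex_of_real (1 / (10 * real r)) * mat_trace (1\<^sub>m r)"
          unfolding Rt trace_add[OF sc(1) smult_carrier_mat[OF one_carrier_mat]] trace_smult[OF one_carrier_mat] ..
        also have "mat_trace (1\<^sub>m r) = complex_of_real (real r)" by (simp add: mat_trace_def)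
        also have "complex_of_real (1 / (10 * real r)) * complex_of_real (real r) = complex_of_real (1 / 10)"
          unfolding of_real_mult[symmetric] of_real_eq_iff using r by simp
        finally show ?thesis unfolding sc(3) by (simp add: complex_eq_iff)
      qed
      ultimately have "complex_of_real (hs_sq Q) = complex_of_real (real a * (11 / 10))"
        by (simp only: of_real_mult)
      then show ?thesis unfolding of_real_eq_iff .
    qed
    \<comment> \<open>By cyclicity tr \<open>adj K * K\<close> is the inner product of C Q and Q C.
      After Cauchy-Schwarz the contraction \<open>C\<close> stands on the outside of each factor and
      drops out.\<close>
    have hK: "hs_sq K \<le> hs_sq Q"
    proof -
      have "adj K * K = (\<Sigma> * (adj C * (Q * C))) * \<Sigma>"
        unfolding K_def Q_def by (simp add: mat_ring dd \<Sigma>(2))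
      then have "complex_of_real (hs_sq K) = mat_trace ((\<Sigma> * (adj C * (Q * C))) * \<Sigma>)"
        using trace_adj_mult[of K] by simp
      also have "\<dots> = mat_trace (\<Sigma> * (\<Sigma> * (adj C * (Q * C))))"
        by (rule trace_mult_comm[OF _ \<Sigma>(1)])
          (rule mult_carrier_mat[OF \<Sigma>(1) mult_carrier_mat[OF adj_carrier[OF C(1)] mult_carrier_mat[OF Q(1) C(1)]]])
      also have "\<Sigma> * (\<Sigma> * (adj C * (Q * C))) = adj (C * Q) * (Q * C)"
        unfolding adj_mult[OF C(1) Q(1)] Q(2) unfolding Q_def by (simp add: mat_ring dd)
      finally have "hs_sq K = cmod (mat_trace (adj (C * Q) * (Q * C)))"
        by (metis abs_of_nonneg hs_sq_nonneg norm_of_real)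
      also have "\<dots> \<le> sqrt (hs_sq (C * Q)) * sqrt (hs_sq (Q * C))"
        by (rule cmod_trace_adj_mult_le[OF mult_carrier_mat[OF C(1) Q(1)] mult_carrier_mat[OF Q(1) C(1)]])
      also have "\<dots> \<le> sqrt (hs_sq Q) * sqrt (hs_sq Q)"
      proof (rule mult_mono)
        show "sqrt (hs_sq (C * Q)) \<le> sqrt (hs_sq Q)"
          using hs_sq_contr_mult[OF C(2,1) Q(1)] by simp
        have "hs_sq (Q * C) = hs_sq (adj C * Q)"
          using hs_sq_adj[of "Q * C"] unfolding adj_mult[OF Q(1) C(1)] Q(2) by simp
        then show "sqrt (hs_sq (Q * C)) \<le> sqrt (hs_sq Q)"
          using hs_sq_contr_mult[OF contr_adj[OF C(2)] adj_carrier[OF C(1)] Q(1)] by simp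
      qed auto
      finally show ?thesis by simp
    qed
    have "mat_trace (C * L \<omega>) = mat_trace ((C * \<Sigma> * L \<omega>') * \<Sigma>)"
      unfolding L_eq by (simp add: mat_ring dd)
    also have "\<dots> = mat_trace (\<Sigma> * (C * \<Sigma> * L \<omega>'))"
      by (rule trace_mult_comm[OF mult_carrier_mat[OF mult_carrier_mat[OF C(1) \<Sigma>(1)] Lc] \<Sigma>(1)])
    also have "\<Sigma> * (C * \<Sigma> * L \<omega>') = adj (adj K) * L \<omega>'" unfolding K_def by (simp add: mat_ring dd)
    finally have "cmod (mat_trace (C * L \<omega>)) \<le> sqrt (hs_sq K) * sqrt (hs_sq (L \<omega>'))"
      using cmod_trace_adj_mult_le[OF adj_carrier[OF K] Lc, of \<omega>'] by simp
    also have "\<dots> \<le> sqrt (real a * (11 / 10)) * sqrt (2 / real b * c)"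
      using hK hsL unfolding hQ by (intro mult_mono) auto
    also have "\<dots> = sqrt (11 / 5 * (real a / real b) * c)"
      unfolding real_sqrt_mult[symmetric] by (simp add: field_simps)
    finally show "cmod (mat_trace (C * L \<omega>)) \<le> sqrt (11 / 5 * (real a / real b) * c)" .
  qed
  then show ?thesis using U UU unfolding L_def TU_def \<pi>_def N_def by blast
qed

subsection \<open>Kraus maps\<close>

text \<open>A positive operator given by a finite ensemble of unnormalized vectors. Kraus maps act
  on such an ensemble vector by vector, from which both complete positivity and the final state of a
  protocol can be read off.\<close>

definition gram :: "nat \<Rightarrow> 's set \<Rightarrow> ('s \<Rightarrow> nat \<Rightarrow> complex) \<Rightarrow> complex mat" where
  "gram n S v = mat n n (\<lambda>(i, j). \<Sum>s\<in>S. v s i * cnj (v s j))"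

lemma gram_carrier [simp]: "gram n S v \<in> carrier_mat n n"
  by (simp add: gram_def)

lemma trace_gram: "mat_trace (gram n S v) = complex_of_real (\<Sum>s\<in>S. \<Sum>i<n. (cmod (v s i))\<^sup>2)"
proof -
  have "mat_trace (gram n S v) = (\<Sum>i<n. \<Sum>s\<in>S. v s i * cnj (v s i))"
    by (simp add: mat_trace_def gram_def)
  also have "\<dots> = (\<Sum>s\<in>S. \<Sum>i<n. v s i * cnj (v s i))" by (rule sum.swap)
  finally show ?thesis unfolding of_real_sum cmod_square .
qed

lemma psd_gram: "psd (gram n S v)"
proof (rule psdI[OF gram_carrier])
  fix u :: "complex vec" assume u: "u \<in> carrier_vec n"
  have "(gram n S v *\<^sub>v u) \<bullet>c u = (\<Sum>i<n. \<Sum>j<n. \<Sum>s\<in>S. (v s i * cnj (u $ i)) * cnj (v s j * cnj (u $ j)))"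
    unfolding quad_form_sum[OF gram_carrier u]
    by (rule sum.cong[OF refl], rule sum.cong[OF refl])
      (simp add: gram_def sum_distrib_left sum_distrib_right mult_ac)
  also have "\<dots> = (\<Sum>i<n. \<Sum>s\<in>S. \<Sum>j<n. (v s i * cnj (u $ i)) * cnj (v s j * cnj (u $ j)))"
    by (rule sum.cong[OF refl], rule sum.swap)
  also have "\<dots> = (\<Sum>s\<in>S. \<Sum>i<n. \<Sum>j<n. (v s i * cnj (u $ i)) * cnj (v s j * cnj (u $ j)))"
    by (rule sum.swap)
  also have "\<dots> = (\<Sum>s\<in>S. (\<Sum>i<n. v s i * cnj (u $ i)) * cnj (\<Sum>i<n. v s i * cnj (u $ i)))"
    unfolding cnj_sum sum_product ..
  also have "\<dots> = complex_of_real (\<Sum>s\<in>S. (cmod (\<Sum>i<n. v s i * cnj (u $ i)))\<^sup>2)"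
    unfolding of_real_sum cmod_square ..
  finally show "0 \<le> (gram n S v *\<^sub>v u) \<bullet>c u"
    by (simp add: less_eq_complex_def sum_nonneg)
qed

lemma psd_imp_gram:
  assumes "psd X" "X \<in> carrier_mat n n"
  shows "X = gram n {..<n} (\<lambda>s i. psd_sqrt X $$ (i, s))"
proof -
  note S = psd_sqrt[OF assms]
  show ?thesis
  proof (rule eq_matI)
    fix i j assume "i < dim_row (gram n {..<n} (\<lambda>s i. psd_sqrt X $$ (i, s)))"
      "j < dim_col (gram n {..<n} (\<lambda>s i. psd_sqrt X $$ (i, s)))"
    then have ij: "i < n" "j < n" by (simp_all add: gram_def)
    have "X $$ (i, j) = (psd_sqrt X * adj (psd_sqrt X)) $$ (i, j)" unfolding S(4) S(2) ..
    also have "\<dots> = (\<Sum>s<n. psd_sqrt X $$ (i, s) * cnj (psd_sqrt X $$ (j, s)))"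
      unfolding mult_index_sum[OF S(3) adj_carrier[OF S(3)] ij]
      by (rule sum.cong[OF refl]) (use ij in \<open>simp add: adj_index_carrier[OF S(3)] del: adj_index\<close>)
    finally show "X $$ (i, j) = gram n {..<n} (\<lambda>s i. psd_sqrt X $$ (i, s)) $$ (i, j)"
      using ij by (simp add: gram_def)
  qed (use assms(2) in \<open>auto simp: gram_def\<close>)
qed

definition kraus_map :: "nat \<Rightarrow> nat \<Rightarrow> nat \<Rightarrow> (nat \<Rightarrow> complex mat) \<Rightarrow> complex mat \<Rightarrow> complex mat" where
  "kraus_map m n q L X = mat n n (\<lambda>(i, j).
     \<Sum>k<q. \<Sum>a<m. \<Sum>b<m. L k $$ (i, a) * X $$ (a, b) * cnj (L k $$ (j, b)))"

definition kraus_complete :: "nat \<Rightarrow> nat \<Rightarrow> nat \<Rightarrow> (nat \<Rightarrow> complex mat) \<Rightarrow> bool" where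
  "kraus_complete m n q L \<longleftrightarrow> (\<forall>a<m. \<forall>b<m.
     (\<Sum>k<q. \<Sum>i<n. cnj (L k $$ (i, a)) * L k $$ (i, b)) = (if a = b then 1 else 0))"

text \<open>The vector \<open>v\<close> after \<open>L\<close> has acted on the middle of three
  tensor factors, in the same index arithmetic as \<open>extend_map\<close>.\<close>

definition kraus_vec :: "nat \<Rightarrow> nat \<Rightarrow> nat \<Rightarrow> complex mat \<Rightarrow> (nat \<Rightarrow> complex) \<Rightarrow> nat \<Rightarrow> complex" where
  "kraus_vec m n r L v i = (\<Sum>a<m. L $$ (i div r mod n, a) * v ((i div (n * r) * m + a) * r + i mod r))"

lemma extend_kraus_map_gram:
  assumes "finite S"
  shows "extend_map l m n r (kraus_map m n q L) (gram (l * m * r) S v)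
    = gram (l * n * r) (S \<times> {..<q}) (\<lambda>(s, k). kraus_vec m n r (L k) (v s))"
proof (rule eq_matI)
  fix i j assume "i < dim_row (gram (l * n * r) (S \<times> {..<q}) (\<lambda>(s, k). kraus_vec m n r (L k) (v s)))"
    "j < dim_col (gram (l * n * r) (S \<times> {..<q}) (\<lambda>(s, k). kraus_vec m n r (L k) (v s)))"
  then have ij: "i < l * n * r" "j < l * n * r" by (simp_all add: gram_def)
  have nr: "0 < n" "0 < r" using ij by (auto intro: Nat.gr0I)
  define I where "I = (\<lambda>i a. (i div (n * r) * m + a) * r + i mod r)"
  have I: "I i' a < l * m * r" if "i' < l * n * r" "a < m" for i' a
  proof -
    have "i' div (n * r) < l" using that(1) by (simp add: less_mult_imp_div_less mult.assoc)
    then show ?thesis unfolding I_def by (intro index_less that) (use nr in auto)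
  qed
  have mods: "i div r mod n < n" "j div r mod n < n" using nr by auto
  define A where "A = (\<lambda>i k s. kraus_vec m n r (L k) (v s) i)"
  have A: "A i k s = (\<Sum>a<m. L k $$ (i div r mod n, a) * v s (I i a))" for i k s
    by (simp add: A_def kraus_vec_def I_def)
  have "extend_map l m n r (kraus_map m n q L) (gram (l * m * r) S v) $$ (i, j)
      = (\<Sum>k<q. \<Sum>a<m. \<Sum>b<m. L k $$ (i div r mod n, a) * (\<Sum>s\<in>S. v s (I i a) * cnj (v s (I j b)))
          * cnj (L k $$ (j div r mod n, b)))"
    unfolding extend_map_def using ij mods I[OF ij(1)] I[OF ij(2)]
    by (simp add: kraus_map_def gram_def I_def)
  also have "\<dots> = (\<Sum>k<q. \<Sum>s\<in>S. A i k s * cnj (A j k s))"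
  proof (rule sum.cong[OF refl])
    fix k
    have "(\<Sum>a<m. \<Sum>b<m. L k $$ (i div r mod n, a) * (\<Sum>s\<in>S. v s (I i a) * cnj (v s (I j b))) * cnj (L k $$ (j div r mod n, b)))
        = (\<Sum>a<m. \<Sum>b<m. \<Sum>s\<in>S. (L k $$ (i div r mod n, a) * v s (I i a)) * cnj (L k $$ (j div r mod n, b) * v s (I j b)))"
      by (simp add: sum_distrib_left sum_distrib_right mult_ac)
    also have "\<dots> = (\<Sum>a<m. \<Sum>s\<in>S. \<Sum>b<m. (L k $$ (i div r mod n, a) * v s (I i a)) * cnj (L k $$ (j div r mod n, b) * v s (I j b)))"
      by (rule sum.cong[OF refl], rule sum.swap)
    also have "\<dots> = (\<Sum>s\<in>S. \<Sum>a<m. \<Sum>b<m. (L k $$ (i div r mod n, a) * v s (I i a)) * cnj (L k $$ (j div r mod n, b) * v s (I j b)))"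
      by (rule sum.swap)
    also have "\<dots> = (\<Sum>s\<in>S. A i k s * cnj (A j k s))"
      unfolding A cnj_sum sum_product ..
    finally show "(\<Sum>a<m. \<Sum>b<m. L k $$ (i div r mod n, a) * (\<Sum>s\<in>S. v s (I i a) * cnj (v s (I j b))) * cnj (L k $$ (j div r mod n, b)))
        = (\<Sum>s\<in>S. A i k s * cnj (A j k s))" .
  qed
  also have "\<dots> = (\<Sum>s\<in>S. \<Sum>k<q. A i k s * cnj (A j k s))" by (rule sum.swap)
  also have "\<dots> = gram (l * n * r) (S \<times> {..<q}) (\<lambda>(s, k). kraus_vec m n r (L k) (v s)) $$ (i, j)"
    using ij by (simp add: gram_def sum.cartesian_product A_def case_prod_unfold)
  finally show "extend_map l m n r (kraus_map m n q L) (gram (l * m * r) S v) $$ (i, j)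
    = gram (l * n * r) (S \<times> {..<q}) (\<lambda>(s, k). kraus_vec m n r (L k) (v s)) $$ (i, j)" .
qed (simp_all add: gram_def extend_map_def)

lemma kraus_vec_index:
  assumes "x < l" "z < n" "y < r"
  shows "kraus_vec m n r L v ((x * n + z) * r + y) = (\<Sum>a<m. L $$ (z, a) * v ((x * m + a) * r + y))"
proof -
  have "((x * n + z) * r + y) div r = x * n + z" "((x * n + z) * r + y) mod r = y" using assms by auto
  moreover have "((x * n + z) * r + y) div (n * r) = x"
    using assms by (simp add: div_mult2_eq[of _ r n] mult.commute[of n r])
  ultimately show ?thesis using assms by (simp add: kraus_vec_def)
qed

lemma kraus_vec_norm:
  assumes "kraus_complete m n q L"
  shows "(\<Sum>k<q. \<Sum>i<l * n * r. (cmod (kraus_vec m n r (L k) v i))\<^sup>2) = (\<Sum>i<l * m * r. (cmod (v i))\<^sup>2)"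
proof -
  have c: "(\<Sum>k<q. \<Sum>z<n. (\<Sum>a<m. L k $$ (z, a) * u a) * cnj (\<Sum>a<m. L k $$ (z, a) * u a)) = (\<Sum>a<m. u a * cnj (u a))" for u
  proof -
    have "(\<Sum>k<q. \<Sum>z<n. (\<Sum>a<m. L k $$ (z, a) * u a) * cnj (\<Sum>a<m. L k $$ (z, a) * u a))
        = (\<Sum>k<q. \<Sum>z<n. \<Sum>a<m. \<Sum>b<m. (u a * cnj (u b)) * (cnj (L k $$ (z, b)) * L k $$ (z, a)))"
      unfolding cnj_sum sum_product by (simp add: mult_ac)
    also have "\<dots> = (\<Sum>a<m. \<Sum>b<m. (u a * cnj (u b)) * (\<Sum>k<q. \<Sum>z<n. cnj (L k $$ (z, b)) * L k $$ (z, a)))"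
      unfolding sum_swap4[of _ "{..<n}" "{..<q}"] sum_distrib_left ..
    also have "\<dots> = (\<Sum>a<m. \<Sum>b<m. if b = a then u a * cnj (u a) else 0)"
      by (rule sum.cong[OF refl], rule sum.cong[OF refl])
        (use assms in \<open>auto simp: kraus_complete_def\<close>)
    finally show ?thesis by simp
  qed
  have "complex_of_real (\<Sum>k<q. \<Sum>i<l * n * r. (cmod (kraus_vec m n r (L k) v i))\<^sup>2)
      = (\<Sum>k<q. \<Sum>x<l. \<Sum>z<n. \<Sum>y<r. (\<Sum>a<m. L k $$ (z, a) * v ((x * m + a) * r + y))
          * cnj (\<Sum>a<m. L k $$ (z, a) * v ((x * m + a) * r + y)))"
    unfolding of_real_sum cmod_square sum_nat_mult
    by (rule sum.cong[OF refl], rule sum.cong[OF refl], rule sum.cong[OF refl], rule sum.cong[OF refl])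
      (simp add: kraus_vec_index[of _ l])
  also have "\<dots> = (\<Sum>k<q. \<Sum>x<l. \<Sum>y<r. \<Sum>z<n. (\<Sum>a<m. L k $$ (z, a) * v ((x * m + a) * r + y))
          * cnj (\<Sum>a<m. L k $$ (z, a) * v ((x * m + a) * r + y)))"
    by (rule sum.cong[OF refl], rule sum.cong[OF refl], rule sum.swap)
  also have "\<dots> = (\<Sum>x<l. \<Sum>k<q. \<Sum>y<r. \<Sum>z<n. (\<Sum>a<m. L k $$ (z, a) * v ((x * m + a) * r + y))
          * cnj (\<Sum>a<m. L k $$ (z, a) * v ((x * m + a) * r + y)))"
    by (rule sum.swap)
  also have "\<dots> = (\<Sum>x<l. \<Sum>y<r. \<Sum>k<q. \<Sum>z<n. (\<Sum>a<m. L k $$ (z, a) * v ((x * m + a) * r + y))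
          * cnj (\<Sum>a<m. L k $$ (z, a) * v ((x * m + a) * r + y)))"
    by (rule sum.cong[OF refl], rule sum.swap)
  also have "\<dots> = (\<Sum>x<l. \<Sum>y<r. \<Sum>a<m. v ((x * m + a) * r + y) * cnj (v ((x * m + a) * r + y)))"
    unfolding c ..
  also have "\<dots> = (\<Sum>x<l. \<Sum>a<m. \<Sum>y<r. v ((x * m + a) * r + y) * cnj (v ((x * m + a) * r + y)))"
    by (rule sum.cong[OF refl], rule sum.swap)
  also have "\<dots> = complex_of_real (\<Sum>i<l * m * r. (cmod (v i))\<^sup>2)"
    unfolding of_real_sum cmod_square sum_nat_mult ..
  finally show ?thesis unfolding of_real_eq_iff .
qed

lemma cptp_kraus_map:
  assumes "kraus_complete m n q L"
  shows "cptp m n (kraus_map m n q L)"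
  unfolding cptp_def
proof (intro conjI ballI)
  show "linear_map m n (kraus_map m n q L)"
    unfolding linear_map_def
  proof (intro conjI ballI allI)
    fix X Y :: "complex mat" and c
    assume X: "X \<in> carrier_mat m m"
    show "kraus_map m n q L X \<in> carrier_mat n n" by (simp add: kraus_map_def)
    show "kraus_map m n q L (c \<cdot>\<^sub>m X) = c \<cdot>\<^sub>m kraus_map m n q L X"
      by (rule eq_matI) (use X in \<open>auto simp: kraus_map_def sum_distrib_left mult_ac\<close>)
    assume Y: "Y \<in> carrier_mat m m"
    show "kraus_map m n q L (X + Y) = kraus_map m n q L X + kraus_map m n q L Y"
      by (rule eq_matI) (use X Y in \<open>auto simp: kraus_map_def distrib_left distrib_right sum.distrib\<close>)
  qed
  show "completely_positive m n (kraus_map m n q L)"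
    unfolding completely_positive_def
  proof (intro allI ballI impI)
    fix k and X :: "complex mat" assume X: "X \<in> carrier_mat (k * m) (k * m)" "psd X"
    define v where "v = (\<lambda>s i. psd_sqrt X $$ (i, s))"
    have "X = gram (k * m * 1) {..<k * m} v"
      using psd_imp_gram[OF X(2,1)] by (simp add: v_def)
    then have "extend_map k m n 1 (kraus_map m n q L) X
        = gram (k * n * 1) ({..<k * m} \<times> {..<q}) (\<lambda>(s, j). kraus_vec m n 1 (L j) (v s))"
      using extend_kraus_map_gram[of "{..<k * m}" k m n 1 q L v] by simp
    then show "psd (extend_map k m n 1 (kraus_map m n q L) X)" using psd_gram by simp
  qed
  fix X :: "complex mat" assume X: "X \<in> carrier_mat m m"
  have "mat_trace (kraus_map m n q L X)
      = (\<Sum>i<n. \<Sum>k<q. \<Sum>a<m. \<Sum>b<m. X $$ (a, b) * (cnj (L k $$ (i, b)) * L k $$ (i, a)))"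
    by (simp add: mat_trace_def kraus_map_def mult_ac)
  also have "\<dots> = (\<Sum>k<q. \<Sum>i<n. \<Sum>a<m. \<Sum>b<m. X $$ (a, b) * (cnj (L k $$ (i, b)) * L k $$ (i, a)))"
    by (rule sum.swap)
  also have "\<dots> = (\<Sum>a<m. \<Sum>b<m. X $$ (a, b) * (\<Sum>k<q. \<Sum>i<n. cnj (L k $$ (i, b)) * L k $$ (i, a)))"
    unfolding sum_swap4[of _ "{..<n}" "{..<q}"] sum_distrib_left ..
  also have "\<dots> = (\<Sum>a<m. \<Sum>b<m. if b = a then X $$ (a, a) else 0)"
    by (rule sum.cong[OF refl], rule sum.cong[OF refl])
      (use assms in \<open>auto simp: kraus_complete_def\<close>)
  finally show "mat_trace (kraus_map m n q L X) = mat_trace X"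
    using X by (simp add: mat_trace_def)
qed

text \<open>A contraction loses the weight described by its defect \<open>adj G * G\<close>. Each
  row of \<open>G\<close> yields one further Kraus operator, which sends the corresponding lost
  component to the basis vector 0; this is why the target must not be trivial. Only operator 0
  matters for the protocol, the others restore the trace.\<close>

lemma contr_kraus_complete:
  assumes "contr K" "K \<in> carrier_mat n m" "0 < n"
  shows "\<exists>q L. kraus_complete m n (Suc q) L \<and> L 0 = K"
proof -
  define P where "P = 1\<^sub>m m - adj K * K"
  have KK: "adj K * K \<in> carrier_mat m m" by (rule mult_carrier_mat[OF adj_carrier[OF assms(2)] assms(2)])
  have P: "P \<in> carrier_mat m m" "psd P"
    using assms minus_carrier_mat[OF KK] by (auto simp: P_def contr_def)
  define G where "G = psd_sqrt P"
  note G = psd_sqrt[OF P(2,1), folded G_def]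
  define L where "L = case_nat K (\<lambda>k. mat n m (\<lambda>(i, a). if i = 0 then G $$ (k, a) else 0))"
  have "kraus_complete m n (Suc m) L"
    unfolding kraus_complete_def
  proof (intro allI impI)
    fix a b assume ab: "a < m" "b < m"
    have "(\<Sum>k<Suc m. \<Sum>i<n. cnj (L k $$ (i, a)) * L k $$ (i, b))
        = (\<Sum>i<n. cnj (K $$ (i, a)) * K $$ (i, b)) + (\<Sum>k<m. \<Sum>i<n. if i = 0 then cnj (G $$ (k, a)) * G $$ (k, b) else 0)"
      unfolding sum.lessThan_Suc_shift using ab
      by (intro arg_cong2[of _ _ _ _ plus] sum.cong refl) (auto simp: L_def)
    also have "\<dots> = (\<Sum>i<n. cnj (K $$ (i, a)) * K $$ (i, b)) + (\<Sum>k<m. cnj (G $$ (k, a)) * G $$ (k, b))"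
      using assms(3) by simp
    also have "(\<Sum>i<n. cnj (K $$ (i, a)) * K $$ (i, b)) = (adj K * K) $$ (a, b)"
      unfolding mult_index_sum[OF adj_carrier[OF assms(2)] assms(2) ab]
      by (rule sum.cong[OF refl]) (use ab in \<open>simp add: adj_index_carrier[OF assms(2)] del: adj_index\<close>)
    also have "(\<Sum>k<m. cnj (G $$ (k, a)) * G $$ (k, b)) = (adj G * G) $$ (a, b)"
      unfolding mult_index_sum[OF adj_carrier[OF G(3)] G(3) ab]
      by (rule sum.cong[OF refl]) (use ab in \<open>simp add: adj_index_carrier[OF G(3)] del: adj_index\<close>)
    also have "adj G * G = P" unfolding G(4,2) ..
    also have "(adj K * K) $$ (a, b) + P $$ (a, b) = (if a = b then 1 else 0)"
      unfolding P_def using ab carrier_matD[OF KK] by simp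
    finally show "(\<Sum>k<Suc m. \<Sum>i<n. cnj (L k $$ (i, a)) * L k $$ (i, b)) = (if a = b then 1 else 0)" .
  qed
  moreover have "L 0 = K" by (simp add: L_def)
  ultimately show ?thesis by blast
qed

section \<open>Comparison of purifications\<close>

lemma pure_state_gram: "pure_state \<psi> = gram (dim_vec \<psi>) {()} (\<lambda>_ i. \<psi> $ i)"
  by (simp add: pure_state_def gram_def)

text \<open>The leading vector v of the ensemble is separated from the remainder J. The difference
  of the projections onto \<theta> and v is (\<theta> - v) \<theta>^* + v (\<theta> - v)^*, where
  \<theta> - v has norm at most sqrt x; J has trace 1 - |v|^2 \<le> x since v has norm at least 1 -
  x / 2. Hence 2 sqrt x + x.\<close>

lemma tn_le_pure_minus_gram:
  assumes "finite S" "s0 \<in> S" "(\<Sum>s\<in>S. \<Sum>i<n. (cmod (v s i))\<^sup>2) = 1"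
    and "\<theta> \<in> carrier_vec n" "(\<Sum>i<n. (cmod (\<theta> $ i))\<^sup>2) = 1"
    and ov: "1 - x / 2 \<le> Re (\<Sum>i<n. cnj (\<theta> $ i) * v s0 i)" and x: "0 \<le> x" "x \<le> 1"
  shows "tn_le (pure_state \<theta> - gram n S v) (2 * sqrt x + x)"
proof -
  define A where "A = mat n 1 (\<lambda>(i, _). \<theta> $ i)"
  define B where "B = mat n 1 (\<lambda>(i, _). v s0 i)"
  have A: "A \<in> carrier_mat n 1" and B: "B \<in> carrier_mat n 1" by (auto simp: A_def B_def)
  note d = carrier_matD[OF A] carrier_matD[OF B]
  define J where "J = gram n (S - {s0}) v"
  have hA: "hs_sq A = 1" using assms(5) by (simp add: hs_sq_def A_def)
  have hB: "hs_sq B = (\<Sum>i<n. (cmod (v s0 i))\<^sup>2)" by (simp add: hs_sq_def B_def)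
  have tJ: "Re (mat_trace J) = 1 - hs_sq B"
    unfolding J_def trace_gram hB using assms(3) sum.remove[OF assms(1,2), of "\<lambda>s. \<Sum>i<n. (cmod (v s i))\<^sup>2"] by simp
  have hB1: "hs_sq B \<le> 1"
  proof -
    have "0 \<le> Re (mat_trace J)" using psd_trace_nonneg[OF psd_gram[of n "S - {s0}" v]] unfolding J_def by (simp add: less_eq_complex_def)
    then show ?thesis using tJ by simp
  qed
  define ov where "ov = (\<Sum>i<n. cnj (\<theta> $ i) * v s0 i)"
  have tAB: "mat_trace (adj A * B) = ov"
    unfolding trace_mult_sum[OF adj_carrier[OF A] B] ov_def by (simp add: A_def B_def)
  have tBA: "mat_trace (adj B * A) = cnj ov"
    unfolding trace_mult_sum[OF adj_carrier[OF B] A] ov_def by (simp add: A_def B_def mult.commute)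
  define E where "E = A - B"
  have E: "E \<in> carrier_mat n 1" unfolding E_def by (rule minus_carrier_mat[OF B])
  have hE: "hs_sq E \<le> x"
  proof -
    have "adj E * E = (adj A * A - adj B * A) - (adj A * B - adj B * B)"
      unfolding E_def adj_minus[OF A B] by (simp add: mat_ring d)
    moreover have c: "adj A * A \<in> carrier_mat 1 1" "adj B * A \<in> carrier_mat 1 1"
      "adj A * B \<in> carrier_mat 1 1" "adj B * B \<in> carrier_mat 1 1"
      using A B by (auto intro: mult_carrier_mat)
    ultimately have "mat_trace (adj E * E) = (mat_trace (adj A * A) - mat_trace (adj B * A))
        - (mat_trace (adj A * B) - mat_trace (adj B * B))"
      by (simp only: trace_minus[OF c(1,2)] trace_minus[OF c(3,4)]
        trace_minus[OF minus_carrier_mat[OF c(2)] minus_carrier_mat[OF c(4)]])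
    then have "hs_sq E = 1 + hs_sq B - 2 * Re ov"
      unfolding tAB tBA trace_adj_mult hA by (simp add: complex_eq_iff)
    then show ?thesis using hB1 ov unfolding ov_def by simp
  qed
  have t1: "tn_le (E * adj A) (sqrt x * 1)"
    by (rule tn_le_mono[OF tn_le_mult_adj[OF E A]]) (use hE hA in simp)
  have t2: "tn_le (B * adj E) (1 * sqrt x)"
    by (rule tn_le_mono[OF tn_le_mult_adj[OF B E]]) (use hE hB1 in \<open>intro mult_mono; simp\<close>)
  have t3: "tn_le J x"
  proof (rule tn_le_mono[OF tn_le_psd])
    show "psd J" unfolding J_def by (rule psd_gram)
    have "Re ov \<le> sqrt (hs_sq B)"
      using cmod_trace_adj_mult_le[OF A B] complex_Re_le_cmod[of ov] unfolding tAB hA by simp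
    then have "1 - x / 2 \<le> sqrt (hs_sq B)" using ov unfolding ov_def by simp
    from power_mono[OF this, of 2] have "(1 - x / 2)\<^sup>2 \<le> hs_sq B" using x by simp
    moreover have "1 - x \<le> (1 - x / 2)\<^sup>2" by (simp add: power2_eq_square algebra_simps)
    ultimately show "Re (mat_trace J) \<le> x" using tJ by simp
  qed
  have Ec: "E * adj A \<in> carrier_mat n n" "B * adj E \<in> carrier_mat n n"
    by (rule mult_carrier_mat[OF E adj_carrier[OF A]], rule mult_carrier_mat[OF B adj_carrier[OF E]])
  have J: "J \<in> carrier_mat n n" unfolding J_def by simp
  have "pure_state \<theta> - gram n S v = (E * adj A + B * adj E) - J"
  proof -
    have "E * adj A + B * adj E = (A * adj A - B * adj A) + (B * adj A - B * adj B)"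
      unfolding E_def adj_minus[OF A B] by (simp add: mat_ring d)
    also have "\<dots> = A * adj A - B * adj B"
      by (rule eq_matI) (auto simp: d)
    also have "A * adj A = pure_state \<theta>"
    proof (rule eq_matI)
      fix i j assume "i < dim_row (pure_state \<theta>)" "j < dim_col (pure_state \<theta>)"
      then have ij: "i < n" "j < n" using assms(4) by (auto simp: pure_state_def)
      show "(A * adj A) $$ (i, j) = pure_state \<theta> $$ (i, j)"
        unfolding mult_index_sum[OF A adj_carrier[OF A] ij] using ij assms(4)
        by (simp add: A_def pure_state_def)
    qed (use assms(4) in \<open>auto simp: pure_state_def d\<close>)
    finally have 1: "E * adj A + B * adj E = pure_state \<theta> - B * adj B" .
    have 2: "gram n S v = B * adj B + J"
    proof (rule eq_matI)
      fix i j assume "i < dim_row (B * adj B + J)" "j < dim_col (B * adj B + J)"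
      then have ij: "i < n" "j < n" using J by auto
      have "(B * adj B) $$ (i, j) = v s0 i * cnj (v s0 j)"
        unfolding mult_index_sum[OF B adj_carrier[OF B] ij] using ij by (simp add: B_def)
      then show "gram n S v $$ (i, j) = (B * adj B + J) $$ (i, j)"
        using ij J d sum.remove[OF assms(1,2), of "\<lambda>s. v s i * cnj (v s j)"] by (simp add: gram_def J_def)
    qed (use J in \<open>auto simp: gram_def\<close>)
    show ?thesis unfolding 1 2
      by (rule eq_matI) (use J assms(4) d in \<open>auto simp: pure_state_def\<close>)
  qed
  moreover have "tn_le ((E * adj A + B * adj E) - J) ((sqrt x * 1 + 1 * sqrt x) + x)"
    by (rule tn_le_minus[OF tn_le_add[OF t1 t2 Ec] t3 add_carrier_mat[OF Ec(2)] J])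
  ultimately show ?thesis by simp
qed

text \<open>\<open>X\<close> and \<open>Y\<close> are amplitude matrices of two vectors whose
  reductions are close. The polar contractions C and D of \<open>X\<close> and \<open>Y\<close>
  combine to W = \<open>adj D * C\<close>, for which the trace becomes tr |X| |Y|. Expanding the
  squared norm of |X| - |Y|, which Powers-Stormer bounds by \<eta>, bounds this overlap from below.
  A contraction W makes no demand on the two purifying dimensions.\<close>

lemma uhlmann_contr:
  assumes X: "X \<in> carrier_mat q n" and Y: "Y \<in> carrier_mat m n" and "tn_le (adj X * X - adj Y * Y) \<eta>"
  shows "\<exists>W \<in> carrier_mat m q. contr W \<and>
    (\<exists>g. mat_trace (W * X * adj Y) = complex_of_real g \<and> (hs_sq X + hs_sq Y - \<eta>) / 2 \<le> g)"
proof -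
  have XX: "adj X * X \<in> carrier_mat n n" and YY: "adj Y * Y \<in> carrier_mat n n"
    by (rule mult_carrier_mat[OF adj_carrier[OF X] X], rule mult_carrier_mat[OF adj_carrier[OF Y] Y])
  define P where "P = psd_sqrt (adj X * X)"
  define S where "S = psd_sqrt (adj Y * Y)"
  note P = psd_sqrt[OF psd_adj_mult[OF X] XX, folded P_def] and S = psd_sqrt[OF psd_adj_mult[OF Y] YY, folded S_def]
  obtain C where C: "C \<in> carrier_mat n q" "contr C" "C * X = P" using polar_contr[OF X] unfolding P_def by blast
  obtain D where D: "D \<in> carrier_mat n m" "contr D" "D * Y = S" using polar_contr[OF Y] unfolding S_def by blast
  note d = carrier_matD[OF X] carrier_matD[OF Y] carrier_matD[OF C(1)] carrier_matD[OF D(1)]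
    carrier_matD[OF P(3)] carrier_matD[OF S(3)]
  define W where "W = adj D * C"
  have W: "W \<in> carrier_mat m q" unfolding W_def by (rule mult_carrier_mat[OF adj_carrier[OF D(1)] C(1)])
  have cW: "contr W" unfolding W_def by (rule contr_mult[OF contr_adj[OF D(2)] C(2) adj_carrier[OF D(1)] C(1)])
  have "mat_trace (W * X * adj Y) = mat_trace (adj D * (P * adj Y))"
    unfolding W_def C(3)[symmetric] by (simp add: mat_ring d)
  also have "\<dots> = mat_trace ((P * adj Y) * adj D)"
    by (rule trace_mult_comm[OF adj_carrier[OF D(1)] mult_carrier_mat[OF P(3) adj_carrier[OF Y]]])
  also have "(P * adj Y) * adj D = P * adj (D * Y)" by (simp add: mat_ring d)
  finally have t: "mat_trace (W * X * adj Y) = mat_trace (P * S)" unfolding D(3) S(4) .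
  define g where "g = Re (mat_trace (P * S))"
  have g: "mat_trace (P * S) = complex_of_real g"
    using trace_psd_mult_nonneg[OF P(1) S(1) P(3) S(3)] by (simp add: g_def less_eq_complex_def complex_eq_iff)
  have g': "mat_trace (S * P) = complex_of_real g" using trace_mult_comm[OF P(3) S(3)] g by simp
  have "tn_le (P * P - S * S) \<eta>" unfolding P(2) S(2) by (rule assms(3))
  from powers_stormer[OF P(1) S(1) P(3) S(3) this] have h: "hs_sq (P - S) \<le> \<eta>" .
  have "adj (P - S) * (P - S) = (adj X * X - S * P) - (P * S - adj Y * Y)"
    unfolding adj_minus[OF P(3) S(3)] P(4) S(4) P(2)[symmetric] S(2)[symmetric] by (simp add: mat_ring d)
  moreover have c: "S * P \<in> carrier_mat n n" "P * S \<in> carrier_mat n n"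
    by (rule mult_carrier_mat[OF S(3) P(3)], rule mult_carrier_mat[OF P(3) S(3)])
  ultimately have "mat_trace (adj (P - S) * (P - S)) = (mat_trace (adj X * X) - mat_trace (S * P))
      - (mat_trace (P * S) - mat_trace (adj Y * Y))"
    by (simp only: trace_minus[OF XX c(1)] trace_minus[OF c(2) YY]
      trace_minus[OF minus_carrier_mat[OF c(1)] minus_carrier_mat[OF YY]])
  then have "complex_of_real (hs_sq (P - S)) = complex_of_real (hs_sq X + hs_sq Y - 2 * g)"
    unfolding g g' trace_adj_mult by simp
  then have "hs_sq (P - S) = hs_sq X + hs_sq Y - 2 * g" unfolding of_real_eq_iff .
  then have "(hs_sq X + hs_sq Y - \<eta>) / 2 \<le> g" using h by simp
  then show ?thesis using W cW t g by (intro bexI[of _ W]) auto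
qed

subsection \<open>Protocols from decoupling\<close>

text \<open>Entrywise conjugation respects products and adjoints, so a factorization of the defect
  of \<open>W\<close> conjugates to one for the conjugate of \<open>W\<close>. The decoder needs
  this because Uhlmann's theorem is applied to conjugated amplitudes.\<close>

lemma contr_cnj:
  assumes "contr W" "W \<in> carrier_mat n m" shows "contr (map_mat cnj W)"
proof -
  define P where "P = 1\<^sub>m m - adj W * W"
  have WW: "adj W * W \<in> carrier_mat m m" by (rule mult_carrier_mat[OF adj_carrier[OF assms(2)] assms(2)])
  have P: "P \<in> carrier_mat m m" "psd P"
    using assms minus_carrier_mat[OF WW] by (auto simp: P_def contr_def)
  define G where "G = psd_sqrt P"
  note G = psd_sqrt[OF P(2,1), folded G_def]
  have cc: "map_mat cnj X \<in> carrier_mat k l" if "X \<in> carrier_mat k l" for X :: "complex mat" and k l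
    using that by auto
  have mm: "adj (map_mat cnj X) * map_mat cnj X = map_mat cnj (adj X * X)" if X: "X \<in> carrier_mat k m" for X k
  proof (rule eq_matI)
    fix i j assume "i < dim_row (map_mat cnj (adj X * X))" "j < dim_col (map_mat cnj (adj X * X))"
    then have ij: "i < m" "j < m" using X by auto
    have "(adj (map_mat cnj X) * map_mat cnj X) $$ (i, j) = (\<Sum>k'<k. cnj (adj X $$ (i, k') * X $$ (k', j)))"
      unfolding mult_index_sum[OF adj_carrier[OF cc[OF X]] cc[OF X] ij]
      by (rule sum.cong[OF refl]) (use X ij in auto)
    also have "\<dots> = cnj ((adj X * X) $$ (i, j))"
      unfolding mult_index_sum[OF adj_carrier[OF X] X ij] cnj_sum ..
    finally show "(adj (map_mat cnj X) * map_mat cnj X) $$ (i, j) = map_mat cnj (adj X * X) $$ (i, j)"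
      using ij X by simp
  qed (use X in auto)
  have "1\<^sub>m m - map_mat cnj (adj W * W) = map_mat cnj P"
    unfolding P_def by (rule eq_matI) (use assms(2) in auto)
  also have "P = adj G * G" unfolding G(4,2) ..
  also have "map_mat cnj (adj G * G) = adj (map_mat cnj G) * map_mat cnj G" by (rule mm[OF G(3), symmetric])
  finally have "1\<^sub>m m - map_mat cnj (adj W * W) = adj (map_mat cnj G) * map_mat cnj G" .
  then have "psd (1\<^sub>m m - adj (map_mat cnj W) * map_mat cnj W)"
    unfolding mm[OF assms(2)] using psd_adj_mult[OF cc[OF G(3)]] by simp
  then show ?thesis using assms(2) by (simp add: contr_def)
qed

lemma tensor_pure_state:
  "tensor_mat (pure_state u) (pure_state v)
    = pure_state (vec (dim_vec u * dim_vec v) (\<lambda>i. u $ (i div dim_vec v) * v $ (i mod dim_vec v)))"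
proof (rule eq_matI)
  let ?w = "vec (dim_vec u * dim_vec v) (\<lambda>i. u $ (i div dim_vec v) * v $ (i mod dim_vec v))"
  fix i j assume "i < dim_row (pure_state ?w)" "j < dim_col (pure_state ?w)"
  then have ij: "i < dim_vec u * dim_vec v" "j < dim_vec u * dim_vec v" by (simp_all add: pure_state_def)
  then have "dim_vec v > 0" by (intro Nat.gr0I) auto
  then show "tensor_mat (pure_state u) (pure_state v) $$ (i, j) = pure_state ?w $$ (i, j)"
    using ij by (simp add: tensor_mat_def pure_state_def less_mult_imp_div_less)
qed (simp_all add: tensor_mat_def pure_state_def)

lemma gram_norm_kraus:
  assumes "kraus_complete m n q L" "finite S"
  shows "(\<Sum>t\<in>S \<times> {..<q}. \<Sum>i<l * n * r. (cmod ((\<lambda>(s, k). kraus_vec m n r (L k) (v s)) t i))\<^sup>2)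
    = (\<Sum>s\<in>S. \<Sum>i<l * m * r. (cmod (v s i))\<^sup>2)"
proof -
  have "(\<Sum>t\<in>S \<times> {..<q}. \<Sum>i<l * n * r. (cmod ((\<lambda>(s, k). kraus_vec m n r (L k) (v s)) t i))\<^sup>2)
    = (\<Sum>s\<in>S. \<Sum>k<q. \<Sum>i<l * n * r. (cmod (kraus_vec m n r (L k) (v s) i))\<^sup>2)"
    unfolding sum.cartesian_product[where A = S and B = "{..<q}" and
      g = "\<lambda>s k. \<Sum>i<l * n * r. (cmod (kraus_vec m n r (L k) (v s) i))\<^sup>2"] case_prod_unfold ..
  then show ?thesis unfolding kraus_vec_norm[OF assms(1)] .
qed

lemma pure_state_trace:
  "\<psi> \<bullet>c \<psi> = 1 \<Longrightarrow> mat_trace (pure_state \<psi>) = 1" "psd (pure_state \<psi>)"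
  "\<psi> \<in> carrier_vec n \<Longrightarrow> pure_state \<psi> \<in> carrier_mat n n"
proof -
  show "mat_trace (pure_state \<psi>) = 1" if "\<psi> \<bullet>c \<psi> = 1"
    using that cscalar_self[of \<psi>] unfolding pure_state_gram trace_gram by simp
  show "psd (pure_state \<psi>)" unfolding pure_state_gram by (rule psd_gram)
qed (simp add: pure_state_def)

text \<open>Decoupling of \<open>A\<^sub>1\<close> from \<open>R\<close> makes the state after the (subnormalized) encoding \<open>K\<close> and the
  target state have nearly equal reductions to \<open>A\<^sub>1 R\<close>, so that Bob can rotate one into the other.\<close>

lemma fqsw_protocol_exists:
  fixes \<psi> :: "complex vec" and K :: "complex mat" and dA dB dR a b :: nat and \<eta> x :: real
  assumes \<psi>: "\<psi> \<in> carrier_vec (dA * dB * dR)" "\<psi> \<bullet>c \<psi> = 1"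
    and ab: "0 < a" "0 < b" and K: "K \<in> carrier_mat (a * b) dA" "contr K"
  defines "\<rho>AR \<equiv> partial_trace dA dB dR (pure_state \<psi>)"
  defines "Z \<equiv> tensor_mat K (1\<^sub>m dR) * \<rho>AR * adj (tensor_mat K (1\<^sub>m dR))"
  assumes dec: "tn_le (partial_trace a b dR Z
      - tensor_mat ((1 / of_nat a) \<cdot>\<^sub>m 1\<^sub>m a) (partial_trace 1 dA dR \<rho>AR)) \<eta>"
    and x: "1 - Re (mat_trace Z) + \<eta> \<le> x" "0 \<le> x" "x \<le> 1"
  shows "\<exists>P. fqsw_protocol dA dB P \<and> dim_A1 P = a \<and> dim_A2 P = b \<and>
    fqsw_error_le (2 * sqrt x + x) dA dB dR \<psi> P"
proof -
  define D where "D = dA * dB * dR"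
  have psi1: "(\<Sum>i<D. (cmod (\<psi> $ i))\<^sup>2) = 1"
    using cscalar_self[of \<psi>] \<psi> unfolding D_def by (metis carrier_vecD of_real_eq_1_iff)
  have "D \<noteq> 0" using psi1 by (intro notI) simp
  then have pos: "0 < dA" "0 < dB" "0 < dR" unfolding D_def by auto
  \<comment> \<open>Amplitudes of \<psi> after \<open>K\<close>, with \<open>n\<close> the joint
    index of the two systems produced from A; \<open>\<phi>\<close> below is the same vector with a
    single index.\<close>
  define f where "f = (\<lambda>n \<beta> y. \<Sum>\<alpha><dA. K $$ (n, \<alpha>) * \<psi> $ ((\<alpha> * dB + \<beta>) * dR + y))"
  define \<phi> where "\<phi> = kraus_vec dA (a * b) (dB * dR) K (\<lambda>i. \<psi> $ i)"
  have \<phi>: "\<phi> ((n * dB + \<beta>) * dR + y) = f n \<beta> y" if "n < a * b" "\<beta> < dB" "y < dR" for n \<beta> y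
  proof -
    have e: "(n * dB + \<beta>) * dR + y = (0 * (a * b) + n) * (dB * dR) + (\<beta> * dR + y)"
      by (simp add: algebra_simps)
    have e': "(0 * dA + \<alpha>) * (dB * dR) + (\<beta> * dR + y) = (\<alpha> * dB + \<beta>) * dR + y" for \<alpha>
      by (simp add: algebra_simps)
    have "kraus_vec dA (a * b) (dB * dR) K (\<lambda>i. \<psi> $ i) ((0 * (a * b) + n) * (dB * dR) + (\<beta> * dR + y))
        = (\<Sum>\<alpha><dA. K $$ (n, \<alpha>) * \<psi> $ ((0 * dA + \<alpha>) * (dB * dR) + (\<beta> * dR + y)))"
      by (rule kraus_vec_index[of 0 1]) (use that index_less in auto)
    then show ?thesis unfolding \<phi>_def e f_def e' .
  qed
  have \<rho>: "\<rho>AR $$ (\<alpha> * dR + y, \<alpha>' * dR + y')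
      = (\<Sum>\<beta><dB. \<psi> $ ((\<alpha> * dB + \<beta>) * dR + y) * cnj (\<psi> $ ((\<alpha>' * dB + \<beta>) * dR + y')))"
    if "\<alpha> < dA" "\<alpha>' < dA" "y < dR" "y' < dR" for \<alpha> \<alpha>' y y'
    unfolding \<rho>AR_def partial_trace_index[OF that]
  proof (rule sum.cong[OF refl])
    fix \<beta> assume "\<beta> \<in> {..<dB}"
    then have "(\<alpha> * dB + \<beta>) * dR + y < dA * dB * dR" "(\<alpha>' * dB + \<beta>) * dR + y' < dA * dB * dR"
      using that by (intro index_less; simp)+
    then show "pure_state \<psi> $$ ((\<alpha> * dB + \<beta>) * dR + y, (\<alpha>' * dB + \<beta>) * dR + y')
      = \<psi> $ ((\<alpha> * dB + \<beta>) * dR + y) * cnj (\<psi> $ ((\<alpha>' * dB + \<beta>) * dR + y'))"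
      using \<psi>(1) by (simp add: pure_state_def)
  qed
  have \<rho>c: "\<rho>AR \<in> carrier_mat (dA * dR) (dA * dR)" unfolding \<rho>AR_def by simp
  have Kc: "tensor_mat K (1\<^sub>m dR) \<in> carrier_mat (a * b * dR) (dA * dR)" using K by auto
  have Zc: "Z \<in> carrier_mat (a * b * dR) (a * b * dR)"
    unfolding Z_def by (rule mult_carrier_mat[OF mult_carrier_mat[OF Kc \<rho>c] adj_carrier[OF Kc]])
  have Z: "Z $$ (n * dR + y, n' * dR + y') = (\<Sum>\<beta><dB. f n \<beta> y * cnj (f n' \<beta> y'))"
    if "n < a * b" "n' < a * b" "y < dR" "y' < dR" for n n' y y'
  proof -
    have "Z $$ (n * dR + y, n' * dR + y') = (\<Sum>\<alpha><dA. \<Sum>\<alpha>'<dA. \<Sum>\<beta><dB.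
        (K $$ (n, \<alpha>) * \<psi> $ ((\<alpha> * dB + \<beta>) * dR + y)) * cnj (K $$ (n', \<alpha>') * \<psi> $ ((\<alpha>' * dB + \<beta>) * dR + y')))"
      unfolding Z_def conj_tensor_one_index[OF K(1) \<rho>c that(1,3,2,4)]
      by (rule sum.cong[OF refl], rule sum.cong[OF refl]) (use that in \<open>simp add: \<rho> sum_distrib_left mult_ac\<close>)
    also have "\<dots> = (\<Sum>\<alpha><dA. \<Sum>\<beta><dB. \<Sum>\<alpha>'<dA.
        (K $$ (n, \<alpha>) * \<psi> $ ((\<alpha> * dB + \<beta>) * dR + y)) * cnj (K $$ (n', \<alpha>') * \<psi> $ ((\<alpha>' * dB + \<beta>) * dR + y')))"
      by (rule sum.cong[OF refl], rule sum.swap)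
    also have "\<dots> = (\<Sum>\<beta><dB. \<Sum>\<alpha><dA. \<Sum>\<alpha>'<dA.
        (K $$ (n, \<alpha>) * \<psi> $ ((\<alpha> * dB + \<beta>) * dR + y)) * cnj (K $$ (n', \<alpha>') * \<psi> $ ((\<alpha>' * dB + \<beta>) * dR + y')))"
      by (rule sum.swap)
    finally show ?thesis unfolding f_def cnj_sum sum_product .
  qed
  define \<theta> where "\<theta> = vec (a * a * D) (\<lambda>i. max_entangled_vec a $ (i div D) * \<psi> $ (i mod D))"
  define m where "m = a * dA * dB"
  define n where "n = a * m * dR"
  have n: "n = a * a * D" by (simp add: n_def m_def D_def)
  have \<theta>c: "\<theta> \<in> carrier_vec n" unfolding n by (simp add: \<theta>_def)
  have \<theta>: "\<theta> $ ((p * m + ((p' * dA + \<alpha>) * dB + \<beta>)) * dR + y)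
      = (if p = p' then complex_of_real (1 / sqrt (real a)) * \<psi> $ ((\<alpha> * dB + \<beta>) * dR + y) else 0)"
    if "p < a" "p' < a" "\<alpha> < dA" "\<beta> < dB" "y < dR" for p p' \<alpha> \<beta> y
  proof -
    have i: "(\<alpha> * dB + \<beta>) * dR + y < D" unfolding D_def using that by (intro index_less)
    have j: "p * a + p' < a * a" using that by (intro index_less)
    have e: "(p * m + ((p' * dA + \<alpha>) * dB + \<beta>)) * dR + y = (p * a + p') * D + ((\<alpha> * dB + \<beta>) * dR + y)"
      by (simp add: m_def D_def algebra_simps)
    have "(p * a + p') * D + ((\<alpha> * dB + \<beta>) * dR + y) < a * a * D" by (rule index_less[OF j i])
    moreover have "((p * a + p') * D + ((\<alpha> * dB + \<beta>) * dR + y)) div D = p * a + p'"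
      "((p * a + p') * D + ((\<alpha> * dB + \<beta>) * dR + y)) mod D = (\<alpha> * dB + \<beta>) * dR + y" using i by auto
    ultimately show ?thesis
      unfolding e \<theta>_def using j that by (simp add: max_entangled_vec_def)
  qed
  \<comment> \<open>Rows belong to the systems on which Bob's decoder acts or which it produces,
    columns to the pair \<open>A\<^sub>1 R\<close>. The conjugation makes \<open>adj MX * MX\<close>
    the reduced state itself instead of its transpose.\<close>
  define MX where "MX = mat (b * dB) (a * dR) (\<lambda>(c, u). cnj (\<phi> ((u div dR * (b * dB) + c) * dR + u mod dR)))"
  define MY where "MY = mat m (a * dR) (\<lambda>(c, u). cnj (\<theta> $ ((u div dR * m + c) * dR + u mod dR)))"
  have MX: "MX \<in> carrier_mat (b * dB) (a * dR)" and MY: "MY \<in> carrier_mat m (a * dR)"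
    by (simp_all add: MX_def MY_def)
  have MXi: "MX $$ (c, p * dR + y) = cnj (\<phi> ((p * (b * dB) + c) * dR + y))"
    if "c < b * dB" "p < a" "y < dR" for c p y
    using that index_less[OF that(2,3)] by (simp add: MX_def)
  have MYi: "MY $$ (c, p * dR + y) = cnj (\<theta> $ ((p * m + c) * dR + y))"
    if "c < m" "p < a" "y < dR" for c p y
    using that index_less[OF that(2,3)] by (simp add: MY_def)
  have XX: "adj MX * MX = partial_trace a b dR Z"
  proof (rule eq_mat_tensorI[of _ a dR a dR])
    fix p y p' y' assume h: "p < a" "y < dR" "p' < a" "y' < dR"
    have u: "p * dR + y < a * dR" "p' * dR + y' < a * dR" using h index_less by auto
    have "(adj MX * MX) $$ (p * dR + y, p' * dR + y') = (\<Sum>q<b. \<Sum>\<beta><dB. f (p * b + q) \<beta> y * cnj (f (p' * b + q) \<beta> y'))"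
      unfolding mult_index_sum[OF adj_carrier[OF MX] MX u] sum_nat_mult
    proof (rule sum.cong[OF refl], rule sum.cong[OF refl])
      fix q \<beta> assume "q \<in> {..<b}" "\<beta> \<in> {..<dB}"
      then have q: "q < b" "\<beta> < dB" by auto
      have c: "q * dB + \<beta> < b * dB" by (rule index_less[OF q])
      have e: "p * (b * dB) + (q * dB + \<beta>) = (p * b + q) * dB + \<beta>" for p by (simp add: algebra_simps)
      show "adj MX $$ (p * dR + y, q * dB + \<beta>) * MX $$ (q * dB + \<beta>, p' * dR + y') = f (p * b + q) \<beta> y * cnj (f (p' * b + q) \<beta> y')"
        unfolding adj_index_carrier[OF MX u(1) c] MXi[OF c h(1,2)] MXi[OF c h(3,4)] e
          \<phi>[OF index_less[OF h(1) q(1)] q(2) h(2)] \<phi>[OF index_less[OF h(3) q(1)] q(2) h(4)] by simp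
    qed
    also have "\<dots> = partial_trace a b dR Z $$ (p * dR + y, p' * dR + y')"
      unfolding partial_trace_index[OF h(1,3,2,4)]
      by (rule sum.cong[OF refl]) (use h index_less in \<open>simp add: Z\<close>)
    finally show "(adj MX * MX) $$ (p * dR + y, p' * dR + y') = partial_trace a b dR Z $$ (p * dR + y, p' * dR + y')" .
  qed (use MX in \<open>auto intro: mult_carrier_mat\<close>)
  define \<pi> where "\<pi> = ((1 / of_nat a) \<cdot>\<^sub>m 1\<^sub>m a :: complex mat)"
  define \<rho>R where "\<rho>R = partial_trace 1 dA dR \<rho>AR"
  have \<pi>: "\<pi> \<in> carrier_mat a a" by (simp add: \<pi>_def)
  have \<rho>R: "\<rho>R \<in> carrier_mat dR dR" unfolding \<rho>R_def using partial_trace_carrier[of 1 dA dR] by simp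
  have YY: "adj MY * MY = tensor_mat \<pi> \<rho>R"
  proof (rule eq_mat_tensorI[of _ a dR a dR])
    fix p y p' y' assume h: "p < a" "y < dR" "p' < a" "y' < dR"
    have u: "p * dR + y < a * dR" "p' * dR + y' < a * dR" using h index_less by auto
    have sq: "complex_of_real (1 / sqrt (real a)) * complex_of_real (1 / sqrt (real a)) = 1 / of_nat a"
      unfolding of_real_mult[symmetric] using ab(1) by (simp add: real_sqrt_mult_self)
    have "(adj MY * MY) $$ (p * dR + y, p' * dR + y')
      = (\<Sum>p''<a. if p'' = p then (if p = p' then (1 / of_nat a) * (\<Sum>\<alpha><dA. \<Sum>\<beta><dB.
          \<psi> $ ((\<alpha> * dB + \<beta>) * dR + y) * cnj (\<psi> $ ((\<alpha> * dB + \<beta>) * dR + y'))) else 0) else 0)"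
      unfolding mult_index_sum[OF adj_carrier[OF MY] MY u] unfolding m_def sum_nat_mult unfolding m_def[symmetric]
    proof (rule sum.cong[OF refl])
      fix p'' assume "p'' \<in> {..<a}"
      then have p'': "p'' < a" by auto
      have t: "adj MY $$ (p * dR + y, (p'' * dA + \<alpha>) * dB + \<beta>) * MY $$ ((p'' * dA + \<alpha>) * dB + \<beta>, p' * dR + y')
        = (if p'' = p then (if p = p' then (1 / of_nat a) *
          (\<psi> $ ((\<alpha> * dB + \<beta>) * dR + y) * cnj (\<psi> $ ((\<alpha> * dB + \<beta>) * dR + y'))) else 0) else 0)"
        if q: "\<alpha> < dA" "\<beta> < dB" for \<alpha> \<beta>
      proof -
        have c: "(p'' * dA + \<alpha>) * dB + \<beta> < m" unfolding m_def using p'' q by (intro index_less)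
        show ?thesis
          unfolding adj_index_carrier[OF MY u(1) c] MYi[OF c h(1,2)] MYi[OF c h(3,4)]
            \<theta>[OF h(1) p'' q h(2)] \<theta>[OF h(3) p'' q h(4)] sq[symmetric] by simp
      qed
      show "(\<Sum>\<alpha><dA. \<Sum>\<beta><dB. adj MY $$ (p * dR + y, (p'' * dA + \<alpha>) * dB + \<beta>) * MY $$ ((p'' * dA + \<alpha>) * dB + \<beta>, p' * dR + y'))
        = (if p'' = p then (if p = p' then (1 / of_nat a) * (\<Sum>\<alpha><dA. \<Sum>\<beta><dB.
          \<psi> $ ((\<alpha> * dB + \<beta>) * dR + y) * cnj (\<psi> $ ((\<alpha> * dB + \<beta>) * dR + y'))) else 0) else 0)"
        by (simp add: t sum_distrib_left)
    qed
    also have "\<dots> = (if p = p' then (1 / of_nat a) * (\<Sum>\<alpha><dA. \<Sum>\<beta><dB.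
          \<psi> $ ((\<alpha> * dB + \<beta>) * dR + y) * cnj (\<psi> $ ((\<alpha> * dB + \<beta>) * dR + y'))) else 0)"
      using h by simp
    also have "\<dots> = tensor_mat \<pi> \<rho>R $$ (p * dR + y, p' * dR + y')"
    proof -
      have "\<rho>R $$ (y, y') = (\<Sum>\<alpha><dA. \<Sum>\<beta><dB.
          \<psi> $ ((\<alpha> * dB + \<beta>) * dR + y) * cnj (\<psi> $ ((\<alpha> * dB + \<beta>) * dR + y')))"
        using partial_trace_index[of 0 1 0 y dR y' dA \<rho>AR] h unfolding \<rho>R_def by (simp add: \<rho>)
      then show ?thesis
        unfolding tensor_index[OF \<pi> \<rho>R h] using h by (simp add: \<pi>_def)
    qed
    finally show "(adj MY * MY) $$ (p * dR + y, p' * dR + y') = tensor_mat \<pi> \<rho>R $$ (p * dR + y, p' * dR + y')" .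
  qed (use MY \<pi> \<rho>R in \<open>auto intro: mult_carrier_mat\<close>)
  have hX: "hs_sq MX = Re (mat_trace Z)"
    using trace_adj_mult[of MX] unfolding XX trace_partial_trace[OF Zc] by simp
  have hY: "hs_sq MY = 1"
  proof -
    have "mat_trace \<rho>R = mat_trace \<rho>AR"
      unfolding \<rho>R_def by (rule trace_partial_trace) (use \<rho>c in simp)
    also have "\<dots> = 1"
      unfolding \<rho>AR_def trace_partial_trace[OF pure_state_trace(3)[OF \<psi>(1)]] by (rule pure_state_trace(1)[OF \<psi>(2)])
    finally have "mat_trace (tensor_mat \<pi> \<rho>R) = 1"
      unfolding trace_tensor[OF \<pi> \<rho>R] using ab(1) by (simp add: \<pi>_def mat_trace_def)
    then show ?thesis using trace_adj_mult[of MY] unfolding YY by simp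
  qed
  have "tn_le (adj MX * MX - adj MY * MY) \<eta>"
    using dec unfolding XX YY \<pi>_def \<rho>R_def .
  from uhlmann_contr[OF MX MY this] obtain W g where W: "W \<in> carrier_mat m (b * dB)" "contr W"
    and g: "mat_trace (W * MX * adj MY) = complex_of_real g" "(hs_sq MX + hs_sq MY - \<eta>) / 2 \<le> g" by blast
  \<comment> \<open>The squared norms are tr Z and 1, so Uhlmann's bound is (tr Z + 1 - \<eta>) / 2
    = 1 - (1 - tr Z + \<eta>) / 2.\<close>
  have g1: "1 - x / 2 \<le> g" using g(2) x(1) unfolding hX hY by (simp add: field_simps)
  \<comment> \<open>Undoes the conjugation of the amplitudes: the overlap achieved by
    \<open>Wc\<close> is the conjugate of the trace for \<open>W\<close>, that is, the same real
    number \<open>g\<close>.\<close>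
  define Wc where "Wc = map_mat cnj W"
  have Wc: "Wc \<in> carrier_mat m (b * dB)" "contr Wc"
    unfolding Wc_def using W contr_cnj[OF W(2,1)] by auto
  have mpos: "0 < m" using ab pos by (simp add: m_def)
  \<comment> \<open>In both channels, Kraus operator 0 is the wanted contraction. The branch
    labelled 0 twice carries the overlap \<open>g\<close>; all other branches are counted as
    loss.\<close>
  obtain q1 L1 where L1: "kraus_complete dA (a * b) (Suc q1) L1" "L1 0 = K"
    using contr_kraus_complete[OF K(2,1)] ab by auto
  obtain q2 L2 where L2: "kraus_complete (b * dB) m (Suc q2) L2" "L2 0 = Wc"
    using contr_kraus_complete[OF Wc(2,1) mpos] by auto
  define P where "P = \<lparr>dim_A1 = a, dim_A2 = b, encoder = kraus_map dA (a * b) (Suc q1) L1,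
    decoder = kraus_map (b * dB) m (Suc q2) L2\<rparr>"
  have prot: "fqsw_protocol dA dB P"
    unfolding fqsw_protocol_def P_def using ab cptp_kraus_map[OF L1(1)] cptp_kraus_map[OF L2(1)] by (simp add: m_def)
  define S1 where "S1 = {()} \<times> {..<Suc q1}"
  define v1 where "v1 = (\<lambda>(s :: unit, k). kraus_vec dA (a * b) (dB * dR) (L1 k) (\<lambda>i. \<psi> $ i))"
  define S2 where "S2 = S1 \<times> {..<Suc q2}"
  define v2 where "v2 = (\<lambda>(s, k). kraus_vec (b * dB) m dR (L2 k) (v1 s))"
  have fin: "finite S1" "finite S2" by (simp_all add: S1_def S2_def)
  have final: "fqsw_final_state dA dB dR P (pure_state \<psi>) = gram n S2 v2"
  proof -
    have "pure_state \<psi> = gram (1 * dA * (dB * dR)) {()} (\<lambda>_ i. \<psi> $ i)"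
      unfolding pure_state_gram using \<psi>(1) by (simp add: mult.assoc)
    then have "extend_map 1 dA (a * b) (dB * dR) (kraus_map dA (a * b) (Suc q1) L1) (pure_state \<psi>)
        = gram (1 * (a * b) * (dB * dR)) S1 v1"
      unfolding S1_def v1_def by (simp only: extend_kraus_map_gram[OF finite.insertI[OF finite.emptyI]])
    also have "1 * (a * b) * (dB * dR) = a * (b * dB) * dR" by simp
    finally show ?thesis
      unfolding fqsw_final_state_def P_def n_def S2_def v2_def
      by (simp add: extend_kraus_map_gram[OF fin(1)] m_def del: One_nat_def)
  qed
  have norm: "(\<Sum>s\<in>S2. \<Sum>i<n. (cmod (v2 s i))\<^sup>2) = 1"
  proof -
    have "(\<Sum>s\<in>S2. \<Sum>i<n. (cmod (v2 s i))\<^sup>2) = (\<Sum>s\<in>S1. \<Sum>i<a * (b * dB) * dR. (cmod (v1 s i))\<^sup>2)"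
      unfolding n_def S2_def v2_def by (rule gram_norm_kraus[OF L2(1) fin(1)])
    also have "\<dots> = (\<Sum>s\<in>S1. \<Sum>i<1 * (a * b) * (dB * dR). (cmod (v1 s i))\<^sup>2)"
    proof -
      have e: "1 * (a * b) * (dB * dR) = a * (b * dB) * dR" by simp
      show ?thesis unfolding e ..
    qed
    also have "\<dots> = (\<Sum>s\<in>{()}. \<Sum>i<1 * dA * (dB * dR). (cmod (\<psi> $ i))\<^sup>2)"
      unfolding S1_def v1_def by (rule gram_norm_kraus[OF L1(1)]) simp
    also have "\<dots> = 1" using psi1 by (simp add: D_def mult.assoc)
    finally show ?thesis .
  qed
  have \<theta>1: "(\<Sum>i<n. (cmod (\<theta> $ i))\<^sup>2) = 1"
  proof -
    have "(\<Sum>i<n. (cmod (\<theta> $ i))\<^sup>2) = (\<Sum>c<m. \<Sum>p<a. \<Sum>y<dR. (cmod (\<theta> $ ((p * m + c) * dR + y)))\<^sup>2)"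
      unfolding n_def sum_nat_mult by (rule sum.swap)
    also have "\<dots> = hs_sq MY"
      unfolding hs_sq_def carrier_matD[OF MY] sum_nat_mult
      by (rule sum.cong[OF refl], rule sum.cong[OF refl], rule sum.cong[OF refl]) (simp add: MYi)
    finally show ?thesis unfolding hY .
  qed
  have ov: "(\<Sum>i<n. cnj (\<theta> $ i) * v2 (((), 0), 0) i) = complex_of_real g"
  proof -
    have v2: "v2 (((), 0), 0) = kraus_vec (b * dB) m dR Wc \<phi>"
      by (simp add: v2_def v1_def L1(2) L2(2) \<phi>_def)
    have "(\<Sum>i<n. cnj (\<theta> $ i) * v2 (((), 0), 0) i)
      = (\<Sum>c<m. \<Sum>p<a. \<Sum>y<dR. cnj (\<theta> $ ((p * m + c) * dR + y)) * kraus_vec (b * dB) m dR Wc \<phi> ((p * m + c) * dR + y))"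
      unfolding v2 n_def sum_nat_mult by (rule sum.swap)
    also have "\<dots> = (\<Sum>c<m. \<Sum>u<a * dR. cnj ((W * MX) $$ (c, u) * adj MY $$ (u, c)))"
      unfolding sum_nat_mult
    proof (rule sum.cong[OF refl], rule sum.cong[OF refl], rule sum.cong[OF refl])
      fix c p y assume "c \<in> {..<m}" "p \<in> {..<a}" "y \<in> {..<dR}"
      then have h: "c < m" "p < a" "y < dR" by auto
      have u: "p * dR + y < a * dR" by (rule index_less[OF h(2,3)])
      have "(W * MX) $$ (c, p * dR + y) = (\<Sum>e<b * dB. W $$ (c, e) * cnj (\<phi> ((p * (b * dB) + e) * dR + y)))"
        unfolding mult_index_sum[OF W(1) MX h(1) u]
        by (rule sum.cong[OF refl]) (use h in \<open>simp add: MXi\<close>)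
      moreover have "kraus_vec (b * dB) m dR Wc \<phi> ((p * m + c) * dR + y)
          = (\<Sum>e<b * dB. cnj (W $$ (c, e)) * \<phi> ((p * (b * dB) + e) * dR + y))"
        unfolding kraus_vec_index[OF h(2,1,3)]
        by (rule sum.cong[OF refl]) (use h W(1) in \<open>simp add: Wc_def\<close>)
      ultimately show "cnj (\<theta> $ ((p * m + c) * dR + y)) * kraus_vec (b * dB) m dR Wc \<phi> ((p * m + c) * dR + y)
        = cnj ((W * MX) $$ (c, p * dR + y) * adj MY $$ (p * dR + y, c))"
        unfolding adj_index_carrier[OF MY u h(1)] MYi[OF h] by simp
    qed
    also have "\<dots> = cnj (mat_trace (W * MX * adj MY))"
      unfolding trace_mult_sum[OF mult_carrier_mat[OF W(1) MX] adj_carrier[OF MY]] cnj_sum ..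
    finally show ?thesis unfolding g(1) by simp
  qed
  have "tn_le (pure_state \<theta> - gram n S2 v2) (2 * sqrt x + x)"
  proof (rule tn_le_pure_minus_gram[OF fin(2) _ norm \<theta>c \<theta>1 _ x(2,3)])
    show "(((), 0), 0) \<in> S2" by (simp add: S1_def S2_def)
    show "1 - x / 2 \<le> Re (\<Sum>i<n. cnj (\<theta> $ i) * v2 (((), 0), 0) i)" unfolding ov using g1 by simp
  qed
  from trace_norm_le[OF this minus_carrier_mat[OF gram_carrier]]
  have "trace_norm (pure_state \<theta> - gram n S2 v2) \<le> 2 * sqrt x + x" .
  moreover have "tensor_mat (pure_state (max_entangled_vec a)) (pure_state \<psi>) = pure_state \<theta>"
    unfolding tensor_pure_state \<theta>_def using \<psi>(1) by (simp add: max_entangled_vec_def D_def)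
  moreover have "dim_A1 P = a" "dim_A2 P = b" by (simp_all add: P_def)
  ultimately show ?thesis using prot unfolding fqsw_error_le_def by (intro exI[of _ P]) (simp add: final)
qed

subsection \<open>Entropies\<close>

text \<open>Each index contributes a matrix with product entries, hence of rank at most 1, and the
  rank is subadditive.\<close>

lemma rank_spectral_projection_le:
  assumes "U \<in> carrier_mat n n" "finite J" "J \<subseteq> {..<n}"
  shows "vec_space.rank n (U * rdiag n (\<lambda>i. if i \<in> J then 1 else 0) * adj U) \<le> card J"
  using assms(2,3)
proof (induction J rule: finite_induct)
  case empty
  have "rdiag n (\<lambda>i. if i \<in> {} then 1 else 0) = 0\<^sub>m n n" by (rule eq_matI) (auto simp: rdiag_def)
  then have "U * rdiag n (\<lambda>i. if i \<in> {} then 1 else 0) * adj U = 0\<^sub>m n n" using assms(1) by simp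
  then show ?case by (simp only: vec_space.rank_0I card.empty)
next
  case (insert j J)
  have Uc: "U * rdiag n f * adj U \<in> carrier_mat n n" for f using assms(1) by auto
  note d = carrier_matD[OF assms(1)]
  define E where "E = U * rdiag n (\<lambda>i. if i = j then 1 else 0) * adj U"
  have "rdiag n (\<lambda>i. if i \<in> insert j J then 1 else 0)
      = rdiag n (\<lambda>i. if i = j then 1 else 0) + rdiag n (\<lambda>i. if i \<in> J then 1 else 0)"
    using insert.hyps by (intro eq_matI) (auto simp: rdiag_def)
  then have e: "U * rdiag n (\<lambda>i. if i \<in> insert j J then 1 else 0) * adj U
      = E + U * rdiag n (\<lambda>i. if i \<in> J then 1 else 0) * adj U"
    unfolding E_def by (simp add: mat_ring d)
  have "vec_space.rank n E \<le> 1"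
  proof (rule vec_space.rank_le_1_product_entries[of _ n n "\<lambda>r. U $$ (r, j)" "\<lambda>c. cnj (U $$ (c, j))"])
    show "E \<in> carrier_mat n n" unfolding E_def by (rule Uc)
    fix r c assume "r < dim_row E" "c < dim_col E"
    then have rc: "r < n" "c < n" by (simp_all add: E_def d)
    have 1: "(U * rdiag n (\<lambda>i. if i = j then 1 else 0)) $$ (r, k) = (if k = j then U $$ (r, j) else 0)" if "k < n" for k
    proof -
      have "(U * rdiag n (\<lambda>i. if i = j then 1 else 0)) $$ (r, k) = (\<Sum>i<n. if i = j then (if k = j then U $$ (r, j) else 0) else 0)"
        unfolding mult_index_sum[OF assms(1) rdiag_dim(3) rc(1) that]
        by (rule sum.cong[OF refl]) (use that in \<open>auto simp: rdiag_def\<close>)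
      then show ?thesis using insert.prems by simp
    qed
    have "E $$ (r, c) = (\<Sum>k<n. if k = j then U $$ (r, j) * cnj (U $$ (c, j)) else 0)"
      unfolding E_def mult_index_sum[OF mult_carrier_mat[OF assms(1) rdiag_dim(3)] adj_carrier[OF assms(1)] rc]
      by (rule sum.cong[OF refl]) (use rc in \<open>simp add: 1 adj_index_carrier[OF assms(1)] del: adj_index\<close>)
    then show "E $$ (r, c) = U $$ (r, j) * cnj (U $$ (c, j))" using insert.prems by simp
  qed
  then show ?case
    unfolding e using vec_space.rank_subadditive[of E n n "U * rdiag n (\<lambda>i. if i \<in> J then 1 else 0) * adj U"]
      insert.IH insert.prems insert.hyps Uc unfolding E_def by fastforce
qed

text \<open>Adding the spectral projection \<open>B\<close> onto the kernel makes \<open>A\<close>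
  invertible, with inverse \<open>X\<close>. So n is at most the rank of \<open>A\<close> plus the
  rank of \<open>B\<close>, and the latter is at most the number of vanishing eigenvalues.\<close>

lemma card_eigenvalues_le_rank:
  assumes "U \<in> carrier_mat n n" "adj U * U = 1\<^sub>m n" "U * adj U = 1\<^sub>m n" "A = U * rdiag n l * adj U"
  shows "card {i. i < n \<and> l i \<noteq> 0} \<le> mat_rank A"
proof -
  define J where "J = {i. i < n \<and> l i = 0}"
  define B where "B = U * rdiag n (\<lambda>i. if i \<in> J then 1 else 0) * adj U"
  define X where "X = U * rdiag n (\<lambda>i. if i \<in> J then 1 else 1 / l i) * adj U"
  note d = carrier_matD[OF assms(1)]
  have Uc: "U * rdiag n f * adj U \<in> carrier_mat n n" for f using assms(1) by auto
  have A: "A \<in> carrier_mat n n" and B: "B \<in> carrier_mat n n" and X: "X \<in> carrier_mat n n"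
    unfolding assms(4) B_def X_def by (rule Uc)+
  have "rdiag n l + rdiag n (\<lambda>i. if i \<in> J then 1 else 0) = rdiag n (\<lambda>i. if i \<in> J then 1 else l i)"
    by (rule eq_matI) (auto simp: rdiag_def J_def)
  then have AB: "A + B = U * rdiag n (\<lambda>i. if i \<in> J then 1 else l i) * adj U"
    unfolding assms(4) B_def by (simp add: mat_ring d flip: mat_times_add mat_add_times)
  have "X * (A + B) = U * (rdiag n (\<lambda>i. if i \<in> J then 1 else 1 / l i)
      * ((adj U * U) * (rdiag n (\<lambda>i. if i \<in> J then 1 else l i) * adj U)))"
    unfolding AB X_def by (simp add: mat_ring d)
  also have "\<dots> = U * ((rdiag n (\<lambda>i. if i \<in> J then 1 else 1 / l i) * rdiag n (\<lambda>i. if i \<in> J then 1 else l i)) * adj U)"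
    unfolding assms(2) by (simp add: mat_ring d)
  also have "rdiag n (\<lambda>i. if i \<in> J then 1 else 1 / l i) * rdiag n (\<lambda>i. if i \<in> J then 1 else l i) = 1\<^sub>m n"
    unfolding rdiag_mult by (rule eq_matI) (auto simp: rdiag_def J_def)
  finally have "X * (A + B) = 1\<^sub>m n" using assms(1,3) by (simp add: mat_ring)
  then have "det X * det (A + B) = 1"
    using det_mult[OF X add_carrier_mat[OF B], of A] by simp
  then have "det (A + B) \<noteq> 0" by auto
  then have "vec_space.rank n (A + B) = n"
    using vec_space.det_rank_iff[OF add_carrier_mat[OF B], of A] by simp
  moreover have "vec_space.rank n (A + B) \<le> vec_space.rank n A + vec_space.rank n B"
    by (rule vec_space.rank_subadditive[OF A B])
  moreover have "vec_space.rank n B \<le> card J"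
    unfolding B_def by (rule rank_spectral_projection_le[OF assms(1)]) (auto simp: J_def)
  moreover have "card {i. i < n \<and> l i \<noteq> 0} + card J = n"
  proof -
    have "card ({i. i < n \<and> l i \<noteq> 0} \<union> J) = card {i. i < n \<and> l i \<noteq> 0} + card J"
      by (rule card_Un_disjoint) (auto simp: J_def)
    moreover have "{i. i < n \<and> l i \<noteq> 0} \<union> J = {..<n}" by (auto simp: J_def)
    ultimately show ?thesis by simp
  qed
  ultimately show ?thesis using A by (simp add: mat_rank_def)
qed

lemma elog2_real: "0 < x \<Longrightarrow> elog2 (ereal x) = ereal (log 2 x)"
  by (simp add: elog2_def)

lemma elog2_mono: "x \<le> y \<Longrightarrow> elog2 x \<le> elog2 y"
  by (cases x; cases y) (auto simp: elog2_def)

text \<open>The map T applies the root of \<open>Q\<close>, rotates to an eigenbasis of the cut-off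
  operator \<open>A\<close>, and keeps the coordinates with nonzero eigenvalue. Nothing of
  \<open>A\<close> is lost, so the remaining weight is tr A = tr \<open>Q * \<rho>\<close>.\<close>

lemma compression:
  assumes \<rho>: "\<rho> \<in> carrier_mat a a" and Q: "Q \<in> carrier_mat a a" "psd Q" "psd (1\<^sub>m a - Q)"
    and "psd \<rho>"
  shows "\<exists>T \<in> carrier_mat (mat_rank (psd_sqrt Q * \<rho> * psd_sqrt Q)) a.
    contr T \<and> mat_trace (T * \<rho> * adj T) = mat_trace (Q * \<rho>)"
proof -
  note R = psd_sqrt[OF Q(2,1)]
  define A where "A = psd_sqrt Q * \<rho> * psd_sqrt Q"
  have A: "A \<in> carrier_mat a a" "psd A"
    using psd_conj[OF assms(5) \<rho> R(3)] mult_carrier_mat[OF mult_carrier_mat[OF R(3) \<rho>] R(3)]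
    unfolding A_def R(4) by auto
  obtain U l where U: "U \<in> carrier_mat a a" "adj U * U = 1\<^sub>m a" "U * adj U = 1\<^sub>m a" and AU: "A = U * rdiag a l * adj U"
    using psd_diagonalization[OF A(2,1)] by blast
  define I where "I = {i. i < a \<and> l i \<noteq> 0}"
  define d where "d = mat_rank A"
  have Id: "card I \<le> d" unfolding I_def d_def by (rule card_eigenvalues_le_rank[OF U AU])
  have finI: "finite I" by (simp add: I_def)
  obtain e where e: "bij_betw e {..<card I} I"
    using ex_bij_betw_nat_finite[OF finI] by (auto simp: lessThan_atLeast0)
  \<comment> \<open>Only card I \<le> d has been established, so rows of \<open>S\<close> with index
    at least card I are set to 0.\<close>
  define S where "S = mat d a (\<lambda>(k, j). if k < card I \<and> j = e k then 1 else 0 :: complex)"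
  have S: "S \<in> carrier_mat d a" by (simp add: S_def)
  have SS: "adj S * S = rdiag a (\<lambda>i. if i \<in> I then 1 else 0)"
  proof (rule eq_matI)
    fix i j assume "i < dim_row (rdiag a (\<lambda>i. if i \<in> I then 1 else 0))" "j < dim_col (rdiag a (\<lambda>i. if i \<in> I then 1 else 0))"
    then have ij: "i < a" "j < a" by auto
    have "(adj S * S) $$ (i, j) = (\<Sum>k<d. if k < card I then (if e k = i then (if i = j then 1 else 0) else 0) else 0)"
      unfolding mult_index_sum[OF adj_carrier[OF S] S ij]
      by (rule sum.cong[OF refl]) (use ij in \<open>auto simp: S_def\<close>)
    also have "\<dots> = (\<Sum>k<card I. if e k = i then (if i = j then 1 else 0) else 0)"
      using Id by (intro sum.mono_neutral_cong_right) auto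
    also have "\<dots> = (\<Sum>y\<in>I. if y = i then (if i = j then 1 else 0) else 0)"
      by (rule sum.reindex_bij_betw[OF e])
    also have "\<dots> = rdiag a (\<lambda>i. if i \<in> I then 1 else 0) $$ (i, j)"
      using ij finI by (simp add: rdiag_def)
    finally show "(adj S * S) $$ (i, j) = rdiag a (\<lambda>i. if i \<in> I then 1 else 0) $$ (i, j)" .
  qed (use S in auto)
  have cS: "contr S"
  proof -
    have "1\<^sub>m a - adj S * S = rdiag a (\<lambda>i. if i \<in> I then 0 else 1)"
      unfolding SS by (rule eq_matI) (auto simp: rdiag_def)
    then show ?thesis using S psd_rdiag[of a "\<lambda>i. if i \<in> I then 0 else 1"] by (simp add: contr_def)
  qed
  have cU: "contr (adj U)" by (rule contr_isometry[OF adj_carrier[OF U(1)]]) (simp add: U(3))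
  have cR: "contr (psd_sqrt Q)" unfolding contr_def R(4) R(2) carrier_matD[OF R(3)] by (rule Q(3))
  define T where "T = S * (adj U * psd_sqrt Q)"
  have UR: "adj U * psd_sqrt Q \<in> carrier_mat a a" by (rule mult_carrier_mat[OF adj_carrier[OF U(1)] R(3)])
  have T: "T \<in> carrier_mat d a" unfolding T_def by (rule mult_carrier_mat[OF S UR])
  have cT: "contr T"
    unfolding T_def by (rule contr_mult[OF cS contr_mult[OF cU cR adj_carrier[OF U(1)] R(3)] S UR])
  note dd = carrier_matD[OF S] carrier_matD[OF U(1)] carrier_matD[OF R(3)] carrier_matD[OF \<rho>]
  have "T * \<rho> * adj T = S * (adj U * A * U) * adj S"
    unfolding T_def A_def by (simp add: mat_ring dd R(4))
  also have "adj U * A * U = (adj U * U) * rdiag a l * (adj U * U)"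
    unfolding AU by (simp add: mat_ring dd)
  also have "\<dots> = rdiag a l" unfolding U(2) by (simp add: mat_ring)
  finally have TT: "T * \<rho> * adj T = (S * rdiag a l) * adj S" .
  have "mat_trace (T * \<rho> * adj T) = mat_trace (adj S * (S * rdiag a l))"
    unfolding TT by (rule trace_mult_comm[OF mult_carrier_mat[OF S rdiag_dim(3)] adj_carrier[OF S]])
  also have "adj S * (S * rdiag a l) = rdiag a (\<lambda>i. if i \<in> I then 1 else 0) * rdiag a l"
    unfolding SS[symmetric] by (simp add: mat_ring dd)
  also have "\<dots> = rdiag a l" unfolding rdiag_mult by (rule eq_matI) (auto simp: rdiag_def I_def)
  also have "mat_trace (rdiag a l) = mat_trace (rdiag a l * (adj U * U))"
    unfolding U(2) by (simp add: mat_ring)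
  also have "rdiag a l * (adj U * U) = (rdiag a l * adj U) * U" by (simp add: mat_ring dd)
  also have "mat_trace \<dots> = mat_trace (U * (rdiag a l * adj U))"
    by (rule trace_mult_comm[OF mult_carrier_mat[OF rdiag_dim(3) adj_carrier[OF U(1)]] U(1)])
  also have "U * (rdiag a l * adj U) = A" unfolding AU by (simp add: mat_ring dd)
  also have "mat_trace A = mat_trace (psd_sqrt Q * (psd_sqrt Q * \<rho>))"
    unfolding A_def by (rule trace_mult_comm[OF mult_carrier_mat[OF R(3) \<rho>] R(3)])
  also have "psd_sqrt Q * (psd_sqrt Q * \<rho>) = Q * \<rho>"
    by (subst (3) R(2)[symmetric]) (simp add: mat_ring dd)
  finally show ?thesis using T cT unfolding d_def A_def by blast
qed

text \<open>The infimum is attained, because it ranges over logarithms of natural numbers: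
  \<open>d\<close> is the least rank that occurs. It is positive since \<delta> < 1 leaves some
  weight.\<close>

lemma H_0_smooth_compression:
  assumes "\<rho> \<in> states a" "0 \<le> \<delta>" "\<delta> < 1"
  shows "\<exists>d T. 1 \<le> d \<and> H_0_smooth \<delta> a \<rho> = ereal (log 2 (real d)) \<and> T \<in> carrier_mat d a \<and> contr T
    \<and> 1 - \<delta> \<le> Re (mat_trace (T * \<rho> * adj T))"
proof -
  have \<rho>: "\<rho> \<in> carrier_mat a a" "psd \<rho>" "mat_trace \<rho> = 1" using assms(1) by (auto simp: states_def)
  define F where "F = {Q \<in> carrier_mat a a. op_le (0\<^sub>m a a) Q \<and> op_le Q (1\<^sub>m a) \<and> Re (mat_trace (Q * \<rho>)) \<ge> 1 - \<delta>}"
  define rk where "rk = (\<lambda>Q. mat_rank (psd_sqrt Q * \<rho> * psd_sqrt Q))"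
  have rk: "mat_rank (psd_sqrt Q * \<rho> * psd_sqrt Q) = rk Q" for Q by (simp add: rk_def)
  have z: "1\<^sub>m a - 1\<^sub>m a = (0\<^sub>m a a :: complex mat)" by (rule eq_matI) auto
  have "psd (1\<^sub>m a - 1\<^sub>m a)" unfolding z by simp
  moreover have "1\<^sub>m a - 0\<^sub>m a a = (1\<^sub>m a :: complex mat)" by (rule eq_matI) auto
  ultimately have "1\<^sub>m a \<in> F" using assms(2) \<rho> by (simp add: F_def op_le_def)
  then have ne: "\<exists>r. r \<in> rk ` F" by blast
  define d where "d = (LEAST r. r \<in> rk ` F)"
  obtain Q where Q: "Q \<in> F" "rk Q = d"
    using LeastI_ex[OF ne] unfolding d_def by auto
  have min: "d \<le> rk Q'" if "Q' \<in> F" for Q'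
    unfolding d_def by (rule Least_le) (use that in auto)
  have H: "H_0_smooth \<delta> a \<rho> = elog2 (ereal (real d))"
    unfolding H_0_smooth_def F_def[symmetric] rk
  proof (rule antisym)
    show "(INF Q\<in>F. elog2 (ereal (real (rk Q)))) \<le> elog2 (ereal (real d))"
      using INF_lower[OF Q(1), of "\<lambda>Q. elog2 (ereal (real (rk Q)))"] unfolding Q(2) .
    show "elog2 (ereal (real d)) \<le> (INF Q\<in>F. elog2 (ereal (real (rk Q))))"
      by (rule INF_greatest) (use min in \<open>auto intro!: elog2_mono\<close>)
  qed
  have Qc: "Q \<in> carrier_mat a a" "psd (Q - 0\<^sub>m a a)" "psd (1\<^sub>m a - Q)" "1 - \<delta> \<le> Re (mat_trace (Q * \<rho>))"
    using Q(1) unfolding F_def op_le_def mem_Collect_eq by blast+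
  have "Q - 0\<^sub>m a a = Q" by (rule eq_matI) (use Qc(1) in simp_all)
  then have "psd Q" using Qc(2) by (simp only:)
  from compression[OF \<rho>(1) Qc(1) this Qc(3) \<rho>(2)] obtain T where
    T: "T \<in> carrier_mat d a" "contr T" "mat_trace (T * \<rho> * adj T) = mat_trace (Q * \<rho>)"
    unfolding rk Q(2) by blast
  have "d \<noteq> 0"
  proof
    assume "d = 0"
    then have "mat_trace (T * \<rho> * adj T) = 0" using T(1) by (simp add: mat_trace_def)
    then show False using Qc(4) assms(3) unfolding T(3)[symmetric] by simp
  qed
  then have d: "1 \<le> d" "elog2 (ereal (real d)) = ereal (log 2 (real d))"
    using elog2_real[of "real d"] by simp_all
  show ?thesis
    by (intro exI[of _ d] exI[of _ T] conjI d(1) T(1,2)) (use H d(2) Qc(4) T(3) in simp_all)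
qed

text \<open>The suprema and the infimum are not claimed to be attained, so witnesses are drawn from
  a value strictly below the entropy. They are a smoothed state, an operator on the conditioning
  system and a scalar for the operator inequality.\<close>

lemma H_min_smooth_witness:
  assumes "ereal x < H_min_smooth \<delta> a b \<rho>"
  shows "\<exists>\<rho>' \<in> state_ball \<delta> (a * b) \<rho>. \<exists>\<sigma> \<in> states b. \<exists>c. c < 2 powr (- x)
    \<and> op_le \<rho>' (complex_of_real c \<cdot>\<^sub>m tensor_mat (1\<^sub>m a) \<sigma>)"
proof -
  obtain \<rho>' \<sigma> where h: "\<rho>' \<in> state_ball \<delta> (a * b) \<rho>" "\<sigma> \<in> states b" "ereal x < - D_max \<rho>' (tensor_mat (1\<^sub>m a) \<sigma>)"
    using assms unfolding H_min_smooth_def H_min_def less_SUP_iff by blast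
  define C where "C = {c :: real. op_le \<rho>' (complex_of_real c \<cdot>\<^sub>m tensor_mat (1\<^sub>m a) \<sigma>)}"
  define I where "I = (INF c\<in>C. ereal c)"
  have D: "elog2 I < ereal (- x)"
    using h(3) unfolding D_max_def C_def[symmetric] I_def[symmetric]
    by (metis ereal_less_uminus_reorder uminus_ereal.simps(1))
  have "I < ereal (2 powr (- x))"
  proof (rule ccontr)
    assume "\<not> ?thesis"
    then have "elog2 (ereal (2 powr (- x))) \<le> elog2 I" by (intro elog2_mono) auto
    then show False using D by (simp add: elog2_real)
  qed
  then obtain c where "c \<in> C" "ereal c < ereal (2 powr (- x))"
    unfolding I_def INF_less_iff by blast
  then show ?thesis using h unfolding C_def by auto
qed

subsection \<open>Smoothing\<close>

lemma conj_conj_mat: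
  assumes "M \<in> carrier_mat n k" "N \<in> carrier_mat k m" "X \<in> carrier_mat m m"
  shows "M * (N * X * adj N) * adj M = (M * N) * X * adj (M * N)"
  using carrier_matD[OF assms(1)] carrier_matD[OF assms(2)] carrier_matD[OF assms(3)] by (simp add: mat_ring)

lemma conj_minus_mat:
  assumes "M \<in> carrier_mat n m" "X \<in> carrier_mat m m" "Y \<in> carrier_mat m m"
  shows "M * (X - Y) * adj M = M * X * adj M - M * Y * adj M"
  using carrier_matD[OF assms(1)] carrier_matD[OF assms(2)] carrier_matD[OF assms(3)] by (simp add: mat_ring)

text \<open>When the system on which \<open>K\<close> acts is traced out, cyclicity leaves only
  \<open>adj K * K\<close>. Hence zero rows added to \<open>K\<close>, or a unitary applied after
  it, do not change the marginal on R.\<close>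

lemma partial_trace_conj_index:
  assumes K: "K \<in> carrier_mat n m" and X: "X \<in> carrier_mat (m * r) (m * r)" and h: "x < r" "y < r"
  shows "partial_trace 1 n r (tensor_mat K (1\<^sub>m r) * X * adj (tensor_mat K (1\<^sub>m r))) $$ (x, y)
    = (\<Sum>k<m. \<Sum>l<m. (adj K * K) $$ (l, k) * X $$ (k * r + x, l * r + y))"
proof -
  have "partial_trace 1 n r (tensor_mat K (1\<^sub>m r) * X * adj (tensor_mat K (1\<^sub>m r))) $$ (x, y)
      = (\<Sum>i<n. \<Sum>k<m. \<Sum>l<m. K $$ (i, k) * cnj (K $$ (i, l)) * X $$ (k * r + x, l * r + y))"
    using partial_trace_index[of 0 1 0 x r y n "tensor_mat K (1\<^sub>m r) * X * adj (tensor_mat K (1\<^sub>m r))"] h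
    by (simp add: conj_tensor_one_index[OF K X])
  also have "\<dots> = (\<Sum>k<m. \<Sum>i<n. \<Sum>l<m. K $$ (i, k) * cnj (K $$ (i, l)) * X $$ (k * r + x, l * r + y))"
    by (rule sum.swap)
  also have "\<dots> = (\<Sum>k<m. \<Sum>l<m. \<Sum>i<n. K $$ (i, k) * cnj (K $$ (i, l)) * X $$ (k * r + x, l * r + y))"
    by (rule sum.cong[OF refl], rule sum.swap)
  also have "\<dots> = (\<Sum>k<m. \<Sum>l<m. (adj K * K) $$ (l, k) * X $$ (k * r + x, l * r + y))"
  proof (rule sum.cong[OF refl], rule sum.cong[OF refl])
    fix k l assume "k \<in> {..<m}" "l \<in> {..<m}"
    then have kl: "l < m" "k < m" by auto
    show "(\<Sum>i<n. K $$ (i, k) * cnj (K $$ (i, l)) * X $$ (k * r + x, l * r + y))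
      = (adj K * K) $$ (l, k) * X $$ (k * r + x, l * r + y)"
      unfolding mult_index_sum[OF adj_carrier[OF K] K kl] sum_distrib_right
      by (rule sum.cong[OF refl]) (use kl in \<open>simp add: adj_index_carrier[OF K] mult.commute del: adj_index\<close>)
  qed
  finally show ?thesis .
qed

lemma trace_conj_tensor_one:
  assumes K: "K \<in> carrier_mat n m" and X: "X \<in> carrier_mat (m * r) (m * r)"
  shows "mat_trace (tensor_mat K (1\<^sub>m r) * X * adj (tensor_mat K (1\<^sub>m r)))
    = (\<Sum>x<r. \<Sum>k<m. \<Sum>l<m. (adj K * K) $$ (l, k) * X $$ (k * r + x, l * r + x))"
proof -
  let ?Z = "tensor_mat K (1\<^sub>m r) * X * adj (tensor_mat K (1\<^sub>m r))"
  have T: "tensor_mat K (1\<^sub>m r) \<in> carrier_mat (n * r) (m * r)" using K by auto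
  have Z: "?Z \<in> carrier_mat (1 * n * r) (1 * n * r)"
    using mult_carrier_mat[OF mult_carrier_mat[OF T X] adj_carrier[OF T]] by simp
  have "mat_trace ?Z = mat_trace (partial_trace 1 n r ?Z)"
    by (rule trace_partial_trace[OF Z, symmetric])
  also have "\<dots> = (\<Sum>x<r. partial_trace 1 n r ?Z $$ (x, x))"
    using trace_sum[OF partial_trace_carrier[of 1 n r ?Z]] by simp
  also have "\<dots> = (\<Sum>x<r. \<Sum>k<m. \<Sum>l<m. (adj K * K) $$ (l, k) * X $$ (k * r + x, l * r + x))"
    by (rule sum.cong[OF refl]) (simp only: partial_trace_conj_index[OF K X] lessThan_iff)
  finally show ?thesis .
qed

text \<open>Links the compression found on A alone with the weight that remains on AR. Since
  \<open>K\<close> and \<open>T\<close> enter only through their common product with the adjoint,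
  they may map to spaces of different dimensions.\<close>

lemma trace_conj_marginal:
  assumes \<psi>: "\<psi> \<in> carrier_vec (dA * dB * dR)" and K: "K \<in> carrier_mat n dA" and T: "T \<in> carrier_mat d dA"
    and KT: "adj K * K = adj T * T"
  shows "mat_trace (tensor_mat K (1\<^sub>m dR) * partial_trace dA dB dR (pure_state \<psi>) * adj (tensor_mat K (1\<^sub>m dR)))
    = mat_trace (T * partial_trace dA (dB * dR) 1 (pure_state \<psi>) * adj T)"
proof -
  let ?\<rho> = "partial_trace dA dB dR (pure_state \<psi>)" and ?\<rho>A = "partial_trace dA (dB * dR) 1 (pure_state \<psi>)"
  have \<rho>A: "?\<rho>A \<in> carrier_mat dA dA" using partial_trace_carrier[of dA "dB * dR" 1] by simp
  have marg: "(\<Sum>x<dR. ?\<rho> $$ (k * dR + x, l * dR + x)) = ?\<rho>A $$ (k, l)" if "k < dA" "l < dA" for k l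
  proof -
    have e: "k * (dB * dR) + (\<beta> * dR + x) = (k * dB + \<beta>) * dR + x" for k \<beta> x by (simp add: algebra_simps)
    have "(\<Sum>x<dR. ?\<rho> $$ (k * dR + x, l * dR + x))
        = (\<Sum>x<dR. \<Sum>\<beta><dB. pure_state \<psi> $$ ((k * dB + \<beta>) * dR + x, (l * dB + \<beta>) * dR + x))"
      by (rule sum.cong[OF refl]) (use that in \<open>simp add: partial_trace_index\<close>)
    also have "\<dots> = (\<Sum>\<beta><dB. \<Sum>x<dR. pure_state \<psi> $$ ((k * dB + \<beta>) * dR + x, (l * dB + \<beta>) * dR + x))"
      by (rule sum.swap)
    also have "\<dots> = ?\<rho>A $$ (k, l)"
      using partial_trace_index[OF that, of 0 1 0 "dB * dR" "pure_state \<psi>"] by (simp add: sum_nat_mult e)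
    finally show ?thesis .
  qed
  have "mat_trace (tensor_mat K (1\<^sub>m dR) * ?\<rho> * adj (tensor_mat K (1\<^sub>m dR)))
      = (\<Sum>x<dR. \<Sum>k<dA. \<Sum>l<dA. (adj T * T) $$ (l, k) * ?\<rho> $$ (k * dR + x, l * dR + x))"
    unfolding trace_conj_tensor_one[OF K partial_trace_carrier] KT ..
  also have "\<dots> = (\<Sum>k<dA. \<Sum>x<dR. \<Sum>l<dA. (adj T * T) $$ (l, k) * ?\<rho> $$ (k * dR + x, l * dR + x))"
    by (rule sum.swap)
  also have "\<dots> = (\<Sum>k<dA. \<Sum>l<dA. \<Sum>x<dR. (adj T * T) $$ (l, k) * ?\<rho> $$ (k * dR + x, l * dR + x))"
    by (rule sum.cong[OF refl], rule sum.swap)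
  also have "\<dots> = (\<Sum>k<dA. \<Sum>l<dA. (adj T * T) $$ (l, k) * ?\<rho>A $$ (k, l))"
    by (rule sum.cong[OF refl], rule sum.cong[OF refl]) (simp add: marg flip: sum_distrib_left)
  also have "\<dots> = (\<Sum>l<dA. \<Sum>k<dA. (adj T * T) $$ (l, k) * ?\<rho>A $$ (k, l))"
    by (rule sum.swap)
  also have "\<dots> = mat_trace ((adj T * T) * ?\<rho>A)"
    by (rule trace_mult_sum[OF mult_carrier_mat[OF adj_carrier[OF T] T] \<rho>A, symmetric])
  also have "(adj T * T) * ?\<rho>A = adj T * (T * ?\<rho>A)"
    by (rule assoc_mult_mat[OF adj_carrier[OF T] T \<rho>A])
  also have "mat_trace \<dots> = mat_trace (T * ?\<rho>A * adj T)"
    by (rule trace_mult_comm[OF adj_carrier[OF T] mult_carrier_mat[OF T \<rho>A]])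
  finally show ?thesis .
qed

text \<open>Zero rows embed the compressed space of dimension \<open>d\<close> into the larger space
  of \<open>A\<^sub>1 A\<^sub>2\<close>.\<close>

lemma pad_contr:
  assumes T: "T \<in> carrier_mat d m" and "d \<le> n"
  shows "\<exists>K \<in> carrier_mat n m. adj K * K = adj T * T"
proof
  define K where "K = mat n m (\<lambda>(i, j). if i < d then T $$ (i, j) else 0)"
  show K: "K \<in> carrier_mat n m" by (simp add: K_def)
  show "adj K * K = adj T * T"
  proof (rule eq_matI)
    fix i j assume "i < dim_row (adj T * T)" "j < dim_col (adj T * T)"
    then have ij: "i < m" "j < m" using T by auto
    have "(adj K * K) $$ (i, j) = (\<Sum>k<n. if k < d then cnj (T $$ (k, i)) * T $$ (k, j) else 0)"
      unfolding mult_index_sum[OF adj_carrier[OF K] K ij]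
      by (rule sum.cong[OF refl]) (use ij in \<open>auto simp: K_def\<close>)
    also have "\<dots> = (\<Sum>k<d. cnj (T $$ (k, i)) * T $$ (k, j))"
      using assms(2) by (intro sum.mono_neutral_cong_right) auto
    also have "\<dots> = (adj T * T) $$ (i, j)"
      unfolding mult_index_sum[OF adj_carrier[OF T] T ij]
      by (rule sum.cong[OF refl]) (use ij T in auto)
    finally show "(adj K * K) $$ (i, j) = (adj T * T) $$ (i, j)" .
  qed (use K T in auto)
qed

text \<open>Conjugation turns the identity factor into \<open>K * adj K\<close>, which is again
  below the identity because \<open>adj K\<close> is a contraction. So the scalar \<open>c\<close>
  of a min-entropy bound survives a compression.\<close>

lemma op_le_conj:
  assumes K: "K \<in> carrier_mat n m" "contr K" and \<sigma>: "\<sigma> \<in> states r" and X: "X \<in> carrier_mat (m * r) (m * r)"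
    and c: "0 \<le> c" and le: "op_le X (complex_of_real c \<cdot>\<^sub>m tensor_mat (1\<^sub>m m) \<sigma>)"
  shows "op_le (tensor_mat K (1\<^sub>m r) * X * adj (tensor_mat K (1\<^sub>m r))) (complex_of_real c \<cdot>\<^sub>m tensor_mat (1\<^sub>m n) \<sigma>)"
proof -
  let ?M = "tensor_mat K (1\<^sub>m r)"
  have s: "\<sigma> \<in> carrier_mat r r" "psd \<sigma>" using \<sigma> by (auto simp: states_def)
  have M: "?M \<in> carrier_mat (n * r) (m * r)" using K by auto
  have I\<sigma>: "tensor_mat (1\<^sub>m k) \<sigma> \<in> carrier_mat (k * r) (k * r)" for k using s by auto
  have KK: "K * adj K \<in> carrier_mat n n" by (rule mult_carrier_mat[OF K(1) adj_carrier[OF K(1)]])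
  have KK\<sigma>: "tensor_mat (K * adj K) \<sigma> \<in> carrier_mat (n * r) (n * r)" by (rule tensor_carrier[OF KK s(1)])
  have Z: "?M * X * adj ?M \<in> carrier_mat (n * r) (n * r)"
    by (rule mult_carrier_mat[OF mult_carrier_mat[OF M X] adj_carrier[OF M]])
  define c' where "c' = complex_of_real c"
  have p1: "psd (?M * (c' \<cdot>\<^sub>m tensor_mat (1\<^sub>m m) \<sigma> - X) * adj ?M)"
    by (rule psd_conj[OF _ minus_carrier_mat[OF X] M]) (use le in \<open>simp add: op_le_def c'_def\<close>)
  have p2: "psd (c' \<cdot>\<^sub>m tensor_mat (1\<^sub>m n - K * adj K) \<sigma>)"
  proof -
    have "psd (1\<^sub>m n - K * adj K)" using contr_adj[OF K(2)] K(1) by (simp add: contr_def)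
    then show ?thesis unfolding c'_def by (intro psd_smult psd_tensor s(2) c)
  qed
  have e1: "?M * (c' \<cdot>\<^sub>m tensor_mat (1\<^sub>m m) \<sigma> - X) * adj ?M = c' \<cdot>\<^sub>m tensor_mat (K * adj K) \<sigma> - ?M * X * adj ?M"
  proof -
    have "?M * (c' \<cdot>\<^sub>m tensor_mat (1\<^sub>m m) \<sigma> - X) * adj ?M
      = ?M * (c' \<cdot>\<^sub>m tensor_mat (1\<^sub>m m) \<sigma>) * adj ?M - ?M * X * adj ?M"
      unfolding mult_minus_distrib_mat[OF M smult_carrier_mat[OF I\<sigma>] X]
      by (rule minus_mult_distrib_mat[OF mult_carrier_mat[OF M smult_carrier_mat[OF I\<sigma>]] mult_carrier_mat[OF M X] adj_carrier[OF M]])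
    also have "?M * (c' \<cdot>\<^sub>m tensor_mat (1\<^sub>m m) \<sigma>) * adj ?M = c' \<cdot>\<^sub>m (?M * tensor_mat (1\<^sub>m m) \<sigma> * adj ?M)"
      unfolding mult_smult_distrib[OF M I\<sigma>]
      by (rule mult_smult_assoc_mat[OF mult_carrier_mat[OF M I\<sigma>] adj_carrier[OF M]])
    also have "?M * tensor_mat (1\<^sub>m m) \<sigma> * adj ?M = tensor_mat (K * adj K) \<sigma>"
      unfolding adj_tensor adj_one tensor_mult[OF K(1) one_carrier_mat one_carrier_mat s(1)]
        tensor_mult[OF mult_carrier_mat[OF K(1) one_carrier_mat] mult_carrier_mat[OF one_carrier_mat s(1)]
          adj_carrier[OF K(1)] one_carrier_mat]
      using K(1) s(1) by simp
    finally show ?thesis .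
  qed
  have e2: "c' \<cdot>\<^sub>m tensor_mat (1\<^sub>m n - K * adj K) \<sigma> = c' \<cdot>\<^sub>m tensor_mat (1\<^sub>m n) \<sigma> - c' \<cdot>\<^sub>m tensor_mat (K * adj K) \<sigma>"
  proof -
    have "c' \<cdot>\<^sub>m (A - B) = c' \<cdot>\<^sub>m A - c' \<cdot>\<^sub>m B" if "A \<in> carrier_mat k k" "B \<in> carrier_mat k k" for A B k
      by (rule eq_matI) (use that in \<open>auto simp: right_diff_distrib\<close>)
    from this[OF I\<sigma> KK\<sigma>] show ?thesis unfolding tensor_minus_left[OF one_carrier_mat KK s(1)] .
  qed
  have "c' \<cdot>\<^sub>m tensor_mat (1\<^sub>m n) \<sigma> - ?M * X * adj ?M
      = (c' \<cdot>\<^sub>m tensor_mat (K * adj K) \<sigma> - ?M * X * adj ?M) + (c' \<cdot>\<^sub>m tensor_mat (1\<^sub>m n) \<sigma> - c' \<cdot>\<^sub>m tensor_mat (K * adj K) \<sigma>)"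
  proof -
    have "A - C = (B - C) + (A - B)"
      if "A \<in> carrier_mat k k" "B \<in> carrier_mat k k" "C \<in> carrier_mat k k" for A B C :: "complex mat" and k
      by (rule eq_matI) (use that in auto)
    then show ?thesis using smult_carrier_mat[OF I\<sigma>] smult_carrier_mat[OF KK\<sigma>] Z by blast
  qed
  moreover have "psd \<dots>"
    by (rule psd_add[OF p1[unfolded e1] p2[unfolded e2] minus_carrier_mat[OF Z] minus_carrier_mat[OF smult_carrier_mat[OF KK\<sigma>]]])
  ultimately show ?thesis using carrier_matD[OF K(1)] carrier_matD[OF s(1)] by (simp add: op_le_def c'_def)
qed

text \<open>A triangle inequality in four steps. The smoothed state is decoupled up to \<kappa>;
  returning to \<rho> costs \<open>e\<close> in the reduced state and \<open>e\<close> in the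
  marginal on R; and the marginal after the compression falls short of the true one by a positive
  operator whose trace is the lost weight.\<close>

lemma smoothed_decoupling:
  fixes \<rho> \<rho>' K U :: "complex mat" and a b m r :: nat
  assumes ab: "0 < a" and \<rho>: "\<rho> \<in> carrier_mat (m * r) (m * r)" "psd \<rho>" and \<rho>': "\<rho>' \<in> carrier_mat (m * r) (m * r)"
    and e: "tn_le (\<rho>' - \<rho>) e" and K: "K \<in> carrier_mat (a * b) m" "contr K"
    and U: "U \<in> carrier_mat (a * b) (a * b)" "adj U * U = 1\<^sub>m (a * b)"
  defines "cj \<equiv> \<lambda>K X. tensor_mat K (1\<^sub>m r) * X * adj (tensor_mat K (1\<^sub>m r))"
  defines "\<pi> \<equiv> (1 / of_nat a) \<cdot>\<^sub>m 1\<^sub>m a"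
  assumes dec: "tn_le (partial_trace a b r (cj U (cj K \<rho>')) - tensor_mat \<pi> (partial_trace 1 (a * b) r (cj K \<rho>'))) \<kappa>"
  shows "tn_le (partial_trace a b r (cj (U * K) \<rho>) - tensor_mat \<pi> (partial_trace 1 m r \<rho>))
    (\<kappa> + 2 * e + (Re (mat_trace \<rho>) - Re (mat_trace (cj (U * K) \<rho>))))"
proof -
  define N where "N = a * b"
  note K = K[folded N_def] and U = U[folded N_def] and dec = dec[folded N_def]
  have UK: "U * K \<in> carrier_mat N m" by (rule mult_carrier_mat[OF U(1) K(1)])
  have cU: "contr U" by (rule contr_isometry[OF U])
  have cUK: "contr (U * K)" by (rule contr_mult[OF cU K(2) U(1) K(1)])
  have M: "tensor_mat L (1\<^sub>m r) \<in> carrier_mat (k * r) (l * r)" if "L \<in> carrier_mat k l" for L k l using that by auto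
  have cc: "cj L X \<in> carrier_mat (k * r) (k * r)" if "L \<in> carrier_mat k l" "X \<in> carrier_mat (l * r) (l * r)" for L X k l
    unfolding cj_def by (rule mult_carrier_mat[OF mult_carrier_mat[OF M[OF that(1)] that(2)] adj_carrier[OF M[OF that(1)]]])
  have cmul: "cj U (cj K X) = cj (U * K) X" if X: "X \<in> carrier_mat (m * r) (m * r)" for X
  proof -
    have "tensor_mat (U * K) (1\<^sub>m r) = tensor_mat U (1\<^sub>m r) * tensor_mat K (1\<^sub>m r)"
      unfolding tensor_mult[OF U(1) one_carrier_mat K(1) one_carrier_mat] by simp
    then show ?thesis
      unfolding cj_def by (simp only: conj_conj_mat[OF M[OF U(1)] M[OF K(1)] X])
  qed
  have cminus: "cj L (\<rho>' - \<rho>) = cj L \<rho>' - cj L \<rho>" if L: "L \<in> carrier_mat k m" for L k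
    unfolding cj_def by (rule conj_minus_mat[OF M[OF L] \<rho>' \<rho>(1)])
  have \<Delta>: "\<rho>' - \<rho> \<in> carrier_mat (m * r) (m * r)" by (rule minus_carrier_mat[OF \<rho>(1)])
  have ctn: "tn_le (cj L X) t" if "tn_le X t" "L \<in> carrier_mat k l" "contr L" "X \<in> carrier_mat (l * r) (l * r)" for L X t k l
    unfolding cj_def by (rule tn_le_conj[OF that(1,4) M[OF that(2)] contr_tensor_one[OF that(3,2)]])
  define a1 a2 where "a1 = partial_trace a b r (cj (U * K) \<rho>')" and "a2 = partial_trace a b r (cj (U * K) \<rho>)"
  define b1 b2 b3 where "b1 = partial_trace 1 N r (cj K \<rho>')" and "b2 = partial_trace 1 N r (cj K \<rho>)"
    and "b3 = partial_trace 1 m r \<rho>"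
  have ac: "a1 \<in> carrier_mat (a * r) (a * r)" "a2 \<in> carrier_mat (a * r) (a * r)" by (simp_all add: a1_def a2_def)
  have ptr1: "partial_trace 1 k r X \<in> carrier_mat r r" for k X using partial_trace_carrier[of 1 k r X] by simp
  have bc: "b1 \<in> carrier_mat r r" "b2 \<in> carrier_mat r r" "b3 \<in> carrier_mat r r"
    unfolding b1_def b2_def b3_def by (rule ptr1)+
  have \<pi>c: "\<pi> \<in> carrier_mat a a" by (simp add: \<pi>_def)
  have \<pi>b: "tensor_mat \<pi> X \<in> carrier_mat (a * r) (a * r)" if "X \<in> carrier_mat r r" for X using \<pi>c that by auto
  have \<pi>minus: "tensor_mat \<pi> (X - Y) = tensor_mat \<pi> X - tensor_mat \<pi> Y" if "X \<in> carrier_mat r r" "Y \<in> carrier_mat r r" for X Y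
  proof (rule eq_mat_tensorI[of _ a r a r])
    fix i x j y assume h: "i < a" "x < r" "j < a" "y < r"
    have b: "i * r + x < a * r" "j * r + y < a * r" using h index_less by auto
    show "tensor_mat \<pi> (X - Y) $$ (i * r + x, j * r + y) = (tensor_mat \<pi> X - tensor_mat \<pi> Y) $$ (i * r + x, j * r + y)"
      using b h that carrier_matD[OF \<pi>b[OF that(2)]]
      unfolding tensor_index[OF \<pi>c minus_carrier_mat[OF that(2)] h]
      by (simp add: tensor_index[OF \<pi>c that(1) h] tensor_index[OF \<pi>c that(2) h] right_diff_distrib)
  qed (rule \<pi>b[OF minus_carrier_mat[OF that(2)]] minus_carrier_mat[OF \<pi>b[OF that(2)]])+
  have t1: "tn_le (a1 - tensor_mat \<pi> b1) \<kappa>"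
    using dec unfolding a1_def b1_def cmul[OF \<rho>'] .
  have t2: "tn_le (a1 - a2) e"
  proof -
    have "tn_le (partial_trace a b r (cj (U * K) (\<rho>' - \<rho>))) e"
      by (rule tn_le_partial_trace[OF ctn[OF e UK cUK \<Delta>]]) (use cc[OF UK \<Delta>] in \<open>simp add: N_def\<close>)
    then show ?thesis
      unfolding cminus[OF UK] a1_def a2_def
      by (subst (asm) partial_trace_minus) (use cc[OF UK \<rho>'] cc[OF UK \<rho>(1)] in \<open>simp_all add: N_def\<close>)
  qed
  have t3: "tn_le (tensor_mat \<pi> (b1 - b2)) e"
  proof -
    have "tn_le (partial_trace 1 N r (cj K (\<rho>' - \<rho>))) e"
      by (rule tn_le_partial_trace[OF ctn[OF e K \<Delta>]]) (use cc[OF K(1) \<Delta>] in simp)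
    then have "tn_le (b1 - b2) e"
      unfolding cminus[OF K(1)] b1_def b2_def
      by (subst (asm) partial_trace_minus) (use cc[OF K(1) \<rho>'] cc[OF K(1) \<rho>(1)] in simp_all)
    then show ?thesis unfolding \<pi>_def by (rule tn_le_max_mixed[OF _ minus_carrier_mat[OF bc(2)] ab])
  qed
  \<comment> \<open>\<open>G\<close> completes \<open>K\<close>, as its square is the defect of
    \<open>K\<close>. The missing part of the marginal on R is therefore the marginal of \<rho>
    conjugated by \<open>G\<close>, visibly positive.\<close>
  define G where "G = psd_sqrt (1\<^sub>m m - adj K * K)"
  have KK: "adj K * K \<in> carrier_mat m m" by (rule mult_carrier_mat[OF adj_carrier[OF K(1)] K(1)])
  have "psd (1\<^sub>m m - adj K * K)" using K by (simp add: contr_def)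
  note G = psd_sqrt[OF this minus_carrier_mat[OF KK], folded G_def]
  have b32: "b3 - b2 = partial_trace 1 m r (cj G \<rho>)"
  proof (rule eq_matI)
    fix x y assume "x < dim_row (partial_trace 1 m r (cj G \<rho>))" "y < dim_col (partial_trace 1 m r (cj G \<rho>))"
    then have h: "x < r" "y < r" using carrier_matD[OF ptr1] by auto
    have "b3 $$ (x, y) = (\<Sum>k<m. \<Sum>l<m. (if l = k then 1 else 0) * \<rho> $$ (k * r + x, l * r + y))"
    proof -
      have "b3 $$ (x, y) = (\<Sum>k<m. \<rho> $$ (k * r + x, k * r + y))"
        using partial_trace_index[of 0 1 0 x r y m \<rho>] h by (simp add: b3_def)
      also have "\<dots> = (\<Sum>k<m. \<Sum>l<m. if l = k then \<rho> $$ (k * r + x, k * r + y) else 0)" by simp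
      also have "\<dots> = (\<Sum>k<m. \<Sum>l<m. (if l = k then 1 else 0) * \<rho> $$ (k * r + x, l * r + y))"
        by (rule sum.cong[OF refl], rule sum.cong[OF refl]) simp
      finally show ?thesis .
    qed
    moreover have "b2 $$ (x, y) = (\<Sum>k<m. \<Sum>l<m. (adj K * K) $$ (l, k) * \<rho> $$ (k * r + x, l * r + y))"
      unfolding b2_def cj_def by (rule partial_trace_conj_index[OF K(1) \<rho>(1) h])
    moreover have "partial_trace 1 m r (cj G \<rho>) $$ (x, y)
        = (\<Sum>k<m. \<Sum>l<m. (1\<^sub>m m - adj K * K) $$ (l, k) * \<rho> $$ (k * r + x, l * r + y))"
      unfolding cj_def partial_trace_conj_index[OF G(3) \<rho>(1) h] G(4) G(2) ..
    moreover have "(\<Sum>k<m. \<Sum>l<m. (1\<^sub>m m - adj K * K) $$ (l, k) * \<rho> $$ (k * r + x, l * r + y))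
        = (\<Sum>k<m. \<Sum>l<m. (if l = k then 1 else 0) * \<rho> $$ (k * r + x, l * r + y))
          - (\<Sum>k<m. \<Sum>l<m. (adj K * K) $$ (l, k) * \<rho> $$ (k * r + x, l * r + y))"
      unfolding sum_subtractf[symmetric]
      by (rule sum.cong[OF refl], rule sum.cong[OF refl]) (use carrier_matD[OF KK] in \<open>simp add: left_diff_distrib\<close>)
    ultimately show "(b3 - b2) $$ (x, y) = partial_trace 1 m r (cj G \<rho>) $$ (x, y)"
      using h carrier_matD[OF bc(2)] by simp
  qed (use carrier_matD[OF ptr1] carrier_matD[OF bc(2)] in simp_all)
  have t4: "tn_le (tensor_mat \<pi> (b3 - b2)) (Re (mat_trace \<rho>) - Re (mat_trace (cj (U * K) \<rho>)))"
  proof -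
    have GM: "cj G \<rho> \<in> carrier_mat (m * r) (m * r)" by (rule cc[OF G(3) \<rho>(1)])
    have "psd (cj G \<rho>)" unfolding cj_def by (rule psd_conj[OF \<rho>(2,1) M[OF G(3)]])
    from tn_le_psd[OF this] have "tn_le (partial_trace 1 m r (cj G \<rho>)) (Re (mat_trace (cj G \<rho>)))"
      by (rule tn_le_partial_trace) (use GM in simp)
    moreover have "mat_trace (cj G \<rho>) = mat_trace \<rho> - mat_trace (cj (U * K) \<rho>)"
    proof -
      have "mat_trace (cj G \<rho>) = mat_trace (partial_trace 1 m r (cj G \<rho>))"
        by (rule trace_partial_trace[symmetric]) (use GM in simp)
      also have "\<dots> = mat_trace b3 - mat_trace b2"
        unfolding b32[symmetric] by (rule trace_minus[OF bc(3,2)])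
      also have "mat_trace b3 = mat_trace \<rho>"
        unfolding b3_def by (rule trace_partial_trace) (use \<rho>(1) in simp)
      also have "mat_trace b2 = mat_trace (cj K \<rho>)"
        unfolding b2_def by (rule trace_partial_trace) (use cc[OF K(1) \<rho>(1)] in simp)
      also have "\<dots> = mat_trace (cj (U * K) \<rho>)"
      proof -
        have "adj (U * K) * (U * K) = adj K * ((adj U * U) * K)"
          using carrier_matD[OF U(1)] carrier_matD[OF K(1)] by (simp add: mat_ring)
        then have "adj (U * K) * (U * K) = adj K * K" unfolding U(2) using K(1) by simp
        then show ?thesis
          unfolding cj_def trace_conj_tensor_one[OF K(1) \<rho>(1)] trace_conj_tensor_one[OF UK \<rho>(1)] by simp
      qed
      finally show ?thesis .
    qed
    ultimately have "tn_le (b3 - b2) (Re (mat_trace \<rho>) - Re (mat_trace (cj (U * K) \<rho>)))"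
      unfolding b32 by simp
    then show ?thesis unfolding \<pi>_def by (rule tn_le_max_mixed[OF _ minus_carrier_mat[OF bc(2)] ab])
  qed
  define p1 p2 p3 where "p1 = tensor_mat \<pi> b1" and "p2 = tensor_mat \<pi> b2" and "p3 = tensor_mat \<pi> b3"
  have pc: "p1 \<in> carrier_mat (a * r) (a * r)" "p2 \<in> carrier_mat (a * r) (a * r)" "p3 \<in> carrier_mat (a * r) (a * r)"
    unfolding p1_def p2_def p3_def by (rule \<pi>b bc)+
  have t3': "tn_le (p1 - p2) e" using t3 unfolding \<pi>minus[OF bc(1,2)] p1_def p2_def .
  have t4': "tn_le (p3 - p2) (Re (mat_trace \<rho>) - Re (mat_trace (cj (U * K) \<rho>)))"
    using t4 unfolding \<pi>minus[OF bc(3,2)] p3_def p2_def .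
  have t12: "tn_le ((a1 - p1) - (a1 - a2)) (\<kappa> + e)"
    using tn_le_minus[OF t1 t2] minus_carrier_mat[OF pc(1)] minus_carrier_mat[OF ac(2)] unfolding p1_def by blast
  have t123: "tn_le ((a1 - p1) - (a1 - a2) + (p1 - p2)) (\<kappa> + e + e)"
    by (rule tn_le_add[OF t12 t3' minus_carrier_mat[OF minus_carrier_mat[OF ac(2)]] minus_carrier_mat[OF pc(2)]])
  have "tn_le ((a1 - p1) - (a1 - a2) + (p1 - p2) - (p3 - p2))
      (\<kappa> + e + e + (Re (mat_trace \<rho>) - Re (mat_trace (cj (U * K) \<rho>))))"
    by (rule tn_le_minus[OF t123 t4' add_carrier_mat[OF minus_carrier_mat[OF pc(2)]] minus_carrier_mat[OF pc(2)]])
  moreover have "(a1 - p1) - (a1 - a2) + (p1 - p2) - (p3 - p2) = a2 - p3"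
    by (rule eq_matI) (use ac pc in auto)
  ultimately show ?thesis unfolding a2_def b3_def p3_def N_def by (simp only: add.assoc mult_2)
qed

lemma tn_le_zero: "tn_le (0\<^sub>m n n) 0"
proof (rule tn_leI)
  fix C :: "complex mat" assume "C \<in> carrier_mat n n"
  then show "cmod (mat_trace (C * 0\<^sub>m n n)) \<le> 0" by (simp add: mat_trace_def)
qed auto

text \<open>A one-dimensional \<open>A\<^sub>1\<close> is decoupled from R without any error, with
  the identity as unitary.\<close>

lemma decoupling_trivial:
  assumes w: "\<omega> \<in> carrier_mat (1 * b * r) (1 * b * r)"
  shows "tn_le (partial_trace 1 b r (tensor_mat (1\<^sub>m (1 * b)) (1\<^sub>m r) * \<omega> * adj (tensor_mat (1\<^sub>m (1 * b)) (1\<^sub>m r)))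
        - tensor_mat ((1 / of_nat 1) \<cdot>\<^sub>m 1\<^sub>m 1) (partial_trace 1 (1 * b) r \<omega>)) 0"
proof -
  have "tensor_mat (1\<^sub>m (1 * b)) (1\<^sub>m r) * \<omega> * adj (tensor_mat (1\<^sub>m (1 * b)) (1\<^sub>m r)) = \<omega>"
    unfolding tensor_one adj_one left_mult_one_mat[OF w] right_mult_one_mat[OF w] ..
  moreover have "tensor_mat ((1 / of_nat 1) \<cdot>\<^sub>m 1\<^sub>m 1) X = X" if "X \<in> carrier_mat r r" for X
    by (rule eq_matI) (use that in \<open>auto simp: tensor_mat_def\<close>)
  ultimately show ?thesis using partial_trace_carrier[of 1 b r \<omega>] tn_le_zero by simp
qed

lemma op_le_trace:
  assumes "op_le X Y" "X \<in> carrier_mat n n" "Y \<in> carrier_mat n n"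
  shows "Re (mat_trace X) \<le> Re (mat_trace Y)"
proof -
  have "0 \<le> mat_trace (Y - X)" using assms(1) by (intro psd_trace_nonneg) (simp add: op_le_def)
  then show ?thesis unfolding trace_minus[OF assms(3,2)] by (simp add: less_eq_complex_def)
qed

lemma trace_one_tensor_state:
  assumes "\<sigma> \<in> states r"
  shows "Re (mat_trace (complex_of_real c \<cdot>\<^sub>m tensor_mat (1\<^sub>m n) \<sigma>)) = c * real n"
proof -
  have s: "\<sigma> \<in> carrier_mat r r" "mat_trace \<sigma> = 1" using assms by (auto simp: states_def)
  have "mat_trace (tensor_mat (1\<^sub>m n) \<sigma>) = of_nat n"
    unfolding trace_tensor[OF one_carrier_mat s(1)] s(2) by (simp add: mat_trace_def)
  then show ?thesis using trace_smult[OF tensor_carrier[OF one_carrier_mat s(1)], of "complex_of_real c" n] by simp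
qed

lemma cmod_trace_le:
  assumes "tn_le M c" "M \<in> carrier_mat n n"
  shows "\<bar>Re (mat_trace M)\<bar> \<le> c"
proof -
  have "contr (1\<^sub>m n)" by (rule contr_isometry[of _ n n]) auto
  from tn_leD[OF assms one_carrier_mat this] show ?thesis
    using assms(2) abs_Re_le_cmod[of "mat_trace M"] by simp
qed

text \<open>Traces are taken in the operator inequality before and after the compression; the trace
  of the identity tensored with a state is the dimension of the first factor.\<close>

lemma smooth_weight:
  assumes K: "K \<in> carrier_mat n m" "contr K" and "0 < m" and \<rho>': "\<rho>' \<in> substates (m * r)" and \<sigma>: "\<sigma> \<in> states r"
    and le: "op_le \<rho>' (complex_of_real c \<cdot>\<^sub>m tensor_mat (1\<^sub>m m) \<sigma>)"
  shows "0 \<le> c"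
    and "Re (mat_trace (tensor_mat K (1\<^sub>m r) * \<rho>' * adj (tensor_mat K (1\<^sub>m r)))) \<le> c * real n"
proof -
  have p: "\<rho>' \<in> carrier_mat (m * r) (m * r)" "psd \<rho>'" using \<rho>' by (auto simp: substates_def)
  have s: "\<sigma> \<in> carrier_mat r r" using \<sigma> by (auto simp: states_def)
  have cI: "complex_of_real c \<cdot>\<^sub>m tensor_mat (1\<^sub>m k) \<sigma> \<in> carrier_mat (k * r) (k * r)" for k
    by (rule smult_carrier_mat[OF tensor_carrier[OF one_carrier_mat s]])
  have "0 \<le> Re (mat_trace \<rho>')" using psd_trace_nonneg[OF p(2)] by (simp add: less_eq_complex_def)
  also have "\<dots> \<le> c * real m"
    using op_le_trace[OF le p(1) cI] unfolding trace_one_tensor_state[OF \<sigma>] .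
  finally show c: "0 \<le> c" using \<open>0 < m\<close> by (simp add: zero_le_mult_iff)
  have M: "tensor_mat K (1\<^sub>m r) \<in> carrier_mat (n * r) (m * r)" by (rule tensor_carrier[OF K(1) one_carrier_mat])
  show "Re (mat_trace (tensor_mat K (1\<^sub>m r) * \<rho>' * adj (tensor_mat K (1\<^sub>m r)))) \<le> c * real n"
    using op_le_trace[OF op_le_conj[OF K \<sigma> p(1) c le] mult_carrier_mat[OF mult_carrier_mat[OF M p(1)] adj_carrier[OF M]] cI]
    unfolding trace_one_tensor_state[OF \<sigma>] .
qed

lemma psd_partial_trace_pure: "psd (partial_trace l m r (pure_state \<psi>))" if \<psi>: "\<psi> \<in> carrier_vec (l * m * r)"
proof -
  define M where "M = mat (l * r) m (\<lambda>(i, k). \<psi> $ ((i div r * m + k) * r + i mod r))"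
  have M: "M \<in> carrier_mat (l * r) m" by (simp add: M_def)
  have Mx: "M $$ (i * r + x, k) = \<psi> $ ((i * m + k) * r + x)" if "i < l" "x < r" "k < m" for i x k
    using index_less[OF that(1,2)] that by (simp add: M_def)
  have adj_Mx: "adj M $$ (k, i * r + x) = cnj (\<psi> $ ((i * m + k) * r + x))" if "i < l" "x < r" "k < m" for i x k
    unfolding adj_index_carrier[OF M that(3) index_less[OF that(1,2)]] Mx[OF that] ..
  have "partial_trace l m r (pure_state \<psi>) = M * adj M"
  proof (rule eq_mat_tensorI[of _ l r l r])
    fix i x j y assume h: "i < l" "x < r" "j < l" "y < r"
    have b: "i * r + x < l * r" "j * r + y < l * r" using h index_less by auto
    have bb: "(i * m + k) * r + x < l * m * r" if "i < l" "x < r" "k < m" for i x k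
      by (rule index_less[OF index_less[OF that(1,3)] that(2)])
    have "partial_trace l m r (pure_state \<psi>) $$ (i * r + x, j * r + y)
        = (\<Sum>k<m. pure_state \<psi> $$ ((i * m + k) * r + x, (j * m + k) * r + y))"
      by (rule partial_trace_index[OF h(1,3,2,4)])
    also have "\<dots> = (\<Sum>k<m. \<psi> $ ((i * m + k) * r + x) * cnj (\<psi> $ ((j * m + k) * r + y)))"
      by (rule sum.cong[OF refl]) (use \<psi> bb h in \<open>auto simp: pure_state_def\<close>)
    also have "\<dots> = (\<Sum>k<m. M $$ (i * r + x, k) * adj M $$ (k, j * r + y))"
      by (rule sum.cong[OF refl]) (simp add: Mx[OF h(1,2)] adj_Mx[OF h(3,4)])
    also have "\<dots> = (M * adj M) $$ (i * r + x, j * r + y)"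
      by (rule mult_index_sum[OF M adj_carrier[OF M] b, symmetric])
    finally show "partial_trace l m r (pure_state \<psi>) $$ (i * r + x, j * r + y) = (M * adj M) $$ (i * r + x, j * r + y)" .
  qed (simp_all add: mult_carrier_mat[OF M adj_carrier[OF M]])
  then show ?thesis using psd_mult_adj[of M] by simp
qed

lemma partial_trace_pure_state:
  assumes "\<psi> \<in> carrier_vec (l * m * r)" "\<psi> \<bullet>c \<psi> = 1"
  shows "partial_trace l m r (pure_state \<psi>) \<in> states (l * r)"
  using psd_partial_trace_pure[OF assms(1)] trace_partial_trace[OF pure_state_trace(3)[OF assms(1)]]
    pure_state_trace(1)[OF assms(2)] by (simp add: states_def)

text \<open>The decoupling unitary enters as an assumption, so that the degenerate and the averaged
  construction share this proof. The lost weight, at most \<delta>, counts twice: once as a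
  deviation of the marginal on R and once as the missing norm of the encoded vector.\<close>

lemma fqsw_protocol_of_decoupling:
  assumes \<psi>: "\<psi> \<in> carrier_vec (dA * dB * dR)" "\<psi> \<bullet>c \<psi> = 1" and ab: "0 < a" "0 < b"
  defines "\<rho>A \<equiv> partial_trace dA (dB * dR) 1 (pure_state \<psi>)"
    and "\<rho>AR \<equiv> partial_trace dA dB dR (pure_state \<psi>)"
  assumes T: "T \<in> carrier_mat d dA" "contr T" "d \<le> a * b" "1 - \<delta> \<le> Re (mat_trace (T * \<rho>A * adj T))"
    and \<rho>': "\<rho>' \<in> carrier_mat (dA * dR) (dA * dR)" "tn_le (\<rho>' - \<rho>AR) e"
  defines "cj \<equiv> \<lambda>K X. tensor_mat K (1\<^sub>m dR) * X * adj (tensor_mat K (1\<^sub>m dR))"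
  assumes dec: "\<And>K. K \<in> carrier_mat (a * b) dA \<Longrightarrow> contr K \<Longrightarrow>
      \<exists>U \<in> carrier_mat (a * b) (a * b). adj U * U = 1\<^sub>m (a * b) \<and>
        tn_le (partial_trace a b dR (cj U (cj K \<rho>'))
          - tensor_mat ((1 / of_nat a) \<cdot>\<^sub>m 1\<^sub>m a) (partial_trace 1 (a * b) dR (cj K \<rho>'))) \<kappa>"
    and x: "\<kappa> + 2 * e + 2 * \<delta> \<le> x" "0 \<le> x" "x \<le> 1"
  shows "\<exists>P. fqsw_protocol dA dB P \<and> dim_A1 P = a \<and> dim_A2 P = b \<and> fqsw_error_le (2 * sqrt x + x) dA dB dR \<psi> P"
proof -
  have \<rho>: "\<rho>AR \<in> carrier_mat (dA * dR) (dA * dR)" "psd \<rho>AR" "mat_trace \<rho>AR = 1"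
    using partial_trace_pure_state[OF \<psi>] by (auto simp: states_def \<rho>AR_def)
  obtain K where K: "K \<in> carrier_mat (a * b) dA" "adj K * K = adj T * T" using pad_contr[OF T(1,3)] by blast
  have cK: "contr K" using T(2) unfolding contr_def K(2) carrier_matD(2)[OF K(1)] carrier_matD(2)[OF T(1)] .
  obtain U where U: "U \<in> carrier_mat (a * b) (a * b)" "adj U * U = 1\<^sub>m (a * b)"
    and tn: "tn_le (partial_trace a b dR (cj U (cj K \<rho>'))
        - tensor_mat ((1 / of_nat a) \<cdot>\<^sub>m 1\<^sub>m a) (partial_trace 1 (a * b) dR (cj K \<rho>'))) \<kappa>"
    using dec[OF K(1) cK] by blast
  have UK: "U * K \<in> carrier_mat (a * b) dA" by (rule mult_carrier_mat[OF U(1) K(1)])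
  have cUK: "contr (U * K)" by (rule contr_mult[OF contr_isometry[OF U] cK U(1) K(1)])
  have "adj (U * K) * (U * K) = adj K * ((adj U * U) * K)"
    using carrier_matD[OF U(1)] carrier_matD[OF K(1)] by (simp add: mat_ring)
  also have "\<dots> = adj T * T" unfolding U(2) left_mult_one_mat[OF K(1)] by (rule K(2))
  finally have tr: "mat_trace (cj (U * K) \<rho>AR) = mat_trace (T * \<rho>A * adj T)"
    unfolding cj_def \<rho>AR_def \<rho>A_def by (rule trace_conj_marginal[OF \<psi>(1) UK T(1)])
  have "tn_le (partial_trace a b dR (cj (U * K) \<rho>AR) - tensor_mat ((1 / of_nat a) \<cdot>\<^sub>m 1\<^sub>m a) (partial_trace 1 dA dR \<rho>AR))
      (\<kappa> + 2 * e + (Re (mat_trace \<rho>AR) - Re (mat_trace (cj (U * K) \<rho>AR))))"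
    unfolding cj_def by (rule smoothed_decoupling[OF ab(1) \<rho>(1,2) \<rho>' K(1) cK U tn[unfolded cj_def]])
  then show ?thesis unfolding \<rho>AR_def cj_def
    by (rule fqsw_protocol_exists[OF \<psi> ab UK cUK _ _ x(2,3)])
      (use tr T(4) x(1) \<rho>(3) in \<open>simp add: cj_def \<rho>AR_def\<close>)
qed

subsection \<open>Parameters\<close>

text \<open>By the intermediate value theorem. The last term alone reaches 1 at \<delta> = 1/4, so
  the interval from 0 to 1/4 covers all admissible errors.\<close>

lemma fqsw_delta_exists:
  fixes \<epsilon> :: real
  assumes "0 < \<epsilon>" "\<epsilon> \<le> 1"
  shows "\<exists>\<delta> \<delta>'. 0 < \<delta> \<and> \<delta> \<le> 1 / 4 \<and> \<delta>' = \<delta> + sqrt (4 * sqrt \<delta> - 4 * \<delta>) \<and> \<epsilon> = 2 * sqrt (5 * \<delta>') + 2 * sqrt \<delta>"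
proof -
  define f where "f = (\<lambda>x :: real. 2 * sqrt (5 * (x + sqrt (4 * sqrt x - 4 * x))) + 2 * sqrt x)"
  have q: "sqrt (1 / 4) = 1 / (2 :: real)" by (rule real_sqrt_unique) (auto simp: power2_eq_square)
  have "\<epsilon> \<le> f (1 / 4)" using assms(2) by (simp add: f_def q add_increasing)
  moreover have "f 0 = 0" by (simp add: f_def)
  moreover have "continuous_on {0..1/4} f" unfolding f_def by (intro continuous_intros)
  ultimately obtain \<delta> where \<delta>: "0 \<le> \<delta>" "\<delta> \<le> 1 / 4" "f \<delta> = \<epsilon>"
    using IVT'[of f 0 \<epsilon> "1/4"] assms(1) by auto
  moreover have "\<delta> \<noteq> 0" using \<delta>(3) \<open>f 0 = 0\<close> assms(1) by auto
  ultimately show ?thesis unfolding f_def by (intro exI[of _ \<delta>] exI) auto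
qed

text \<open>With s = sqrt \<delta> \<le> 1/2 the inner root is at least sqrt (2 s), so 2 s \<le>
  \<delta>'^2 and \<delta> is of fourth order in \<delta>'. Since the total error is at most 1,
  \<delta>' \<le> 1/20, and \<delta> becomes negligible. The last claim converts the error at x = 3
  \<delta>' into the prescribed form.\<close>

lemma fqsw_delta_bounds:
  fixes \<delta> \<delta>' :: real
  assumes "0 < \<delta>" "\<delta> \<le> 1 / 4" and \<delta>': "\<delta>' = \<delta> + sqrt (4 * sqrt \<delta> - 4 * \<delta>)"
    and le: "2 * sqrt (5 * \<delta>') + 2 * sqrt \<delta> \<le> 1"
  shows "0 < \<delta>'" "\<delta>' \<le> 1 / 20" "\<delta> \<le> \<delta>' / 32000" "2 * sqrt (3 * \<delta>') + 3 * \<delta>' \<le> 2 * sqrt (5 * \<delta>')"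
proof -
  define s where "s = sqrt \<delta>"
  have s: "0 < s" "\<delta> = s\<^sup>2" using assms(1) by (auto simp: s_def)
  have "s\<^sup>2 \<le> (1 / 2)\<^sup>2" using assms(2) s(2) by (simp add: power2_eq_square)
  then have s2: "s \<le> 1 / 2" by (rule power2_le_imp_le) simp
  have m: "2 * s \<le> 4 * s - 4 * s\<^sup>2" using mult_left_mono[OF s2, of s] s(1) by (simp add: power2_eq_square)
  have dd: "\<delta>' = s\<^sup>2 + sqrt (4 * s - 4 * s\<^sup>2)" unfolding \<delta>' using s by simp
  have ge: "sqrt (2 * s) \<le> \<delta>'" using real_sqrt_le_mono[OF m] unfolding dd by (simp add: add_increasing)
  show pos: "0 < \<delta>'" using ge s(1) by (meson less_le_trans mult_pos_pos real_sqrt_gt_zero zero_less_numeral)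
  have "sqrt (5 * \<delta>') \<le> 1 / 2" using le s(1) unfolding s_def by linarith
  then have "5 * \<delta>' \<le> (1 / 2)\<^sup>2" by (rule sqrt_le_D)
  then show le20: "\<delta>' \<le> 1 / 20" by (simp add: power2_eq_square)
  have "2 * s \<le> \<delta>'\<^sup>2" by (rule sqrt_le_D[OF ge])
  also have "\<dots> \<le> \<delta>' / 20" using mult_left_mono[OF le20, of \<delta>'] pos by (simp add: power2_eq_square)
  finally have s40: "s \<le> \<delta>' / 40" by simp
  have "s \<le> \<delta>'\<^sup>2 / 2" using \<open>2 * s \<le> \<delta>'\<^sup>2\<close> by simp
  moreover have "\<delta>'\<^sup>2 \<le> (1 / 20)\<^sup>2" by (rule power_mono) (use le20 pos in auto)
  ultimately have "s \<le> 1 / 800" by (simp add: power2_eq_square)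
  then have "s * s \<le> (1 / 800) * (\<delta>' / 40)" using s40 s(1) by (intro mult_mono) auto
  then show "\<delta> \<le> \<delta>' / 32000" unfolding s(2) by (simp add: power2_eq_square)
  define q where "q = sqrt \<delta>'"
  have q: "0 < q" "\<delta>' = q * q" using pos by (auto simp: q_def)
  have "q\<^sup>2 \<le> (9 / 40)\<^sup>2" using le20 q(2) by (simp add: power2_eq_square)
  then have q2: "q \<le> 9 / 40" by (rule power2_le_imp_le) simp
  have "sqrt 3 \<le> (17321 / 10000 :: real)" by (rule real_le_lsqrt) (auto simp: power2_eq_square)
  moreover have "(2236 / 1000 :: real) \<le> sqrt 5" by (rule real_le_rsqrt) (auto simp: power2_eq_square)
  \<comment> \<open>After division by q = sqrt \<delta>' the claim is numerical: q \<le> 9/40 adds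
    less than 0.68 to 2 sqrt 3, while 2 sqrt 5 exceeds 2 sqrt 3 by more than 1.\<close>
  ultimately have "2 * sqrt 3 + 3 * q \<le> 2 * sqrt 5" using q2 by linarith
  then have "(2 * sqrt 3 + 3 * q) * q \<le> (2 * sqrt 5) * q" using q(1) by (intro mult_right_mono) auto
  then show "2 * sqrt (3 * \<delta>') + 3 * \<delta>' \<le> 2 * sqrt (5 * \<delta>')"
    unfolding real_sqrt_mult q_def[symmetric] by (simp add: q(2) algebra_simps)
qed

text \<open>Rounding d / t down for \<open>b\<close> preserves the cost bound exactly, and rounding
  d / b up for \<open>a\<close> preserves the gain bound and makes room for the compressed space.
  The price is a / b, which may exceed the ideal t^2 / d by the factor 630/289.\<close>

lemma fqsw_dimensions:
  fixes d :: nat and H c \<delta> \<delta>' :: real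
  assumes "1 \<le> d" "0 < H" and \<delta>: "0 < \<delta>'" "\<delta>' \<le> 1 / 20" "\<delta> \<le> \<delta>' / 32000"
    and c: "0 \<le> c" "c < 6 / 5 / H" "1 - 5 * \<delta> \<le> c * real d" and t: "1 < t" "t\<^sup>2 = real d * H * \<delta>'\<^sup>2"
  shows "\<exists>a b :: nat. 0 < b \<and> t \<le> real a \<and> real b \<le> real d / t \<and> d \<le> a * b \<and> 2 \<le> a * b
    \<and> sqrt (11 / 5 * (real a / real b) * c) \<le> 12 / 5 * \<delta>'"
proof -
  have d: "0 < real d" using assms(1) by simp
  \<comment> \<open>The compressed smoothed state has weight close to 1 but at most c d, so
    \<open>H\<close> is at most about 6/5 d. Then t is at most 11/10 d \<delta>', and d / t is at
    least 18: rounding it down loses at most one part in 18.\<close>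
  have "999 / 1000 \<le> 1 - 5 * \<delta>" using \<delta> by simp
  also have "\<dots> \<le> (6 / 5 / H) * real d" using c(2,3) mult_right_mono[of c "6 / 5 / H" "real d"] by simp
  finally have H: "H \<le> 121 / 100 * real d" using assms(2) d by (simp add: field_simps)
  have "t\<^sup>2 \<le> real d * (121 / 100 * real d) * \<delta>'\<^sup>2"
    unfolding t(2) by (intro mult_right_mono mult_left_mono H) auto
  also have "\<dots> = (11 / 10 * (real d * \<delta>'))\<^sup>2" by (simp add: power2_eq_square)
  finally have "t \<le> 11 / 10 * (real d * \<delta>')" by (rule power2_le_imp_le) (use \<delta>(1) in simp)
  also have "\<dots> \<le> 11 / 10 * (real d * (1 / 20))" using \<delta>(2) by (intro mult_left_mono) auto
  finally have td: "18 * t \<le> real d" using d by simp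
  define y where "y = real d / t"
  have y: "18 \<le> y" using td t(1) unfolding y_def by (simp add: field_simps)
  have yt: "y * t = real d" using t(1) by (simp add: y_def)
  define b where "b = nat \<lfloor>y\<rfloor>"
  have b: "real b \<le> y" "y < real b + 1" using y unfolding b_def by linarith+
  have b0: "0 < real b" using b(2) y by linarith
  have b1: "17 / 18 * y \<le> real b" using b(2) y by linarith
  define a where "a = nat \<lceil>real d / real b\<rceil>"
  have a: "real d / real b \<le> real a" "real a < real d / real b + 1"
  proof -
    have "0 \<le> real d / real b" by simp
    then show "real d / real b \<le> real a" "real a < real d / real b + 1" unfolding a_def by linarith+
  qed
  have ab: "real d \<le> real a * real b" using a(1) b0 by (simp add: field_simps)
  have "t * real b \<le> real d" using mult_left_mono[OF b(1), of t] t(1) yt by (simp add: mult.commute[of t])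
  then have ta: "t \<le> real d / real b" using b0 by (simp add: field_simps)
  have "17 / 18 * (y * t) \<le> t * real b" using mult_left_mono[OF b1, of t] t(1) by (simp add: mult_ac)
  then have db: "real d \<le> 18 / 17 * t * real b" unfolding yt by simp
  then have "real d / real b \<le> 18 / 17 * t" using b0 by (simp add: divide_le_eq)
  \<comment> \<open>Rounding up adds less than 1, and 1 < t, so 18/17 t grows to at most 35/17
    t.\<close>
  then have a35: "real a \<le> 35 / 17 * t" using a(2) t(1) by linarith
  have "real a * real d \<le> 35 / 17 * t * real d" using a35 by (intro mult_right_mono) auto
  also have "\<dots> \<le> 35 / 17 * t * (18 / 17 * t * real b)"
    using db t(1) by (intro mult_left_mono) auto
  also have "\<dots> = 630 / 289 * t\<^sup>2 * real b" by (simp add: power2_eq_square)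
  also have "\<dots> = (630 / 289 * H * \<delta>'\<^sup>2 * real b) * real d" unfolding t(2) by simp
  finally have "real a \<le> 630 / 289 * H * \<delta>'\<^sup>2 * real b" using d by simp
  then have r: "real a / real b \<le> 630 / 289 * H * \<delta>'\<^sup>2" using b0 by (simp add: divide_le_eq)
  have "11 / 5 * (real a / real b) * c \<le> 11 / 5 * (630 / 289 * H * \<delta>'\<^sup>2) * (6 / 5 / H)"
    using r c b0 assms(2) by (intro mult_mono mult_left_mono) auto
  also have "\<dots> = 11 / 5 * (630 / 289) * (6 / 5) * \<delta>'\<^sup>2" using assms(2) by simp
  \<comment> \<open>The product of the constants is about 5.755, just below 5.76. The factors stem
    from the decoupling bound, the two roundings and the slack 6/5 in the min-entropy.\<close>
  also have "\<dots> \<le> (12 / 5)\<^sup>2 * \<delta>'\<^sup>2" by (intro mult_right_mono) (auto simp: power2_eq_square)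
  also have "\<dots> = (12 / 5 * \<delta>')\<^sup>2" by (simp only: power_mult_distrib)
  finally have "11 / 5 * (real a / real b) * c \<le> (12 / 5 * \<delta>')\<^sup>2" .
  then have "sqrt (11 / 5 * (real a / real b) * c) \<le> 12 / 5 * \<delta>'"
    by (intro real_le_lsqrt) (use \<delta>(1) in simp_all)
  moreover have dab: "d \<le> a * b" using ab by (metis of_nat_le_iff of_nat_mult)
  moreover have "2 \<le> a * b"
  proof -
    have "2 \<le> d" using td t(1) by linarith
    then show ?thesis using dab by linarith
  qed
  moreover have "t \<le> real a" using ta a(1) by linarith
  ultimately show ?thesis using b0 b(1) unfolding y_def
    by (intro exI[of _ a] exI[of _ b] conjI) simp_all
qed

section \<open>Assembly: choice of the dimensions and the error budget\<close>

theorem theorem8: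
  fixes \<epsilon> :: real and dA dB dR :: nat and \<psi> :: "complex vec"
  assumes "0 < \<epsilon>" and "\<epsilon> \<le> 1"
    and "\<psi> \<in> carrier_vec (dA * dB * dR)" and "\<psi> \<bullet>c \<psi> = 1"
  defines "\<rho>A \<equiv> partial_trace dA (dB * dR) 1 (pure_state \<psi>)"
    and "\<rho>AR \<equiv> partial_trace dA dB dR (pure_state \<psi>)"
  shows "\<exists>P \<delta> \<delta>'. 0 < \<delta> \<and> \<delta> \<le> 1 \<and>
    \<delta>' = \<delta> + sqrt (4 * sqrt \<delta> - 4 * \<delta>) \<and>
    \<epsilon> = 2 * sqrt (5 * \<delta>') + 2 * sqrt \<delta> \<and>
    fqsw_protocol dA dB P \<and> fqsw_error_le \<epsilon> dA dB dR \<psi> P \<and>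
    ereal (entanglement_gain P) \<ge>
      ereal (1 / 2) * (H_0_smooth \<delta> dA \<rho>A + H_min_smooth \<delta> dA dR \<rho>AR) + ereal (log 2 \<delta>') \<and>
    ereal (quantum_cost P) \<le>
      ereal (1 / 2) * (H_0_smooth \<delta> dA \<rho>A - H_min_smooth \<delta> dA dR \<rho>AR) - ereal (log 2 \<delta>')"
proof -
  note \<epsilon> = assms(1,2) and \<psi> = assms(3,4)
  obtain \<delta> \<delta>' where \<delta>: "0 < \<delta>" "\<delta> \<le> 1 / 4" "\<delta>' = \<delta> + sqrt (4 * sqrt \<delta> - 4 * \<delta>)"
    and \<epsilon>_eq: "\<epsilon> = 2 * sqrt (5 * \<delta>') + 2 * sqrt \<delta>"
    using fqsw_delta_exists[OF \<epsilon>] by blast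
  note \<delta>' = fqsw_delta_bounds[OF \<delta> \<epsilon>(2)[unfolded \<epsilon>_eq]]
  \<comment> \<open>The protocols below achieve the error 2 sqrt x + x at x = 3 \<delta>', which
    lies within the prescribed error.\<close>
  have err: "fqsw_error_le \<epsilon> dA dB dR \<psi> P" if "fqsw_error_le (2 * sqrt (3 * \<delta>') + 3 * \<delta>') dA dB dR \<psi> P" for P
    using that \<delta>'(4) \<delta>(1) real_sqrt_ge_zero[of \<delta>] unfolding fqsw_error_le_def \<epsilon>_eq by linarith
  have \<rho>A: "\<rho>A \<in> states dA"
    using partial_trace_pure_state[of \<psi> dA "dB * dR" 1] \<psi> unfolding \<rho>A_def by (simp add: mult.assoc)
  have \<rho>AR: "\<rho>AR \<in> states (dA * dR)" unfolding \<rho>AR_def by (rule partial_trace_pure_state[OF \<psi>])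
  then have \<rho>ARc: "\<rho>AR \<in> carrier_mat (dA * dR) (dA * dR)" "mat_trace \<rho>AR = 1" by (auto simp: states_def)
  have dA: "0 < dA"
  proof (rule ccontr)
    assume "\<not> 0 < dA"
    then show False using \<psi> by (simp add: scalar_prod_def)
  qed
  have dR: "0 < dR"
  proof (rule ccontr)
    assume "\<not> 0 < dR"
    then show False using \<psi> by (simp add: scalar_prod_def)
  qed
  obtain d T where d: "1 \<le> d" and H0: "H_0_smooth \<delta> dA \<rho>A = ereal (log 2 (real d))"
    and T: "T \<in> carrier_mat d dA" "contr T" "1 - \<delta> \<le> Re (mat_trace (T * \<rho>A * adj T))"
    using H_0_smooth_compression[OF \<rho>A, of \<delta>] \<delta>(1,2) by auto
  define h where "h = H_min_smooth \<delta> dA dR \<rho>AR"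
  \<comment> \<open>Besides the witnesses for the min-entropy this yields a lower bound on c d. The
    compression keeps weight 1 - \<delta> of \<rho>AR, hence at least 1 - 5 \<delta> of the smoothed
    state, and that weight is at most c d.\<close>
  have wit: "\<exists>\<rho>' \<sigma> c. \<rho>' \<in> substates (dA * dR) \<and> tn_le (\<rho>' - \<rho>AR) (4 * \<delta>) \<and> \<sigma> \<in> states dR
      \<and> op_le \<rho>' (complex_of_real c \<cdot>\<^sub>m tensor_mat (1\<^sub>m dA) \<sigma>) \<and> 0 \<le> c \<and> c < 2 powr (- x) \<and> 1 - 5 * \<delta> \<le> c * real d"
    if xh: "ereal x < h" for x
  proof -
    obtain \<rho>' \<sigma> c where w: "\<rho>' \<in> state_ball \<delta> (dA * dR) \<rho>AR" "\<sigma> \<in> states dR" "c < 2 powr (- x)"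
      "op_le \<rho>' (complex_of_real c \<cdot>\<^sub>m tensor_mat (1\<^sub>m dA) \<sigma>)"
      using H_min_smooth_witness[OF xh[unfolded h_def]] by blast
    have \<rho>': "\<rho>' \<in> substates (dA * dR)" "(fidelity \<rho>' \<rho>AR)\<^sup>2 \<ge> 1 - \<delta>\<^sup>2"
      using w(1) by (auto simp: state_ball_def)
    have \<rho>'c: "\<rho>' \<in> carrier_mat (dA * dR) (dA * dR)" using \<rho>'(1) by (simp add: substates_def)
    have tn: "tn_le (\<rho>' - \<rho>AR) (4 * \<delta>)"
      by (rule tn_le_fidelity[OF \<rho>'(1) \<rho>AR _ _ \<rho>'(2)]) (use \<delta> in auto)
    define M where "M = tensor_mat T (1\<^sub>m dR)"
    have M: "M \<in> carrier_mat (d * dR) (dA * dR)" unfolding M_def by (rule tensor_carrier[OF T(1) one_carrier_mat])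
    have Mc: "M * X * adj M \<in> carrier_mat (d * dR) (d * dR)" if "X \<in> carrier_mat (dA * dR) (dA * dR)" for X
      by (rule mult_carrier_mat[OF mult_carrier_mat[OF M that] adj_carrier[OF M]])
    have "contr M" unfolding M_def by (rule contr_tensor_one[OF T(2,1)])
    from tn_le_conj[OF tn minus_carrier_mat[OF \<rho>ARc(1)] M this]
    have "\<bar>Re (mat_trace (M * (\<rho>' - \<rho>AR) * adj M))\<bar> \<le> 4 * \<delta>"
      by (rule cmod_trace_le) (rule Mc[OF minus_carrier_mat[OF \<rho>ARc(1)]])
    then have "\<bar>Re (mat_trace (M * \<rho>' * adj M)) - Re (mat_trace (M * \<rho>AR * adj M))\<bar> \<le> 4 * \<delta>"
      unfolding conj_minus_mat[OF M \<rho>'c \<rho>ARc(1)] trace_minus[OF Mc[OF \<rho>'c] Mc[OF \<rho>ARc(1)]] by simp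
    moreover have "mat_trace (M * \<rho>AR * adj M) = mat_trace (T * \<rho>A * adj T)"
      unfolding M_def \<rho>AR_def \<rho>A_def by (rule trace_conj_marginal[OF \<psi>(1) T(1) T(1) refl])
    ultimately have "1 - 5 * \<delta> \<le> Re (mat_trace (M * \<rho>' * adj M))" using T(3) by simp
    also have "\<dots> \<le> c * real d" unfolding M_def by (rule smooth_weight(2)[OF T(1,2) dA \<rho>'(1) w(2,4)])
    finally show ?thesis
      using w \<rho>'(1) tn smooth_weight(1)[OF T(1,2) dA \<rho>'(1) w(2,4)] by blast
  qed
  have pos: "0 < 1 - 5 * \<delta>" using \<delta>' by simp
  \<comment> \<open>Otherwise \<open>c\<close> could be taken below (1 - 5 \<delta>) / d, against
    the lower bound just obtained.\<close>
  have hfin: "h \<noteq> \<infinity>"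
  proof
    assume h: "h = \<infinity>"
    define x where "x = log 2 (real d / (1 - 5 * \<delta>))"
    have x: "2 powr (- x) = (1 - 5 * \<delta>) / real d"
      using d pos by (simp add: x_def powr_minus)
    obtain c where "c < 2 powr (- x)" "1 - 5 * \<delta> \<le> c * real d" using wit[of x] h by auto
    then show False unfolding x using d by (simp add: field_simps)
  qed
  \<comment> \<open>Alice sends the whole compressed space, of dimension \<open>d\<close>, and
    \<open>A\<^sub>1\<close> is one-dimensional. The smoothed state can be \<rho>AR itself, so the
    lost weight is the only contribution to x.\<close>
  have triv: "\<exists>P. fqsw_protocol dA dB P \<and> dim_A1 P = 1 \<and> dim_A2 P = d \<and> fqsw_error_le \<epsilon> dA dB dR \<psi> P"
  proof -
    have "\<exists>P. fqsw_protocol dA dB P \<and> dim_A1 P = 1 \<and> dim_A2 P = d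
        \<and> fqsw_error_le (2 * sqrt (3 * \<delta>') + 3 * \<delta>') dA dB dR \<psi> P"
    proof (rule fqsw_protocol_of_decoupling[OF \<psi> _ _ T(1,2) _ T(3)[unfolded \<rho>A_def] \<rho>ARc(1)[unfolded \<rho>AR_def], where \<kappa> = 0 and e = 0])
      show "tn_le (partial_trace dA dB dR (pure_state \<psi>) - partial_trace dA dB dR (pure_state \<psi>)) 0"
        unfolding minus_r_inv_mat[OF \<rho>ARc(1)[unfolded \<rho>AR_def]] by (rule tn_le_zero)
    next
      fix K :: "complex mat" assume K: "K \<in> carrier_mat (1 * d) dA"
      have M: "tensor_mat K (1\<^sub>m dR) \<in> carrier_mat (1 * d * dR) (dA * dR)" by (rule tensor_carrier[OF K one_carrier_mat])
      show "\<exists>U\<in>carrier_mat (1 * d) (1 * d). adj U * U = 1\<^sub>m (1 * d) \<and>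
        tn_le (partial_trace 1 d dR (tensor_mat U (1\<^sub>m dR) * (tensor_mat K (1\<^sub>m dR) * partial_trace dA dB dR (pure_state \<psi>) * adj (tensor_mat K (1\<^sub>m dR))) * adj (tensor_mat U (1\<^sub>m dR)))
          - tensor_mat ((1 / of_nat 1) \<cdot>\<^sub>m 1\<^sub>m 1) (partial_trace 1 (1 * d) dR (tensor_mat K (1\<^sub>m dR) * partial_trace dA dB dR (pure_state \<psi>) * adj (tensor_mat K (1\<^sub>m dR))))) 0"
        by (rule bexI[OF conjI one_carrier_mat], simp,
          rule decoupling_trivial[OF mult_carrier_mat[OF mult_carrier_mat[OF M \<rho>ARc(1)[unfolded \<rho>AR_def]] adj_carrier[OF M]]])
    qed (use d \<delta>' \<delta>(1) in auto)
    then show ?thesis using err by blast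
  qed
  have "\<exists>P. fqsw_protocol dA dB P \<and> fqsw_error_le \<epsilon> dA dB dR \<psi> P \<and>
      ereal (1 / 2) * (ereal (log 2 (real d)) + h) + ereal (log 2 \<delta>') \<le> ereal (log 2 (real (dim_A1 P))) \<and>
      ereal (log 2 (real (dim_A2 P))) \<le> ereal (1 / 2) * (ereal (log 2 (real d)) - h) - ereal (log 2 \<delta>')"
  proof (cases h)
    case PInf
    then show ?thesis using hfin by simp
  next
    \<comment> \<open>Both bounds are vacuous in the extended reals, so the protocol without gain
      serves.\<close>
    case MInf
    obtain P where "fqsw_protocol dA dB P" "dim_A1 P = 1" "dim_A2 P = d" "fqsw_error_le \<epsilon> dA dB dR \<psi> P"
      using triv by blast
    then show ?thesis unfolding MInf by (intro exI[of _ P]) simp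
  next
    case (real h')
    define H where "H = 2 powr h'"
    have H: "0 < H" by (simp add: H_def)
    \<comment> \<open>Chosen such that log t is the required gain and log d - log t the admissible
      cost; the bounds thus read t \<le> a and b \<le> d / t.\<close>
    define t where "t = sqrt (real d * H) * \<delta>'"
    have t0: "0 < t" using d H \<delta>'(1) by (simp add: t_def)
    have lt: "log 2 t = (log 2 (real d) + h') / 2 + log 2 \<delta>'"
    proof -
      have "log 2 t = log 2 (sqrt (real d * H)) + log 2 \<delta>'"
        unfolding t_def by (rule log_mult_pos) (use d H \<delta>'(1) in auto)
      also have "log 2 (sqrt (real d * H)) = log 2 (real d * H) / 2"
        using d H by (simp add: log_def ln_sqrt)
      also have "log 2 (real d * H) = log 2 (real d) + h'"
        using log_mult_pos[of "real d" H 2] d H by (simp add: H_def)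
      finally show ?thesis .
    qed
    have concl: ?thesis if "fqsw_protocol dA dB P" "fqsw_error_le \<epsilon> dA dB dR \<psi> P"
      "log 2 t \<le> log 2 (real (dim_A1 P))" "log 2 (real (dim_A2 P)) \<le> log 2 (real d) - log 2 t" for P
    proof -
      have "ereal (1 / 2) * (ereal (log 2 (real d)) + h) + ereal (log 2 \<delta>') = ereal (log 2 t)"
        unfolding real lt by simp
      moreover have "ereal (1 / 2) * (ereal (log 2 (real d)) - h) - ereal (log 2 \<delta>') = ereal (log 2 (real d) - log 2 t)"
        unfolding real lt by (simp add: diff_divide_distrib add_divide_distrib)
      ultimately show ?thesis using that by (intro exI[of _ P]) (simp only: ereal_less_eq(3) simp_thms)
    qed
    show ?thesis
    proof (cases "t \<le> 1")
      case True
      then have "log 2 t \<le> 0" using t0 by simp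
      then show ?thesis using triv concl by auto
    next
      case False
      \<comment> \<open>A value strictly below the min-entropy, so that witnesses exist; it gives up
        a factor 6/5 in the scalar \<open>c\<close>.\<close>
      define x where "x = h' - log 2 (6 / 5)"
      have "ereal x < h" by (simp add: real x_def)
      moreover have "2 powr (- x) = 6 / 5 / H" by (simp add: x_def H_def powr_diff)
      ultimately obtain \<rho>' \<sigma> c where w: "\<rho>' \<in> substates (dA * dR)" "tn_le (\<rho>' - \<rho>AR) (4 * \<delta>)" "\<sigma> \<in> states dR"
        "op_le \<rho>' (complex_of_real c \<cdot>\<^sub>m tensor_mat (1\<^sub>m dA) \<sigma>)" and c: "0 \<le> c" "c < 6 / 5 / H" "1 - 5 * \<delta> \<le> c * real d"
        using wit[of x] by auto
      have \<rho>': "\<rho>' \<in> carrier_mat (dA * dR) (dA * dR)" "psd \<rho>'" "Re (mat_trace \<rho>') \<le> 1"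
        using w(1) by (auto simp: substates_def less_eq_complex_def)
      have t2: "t\<^sup>2 = real d * H * \<delta>'\<^sup>2" using d H by (simp add: t_def power_mult_distrib)
      obtain a b :: nat where ab: "0 < b" "t \<le> real a" "real b \<le> real d / t" "d \<le> a * b" "2 \<le> a * b"
        and \<kappa>: "sqrt (11 / 5 * (real a / real b) * c) \<le> 12 / 5 * \<delta>'"
        using fqsw_dimensions[OF d H \<delta>'(1-3) c _ t2] False by auto
      have a: "0 < a" using ab(5) by (cases a) auto
      \<comment> \<open>The budget: 12/5 \<delta>' for decoupling, 8 \<delta> for replacing the
        smoothed state twice and 2 \<delta> for the lost weight, together at most 3
        \<delta>'.\<close>
      have "\<exists>P. fqsw_protocol dA dB P \<and> dim_A1 P = a \<and> dim_A2 P = b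
          \<and> fqsw_error_le (2 * sqrt (3 * \<delta>') + 3 * \<delta>') dA dB dR \<psi> P"
      proof (rule fqsw_protocol_of_decoupling[OF \<psi> a ab(1) T(1,2) ab(4) T(3)[unfolded \<rho>A_def] \<rho>'(1) w(2)[unfolded \<rho>AR_def],
            where \<kappa> = "sqrt (11 / 5 * (real a / real b) * c)"])
        fix K :: "complex mat" assume K: "K \<in> carrier_mat (a * b) dA" "contr K"
        define M where "M = tensor_mat K (1\<^sub>m dR)"
        have M: "M \<in> carrier_mat (a * b * dR) (dA * dR)" unfolding M_def by (rule tensor_carrier[OF K(1) one_carrier_mat])
        define \<omega> where "\<omega> = M * \<rho>' * adj M"
        have \<omega>: "\<omega> \<in> carrier_mat (a * b * dR) (a * b * dR)"
          unfolding \<omega>_def by (rule mult_carrier_mat[OF mult_carrier_mat[OF M \<rho>'(1)] adj_carrier[OF M]])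
        have "contr M" unfolding M_def by (rule contr_tensor_one[OF K(2,1)])
        then have "tn_le \<omega> (Re (mat_trace \<rho>'))"
          unfolding \<omega>_def by (rule tn_le_conj[OF tn_le_psd[OF \<rho>'(2)] \<rho>'(1) M])
        then have tr: "Re (mat_trace \<omega>) \<le> 1" using cmod_trace_le[OF _ \<omega>] \<rho>'(3) by fastforce
        have le: "op_le \<omega> (complex_of_real c \<cdot>\<^sub>m tensor_mat (1\<^sub>m (a * b)) \<sigma>)"
          unfolding \<omega>_def M_def by (rule op_le_conj[OF K w(3) \<rho>'(1) c(1) w(4)])
        have "psd \<omega>" unfolding \<omega>_def by (rule psd_conj[OF \<rho>'(2,1) M])
        from decoupling[OF a ab(1) ab(5) dR c(1) \<omega> this tr w(3) le]
        show "\<exists>U\<in>carrier_mat (a * b) (a * b). adj U * U = 1\<^sub>m (a * b) \<and>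
          tn_le (partial_trace a b dR (tensor_mat U (1\<^sub>m dR) * (tensor_mat K (1\<^sub>m dR) * \<rho>' * adj (tensor_mat K (1\<^sub>m dR))) * adj (tensor_mat U (1\<^sub>m dR)))
            - tensor_mat ((1 / of_nat a) \<cdot>\<^sub>m 1\<^sub>m a) (partial_trace 1 (a * b) dR (tensor_mat K (1\<^sub>m dR) * \<rho>' * adj (tensor_mat K (1\<^sub>m dR)))))
            (sqrt (11 / 5 * (real a / real b) * c))"
          unfolding \<omega>_def M_def .
      qed (use \<kappa> \<delta>' \<delta>(1) in auto)
      then obtain P where P: "fqsw_protocol dA dB P" "dim_A1 P = a" "dim_A2 P = b" "fqsw_error_le \<epsilon> dA dB dR \<psi> P"
        using err by blast
      have "log 2 (real b) \<le> log 2 (real d / t)" using ab(1,3) d t0 by simp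
      also have "\<dots> = log 2 (real d) - log 2 t" using d t0 by (intro log_divide_pos) auto
      finally show ?thesis using P ab(2) t0 a by (intro concl[of P]) auto
    qed
  qed
  then obtain P where P: "fqsw_protocol dA dB P" "fqsw_error_le \<epsilon> dA dB dR \<psi> P"
    "ereal (1 / 2) * (ereal (log 2 (real d)) + h) + ereal (log 2 \<delta>') \<le> ereal (log 2 (real (dim_A1 P)))"
    "ereal (log 2 (real (dim_A2 P))) \<le> ereal (1 / 2) * (ereal (log 2 (real d)) - h) - ereal (log 2 \<delta>')"
    by blast
  have "\<delta> \<le> 1" using \<delta>(2) by simp
  show ?thesis
    unfolding entanglement_gain_def quantum_cost_def
    by (rule exI[of _ P], rule exI[of _ \<delta>], rule exI[of _ \<delta>'], intro conjI \<delta>(1,3) \<epsilon>_eq P(1,2) \<open>\<delta> \<le> 1\<close>)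
      (use P(3,4) in \<open>simp_all only: H0 h_def\<close>)
qed

end
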